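(* For any $\gamma>0$ and $\alpha>0$ there is a randomized algorithm that, except with probability at most $n^{-\alpha}$, finds an optimal solution to the Noisy Signal Aggregation problem on strongly $\gamma$-biased signals in time $n^{\tilde{O}((\alpha+1)\gamma^{-3})}$, and whose sampling complexity (number of signals $s_{a,b}$ it inspects) is at most $C\,n\log n$, where $C=C(\alpha,\gamma,A)$ and $A$ is the constant in condition (b) of strong $\gamma$-bias.
   Context: Noisy Signal Aggregation (NSA): there are $n$ items $1,\dots,n$ and an unknown true order given by a permutation $\pi$ of $[n]$; write $a<_\pi b$ if $\pi(a)<\pi(b)$. For each unordered pair $\{a,b\}$ a signal $s_{a,b}$ is available, with distribution ${\cal D}_{a<b}$ if $\pi(a)<\pi(b)$ and ${\cal D}_{b<a}$ otherwise; conditioned on $\pi$ the signals are independent. Define $q(a<b)=\log\frac{{\cal D}_{a<b}(s_{a,b})}{{\cal D}_{b<a}(s_{a,b})}$, so $q(b<a)=-q(a<b)$, and $s_q(\sigma)=\sum_{i,j:\ \sigma(i)<\sigma(j)}q(i<j)$. An optimal solution is a permutation maximizing $s_q$. The signals are strongly $\gamma$-biased if (a) for every integer $m$ with $\frac{\log n}{\gamma}<m\le n$ and any $m$ distinct pairs $(a_k,b_k)$ such that $a_k<_\pi b_k$ for at least $2/3$ of the $k$'s, $\P\left[\sum_{k=1}^m q(a_k<b_k)>0\right]>1-2^{-\gamma m}$; and (b) there is a constant $A$ such that for any $A$ distinct pairs $(a_k,b_k)$ with $a_k<_\pi b_k$ for all $k$, $\P\left[\sum_{k=1}^A q(a_k<b_k)>0\right]>1-10^{-3}$.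 $\tilde O(\cdot)$ denotes order of magnitude up to logarithmic factors.
   Formalization: For γ>1 the time exponent is taken as for γ=1, i.e. Õ((α+1)min(γ,1)^{-3}), because a bound n^{Õ((α+1)γ^{-3})} fails for large γ: merely writing down an order of n items takes about n steps. *)

theory Defs
  imports "HOL-Probability.Probability" "HOL-Combinatorics.Permutations"
begin

section \<open>Noisy signal aggregation\<close>

text \<open>
  Items are the numbers below \<open>n\<close>. An order is a permutation of \<open>{..<n}\<close>, read as the map from
  items to positions, so \<open>a\<close> precedes \<open>b\<close> when \<open>\<pi> a < \<pi> b\<close>.

  \<open>D a b\<close> is the density, with respect to a base measure \<open>M\<close>, of the signal of the unordered pair
  \<open>{a, b}\<close> when \<open>a\<close> precedes \<open>b\<close>; thus \<open>D a b\<close> and \<open>D b a\<close> are the two possible laws of one and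
  the same signal. A probability mass function is the case where \<open>M\<close> is a counting measure.
\<close>

definition item_pairs :: "nat \<Rightarrow> nat set set" where
  "item_pairs n = {e. e \<subseteq> {..<n} \<and> card e = 2}"

text \<open>
  The last condition says that \<open>D a b\<close> and \<open>D b a\<close> vanish at the same points. This is what makes
  the logarithm of their ratio a finite real number. Where both vanish, the ratio below
  is \<open>0 / 0 = 0\<close> and its logarithm is \<open>0\<close>; this happens with probability \<open>0\<close>.
\<close>

definition signal_densities :: "nat \<Rightarrow> 's measure \<Rightarrow> (nat \<Rightarrow> nat \<Rightarrow> 's \<Rightarrow> real) \<Rightarrow> bool" where
  "signal_densities n M D \<longleftrightarrow>
     (\<forall>a<n. \<forall>b<n. a \<noteq> b \<longrightarrow>
        D a b \<in> borel_measurable M \<and>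
        (\<forall>s\<in>space M. 0 \<le> D a b s) \<and>
        prob_space (density M (\<lambda>s. ennreal (D a b s))) \<and>
        (\<forall>s\<in>space M. D a b s = 0 \<longleftrightarrow> D b a s = 0))"

definition signal_law ::
  "(nat \<Rightarrow> nat) \<Rightarrow> 's measure \<Rightarrow> (nat \<Rightarrow> nat \<Rightarrow> 's \<Rightarrow> real) \<Rightarrow> nat set \<Rightarrow> 's measure" where
  "signal_law \<pi> M D e =
     (let a = Min e; b = Max e
      in density M (\<lambda>s. ennreal (if \<pi> a < \<pi> b then D a b s else D b a s)))"

definition signals ::
  "nat \<Rightarrow> (nat \<Rightarrow> nat) \<Rightarrow> 's measure \<Rightarrow> (nat \<Rightarrow> nat \<Rightarrow> 's \<Rightarrow> real) \<Rightarrow> (nat set \<Rightarrow> 's) measure" where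
  "signals n \<pi> M D = (\<Pi>\<^sub>M e\<in>item_pairs n. signal_law \<pi> M D e)"

definition llr :: "(nat \<Rightarrow> nat \<Rightarrow> 's \<Rightarrow> real) \<Rightarrow> (nat set \<Rightarrow> 's) \<Rightarrow> nat \<Rightarrow> nat \<Rightarrow> real" where
  "llr D s a b = log 2 (D a b (s {a, b}) / D b a (s {a, b}))"

definition order_score :: "nat \<Rightarrow> (nat \<Rightarrow> nat \<Rightarrow> real) \<Rightarrow> (nat \<Rightarrow> nat) \<Rightarrow> real" where
  "order_score n q \<sigma> = (\<Sum>(i, j) \<in> {(i, j). i < n \<and> j < n \<and> \<sigma> i < \<sigma> j}. q i j)"

definition optimal_order :: "nat \<Rightarrow> (nat \<Rightarrow> nat \<Rightarrow> real) \<Rightarrow> (nat \<Rightarrow> nat) \<Rightarrow> bool" where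
  "optimal_order n q \<sigma> \<longleftrightarrow>
     \<sigma> permutes {..<n} \<and> (\<forall>\<tau>. \<tau> permutes {..<n} \<longrightarrow> order_score n q \<tau> \<le> order_score n q \<sigma>)"

text \<open>
  \<open>m\<close> pairs, oriented by the listing but distinct as unordered pairs of items.
\<close>

definition distinct_pairs :: "nat \<Rightarrow> nat \<Rightarrow> (nat \<Rightarrow> nat) \<Rightarrow> (nat \<Rightarrow> nat) \<Rightarrow> bool" where
  "distinct_pairs n m a b \<longleftrightarrow>
     (\<forall>k<m. a k < n \<and> b k < n \<and> a k \<noteq> b k) \<and> inj_on (\<lambda>k. {a k, b k}) {..<m}"

definition prob_positive_sum ::
  "nat \<Rightarrow> (nat \<Rightarrow> nat) \<Rightarrow> 's measure \<Rightarrow> (nat \<Rightarrow> nat \<Rightarrow> 's \<Rightarrow> real) \<Rightarrow>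
   nat \<Rightarrow> (nat \<Rightarrow> nat) \<Rightarrow> (nat \<Rightarrow> nat) \<Rightarrow> real" where
  "prob_positive_sum n \<pi> M D m a b =
     measure (signals n \<pi> M D)
       {s \<in> space (signals n \<pi> M D). 0 < (\<Sum>k<m. llr D s (a k) (b k))}"

definition strongly_biased ::
  "real \<Rightarrow> nat \<Rightarrow> nat \<Rightarrow> (nat \<Rightarrow> nat) \<Rightarrow> 's measure \<Rightarrow> (nat \<Rightarrow> nat \<Rightarrow> 's \<Rightarrow> real) \<Rightarrow> bool" where
  "strongly_biased \<gamma> A n \<pi> M D \<longleftrightarrow>
     (\<forall>m a b. log 2 (real n) / \<gamma> < real m \<longrightarrow> m \<le> n \<longrightarrow> distinct_pairs n m a b \<longrightarrow>
        real (card {k. k < m \<and> \<pi> (a k) < \<pi> (b k)}) \<ge> 2 / 3 * real m \<longrightarrow>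
        prob_positive_sum n \<pi> M D m a b > 1 - 2 powr (- (\<gamma> * real m))) \<and>
     (\<forall>a b. distinct_pairs n A a b \<longrightarrow> (\<forall>k<A. \<pi> (a k) < \<pi> (b k)) \<longrightarrow>
        prob_positive_sum n \<pi> M D A a b > 1 - 1 / 10 ^ 3)"


section \<open>Randomized algorithms with oracle access to the signals\<close>

text \<open>
  A unit-cost random access machine with structured control flow. It has finitely many named
  registers in each program and an indirectly addressed heap, both in a version for natural
  numbers and in a version for reals. The arithmetic is limited to addition, (truncated)
  subtraction and comparison: with multiplication, unit cost would not be a reasonable measure of
  time. Nothing can be moved from the real part of the memory to the other part except by
  branching on comparisons.

  Access to the signals is through \<open>Inspect r i j\<close> only. It looks at the signal of the pair of items
  held in the registers \<open>i\<close> and \<open>j\<close> and stores the value \<open>q (i < j)\<close> computed from it in the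
  real register \<open>r\<close>. Randomness is a stream of coins, of which every \<open>Flip\<close> consumes one.
\<close>

datatype instr =
    Const nat nat
  | Add nat nat nat
  | Sub nat nat nat
  | Load nat nat
  | Store nat nat
  | RAdd nat nat nat
  | RSub nat nat nat
  | RLoad nat nat
  | RStore nat nat
  | Flip nat
  | Inspect nat nat nat

datatype test = Less nat nat | RLess nat nat

datatype prog =
    Do instr
  | Seq prog prog
  | If test prog prog
  | While test prog

record state =
  regs :: "nat \<Rightarrow> nat"
  heap :: "nat \<Rightarrow> nat"
  rregs :: "nat \<Rightarrow> real"
  rheap :: "nat \<Rightarrow> real"
  coins_used :: nat
  inspected :: "nat set set"

primrec step :: "(nat \<Rightarrow> nat \<Rightarrow> real) \<Rightarrow> (nat \<Rightarrow> bool) \<Rightarrow> instr \<Rightarrow> state \<Rightarrow> state" where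
  "step q \<omega> (Const r c) st = st\<lparr>regs := (regs st)(r := c)\<rparr>"
| "step q \<omega> (Add r i j) st = st\<lparr>regs := (regs st)(r := regs st i + regs st j)\<rparr>"
| "step q \<omega> (Sub r i j) st = st\<lparr>regs := (regs st)(r := regs st i - regs st j)\<rparr>"
| "step q \<omega> (Load r i) st = st\<lparr>regs := (regs st)(r := heap st (regs st i))\<rparr>"
| "step q \<omega> (Store i r) st = st\<lparr>heap := (heap st)(regs st i := regs st r)\<rparr>"
| "step q \<omega> (RAdd r i j) st = st\<lparr>rregs := (rregs st)(r := rregs st i + rregs st j)\<rparr>"
| "step q \<omega> (RSub r i j) st = st\<lparr>rregs := (rregs st)(r := rregs st i - rregs st j)\<rparr>"
| "step q \<omega> (RLoad r i) st = st\<lparr>rregs := (rregs st)(r := rheap st (regs st i))\<rparr>"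
| "step q \<omega> (RStore i r) st = st\<lparr>rheap := (rheap st)(regs st i := rregs st r)\<rparr>"
| "step q \<omega> (Flip r) st =
     st\<lparr>regs := (regs st)(r := of_bool (\<omega> (coins_used st))), coins_used := Suc (coins_used st)\<rparr>"
| "step q \<omega> (Inspect r i j) st =
     st\<lparr>rregs := (rregs st)(r := q (regs st i) (regs st j)),
        inspected := insert {regs st i, regs st j} (inspected st)\<rparr>"

primrec holds :: "test \<Rightarrow> state \<Rightarrow> bool" where
  "holds (Less i j) st \<longleftrightarrow> regs st i < regs st j"
| "holds (RLess i j) st \<longleftrightarrow> rregs st i < rregs st j"

text \<open>
  \<open>exec q \<omega> p st t st'\<close>: with signal values \<open>q\<close> and coins \<open>\<omega>\<close>, the program \<open>p\<close> started in \<open>st\<close> halts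
  in \<open>st'\<close> after \<open>t\<close> steps. A program that does not halt has no such \<open>t\<close>.
\<close>

inductive exec ::
  "(nat \<Rightarrow> nat \<Rightarrow> real) \<Rightarrow> (nat \<Rightarrow> bool) \<Rightarrow> prog \<Rightarrow> state \<Rightarrow> nat \<Rightarrow> state \<Rightarrow> bool"
  for q :: "nat \<Rightarrow> nat \<Rightarrow> real" and \<omega> :: "nat \<Rightarrow> bool" where
  Do: "exec q \<omega> (Do i) st 1 (step q \<omega> i st)"
| Seq: "exec q \<omega> p1 st t1 st1 \<Longrightarrow> exec q \<omega> p2 st1 t2 st2 \<Longrightarrow> exec q \<omega> (Seq p1 p2) st (t1 + t2) st2"
| IfTrue: "holds b st \<Longrightarrow> exec q \<omega> p1 st t st' \<Longrightarrow> exec q \<omega> (If b p1 p2) st (t + 1) st'"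
| IfFalse: "\<not> holds b st \<Longrightarrow> exec q \<omega> p2 st t st' \<Longrightarrow> exec q \<omega> (If b p1 p2) st (t + 1) st'"
| WhileFalse: "\<not> holds b st \<Longrightarrow> exec q \<omega> (While b p) st 1 st"
| WhileTrue: "holds b st \<Longrightarrow> exec q \<omega> p st t1 st1 \<Longrightarrow> exec q \<omega> (While b p) st1 t2 st2 \<Longrightarrow>
    exec q \<omega> (While b p) st (t1 + t2 + 1) st2"

inductive_cases DoE: "exec q \<omega> (Do i) st t st'"
inductive_cases SeqE: "exec q \<omega> (Seq p1 p2) st t st'"
inductive_cases IfE: "exec q \<omega> (If b p1 p2) st t st'"
inductive_cases WhileE: "exec q \<omega> (While b p) st t st'"

lemma exec_deterministic:
  "exec q \<omega> p st t st' \<Longrightarrow> exec q \<omega> p st u st'' \<Longrightarrow> u = t \<and> st'' = st'"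
proof (induction arbitrary: u st'' rule: exec.induct)
  case (Do i st)
  then show ?case by (auto elim: DoE)
next
  case (Seq p1 st t1 st1 p2 t2 st2)
  from Seq.prems obtain u1 s1 u2 where
    "exec q \<omega> p1 st u1 s1" "exec q \<omega> p2 s1 u2 st''" "u = u1 + u2"
    by (rule SeqE)
  with Seq.IH(1)[of u1 s1] Seq.IH(2)[of u2 st''] show ?case by simp
next
  case (IfTrue b st p1 t st' p2)
  from IfTrue.prems IfTrue.hyps(1) obtain u1 where "exec q \<omega> p1 st u1 st''" "u = u1 + 1"
    by (auto elim: IfE)
  with IfTrue.IH[of u1 st''] show ?case by simp
next
  case (IfFalse b st p2 t st' p1)
  from IfFalse.prems IfFalse.hyps(1) obtain u1 where "exec q \<omega> p2 st u1 st''" "u = u1 + 1"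
    by (auto elim: IfE)
  with IfFalse.IH[of u1 st''] show ?case by simp
next
  case (WhileFalse b st p)
  from WhileFalse.prems WhileFalse.hyps show ?case by (rule_tac WhileE) auto
next
  case (WhileTrue b st p t1 st1 t2 st2)
  from WhileTrue.prems WhileTrue.hyps(1) obtain u1 s1 u2 where
    "exec q \<omega> p st u1 s1" "exec q \<omega> (While b p) s1 u2 st''" "u = u1 + u2 + 1"
    by (rule_tac WhileE) auto
  with WhileTrue.IH(1)[of u1 s1] WhileTrue.IH(2)[of u2 st''] show ?case by simp
qed

definition initial_state :: "nat \<Rightarrow> nat \<Rightarrow> state" where
  "initial_state n A =
     \<lparr>regs = (\<lambda>_. 0)(0 := n, 1 := A), heap = (\<lambda>_. 0), rregs = (\<lambda>_. 0), rheap = (\<lambda>_. 0),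
      coins_used = 0, inspected = {}\<rparr>"

text \<open>
  The answer is the table of positions in the first \<open>n\<close> heap cells, completed by the identity.
\<close>

definition output_order :: "nat \<Rightarrow> state \<Rightarrow> nat \<Rightarrow> nat" where
  "output_order n st i = (if i < n then heap st i else i)"

definition coins :: "(nat \<Rightarrow> bool) measure" where
  "coins = (\<Pi>\<^sub>M i\<in>UNIV. measure_pmf (bernoulli_pmf (1 / 2)))"

text \<open>
  The probability, over independent signals and coins, of halting with an optimal solution. A set
  that is not measurable has measure \<open>0\<close> here, so a lower bound on this number does
  not profit from lack of measurability.
\<close>

definition success_prob ::
  "prog \<Rightarrow> nat \<Rightarrow> nat \<Rightarrow> (nat \<Rightarrow> nat) \<Rightarrow> 's measure \<Rightarrow> (nat \<Rightarrow> nat \<Rightarrow> 's \<Rightarrow> real) \<Rightarrow> real" where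
  "success_prob p A n \<pi> M D =
     measure (signals n \<pi> M D \<Otimes>\<^sub>M coins)
       {(s, \<omega>) \<in> space (signals n \<pi> M D \<Otimes>\<^sub>M coins).
          \<exists>t st. exec (llr D s) \<omega> p (initial_state n A) t st \<and>
                 optimal_order n (llr D s) (output_order n st)}"

definition complexity_bounded ::
  "prog \<Rightarrow> nat \<Rightarrow> nat \<Rightarrow> (nat \<Rightarrow> nat) \<Rightarrow> 's measure \<Rightarrow> (nat \<Rightarrow> nat \<Rightarrow> 's \<Rightarrow> real) \<Rightarrow> real \<Rightarrow> real \<Rightarrow> bool" where
  "complexity_bounded p A n \<pi> M D time_bound sample_bound \<longleftrightarrow>
     (\<forall>s \<in> space (signals n \<pi> M D). \<forall>\<omega>.
        \<exists>t st. exec (llr D s) \<omega> p (initial_state n A) t st \<and>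
               real t \<le> time_bound \<and> real (card (inspected st)) \<le> sample_bound)"

text \<open>
  \<open>f p\<close> is \<open>g p\<close> up to a constant and a power of \<open>log (g p)\<close>, uniformly in the parameters \<open>p \<in> P\<close>.
  The summand \<open>2\<close> only keeps the logarithm away from \<open>0\<close>.

  It will be applied with \<open>(\<alpha> + 1) \<gamma>\<^sup>-\<^sup>3\<close> as \<open>g\<close>, where \<open>\<gamma>\<close> is cut off at \<open>1\<close>: an exponent that tends to \<open>0\<close>
  for large \<open>\<gamma>\<close> is impossible, as just writing down an order takes about \<open>n\<close> steps. Signals that are
  strongly \<open>\<gamma>\<close>-biased with \<open>\<gamma> > 1\<close> are also strongly \<open>1\<close>-biased.
\<close>

definition soft_O :: "'p set \<Rightarrow> ('p \<Rightarrow> real) \<Rightarrow> ('p \<Rightarrow> real) \<Rightarrow> bool" where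
  "soft_O P f g \<longleftrightarrow> (\<exists>c::real. \<exists>k::nat. \<forall>p\<in>P. \<bar>f p\<bar> \<le> c * \<bar>g p\<bar> * log 2 (2 + \<bar>g p\<bar>) ^ k)"

end

theory Submission
  imports Defs "HOL-Real_Asymp.Real_Asymp"
begin

text \<open>
  The items are inserted one by one, and an optimal order of the items seen so far is kept throughout.
  With high probability every such order is close to the true one: every item is within \<open>O(log n)\<close> positions of
  its true rank. Indeed, in an optimal order no inversion pattern can have positive total value, because moving
  single items would improve the order; by strong bias each sizeable pattern has positive value except with
  exponentially small probability, and an order with items far out of place would contain a sizeable pattern
  from a family that is small enough for a union bound.

  To insert item \<open>t\<close>, its approximate position is found by a search with multiplicative weights, in which each test
  asks whether \<open>A\<close> fresh comparisons have positive sum. Comparing \<open>t\<close> with the \<open>O(log n)\<close> items around that position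
  makes it possible to place \<open>t\<close> within \<open>O(log n)\<close> of its true rank. The next optimal order differs from the resulting
  list by displacements of \<open>O(log n)\<close>, so it is found by a dynamic program over the sets of items placed among
  the first \<open>j\<close> positions, which needs only values that have been inspected. The algorithm uses no coins.
\<close>

section \<open>A language of bounded loops\<close>

text \<open>What shapes the proof is the union bound. A window of \<open>8*Q\<close> places can be
  filled in about \<open>n ^ (8*Q)\<close> ways, while one misplaced item involves only O(Q) pairs,
  whose sum has the wrong sign with a probability of order 2^(-\<gamma> Q): the family is too large.
  A window cut at a threshold compares quadratically many pairs, so cuts with x^2 misordered pairs
  can be excluded if \<gamma> x^2 > 8 Q log n. Given that, the stretch before a misplaced item is a
  band of the true order up to O(x) corrections, and such sets are few. With Q = c log n, x = y log
  n and h about log (1/\<gamma>) this asks for \<gamma> y^2 >= 8 c and \<gamma> c >= 136 h y up to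
  lower terms, so c is of order h^2 \<gamma>^-3. The dynamic program has 2^(O(Q)) states, whence the
  exponent of the theorem. The time must not depend on \<open>A\<close>; this is why all loops are
  capped. Condition (a) covers at most n pairs and says too little for small n; there the radius is
  raised beyond n, so that every stage is exhaustive.\<close>

datatype exp = Vr nat | Nm nat | Plus exp exp | Minus exp exp | TCap exp | Ar nat exp
datatype rexp = RV nat | RPlus rexp rexp | RMinus rexp rexp | RAr nat exp
datatype bexp = BLess exp exp | BRLess rexp rexp | BNot bexp | BAnd bexp bexp
datatype cmd =
  Skip
 | Assign nat exp
 | AStore nat exp exp
 | RAssign nat rexp
 | RAStore nat exp rexp
 | Out exp exp
 | Insp nat exp exp
 | SeqC cmd cmd
 | IfC bexp cmd cmd
 | For nat exp cmd

record hstate =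
 nvar :: "nat => nat"
 narr :: "nat => nat => nat"
 rvar :: "nat => real"
 rarr :: "nat => nat => real"
 outp :: "nat => nat"
 seen :: "nat set set"

text \<open>
 Variable \<open>0\<close> holds \<open>n\<close>, variable \<open>1\<close> holds \<open>A\<close>. Variable \<open>2\<close> caps the number of iterations of every
 loop, which makes the running time of a command a syntactic matter.
\<close>

primrec eval :: "exp => hstate => nat" where
 "eval (Vr i) h = nvar h i"
| "eval (Nm c) h = c"
| "eval (Plus a b) h = eval a h + eval b h"
| "eval (Minus a b) h = eval a h - eval b h"
| "eval (TCap a) h = eval a h * nvar h 2"
| "eval (Ar k a) h = narr h k (eval a h)"

primrec reval :: "rexp => hstate => real" where
 "reval (RV i) h = rvar h i"
| "reval (RPlus a b) h = reval a h + reval b h"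
| "reval (RMinus a b) h = reval a h - reval b h"
| "reval (RAr k a) h = rarr h k (eval a h)"

primrec beval :: "bexp => hstate => bool" where
 "beval (BLess a b) h \<longleftrightarrow> eval a h < eval b h"
| "beval (BRLess a b) h \<longleftrightarrow> reval a h < reval b h"
| "beval (BNot b) h \<longleftrightarrow> \<not> beval b h"
| "beval (BAnd a b) h \<longleftrightarrow> beval a h & beval b h"

abbreviation setv :: "nat => nat => hstate => hstate" where
 "setv i k h \<equiv> h\<lparr>nvar := (nvar h)(i := k)\<rparr>"

primrec sem :: "(nat => nat => real) => cmd => hstate => hstate" where
 "sem q Skip h = h"
| "sem q (Assign i e) h = setv i (eval e h) h"
| "sem q (AStore k a e) h = h\<lparr>narr := (narr h)(k := (narr h k)(eval a h := eval e h))\<rparr>"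
| "sem q (RAssign i e) h = h\<lparr>rvar := (rvar h)(i := reval e h)\<rparr>"
| "sem q (RAStore k a e) h = h\<lparr>rarr := (rarr h)(k := (rarr h k)(eval a h := reval e h))\<rparr>"
| "sem q (Out a e) h = h\<lparr>outp := (outp h)(eval a h := eval e h)\<rparr>"
| "sem q (Insp i a b) h =
  h\<lparr>rvar := (rvar h)(i := q (eval a h) (eval b h)), seen := insert {eval a h, eval b h} (seen h)\<rparr>"
| "sem q (SeqC c1 c2) h = sem q c2 (sem q c1 h)"
| "sem q (IfC b c1 c2) h = (if beval b h then sem q c1 h else sem q c2 h)"
| "sem q (For i e c) h = fold (%k h. sem q c (setv i k h)) [0..<min (eval e h) (nvar h 2)] h"

primrec wfe :: "exp => bool" where
 "wfe (Vr i) \<longleftrightarrow> i < 64"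
| "wfe (Nm c) \<longleftrightarrow> True"
| "wfe (Plus a b) \<longleftrightarrow> wfe a & wfe b"
| "wfe (Minus a b) \<longleftrightarrow> wfe a & wfe b"
| "wfe (TCap a) \<longleftrightarrow> wfe a"
| "wfe (Ar k a) \<longleftrightarrow> k < 16 & wfe a"

primrec wfr :: "rexp => bool" where
 "wfr (RV i) \<longleftrightarrow> i < 64"
| "wfr (RPlus a b) \<longleftrightarrow> wfr a & wfr b"
| "wfr (RMinus a b) \<longleftrightarrow> wfr a & wfr b"
| "wfr (RAr k a) \<longleftrightarrow> k < 4 & wfe a"

primrec wfb :: "bexp => bool" where
 "wfb (BLess a b) \<longleftrightarrow> wfe a & wfe b"
| "wfb (BRLess a b) \<longleftrightarrow> wfr a & wfr b"
| "wfb (BNot b) \<longleftrightarrow> wfb b"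
| "wfb (BAnd a b) \<longleftrightarrow> wfb a & wfb b"

text \<open>Variables 0 and 2 may not be assigned: the first fixes where the arrays start on the
  heap, the second bounds all loops, and both must stay constant throughout a command.\<close>

definition wfv :: "nat => bool" where
 "wfv i \<longleftrightarrow> i < 64 & i ~= 0 & i ~= 2"

primrec wfc :: "cmd => bool" where
 "wfc Skip \<longleftrightarrow> True"
| "wfc (Assign i e) \<longleftrightarrow> wfv i & wfe e"
| "wfc (AStore k a e) \<longleftrightarrow> k < 16 & wfe a & wfe e"
| "wfc (RAssign i e) \<longleftrightarrow> i < 64 & wfr e"
| "wfc (RAStore k a e) \<longleftrightarrow> k < 4 & wfe a & wfr e"
| "wfc (Out a e) \<longleftrightarrow> wfe a & wfe e"
| "wfc (Insp i a b) \<longleftrightarrow> i < 64 & wfe a & wfe b"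
| "wfc (SeqC c1 c2) \<longleftrightarrow> wfc c1 & wfc c2"
| "wfc (IfC b c1 c2) \<longleftrightarrow> wfb b & wfc c1 & wfc c2"
| "wfc (For i e c) \<longleftrightarrow> wfv i & wfe e & wfc c"

lemma fold_upt_induct:
 assumes "I 0 x" "\<And>k y. k < n ==> I k y ==> I (Suc k) (f k y)"
 shows "I n (fold f [0..<n] x)"
 using assms(2)
proof (induction n)
 case 0
 then show ?case using assms(1) by simp
next
 case (Suc n)
 then show ?case by simp
qed

lemma sem_keeps: "wfc c ==> nvar (sem q c h) 0 = nvar h 0 & nvar (sem q c h) 2 = nvar h 2"
proof (induction c arbitrary: h)
 case (For i e c)
 show ?case unfolding sem.simps
  by (rule fold_upt_induct[where I = "%k y. nvar y 0 = nvar h 0 & nvar y 2 = nvar h 2"])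
   (use For in "auto simp: wfv_def")
qed (auto simp: wfv_def)


subsection \<open>Compilation\<close>

definition ex ::
 "(nat => nat => real) => (nat => bool) => prog => state => nat => (state => bool) => bool" where
 "ex q \<omega> p st T Q \<longleftrightarrow> (\<exists>t st'. exec q \<omega> p st t st' & t \<le> T & Q st')"

lemma ex_Do: "Q (step q \<omega> i st) ==> 1 \<le> T ==> ex q \<omega> (Do i) st T Q"
 unfolding ex_def using exec.Do by blast

lemma ex_Seq:
 assumes "ex q \<omega> p1 st T1 R" "\<And>st'. R st' ==> ex q \<omega> p2 st' T2 Q" "T1 + T2 \<le> T"
 shows "ex q \<omega> (Seq p1 p2) st T Q"
proof -
 obtain t1 st1 where 1: "exec q \<omega> p1 st t1 st1" "t1 \<le> T1" "R st1"
  using assms(1) unfolding ex_def by blast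
 obtain t2 st2 where 2: "exec q \<omega> p2 st1 t2 st2" "t2 \<le> T2" "Q st2"
  using assms(2)[OF 1(3)] unfolding ex_def by blast
 show ?thesis unfolding ex_def using exec.Seq[OF 1(1) 2(1)] 1 2 assms(3) by fastforce
qed

lemma ex_DoSeq:
 assumes "ex q \<omega> p2 (step q \<omega> i st) T2 Q" "1 + T2 \<le> T"
 shows "ex q \<omega> (Seq (Do i) p2) st T Q"
 by (rule ex_Seq[where R = "%s. s = step q \<omega> i st" and ?T1.0 = 1 and ?T2.0 = T2])
  (use assms in "auto intro: ex_Do")

lemma ex_If:
 assumes "holds b st ==> ex q \<omega> p1 st T Q" "\<not> holds b st ==> ex q \<omega> p2 st T Q" "T + 1 \<le> T'"
 shows "ex q \<omega> (If b p1 p2) st T' Q"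
proof (cases "holds b st")
 case True
 with assms(1) obtain t st' where "exec q \<omega> p1 st t st'" "t \<le> T" "Q st'" unfolding ex_def by blast
 with True show ?thesis unfolding ex_def using exec.IfTrue[of b st q \<omega> p1 t st'] assms(3)
  by (intro exI[of _ "t+1"] exI[of _ st']) simp
next
 case False
 with assms(2) obtain t st' where "exec q \<omega> p2 st t st'" "t \<le> T" "Q st'" unfolding ex_def by blast
 with False show ?thesis unfolding ex_def using exec.IfFalse[of b st q \<omega> p2 t st'] assms(3)
  by (intro exI[of _ "t+1"] exI[of _ st']) simp
qed

lemma ex_mono: "ex q \<omega> p st T Q ==> T \<le> T' ==> (\<And>s. Q s ==> Q' s) ==> ex q \<omega> p st T' Q'"
 unfolding ex_def by (meson order_trans)

text \<open>The loop makes exactly \<open>n\<close> rounds; the 1 per round and the final 1 pay for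
  evaluating the test.\<close>

lemma ex_While:
 assumes "I 0 st" "\<And>k st. k < n ==> I k st ==> holds b st & ex q \<omega> p st T (I (Suc k))"
  "\<And>st. I n st ==> \<not> holds b st"
 shows "ex q \<omega> (While b p) st (n * (T + 1) + 1) (I n)"
proof -
 have "ex q \<omega> (While b p) st ((n - k) * (T + 1) + 1) (I n)" if "k \<le> n" "I k st" for k st
  using that
 proof (induction k arbitrary: st rule: inc_induct)
  case base
  then show ?case unfolding ex_def using exec.WhileFalse[of b st] assms(3) by fastforce
 next
  case (step k)
  from assms(2)[OF \<open>k < n\<close> \<open>I k st\<close>] obtain t1 st1 where
   1: "holds b st" "exec q \<omega> p st t1 st1" "t1 \<le> T" "I (Suc k) st1" unfolding ex_def by blast
  from step.IH[OF 1(4)] obtain t2 st2 where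
   2: "exec q \<omega> (While b p) st1 t2 st2" "t2 \<le> (n - Suc k) * (T + 1) + 1" "I n st2"
   unfolding ex_def by blast
  have eq: "n - k = Suc (n - Suc k)" using step.hyps by simp
  have "t1 + t2 + 1 \<le> (n - k) * (T + 1) + 1" using 1 2 unfolding eq by simp
  with exec.WhileTrue[OF 1(1,2) 2(1)] 2(3) show ?case unfolding ex_def by blast
 qed
 from this[of 0 st] assms(1) show ?thesis by simp
qed

text \<open>Registers from 64 on are a stack of temporaries and \<open>d\<close> is its height:
  compiled expressions work from \<open>64 + d\<close> upwards and leave everything below in
  place.\<close>

definition sim :: "nat => state => state => bool" where
 "sim d st st' \<longleftrightarrow> (\<forall>k<64+d. regs st' k = regs st k) & (\<forall>k<64+d. rregs st' k = rregs st k) &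
  heap st' = heap st & rheap st' = rheap st & inspected st' = inspected st"

lemma sim_refl [simp]: "sim d st st" by (simp add: sim_def)
lemma sim_trans: "sim d st st' ==> sim d st' st'' ==> sim d st st''" by (simp add: sim_def)
text \<open>The memory layout. The first n heap cells are reserved for the answer; the 16 arrays are
  interleaved behind them, and the 4 real arrays in the real heap, so that all of them are
  unbounded.\<close>

definition rel :: "hstate => state => bool" where
 "rel h st \<longleftrightarrow> (\<forall>i<64. regs st i = nvar h i) & (\<forall>i<64. rregs st i = rvar h i) &
  (\<forall>k<16. \<forall>i. heap st (nvar h 0 + (16 * i + k)) = narr h k i) &
  (\<forall>k<4. \<forall>i. rheap st (4 * i + k) = rarr h k i) &
  (\<forall>i<nvar h 0. heap st i = outp h i) & inspected st = seen h"

lemma rel_sim: "rel h st ==> sim d st st' ==> rel h st'"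
 by (simp add: rel_def sim_def)

text \<open>\<open>TCap\<close> multiplies by the loop cap, which serves as the row length of all
  two-dimensional tables; lacking multiplication, the machine adds in a loop. In \<open>Ar\<close>,
  four doublings produce the factor 16 of the layout. A copy is the addition of a zero.\<close>

primrec ce :: "nat => exp => prog" where
 "ce d (Vr i) = Seq (Do (Const (65+d) 0)) (Do (Add (64+d) i (65+d)))"
| "ce d (Nm c) = Do (Const (64+d) c)"
| "ce d (Plus a b) = Seq (ce d a) (Seq (ce (d+1) b) (Do (Add (64+d) (64+d) (65+d))))"
| "ce d (Minus a b) = Seq (ce d a) (Seq (ce (d+1) b) (Do (Sub (64+d) (64+d) (65+d))))"
| "ce d (TCap a) = Seq (ce (d+1) a) (Seq (Do (Const (64+d) 0)) (Seq (Do (Const (66+d) 0))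
  (Seq (Do (Const (67+d) 1)) (While (Less (66+d) 2)
   (Seq (Do (Add (64+d) (64+d) (65+d))) (Do (Add (66+d) (66+d) (67+d))))))))"
| "ce d (Ar k a) = Seq (ce d a) (Seq (Do (Add (64+d) (64+d) (64+d))) (Seq (Do (Add (64+d) (64+d) (64+d)))
  (Seq (Do (Add (64+d) (64+d) (64+d))) (Seq (Do (Add (64+d) (64+d) (64+d)))
  (Seq (Do (Const (65+d) k)) (Seq (Do (Add (64+d) (64+d) (65+d))) (Seq (Do (Add (64+d) 0 (64+d)))
   (Do (Load (64+d) (64+d))))))))))"

text \<open>A bound on the number of steps in units of \<open>nvar h 2 + 1\<close>. One such factor
  is enough, since the addition loops of several \<open>TCap\<close> run one after another and never
  inside each other.\<close>

primrec ecst :: "exp => nat" where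
 "ecst (Vr i) = 2"
| "ecst (Nm c) = 1"
| "ecst (Plus a b) = ecst a + ecst b + 1"
| "ecst (Minus a b) = ecst a + ecst b + 1"
| "ecst (TCap a) = ecst a + 7"
| "ecst (Ar k a) = ecst a + 8"

lemma ce_ok:
 assumes "wfe e" "rel h st"
 shows "ex q \<omega> (ce d e) st (ecst e * (nvar h 2 + 1))
  (%st'. sim d st st' & regs st' (64+d) = eval e h)"
 using assms
proof (induction e arbitrary: d st)
 case (Vr i)
 show ?case unfolding ce.simps
  by (rule ex_DoSeq[OF ex_Do[OF _ order_refl]])
   (use Vr in "auto simp: sim_def rel_def")
next
 case (Nm c)
 show ?case unfolding ce.simps by (rule ex_Do) (auto simp: sim_def)
next
 case (Plus a b)
 show ?case unfolding ce.simps
  apply (rule ex_Seq[OF Plus.IH(1)], use Plus in simp, use Plus in simp)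
  apply (rule ex_Seq[OF Plus.IH(2)], use Plus in simp)
   apply (use Plus(4) rel_sim in blast)
   apply (rule ex_Do[OF _ order_refl])
   apply (auto simp: sim_def)[1]
  apply (rule order_refl)
  apply (simp add: algebra_simps)
  done
next
 case (Minus a b)
 show ?case unfolding ce.simps
  apply (rule ex_Seq[OF Minus.IH(1)], use Minus in simp, use Minus in simp)
  apply (rule ex_Seq[OF Minus.IH(2)], use Minus in simp)
   apply (use Minus(4) rel_sim in blast)
   apply (rule ex_Do[OF _ order_refl])
   apply (auto simp: sim_def)[1]
  apply (rule order_refl)
  apply (simp add: algebra_simps)
  done
next
 case (TCap a)
 let ?I = "%k st'. sim d st st' & regs st' (65+d) = eval a h & regs st' (66+d) = k
  & regs st' (67+d) = 1 & regs st' (64+d) = k * eval a h"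
 have W: "ex q \<omega> (While (Less (66+d) 2)
   (Seq (Do (Add (64+d) (64+d) (65+d))) (Do (Add (66+d) (66+d) (67+d))))) st1
   (nvar h 2 * (2 + 1) + 1) (?I (nvar h 2))"
  if "?I 0 st1" for st1
 proof (rule ex_While)
  show "?I 0 st1" by (rule that)
 next
  fix k st2 assume *: "k < nvar h 2" "?I k st2"
  have "regs st2 2 = nvar h 2" using *(2) TCap.prems by (auto simp: sim_def rel_def)
  then have "holds (Less (66+d) 2) st2" using * by simp
  moreover have "ex q \<omega> (Seq (Do (Add (64+d) (64+d) (65+d))) (Do (Add (66+d) (66+d) (67+d)))) st2 2 (?I (Suc k))"
   by (rule ex_DoSeq[OF ex_Do[OF _ order_refl]])
    (use * in "auto simp: sim_def")
  ultimately show "holds (Less (66+d) 2) st2 &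
   ex q \<omega> (Seq (Do (Add (64+d) (64+d) (65+d))) (Do (Add (66+d) (66+d) (67+d)))) st2 2 (?I (Suc k))" ..
 next
  fix st2 assume *: "?I (nvar h 2) st2"
  have "regs st2 2 = nvar h 2" using * TCap.prems by (auto simp: sim_def rel_def)
  then show "\<not> holds (Less (66+d) 2) st2" using * by simp
 qed
 show ?case unfolding ce.simps
  apply (rule ex_Seq[OF TCap.IH], use TCap in simp, use TCap in simp)
  apply (rule ex_DoSeq)+
    apply (rule ex_mono[OF W])
     apply (auto simp: sim_def mult.commute)[3]
   apply (rule order_refl)+
  apply (simp add: algebra_simps)
  done
next
 case (Ar k a)
 have *: "heap st (nvar h 0 + (16 * i + k)) = narr h k i" for i using Ar.prems by (auto simp: rel_def)
 have **: "heap st (regs st 0 + (16 * i + k)) = narr h k i" for i using Ar.prems by (auto simp: rel_def)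
 show ?case unfolding ce.simps
  apply (rule ex_Seq[OF Ar.IH], use Ar in simp, use Ar in simp)
  apply (rule ex_DoSeq)+
       apply (rule ex_Do[OF _ order_refl])
       apply (use **[of "eval a h"] in "simp add: mult_2[symmetric] sim_def")
      apply (rule order_refl)+
  apply (simp add: algebra_simps)
  done
qed

primrec cr :: "nat => rexp => prog" where
 "cr d (RV i) = Seq (Do (RSub (65+d) (65+d) (65+d))) (Do (RAdd (64+d) i (65+d)))"
| "cr d (RPlus a b) = Seq (cr d a) (Seq (cr (d+1) b) (Do (RAdd (64+d) (64+d) (65+d))))"
| "cr d (RMinus a b) = Seq (cr d a) (Seq (cr (d+1) b) (Do (RSub (64+d) (64+d) (65+d))))"
| "cr d (RAr k a) = Seq (ce d a) (Seq (Do (Add (64+d) (64+d) (64+d))) (Seq (Do (Add (64+d) (64+d) (64+d)))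
  (Seq (Do (Const (65+d) k)) (Seq (Do (Add (64+d) (64+d) (65+d))) (Do (RLoad (64+d) (64+d)))))))"

primrec rcst :: "rexp => nat" where
 "rcst (RV i) = 2"
| "rcst (RPlus a b) = rcst a + rcst b + 1"
| "rcst (RMinus a b) = rcst a + rcst b + 1"
| "rcst (RAr k a) = ecst a + 5"

lemma cr_ok:
 assumes "wfr e" "rel h st"
 shows "ex q \<omega> (cr d e) st (rcst e * (nvar h 2 + 1))
  (%st'. sim d st st' & rregs st' (64+d) = reval e h)"
 using assms
proof (induction e arbitrary: d st)
 case (RV i)
 show ?case unfolding cr.simps
  by (rule ex_DoSeq[OF ex_Do[OF _ order_refl]])
   (use RV in "auto simp: sim_def rel_def")
next
 case (RPlus a b)
 show ?case unfolding cr.simps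
  apply (rule ex_Seq[OF RPlus.IH(1)], use RPlus in simp, use RPlus in simp)
  apply (rule ex_Seq[OF RPlus.IH(2)], use RPlus in simp)
   apply (use RPlus(4) rel_sim in blast)
   apply (rule ex_Do[OF _ order_refl])
   apply (auto simp: sim_def)[1]
  apply (rule order_refl)
  apply (simp add: algebra_simps)
  done
next
 case (RMinus a b)
 show ?case unfolding cr.simps
  apply (rule ex_Seq[OF RMinus.IH(1)], use RMinus in simp, use RMinus in simp)
  apply (rule ex_Seq[OF RMinus.IH(2)], use RMinus in simp)
   apply (use RMinus(4) rel_sim in blast)
   apply (rule ex_Do[OF _ order_refl])
   apply (auto simp: sim_def)[1]
  apply (rule order_refl)
  apply (simp add: algebra_simps)
  done
next
 case (RAr k a)
 have **: "rheap st (4 * i + k) = rarr h k i" for i using RAr.prems by (auto simp: rel_def)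
 show ?case unfolding cr.simps
  apply (rule ex_Seq[OF ce_ok], use RAr in simp, use RAr in simp)
  apply (rule ex_DoSeq)+
       apply (rule ex_Do[OF _ order_refl])
       apply (use **[of "eval a h"] in "simp add: mult_2[symmetric] sim_def")
      apply (rule order_refl)+
  apply (simp add: algebra_simps)
  done
qed

text \<open>Conditions take the two branches as continuations, because there is no Boolean register.
  \<open>BAnd\<close> copies the second branch; this costs program size but no time.\<close>

primrec cb :: "bexp => nat => prog => prog => prog" where
 "cb (BLess a b) d p1 p2 = Seq (ce d a) (Seq (ce (d+1) b) (If (Less (64+d) (65+d)) p1 p2))"
| "cb (BRLess a b) d p1 p2 = Seq (cr d a) (Seq (cr (d+1) b) (If (RLess (64+d) (65+d)) p1 p2))"
| "cb (BNot b) d p1 p2 = cb b d p2 p1"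
| "cb (BAnd a b) d p1 p2 = cb a d (cb b d p1 p2) p2"

primrec bcst :: "bexp => nat" where
 "bcst (BLess a b) = ecst a + ecst b + 1"
| "bcst (BRLess a b) = rcst a + rcst b + 1"
| "bcst (BNot b) = bcst b"
| "bcst (BAnd a b) = bcst a + bcst b"

lemma cb_ok:
 assumes "wfb b" "rel h st"
  "\<And>st'. sim d st st' ==> beval b h ==> ex q \<omega> p1 st' T Q"
  "\<And>st'. sim d st st' ==> \<not> beval b h ==> ex q \<omega> p2 st' T Q"
 shows "ex q \<omega> (cb b d p1 p2) st (bcst b * (nvar h 2 + 1) + T) Q"
 using assms
proof (induction b arbitrary: st p1 p2 T)
 case (BLess a b)
 show ?case unfolding cb.simps
  apply (rule ex_Seq[OF ce_ok], use BLess in simp, use BLess in simp)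
  apply (rule ex_Seq[OF ce_ok], use BLess in simp)
   apply (use BLess(2) rel_sim in blast)
   apply (rule ex_If[where T = T])
    apply (rule BLess(3))
    apply (auto simp: sim_def)[2]
   apply (rule BLess(4))
    apply (auto simp: sim_def)[2]
   apply (rule order_refl)
  apply (rule order_refl)
  apply (simp add: algebra_simps)
  done
next
 case (BRLess a b)
 show ?case unfolding cb.simps
  apply (rule ex_Seq[OF cr_ok], use BRLess in simp, use BRLess in simp)
  apply (rule ex_Seq[OF cr_ok], use BRLess in simp)
   apply (use BRLess(2) rel_sim in blast)
   apply (rule ex_If[where T = T])
    apply (rule BRLess(3))
    apply (auto simp: sim_def)[2]
   apply (rule BRLess(4))
    apply (auto simp: sim_def)[2]
   apply (rule order_refl)
  apply (rule order_refl)
  apply (simp add: algebra_simps)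
  done
next
 case (BNot b)
 then show ?case by simp
next
 case (BAnd a b)
 have "ex q \<omega> (cb a d (cb b d p1 p2) p2) st (bcst a * (nvar h 2 + 1) + (bcst b * (nvar h 2 + 1) + T)) Q"
 proof (rule BAnd.IH(1))
  show "wfb a" "rel h st" using BAnd.prems by auto
  show "ex q \<omega> (cb b d p1 p2) st' (bcst b * (nvar h 2 + 1) + T) Q" if "sim d st st'" "beval a h" for st'
   by (rule BAnd.IH(2))
    (use BAnd.prems(1) that(2) rel_sim[OF BAnd.prems(2) that(1)]
     BAnd.prems(3,4)[OF sim_trans[OF that(1)]] in "simp_all")
  show "ex q \<omega> p2 st' (bcst b * (nvar h 2 + 1) + T) Q" if "sim d st st'" "\<not> beval a h" for st'
   by (rule ex_mono[OF BAnd.prems(4)]) (use that in auto)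
 qed
 then show ?case by (simp add: algebra_simps)
qed

text \<open>In \<open>For\<close>, the limit and the counter live in the temporaries
  \<open>64 + d\<close> and \<open>65 + d\<close>, and the body is compiled two levels higher up the
  stack. The loop variable is set from the counter in every round, so the body may overwrite it
  without changing the number of rounds.\<close>

primrec cc :: "cmd => nat => prog" where
 "cc Skip d = Do (Const (64+d) 0)"
| "cc (Assign i e) d = Seq (ce d e) (Seq (Do (Const (65+d) 0)) (Do (Add i (64+d) (65+d))))"
| "cc (AStore k a e) d = Seq (ce d a) (Seq (ce (d+1) e)
  (Seq (Do (Add (64+d) (64+d) (64+d))) (Seq (Do (Add (64+d) (64+d) (64+d)))
  (Seq (Do (Add (64+d) (64+d) (64+d))) (Seq (Do (Add (64+d) (64+d) (64+d)))
  (Seq (Do (Const (66+d) k)) (Seq (Do (Add (64+d) (64+d) (66+d))) (Seq (Do (Add (64+d) 0 (64+d)))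
   (Do (Store (64+d) (65+d)))))))))))"
| "cc (RAssign i e) d = Seq (cr d e) (Seq (Do (RSub (65+d) (65+d) (65+d))) (Do (RAdd i (64+d) (65+d))))"
| "cc (RAStore k a e) d = Seq (ce d a) (Seq (cr (d+1) e)
  (Seq (Do (Add (64+d) (64+d) (64+d))) (Seq (Do (Add (64+d) (64+d) (64+d)))
  (Seq (Do (Const (66+d) k)) (Seq (Do (Add (64+d) (64+d) (66+d)))
   (Do (RStore (64+d) (65+d))))))))"
| "cc (Out a e) d = Seq (ce d a) (Seq (ce (d+1) e)
  (If (Less (64+d) 0) (Do (Store (64+d) (65+d))) (Do (Const (64+d) 0))))"
| "cc (Insp i a b) d = Seq (ce d a) (Seq (ce (d+1) b) (Do (Inspect i (64+d) (65+d))))"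
| "cc (SeqC c1 c2) d = Seq (cc c1 d) (cc c2 d)"
| "cc (IfC b c1 c2) d = cb b d (cc c1 d) (cc c2 d)"
| "cc (For i e c) d = Seq (ce d e) (Seq
  (If (Less 2 (64+d)) (Seq (Do (Const (65+d) 0)) (Do (Add (64+d) 2 (65+d)))) (Do (Const (65+d) 0)))
  (Seq (Do (Const (65+d) 0)) (While (Less (65+d) (64+d))
   (Seq (Do (Const (66+d) 0)) (Seq (Do (Add i (65+d) (66+d))) (Seq (cc c (d+2))
    (Seq (Do (Const (66+d) 1)) (Do (Add (65+d) (65+d) (66+d))))))))))"

text \<open>The exponent of the cap in the running time: the nesting depth of loops plus one, the
  one paying for \<open>TCap\<close>.\<close>

primrec cdep :: "cmd => nat" where
 "cdep Skip = 1"
| "cdep (Assign i e) = 1"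
| "cdep (AStore k a e) = 1"
| "cdep (RAssign i e) = 1"
| "cdep (RAStore k a e) = 1"
| "cdep (Out a e) = 1"
| "cdep (Insp i a b) = 1"
| "cdep (SeqC c1 c2) = max (cdep c1) (cdep c2)"
| "cdep (IfC b c1 c2) = max (cdep c1) (cdep c2)"
| "cdep (For i e c) = Suc (cdep c)"

primrec ccst :: "cmd => nat" where
 "ccst Skip = 1"
| "ccst (Assign i e) = ecst e + 2"
| "ccst (AStore k a e) = ecst a + ecst e + 8"
| "ccst (RAssign i e) = rcst e + 2"
| "ccst (RAStore k a e) = ecst a + rcst e + 5"
| "ccst (Out a e) = ecst a + ecst e + 2"
| "ccst (Insp i a b) = ecst a + ecst b + 1"
| "ccst (SeqC c1 c2) = ccst c1 + ccst c2"
| "ccst (IfC b c1 c2) = bcst b + ccst c1 + ccst c2"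
| "ccst (For i e c) = ecst e + ccst c + 10"

lemma cdep_pos: "1 \<le> cdep c" by (induction c) auto

lemma addr_inj [simp]:
 fixes i i' :: nat
 assumes "k < 16" "k' < 16"
 shows "(16 * i + k = 16 * i' + k') = (i = i' & k = k')"
proof -
 have "i = i'" if "16 * i + k = 16 * i' + k'"
  using assms arg_cong[OF that, of "%x. x div 16"] by simp
 then show ?thesis by auto
qed

lemma raddr_inj [simp]:
 fixes i i' :: nat
 assumes "k < 4" "k' < 4"
 shows "(4 * i + k = 4 * i' + k') = (i = i' & k = k')"
proof -
 have "i = i'" if "4 * i + k = 4 * i' + k'"
  using assms arg_cong[OF that, of "%x. x div 4"] by simp
 then show ?thesis by auto
qed

lemma pow_lin: "1 \<le> c ==> (x::nat) + 1 \<le> (x + 1) ^ c"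
 by (metis One_nat_def Suc_le_eq Suc_pred add.commute le_add1 mult.right_neutral power_Suc
   mult_le_mono2 one_le_power plus_1_eq_Suc)

lemma rel_AStore:
 assumes "rel h st" "k < 16" "heap st' = (heap st)(nvar h 0 + (16 * i + k) := x)"
  "\<forall>j<64. regs st' j = regs st j" "\<forall>j<64. rregs st' j = rregs st j" "rheap st' = rheap st"
  "inspected st' = inspected st"
 shows "rel (h\<lparr>narr := (narr h)(k := (narr h k)(i := x))\<rparr>) st'"
 using assms by (auto simp: rel_def)

lemma rel_RAStore:
 assumes "rel h st" "k < 4" "rheap st' = (rheap st)(4 * i + k := x)"
  "\<forall>j<64. regs st' j = regs st j" "\<forall>j<64. rregs st' j = rregs st j" "heap st' = heap st"
  "inspected st' = inspected st"
 shows "rel (h\<lparr>rarr := (rarr h)(k := (rarr h k)(i := x))\<rparr>) st'"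
 using assms by (auto simp: rel_def)

text \<open>Besides the simulation, the natural temporaries below depth \<open>d\<close> must
  survive, as they hold the counters and limits of the enclosing loops. Coefficient and degree of
  the time bound are read off the syntax, for every input and every \<open>q\<close>.\<close>

lemma cc_ok:
 assumes "wfc c" "rel h st"
 shows "ex q \<omega> (cc c d) st (ccst c * (nvar h 2 + 1) ^ cdep c)
  (%st'. rel (sem q c h) st' & (\<forall>k. 64 \<le> k --> k < 64+d --> regs st' k = regs st k))"
 using assms
proof (induction c arbitrary: d h st)
 case Skip
 show ?case unfolding cc.simps by (rule ex_Do) (use Skip in "auto simp: rel_def")
next
 case (Assign i e)
 show ?case unfolding cc.simps
  apply (rule ex_Seq[OF ce_ok], use Assign in simp, use Assign in simp)
  apply (rule ex_DoSeq)
   apply (rule ex_Do[OF _ order_refl])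
   apply (use Assign in "auto simp: sim_def rel_def wfv_def")[1]
  apply (rule order_refl)+
  apply (simp add: algebra_simps)
  done
next
 case (AStore k a e)
 show ?case unfolding cc.simps
  apply (rule ex_Seq[OF ce_ok], use AStore in simp, use AStore in simp)
  apply (rule ex_Seq[OF ce_ok], use AStore in simp)
   apply (use AStore(2) rel_sim in blast)
  apply (rule ex_DoSeq)+
   apply (rule ex_Do[OF _ order_refl])
      apply (rule conjI)
  subgoal for s1 s2
   unfolding sem.simps
   apply (rule rel_AStore[where st = st], use AStore in simp, use AStore in simp)
     apply (use AStore in "auto simp: sim_def rel_def mult_2[symmetric]")
   done
  subgoal for s1 s2 by (auto simp: sim_def)
      apply (rule order_refl)+
  apply (simp add: algebra_simps)
  done
next
 case (RAssign i e)
 show ?case unfolding cc.simps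
  apply (rule ex_Seq[OF cr_ok], use RAssign in simp, use RAssign in simp)
  apply (rule ex_DoSeq)
   apply (rule ex_Do[OF _ order_refl])
   apply (use RAssign in "auto simp: sim_def rel_def")[1]
  apply (rule order_refl)+
  apply (simp add: algebra_simps)
  done
next
 case (RAStore k a e)
 show ?case unfolding cc.simps
  apply (rule ex_Seq[OF ce_ok], use RAStore in simp, use RAStore in simp)
  apply (rule ex_Seq[OF cr_ok], use RAStore in simp)
   apply (use RAStore(2) rel_sim in blast)
  apply (rule ex_DoSeq)+
   apply (rule ex_Do[OF _ order_refl])
      apply (rule conjI)
  subgoal for s1 s2
   unfolding sem.simps
   apply (rule rel_RAStore[where st = st], use RAStore in simp, use RAStore in simp)
     apply (use RAStore in "auto simp: sim_def rel_def mult_2[symmetric]")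
   done
  subgoal for s1 s2 by (auto simp: sim_def)
      apply (rule order_refl)+
  apply (simp add: algebra_simps)
  done
next
 case (Out a e)
 show ?case unfolding cc.simps
  apply (rule ex_Seq[OF ce_ok], use Out in simp, use Out in simp)
  apply (rule ex_Seq[OF ce_ok], use Out in simp)
   apply (use Out(2) rel_sim in blast)
   apply (rule ex_If[where T = 1])
    apply (rule ex_Do[OF _ order_refl])
    apply (use Out in "auto simp: sim_def rel_def")[1]
   apply (rule ex_Do[OF _ order_refl])
   apply (use Out in "auto simp: sim_def rel_def")[1]
   apply (rule order_refl)+
  apply (simp add: algebra_simps)
  done
next
 case (Insp i a b)
 show ?case unfolding cc.simps
  apply (rule ex_Seq[OF ce_ok], use Insp in simp, use Insp in simp)
  apply (rule ex_Seq[OF ce_ok], use Insp in simp)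
   apply (use Insp(2) rel_sim in blast)
   apply (rule ex_Do[OF _ order_refl])
   apply (use Insp in "auto simp: sim_def rel_def")[1]
  apply (rule order_refl)
  apply (simp add: algebra_simps)
  done
next
 case (SeqC c1 c2)
 have k: "nvar (sem q c1 h) 2 = nvar h 2" using sem_keeps SeqC by simp
 have le: "(nvar h 2 + 1) ^ cdep c1 \<le> (nvar h 2 + 1) ^ max (cdep c1) (cdep c2)"
  "(nvar h 2 + 1) ^ cdep c2 \<le> (nvar h 2 + 1) ^ max (cdep c1) (cdep c2)"
  by (auto intro: power_increasing)
 show ?case unfolding cc.simps
  apply (rule ex_Seq[OF SeqC.IH(1)], use SeqC in simp, use SeqC in simp)
  apply (rule ex_mono[OF SeqC.IH(2)[where h = "sem q c1 h"]], use SeqC in simp)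
   apply simp
   apply (rule order_refl)
  apply simp
  using le by (simp add: k distrib_right add_mono mult_le_mono2)
next
 case (IfC b c1 c2)
 let ?B = "(nvar h 2 + 1) ^ max (cdep c1) (cdep c2)"
 have le: "(nvar h 2 + 1) ^ cdep c1 \<le> ?B" "(nvar h 2 + 1) ^ cdep c2 \<le> ?B"
  by (auto intro: power_increasing)
 \<comment> \<open>Evaluating the condition costs one factor of the cap, which fits since
   \<open>cdep\<close> is at least 1.\<close>
 have le1: "nvar h 2 + 1 \<le> ?B"
  by (rule order_trans[OF pow_lin[OF cdep_pos[of c1]] le(1)])
 have "ex q \<omega> (cb b d (cc c1 d) (cc c2 d)) st (bcst b * (nvar h 2 + 1) + (ccst c1 + ccst c2) * ?B)
  (%st'. rel (sem q (IfC b c1 c2) h) st' & (\<forall>k. 64 \<le> k --> k < 64+d --> regs st' k = regs st k))"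
 proof (rule cb_ok)
  show "wfb b" "rel h st" using IfC.prems by auto
  fix st' assume s: "sim d st st'"
  show "ex q \<omega> (cc c1 d) st' ((ccst c1 + ccst c2) * ?B)
   (%st'. rel (sem q (IfC b c1 c2) h) st' & (\<forall>k. 64 \<le> k --> k < 64+d --> regs st' k = regs st k))"
   if "beval b h"
   by (rule ex_mono[OF IfC.IH(1)[of h]])
    (use IfC.prems that s rel_sim[OF _ s] le in "auto simp: sim_def intro!: mult_le_mono")
  show "ex q \<omega> (cc c2 d) st' ((ccst c1 + ccst c2) * ?B)
   (%st'. rel (sem q (IfC b c1 c2) h) st' & (\<forall>k. 64 \<le> k --> k < 64+d --> regs st' k = regs st k))"
   if "\<not> beval b h"
   by (rule ex_mono[OF IfC.IH(2)[of h]])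
    (use IfC.prems that s rel_sim[OF _ s] le in "auto simp: sim_def intro!: mult_le_mono")
 qed
 then show ?case unfolding cc.simps
  apply (rule ex_mono)
  using mult_le_mono2[OF le1, of "bcst b"] by (auto simp: algebra_simps)
next
 case (For i e c)
 define N where "N = min (eval e h) (nvar h 2)"
 define f where "f = (%k h. sem q c (setv i k h))"
 define B where "B = ccst c * (nvar h 2 + 1) ^ cdep c"
 let ?I = "%k st'. rel (fold f [0..<k] h) st' & regs st' (64+d) = N & regs st' (65+d) = k &
  (\<forall>k. 64 \<le> k --> k < 64+d --> regs st' k = regs st k)"
 let ?body = "Seq (Do (Const (66+d) 0)) (Seq (Do (Add i (65+d) (66+d))) (Seq (cc c (d+2))
    (Seq (Do (Const (66+d) 1)) (Do (Add (65+d) (65+d) (66+d))))))"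
 have wf: "wfv i" "wfe e" "wfc c" using For.prems by auto
 have keeps: "nvar (fold f [0..<k] h) 2 = nvar h 2" for k
  by (rule fold_upt_induct[where I = "%k y. nvar y 2 = nvar h 2"])
   (use wf sem_keeps in "auto simp: f_def wfv_def")
 \<comment> \<open>\<open>B + 4\<close> bounds a round: the body and the four instructions around
   it.\<close>
 have W: "ex q \<omega> (While (Less (65+d) (64+d)) ?body) st1 (N * ((B + 4) + 1) + 1) (?I N)"
  if "?I 0 st1" for st1
 proof (rule ex_While[where I = ?I and T = "B + 4"])
  show "?I 0 st1" by (rule that)
 next
  fix k st2 assume *: "k < N" "?I k st2"
  let ?h = "setv i k (fold f [0..<k] h)"
  have "nvar ?h 2 = nvar h 2" using keeps wf by (simp add: wfv_def)
  then have Beq: "B = ccst c * (nvar ?h 2 + 1) ^ cdep c" by (simp add: B_def)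
  have "ex q \<omega> ?body st2 (B + 4) (?I (Suc k))"
  apply (rule ex_DoSeq)+
    apply (rule ex_Seq[OF For.IH[where h = ?h]])
     apply (use wf in simp)
    apply (use * wf in "auto simp: rel_def wfv_def")[1]
    apply (rule ex_DoSeq)
     apply (rule ex_Do[OF _ order_refl])
    apply (use * wf in "auto simp: f_def rel_def wfv_def")[1]
    apply (rule order_refl)+
   unfolding Beq by simp
  then show "holds (Less (65+d) (64+d)) st2 & ex q \<omega> ?body st2 (B + 4) (?I (Suc k))"
   using * by simp
 next
  fix st2 assume "?I N st2"
  then show "\<not> holds (Less (65+d) (64+d)) st2" by simp
 qed
 have NB: "N * ((B + 4) + 1) + 1 + ecst e * (nvar h 2 + 1) + 4 \<le> (ecst e + ccst c + 10) * (nvar h 2 + 1) ^ Suc (cdep c)"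
 proof -
  let ?c = "nvar h 2 + 1"
  have p: "1 \<le> ?c ^ cdep c" by simp
  have "N * (B + 5) \<le> ?c * (B + 5)" by (rule mult_le_mono1) (simp add: N_def)
  also have "... \<le> ?c * ((ccst c + 5) * ?c ^ cdep c)"
   unfolding B_def using p by (intro mult_le_mono2) (simp add: algebra_simps)
  finally have 1: "N * (B + 5) \<le> (ccst c + 5) * ?c ^ Suc (cdep c)" by (simp add: algebra_simps)
  have 2: "ecst e * ?c \<le> ecst e * ?c ^ Suc (cdep c)" by (intro mult_le_mono2 pow_lin) simp
  have "1 \<le> ?c ^ Suc (cdep c)" by (rule one_le_power) simp
  then have 3: "5 \<le> 5 * ?c ^ Suc (cdep c)" by linarith
  have 4: "(ecst e + ccst c + 10) * X = ecst e * X + (ccst c + 5) * X + 5 * X" for X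
   by (simp add: algebra_simps)
  have 5: "B + 4 + 1 = B + 5" by simp
  have gen: "a \<le> a' ==> b \<le> b' ==> 5 \<le> c' ==> a + 1 + b + 4 \<le> b' + a' + c'" for a b a' b' c' :: nat
   by simp
  show ?thesis unfolding 4 5 by (rule gen[OF 1 2 3])
 qed
 show ?case unfolding cc.simps
  apply (rule ex_Seq[OF ce_ok], use For in simp, use For in simp)
  apply (rule ex_Seq[where R = "%s. sim d st s & regs s (64+d) = N" and ?T1.0 = 3])
   apply (rule ex_If[where T = 2])
    apply (rule ex_DoSeq)
     apply (rule ex_Do[OF _ order_refl])
     apply (use For.prems in "auto simp: sim_def N_def rel_def")[1]
    apply simp
    apply (rule ex_Do)
    apply (use For.prems in "auto simp: sim_def N_def rel_def")[3]
   apply (rule ex_DoSeq)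
   apply (rule ex_mono[OF W])
    apply (use For.prems in "auto simp: sim_def rel_def")[1]
    apply (rule order_refl)
   apply (simp add: f_def N_def)
   apply (rule order_refl)+
  using NB by simp
qed

lemma For_rule:
 assumes "eval e h = N" "N \<le> nvar h 2" "I 0 h"
  "\<And>k h. k < N ==> I k h ==> I (Suc k) (sem q c (setv i k h))"
 shows "I N (sem q (For i e c) h)"
 using assms by (auto simp: min_absorb1 intro!: fold_upt_induct[where I = I])

section \<open>Dependence of a run on the inspected values only\<close>

lemma seen_mono: "seen h \<subseteq> seen (sem q c h)"
proof (induction c arbitrary: h)
 case (For i e c)
 show ?case unfolding sem.simps
  by (rule fold_upt_induct[where I = "%k y. seen h \<subseteq> seen y"])
   (use For[of "setv i _ _"] in "auto")
next
 case (SeqC c1 c2)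
 then show ?case by (simp, blast)
qed auto

definition agree :: "(nat => nat => real) => (nat => nat => real) => nat set set => bool" where
 "agree q q' S \<longleftrightarrow> (\<forall>i j. {i, j} \<in> S --> q i j = q' i j)"

lemma agree_subset: "agree q q' S ==> T \<subseteq> S ==> agree q q' T"
 by (auto simp: agree_def)

text \<open>A run consults \<open>q\<close> only at pairs that it records in \<open>seen\<close>.
  All independence rests on this: what was computed before a stage cannot depend on signals not yet
  inspected.\<close>

lemma sem_agree: "agree q q' (seen (sem q c h)) ==> sem q' c h = sem q c h"
proof (induction c arbitrary: h)
 case (For i e c)
 define f where "f = (%q k h. sem q c (setv i k h))"
 have "fold (f q') [0..<N] h = fold (f q) [0..<N] h" if "agree q q' (seen (fold (f q) [0..<N] h))" for N
  using that
 proof (induction N)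
  case (Suc N)
  let ?y = "fold (f q) [0..<N] h"
  have 1: "agree q q' (seen (sem q c (setv i N ?y)))" using Suc.prems by (simp add: f_def)
  have "seen ?y \<subseteq> seen (sem q c (setv i N ?y))" using seen_mono[of "setv i N ?y" q c] by simp
  then have "fold (f q') [0..<N] h = ?y" using Suc.IH agree_subset[OF 1] by blast
  then show ?case using For.IH[OF 1] by (simp add: f_def)
 qed simp
 then show ?case using For.prems unfolding sem.simps f_def by blast
next
 case (SeqC c1 c2)
 have "agree q q' (seen (sem q c1 h))"
  using SeqC.prems seen_mono[of "sem q c1 h" q c2] by (auto intro: agree_subset)
 then show ?case using SeqC by simp
next
 case (Insp i a b)
 then show ?case by (auto simp: agree_def)
qed auto

primrec cblind :: "cmd => bool" where
 "cblind Skip \<longleftrightarrow> True"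
| "cblind (Assign i e) \<longleftrightarrow> True"
| "cblind (AStore k a e) \<longleftrightarrow> True"
| "cblind (RAssign i e) \<longleftrightarrow> True"
| "cblind (RAStore k a e) \<longleftrightarrow> True"
| "cblind (Out a e) \<longleftrightarrow> True"
| "cblind (Insp i a b) \<longleftrightarrow> False"
| "cblind (SeqC c1 c2) \<longleftrightarrow> cblind c1 & cblind c2"
| "cblind (IfC b c1 c2) \<longleftrightarrow> cblind c1 & cblind c2"
| "cblind (For i e c) \<longleftrightarrow> cblind c"

lemma cblind_seen: "cblind c ==> seen (sem q c h) = seen h"
proof (induction c arbitrary: h)
 case (For i e c)
 show ?case unfolding sem.simps
  by (rule fold_upt_induct[where I = "%k y. seen y = seen h"]) (use For in auto)
qed auto

subsection \<open>Measurability\<close>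

abbreviation nat_measurable :: "'x measure => ('x => 'y) => bool" where
 "nat_measurable N f \<equiv> f \<in> measurable N (count_space UNIV)"

definition hmeas :: "'x measure => ('x => hstate) => bool" where
 "hmeas N h \<longleftrightarrow> (\<forall>i. nat_measurable N (%x. nvar (h x) i)) &
  (\<forall>k i. nat_measurable N (%x. narr (h x) k i)) &
  (\<forall>i. (%x. rvar (h x) i) \<in> borel_measurable N) &
  (\<forall>k i. (%x. rarr (h x) k i) \<in> borel_measurable N) &
  (\<forall>i. nat_measurable N (%x. outp (h x) i))"

text \<open>An address computed at run time has countably many values, so an array access is a
  countable case distinction.\<close>

lemma meas_countable_idx:
 assumes "g \<in> measurable N (count_space UNIV)" "\<And>i::nat. f i \<in> measurable N L"
 shows "(%x. f (g x) x) \<in> measurable N L"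
 by (rule measurable_compose_countable'[OF _ assms(1)]) (use assms(2) in auto)

lemma meas_eval: "hmeas N h ==> nat_measurable N (%x. eval e (h x))"
proof (induction e)
 case (Ar k a)
 show ?case unfolding eval.simps
  by (rule meas_countable_idx[where f = "%i x. narr (h x) k i"]) (use Ar in "auto simp: hmeas_def")
next
 case (Plus a b)
 note [measurable] = Plus.IH(1)[OF Plus.prems] Plus.IH(2)[OF Plus.prems]
 show ?case by simp
next
 case (Minus a b)
 note [measurable] = Minus.IH(1)[OF Minus.prems] Minus.IH(2)[OF Minus.prems]
 show ?case by simp
next
 case (TCap a)
 note [measurable] = TCap.IH[OF TCap.prems]
 have [measurable]: "nat_measurable N (%x. nvar (h x) 2)" using TCap.prems by (simp add: hmeas_def)
 show ?case by simp
qed (auto simp: hmeas_def)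

lemma meas_reval: "hmeas N h ==> (%x. reval e (h x)) \<in> borel_measurable N"
proof (induction e)
 case (RAr k a)
 show ?case unfolding reval.simps
  by (rule meas_countable_idx[where f = "%i x. rarr (h x) k i"])
   (use RAr meas_eval in "auto simp: hmeas_def")
qed (auto simp: hmeas_def)

lemma meas_beval: "hmeas N h ==> Measurable.pred N (%x. beval b (h x))"
proof (induction b)
 case (BLess a b)
 have "nat_measurable N (%x. i < eval b (h x))" for i
  using measurable_compose[OF meas_eval[OF BLess, of b], of "%k. i < k" "count_space UNIV"] by simp
 then have "nat_measurable N (%x. eval a (h x) < eval b (h x))"
  by (rule meas_countable_idx[OF meas_eval[OF BLess, of a], where f = "%i x. i < eval b (h x)"])
 then show ?case by simp
next
 case (BRLess a b)
 note [measurable] = meas_reval[OF BRLess]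
 show ?case by simp
qed auto

lemma hmeas_piecewise:
 assumes "\<And>k::nat. hmeas N (h k)" "g \<in> measurable N (count_space UNIV)"
 shows "hmeas N (%x. h (g x) x)"
 unfolding hmeas_def
 by (intro conjI allI; rule meas_countable_idx[where f = "%k x. _ (h k x) _"]
    meas_countable_idx[where f = "%k x. _ (h k x) _ _"])
  (use assms in "auto simp: hmeas_def")

lemma hmeas_if:
 assumes "hmeas N f" "hmeas N g" "Measurable.pred N P"
 shows "hmeas N (%x. if P x then f x else g x)"
proof -
 have "hmeas N (%x. (%k x. if k = (1::nat) then f x else g x) (of_bool (P x)) x)"
 proof (rule hmeas_piecewise[where h = "%k x. if k = (1::nat) then f x else g x" and g = "%x. of_bool (P x)"])
  show "hmeas N (%x. if k = (1::nat) then f x else g x)" for k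
   using assms by (cases "k = 1") auto
  show "nat_measurable N (%x. of_bool (P x))"
   using assms(3) measurable_compose[of P N "count_space UNIV" of_bool] by simp
 qed
 moreover have "(%x. (%k x. if k = (1::nat) then f x else g x) (of_bool (P x)) x) =
   (%x. if P x then f x else g x)" by auto
 ultimately show ?thesis by simp
qed

lemma hmeas_setv:
 assumes "hmeas N h"
 shows "hmeas N (%x. setv i k (h x))"
proof -
 have "nat_measurable N (%x. nvar (setv i k (h x)) j)" for j
  using assms by (cases "j = i") (auto simp: hmeas_def)
 then show ?thesis using assms by (auto simp: hmeas_def)
qed

text \<open>The success event has to be shown measurable, because \<open>success_prob\<close>
  assigns 0 to a set that is not. Branches and loop bounds depend on random values;
  \<open>hmeas_if\<close> and \<open>hmeas_piecewise\<close> resolve them into countably many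
  cases.\<close>

lemma hmeas_sem:
 assumes "\<And>i j. (%x. q x i j) \<in> borel_measurable N" "hmeas N h"
 shows "hmeas N (%x. sem (q x) c (h x))"
 using assms(2)
proof (induction c arbitrary: h)
 case Skip
 then show ?case by simp
next
 case (Assign i e)
 have "nat_measurable N (%x. nvar (sem (q x) (Assign i e) (h x)) j)" for j
  using meas_eval[OF Assign, of e] Assign by (cases "j = i") (auto simp: hmeas_def)
 then show ?case using Assign by (auto simp: hmeas_def)
next
 case (AStore k a e)
 have [measurable]: "nat_measurable N (%x. eval a (h x))"
  "nat_measurable N (%x. eval e (h x))"
  "nat_measurable N (%x. narr (h x) k' i)" for k' i
  using meas_eval[OF AStore] AStore by (auto simp: hmeas_def)
 have "nat_measurable N (%x. narr (sem (q x) (AStore k a e) (h x)) k' i)" for k' i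
  by (cases "k' = k") (auto simp: fun_upd_def)
 then show ?case using AStore by (auto simp: hmeas_def)
next
 case (RAssign i e)
 have "(%x. rvar (sem (q x) (RAssign i e) (h x)) j) \<in> borel_measurable N" for j
  using meas_reval[OF RAssign, of e] RAssign by (cases "j = i") (auto simp: hmeas_def)
 then show ?case using RAssign by (auto simp: hmeas_def)
next
 case (RAStore k a e)
 have [measurable]: "nat_measurable N (%x. eval a (h x))"
  "(%x. reval e (h x)) \<in> borel_measurable N"
  "(%x. rarr (h x) k' i) \<in> borel_measurable N" for k' i
  using meas_eval[OF RAStore] meas_reval[OF RAStore] RAStore by (auto simp: hmeas_def)
 have "(%x. rarr (sem (q x) (RAStore k a e) (h x)) k' i) \<in> borel_measurable N" for k' i
  by (cases "k' = k") (auto simp: fun_upd_def)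
 then show ?case using RAStore by (auto simp: hmeas_def)
next
 case (Out a e)
 have [measurable]: "nat_measurable N (%x. eval a (h x))"
  "nat_measurable N (%x. eval e (h x))"
  "nat_measurable N (%x. outp (h x) i)" for i
  using meas_eval[OF Out] Out by (auto simp: hmeas_def)
 have "nat_measurable N (%x. outp (sem (q x) (Out a e) (h x)) i)" for i
  by (auto simp: fun_upd_def)
 then show ?case using Out by (auto simp: hmeas_def)
next
 case (Insp i a b)
 have m: "nat_measurable N (%x. eval a (h x))"
  "nat_measurable N (%x. eval b (h x))"
  using meas_eval[OF Insp] by auto
 have "(%x. q x k (eval b (h x))) \<in> borel_measurable N" for k
  by (rule meas_countable_idx[OF m(2), where f = "%j x. q x k j"]) (rule assms(1))
 then have "(%x. q x (eval a (h x)) (eval b (h x))) \<in> borel_measurable N"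
  by (rule meas_countable_idx[OF m(1), where f = "%k x. q x k (eval b (h x))"])
 then have "(%x. rvar (sem (q x) (Insp i a b) (h x)) j) \<in> borel_measurable N" for j
  using Insp by (cases "j = i") (auto simp: hmeas_def)
 then show ?case using Insp by (auto simp: hmeas_def)
next
 case (SeqC c1 c2)
 show ?case using SeqC.IH(2)[OF SeqC.IH(1)[OF SeqC.prems]] by simp
next
 case (IfC b c1 c2)
 have "hmeas N (%x. if beval b (h x) then sem (q x) c1 (h x) else sem (q x) c2 (h x))"
  by (rule hmeas_if[OF IfC.IH(1)[OF IfC.prems] IfC.IH(2)[OF IfC.prems] meas_beval[OF IfC.prems]])
 then show ?case by simp
next
 case (For i e c)
 have [measurable]: "nat_measurable N (%x. eval e (h x))"
  "nat_measurable N (%x. nvar (h x) 2)"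
  using meas_eval[OF For.prems] For.prems by (auto simp: hmeas_def)
 define g where "g = (%x k y. sem (q x) c (setv i k y))"
 have "hmeas N (%x. fold (g x) [0..<k] (h x))" for k
 proof (induction k)
  case 0
  then show ?case using For.prems by simp
 next
  case (Suc k)
  have "hmeas N (%x. g x k (fold (g x) [0..<k] (h x)))"
   unfolding g_def by (rule For.IH[OF hmeas_setv]) (use Suc in "simp add: g_def")
  then show ?case by simp
 qed
 then have "hmeas N (%x. (%k x. fold (g x) [0..<k] (h x)) (min (eval e (h x)) (nvar (h x) 2)) x)"
  by (rule hmeas_piecewise) simp
 then show ?case by (simp add: g_def)
qed

section \<open>Optimal orders and single moves\<close>

definition antisym_on_lt :: "nat => (nat => nat => real) => bool" where
 "antisym_on_lt m w \<longleftrightarrow> (\<forall>i<m. \<forall>j<m. w i j = - w j i)"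

text \<open>The competitors are arbitrary injections into the naturals rather than permutations. A
  move can then be given by a formula that leaves gaps, and \<open>rank\<close> closes the gaps
  afterwards.\<close>

definition idopt :: "nat => (nat => nat => real) => bool" where
 "idopt m w \<longleftrightarrow> (\<forall>\<tau>. inj_on \<tau> {..<m} --> order_score m w \<tau> \<le> order_score m w id)"

text \<open>Pairs ordered alike cancel; by antisymmetry a pair ordered differently contributes its
  value to one score and the negative to the other, hence the factor 2.\<close>

lemma order_score_flip:
 assumes anti: "antisym_on_lt m w" and inj: "inj_on \<sigma> {..<m}" "inj_on \<tau> {..<m}"
 shows "order_score m w \<tau> - order_score m w \<sigma> =
  2 * (\<Sum>(i, j) \<in> {(i, j). i < m & j < m & \<tau> i < \<tau> j & \<sigma> j < \<sigma> i}. w i j)"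
proof -
 let ?P = "%\<rho>. {(i, j). i < m & j < m & \<rho> i < (\<rho> j :: nat)}"
 let ?F = "{(i, j). i < m & j < m & \<tau> i < \<tau> j & \<sigma> j < \<sigma> i}"
 have fin: "finite (?P \<rho>)" for \<rho>
  by (rule finite_subset[of _ "{..<m} \<times> {..<m}"]) auto
 have finF: "finite ?F" by (rule finite_subset[of _ "{..<m} \<times> {..<m}"]) auto
 have ne: "\<sigma> i ~= \<sigma> j" "\<tau> i ~= \<tau> j" if "i < m" "j < m" "i ~= j" for i j
  using inj that by (auto dest: inj_onD)
 have ne1: "\<sigma> j < \<sigma> i" if "\<tau> i < \<tau> j" "i < m" "j < m" "\<not> \<sigma> i < \<sigma> j" for i j
  using ne(1)[of i j] that by (metis less_irrefl linorder_neqE_nat)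
 have ne2: "\<tau> j < \<tau> i" if "\<sigma> i < \<sigma> j" "i < m" "j < m" "\<not> \<tau> i < \<tau> j" for i j
  using ne(2)[of i j] that by (metis less_irrefl linorder_neqE_nat)
 have 1: "?P \<tau> = (?P \<tau> \<inter> ?P \<sigma>) \<union> ?F"
  using ne1 by blast
 have 2: "?P \<sigma> = (?P \<tau> \<inter> ?P \<sigma>) \<union> prod.swap ` ?F"
 proof (intro equalityI subsetI)
  fix x assume "x \<in> ?P \<sigma>"
  then obtain i j where x: "x = (i, j)" "i < m" "j < m" "\<sigma> i < \<sigma> j" by auto
  show "x \<in> (?P \<tau> \<inter> ?P \<sigma>) \<union> prod.swap ` ?F"
  proof (cases "\<tau> i < \<tau> j")
   case False
   then have "(j, i) \<in> ?F" using x ne2 by auto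
   then have "prod.swap (j, i) \<in> prod.swap ` ?F" by (rule imageI)
   then show ?thesis unfolding x(1) swap_simp by (rule UnI2)
  qed (use x in auto)
 qed auto
 have "sum (%(i, j). w i j) (?P \<tau>) = sum (%(i, j). w i j) (?P \<tau> \<inter> ?P \<sigma>) + sum (%(i, j). w i j) ?F"
  by (subst 1, rule sum.union_disjoint) (use fin finF in auto)
 moreover have "sum (%(i, j). w i j) (?P \<sigma>) =
   sum (%(i, j). w i j) (?P \<tau> \<inter> ?P \<sigma>) + sum (%(i, j). w i j) (prod.swap ` ?F)"
  by (subst 2, rule sum.union_disjoint) (use fin finF in auto)
 moreover have "sum (%(i, j). w i j) (prod.swap ` ?F) = sum (%(i, j). - w i j) ?F"
  by (subst sum.reindex) (use anti in "auto simp: antisym_on_lt_def inj_on_def intro!: sum.cong")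
 ultimately show ?thesis unfolding order_score_def by (simp add: sum_negf case_prod_beta)
qed

lemma idopt_flip:
 fixes \<tau> :: "nat => nat"
 assumes "antisym_on_lt m w" "idopt m w" "inj_on \<tau> {..<m}"
 shows "(\<Sum>(i, j) \<in> {(i, j). i < m & j < m & \<tau> i < \<tau> j & j < i}. w i j) \<le> 0"
proof -
 have "order_score m w \<tau> \<le> order_score m w id" using assms(2,3) by (simp add: idopt_def)
 then show ?thesis using order_score_flip[OF assms(1) inj_on_id assms(3)] by simp
qed

lemma idopt_move_left:
 assumes "antisym_on_lt m w" "idopt m w" "u \<le> p" "p < m"
 shows "(\<Sum>b\<in>{u..<p}. w p b) \<le> 0"
proof -
 \<comment> \<open>Spreading the positions over the odd numbers frees the even number
   \<open>2 * u\<close> directly before the image of \<open>u\<close>; \<open>p\<close> is put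
   there.\<close>
 let ?\<tau> = "%x. if x = p then 2 * u else 2 * x + 1"
 have "inj_on ?\<tau> {..<m}" by (auto simp: inj_on_def split: if_splits) presburger+
 from idopt_flip[OF assms(1,2) this]
 have "(\<Sum>(i, j) \<in> {(i, j). i < m & j < m & ?\<tau> i < ?\<tau> j & j < i}. w i j) \<le> 0" .
 also have "{(i, j). i < m & j < m & ?\<tau> i < ?\<tau> j & j < i} = {p} \<times> {u..<p}"
  using assms(3,4) by (auto split: if_splits)
 finally show ?thesis by (simp add: sum.cartesian_product[symmetric])
qed

lemma idopt_move_right:
 assumes "antisym_on_lt m w" "idopt m w" "p < u" "u \<le> m"
 shows "(\<Sum>b\<in>{Suc p..<u}. w b p) \<le> 0"
proof -
 \<comment> \<open>The odd number \<open>2 * u - 1\<close> lies directly before the image of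
   \<open>u\<close> and behind all earlier ones.\<close>
 let ?\<tau> = "%x. if x = p then 2 * u - 1 else 2 * x"
 have "inj_on ?\<tau> {..<m}" using assms by (auto simp: inj_on_def split: if_splits) presburger+
 from idopt_flip[OF assms(1,2) this]
 have "(\<Sum>(i, j) \<in> {(i, j). i < m & j < m & ?\<tau> i < ?\<tau> j & j < i}. w i j) \<le> 0" .
 also have "{(i, j). i < m & j < m & ?\<tau> i < ?\<tau> j & j < i} = {Suc p..<u} \<times> {p}"
  using assms(3,4) by (auto split: if_splits)
 finally show ?thesis by (simp add: sum.cartesian_product[symmetric])
qed

text \<open>The competitor is the stable partition of the window from \<open>u\<close> to
  \<open>v\<close> that moves the positions in \<open>T\<close> behind the others; it flips
  precisely the pairs of the sum. With \<open>T\<close> the positions above a threshold,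
  quadratically many pairs are compared at once.\<close>

lemma idopt_cut:
 assumes "antisym_on_lt m w" "idopt m w" "u \<le> v" "v \<le> m"
 shows "(\<Sum>(i, j) \<in> {(i, j). u \<le> j & j < i & i < v & j \<in> T & i \<notin> T}. w i j) \<le> 0"
proof -
 let ?\<tau> = "%x. if x < u \<or> x < v & x \<notin> T then x else if x < v then m + x else 2 * m + x"
 have "inj_on ?\<tau> {..<m}" using assms by (auto simp: inj_on_def split: if_splits)
 from idopt_flip[OF assms(1,2) this]
 have "(\<Sum>(i, j) \<in> {(i, j). i < m & j < m & ?\<tau> i < ?\<tau> j & j < i}. w i j) \<le> 0" .
 also have "{(i, j). i < m & j < m & ?\<tau> i < ?\<tau> j & j < i} =
   {(i, j). u \<le> j & j < i & i < v & j \<in> T & i \<notin> T}"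
  using assms(3,4) by (auto split: if_splits)
 finally show ?thesis .
qed

section \<open>From injections to permutations\<close>

definition rank :: "nat => (nat => nat) => nat => nat" where
 "rank m \<tau> i = card {j. j < m & \<tau> j < \<tau> i}"

lemma rank_less:
 assumes "inj_on \<tau> {..<m}" "i < m" "j < m"
 shows "rank m \<tau> i < rank m \<tau> j \<longleftrightarrow> \<tau> i < \<tau> j"
proof -
 have mono: "rank m \<tau> i < rank m \<tau> j" if "\<tau> i < \<tau> j" "i < m" for i j
  unfolding rank_def by (rule psubset_card_mono) (use that in auto)
 show ?thesis
 proof (cases "i = j")
  case False
  then have "\<tau> i ~= \<tau> j" using assms by (auto dest: inj_onD)
  then show ?thesis using mono[of i j] mono[of j i] assms by (metis less_asym linorder_neqE_nat)
 qed simp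
qed

lemma rank_bij:
 assumes "inj_on \<tau> {..<m}"
 shows "bij_betw (rank m \<tau>) {..<m} {..<m}"
proof -
 have "inj_on (rank m \<tau>) {..<m}"
 proof (rule inj_onI)
  fix i j assume *: "i \<in> {..<m}" "j \<in> {..<m}" "rank m \<tau> i = rank m \<tau> j"
  then have "\<tau> i = \<tau> j" using rank_less[OF assms, of i j] rank_less[OF assms, of j i]
   by (metis lessThan_iff less_irrefl linorder_neqE_nat)
  then show "i = j" using * assms by (auto dest: inj_onD)
 qed
 moreover have "rank m \<tau> ` {..<m} \<subseteq> {..<m}"
 proof (intro subsetI, elim imageE)
  fix k i assume "i \<in> {..<m}" "k = rank m \<tau> i"
  moreover from this have "card {j. j < m & \<tau> j < \<tau> i} < card {..<m}" by (intro psubset_card_mono) auto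
  ultimately show "k \<in> {..<m}" by (simp add: rank_def)
 qed
 ultimately show ?thesis
  by (simp add: bij_betw_def card_image card_subset_eq)
qed

lemma order_score_rank:
 assumes "inj_on \<tau> {..<m}"
 shows "order_score m w (rank m \<tau>) = order_score m w \<tau>"
proof -
 have "{(i, j). i < m & j < m & rank m \<tau> i < rank m \<tau> j} = {(i, j). i < m & j < m & \<tau> i < \<tau> j}"
  using rank_less[OF assms] by auto
 then show ?thesis by (simp add: order_score_def)
qed

text \<open>Lists of items are read as maps from positions to items.\<close>

definition list_score :: "(nat => nat => real) => nat => (nat => nat) => real" where
 "list_score q m L = (\<Sum>j<m. \<Sum>i<j. q (L i) (L j))"

definition listing :: "nat => (nat => nat) => bool" where
 "listing m L \<longleftrightarrow> bij_betw L {..<m} {..<m}"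

definition best_listing :: "(nat => nat => real) => nat => (nat => nat) => bool" where
 "best_listing q m L \<longleftrightarrow> listing m L & (\<forall>L'. listing m L' --> list_score q m L' \<le> list_score q m L)"

lemma list_score_order_score:
 assumes "listing m L" "\<And>p. p < m ==> \<sigma> (L p) = p"
 shows "order_score m q \<sigma> = list_score q m L"
proof -
 let ?A = "{(j, i). j < m & i < j}"
 have L: "bij_betw L {..<m} {..<m}" using assms(1) by (simp add: listing_def)
 have Lm: "L p < m" if "p < m" for p using bij_betwE[OF L] that by auto
 have inv: "\<exists>p<m. L p = i" if "i < m" for i
  using bij_betw_imp_surj_on[OF L] that by (metis imageE lessThan_iff)
 have "bij_betw (%(j, i). (L i, L j)) ?A {(i, j). i < m & j < m & \<sigma> i < \<sigma> j}"
 proof (rule bij_betw_imageI)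
  show "inj_on (%(j, i). (L i, L j)) ?A"
   using bij_betw_imp_inj_on[OF L] by (auto simp: inj_on_def)
  show "(%(j, i). (L i, L j)) ` ?A = {(i, j). i < m & j < m & \<sigma> i < \<sigma> j}"
  proof (intro equalityI subsetI)
   fix x assume "x \<in> (%(j, i). (L i, L j)) ` ?A"
   then show "x \<in> {(i, j). i < m & j < m & \<sigma> i < \<sigma> j}" using assms(2) Lm by fastforce
  next
   fix x assume x: "x \<in> {(i, j). i < m & j < m & \<sigma> i < \<sigma> j}"
   then obtain i j where ij: "x = (i, j)" "i < m" "j < m" "\<sigma> i < \<sigma> j" by auto
   obtain p p' where p: "p < m" "L p = i" "p' < m" "L p' = j" using inv ij(2,3) by blast
   have "p < p'" using ij(4) p assms(2) by force
   then have "(p', p) \<in> ?A" using p by auto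
   then have "(%(j, i). (L i, L j)) (p', p) \<in> (%(j, i). (L i, L j)) ` ?A" by (rule imageI)
   then show "x \<in> (%(j, i). (L i, L j)) ` ?A" using ij p by simp
  qed
 qed
 from sum.reindex_bij_betw[OF this, of "%(i, j). q i j"]
 have "order_score m q \<sigma> = (\<Sum>(j, i)\<in>?A. q (L i) (L j))"
  by (simp add: order_score_def case_prod_beta)
 also have "?A = (SIGMA j:{..<m}. {..<j})" by auto
 also have "(\<Sum>(j, i)\<in>(SIGMA j:{..<m}. {..<j}). q (L i) (L j)) = list_score q m L"
  unfolding list_score_def by (rule sum.Sigma[symmetric]) auto
 finally show ?thesis .
qed

lemma order_score_id: "order_score m w id = list_score w m id"
 by (rule list_score_order_score) (auto simp: listing_def bij_betw_id)

text \<open>Naming items by their positions in \<open>L\<close> turns an optimal listing into the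
  identity. A competitor \<open>\<tau>\<close> of the identity corresponds to the listing
  \<open>L \<circ> f\<close>, with \<open>f\<close> the inverse of its rank function.\<close>

lemma best_listing_idopt:
 assumes "best_listing q m L"
 shows "idopt m (%i j. q (L i) (L j))"
 unfolding idopt_def
proof (intro allI impI)
 fix \<tau> :: "nat => nat" assume inj: "inj_on \<tau> {..<m}"
 define f where "f = the_inv_into {..<m} (rank m \<tau>)"
 have bij: "bij_betw (rank m \<tau>) {..<m} {..<m}" by (rule rank_bij[OF inj])
 have f: "bij_betw f {..<m} {..<m}" unfolding f_def by (rule bij_betw_the_inv_into[OF bij])
 have lf: "listing m f" using f by (simp add: listing_def)
 have rf: "rank m \<tau> (f p) = p" if "p < m" for p
  unfolding f_def using f_the_inv_into_f_bij_betw[OF bij] that by auto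
 have "order_score m (%i j. q (L i) (L j)) \<tau> = order_score m (%i j. q (L i) (L j)) (rank m \<tau>)"
  by (rule order_score_rank[OF inj, symmetric])
 also have "... = list_score (%i j. q (L i) (L j)) m f"
  by (rule list_score_order_score[OF lf rf])
 also have "... = list_score q m (L \<circ> f)" by (simp add: list_score_def)
 also have "... \<le> list_score q m L"
 proof -
  have "listing m (L \<circ> f)"
   using assms bij_betw_trans[OF f, of L] by (simp add: best_listing_def listing_def)
  then show ?thesis using assms by (simp add: best_listing_def)
 qed
 also have "... = order_score m (%i j. q (L i) (L j)) id"
  unfolding order_score_id by (simp add: list_score_def)
 finally show "order_score m (%i j. q (L i) (L j)) \<tau> \<le> order_score m (%i j. q (L i) (L j)) id" .
qed

lemma list_score_cong: "(\<And>p. p < m ==> L p = L' p) ==> list_score q m L = list_score q m L'"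
 unfolding list_score_def by (intro sum.cong refl) auto

lemma best_listing_exists: "\<exists>L. best_listing q m L"
proof -
 let ?S = "{L. L permutes {..<m}}"
 have "finite ?S" by (rule finite_permutations) simp
 moreover have "id \<in> ?S" by (simp add: permutes_id)
 ultimately have "Max (list_score q m ` ?S) \<in> list_score q m ` ?S"
  by (intro Max_in) (auto intro: exI[of _ id])
 then obtain L where L: "L \<in> ?S" "list_score q m L = Max (list_score q m ` ?S)" by auto
 have L: "L \<in> ?S" "\<And>L'. L' \<in> ?S ==> list_score q m L' \<le> list_score q m L"
  using L \<open>finite ?S\<close> by auto
 have "list_score q m L' \<le> list_score q m L" if "listing m L'" for L'
 proof -
  let ?L = "%p. if p < m then L' p else p"
  have "bij_betw ?L {..<m} {..<m}" using that unfolding listing_def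
   by (subst bij_betw_cong[of _ _ L']) auto
  then have "?L permutes {..<m}" by (rule bij_imp_permutes) auto
  then have "list_score q m ?L \<le> list_score q m L" using L by auto
  also have "list_score q m ?L = list_score q m L'" by (rule list_score_cong) simp
  finally show ?thesis .
 qed
 then show ?thesis using L(1) permutes_imp_bij unfolding best_listing_def listing_def by blast
qed

text \<open>The bridge to the notion in the theorem: an order maps items to positions, a listing
  positions to items, and the two are inverse to each other.\<close>

lemma best_listing_optimal:
 assumes "best_listing q m L" "\<And>p. p < m ==> \<sigma> (L p) = p" "\<And>i. m \<le> i ==> \<sigma> i = i"
 shows "optimal_order m q \<sigma>"
proof -
 have L: "listing m L" using assms by (simp add: best_listing_def)
 have bL: "bij_betw L {..<m} {..<m}" using L by (simp add: listing_def)
 have "L (\<sigma> i) = i & \<sigma> i < m" if "i < m" for i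
  using bij_betw_imp_surj_on[OF bL] that assms(2) by (metis imageE lessThan_iff)
 then have "bij_betw \<sigma> {..<m} {..<m}"
  by (intro bij_betw_byWitness[where f' = L])
   (use bij_betwE[OF bL] assms(2) in "auto")
 then have "\<sigma> permutes {..<m}" by (rule bij_imp_permutes) (use assms(3) in auto)
 moreover have "order_score m q \<tau> \<le> order_score m q \<sigma>" if "\<tau> permutes {..<m}" for \<tau>
 proof -
  have b: "bij_betw \<tau> {..<m} {..<m}" using that by (rule permutes_imp_bij)
  let ?f = "the_inv_into {..<m} \<tau>"
  have lf: "listing m ?f" unfolding listing_def by (rule bij_betw_the_inv_into[OF b])
  have "order_score m q \<tau> = list_score q m ?f"
   by (rule list_score_order_score[OF lf]) (use f_the_inv_into_f_bij_betw[OF b] in auto)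
  also have "... \<le> list_score q m L" using assms(1) lf by (simp add: best_listing_def)
  also have "... = order_score m q \<sigma>" by (rule list_score_order_score[OF L assms(2), symmetric])
  finally show ?thesis .
 qed
 ultimately show ?thesis by (simp add: optimal_order_def)
qed

section \<open>Structure of an order all of whose windows are nearly sorted\<close>

definition dsorted :: "nat => nat => (nat => nat) => bool" where
 "dsorted d m v \<longleftrightarrow> (\<forall>i j. i + d < j --> j < m --> v i < v j)"

text \<open>A discrete intermediate value argument: the count grows by at most 1 when
  \<open>k\<close> does.\<close>

lemma cut_exists:
 fixes X :: "nat set"
 assumes "finite X" "s \<le> card X"
 shows "\<exists>k. card {x\<in>X. x < k} = s"
proof -
 define f where "f k = card {x\<in>X. x < k}" for k
 obtain b where "\<forall>x\<in>X. x < b" using assms(1) finite_nat_set_iff_bounded by blast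
 then have "{x\<in>X. x < b} = X" by auto
 then have "s \<le> f b" using assms(2) by (simp add: f_def)
 then have ex: "\<exists>k. s \<le> f k" by blast
 define k where "k = (LEAST k. s \<le> f k)"
 have k: "s \<le> f k" unfolding k_def using ex by (rule LeastI_ex)
 have "f k \<le> s"
 proof (cases k)
  case 0
  then show ?thesis by (simp add: f_def)
 next
  case (Suc k')
  then have "f k' < s" using not_less_Least[of k' "%k. s \<le> f k"] by (simp add: k_def[symmetric])
  moreover have "f (Suc k') \<le> Suc (f k')"
  proof -
   have "{x\<in>X. x < Suc k'} \<subseteq> insert k' {x\<in>X. x < k'}" by auto
   then have "card {x\<in>X. x < Suc k'} \<le> card (insert k' {x\<in>X. x < k'})"
    using assms(1) by (intro card_mono) auto
   also have "... \<le> Suc (card {x\<in>X. x < k'})" by (rule card_insert_le_m1) auto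
   finally show ?thesis by (simp add: f_def)
  qed
  ultimately show ?thesis using Suc by simp
 qed
 with k show ?thesis unfolding f_def by (intro exI[of _ k]) simp
qed

text \<open>
 The data \<open>Y\<close>, \<open>Z\<close>, \<open>a\<close>, \<open>b\<close> and, for each \<open>p \<in> Y\<close>, a band and a small correction have few
 possible values; together they determine the pairs \<open>(p, t)\<close> with \<open>u \<le> t < p\<close>.
\<close>

definition rstruct :: "nat => nat => nat => (nat => nat) => bool" where
 "rstruct m Q x v \<longleftrightarrow> (\<exists>u Y Z a b k h. Y \<subseteq> {..<m} & Y ~= {} & card Y < x & Z \<subseteq> {..<m} & card Z \<le> 26 * card Y &
  card {t. t < m & a \<le> v t & v t < b} \<le> 21*Q &
  (\<forall>p\<in>Y. u + Q \<le> p & p < u + 2*Q & 3 * card {t \<in> {u..<p}. v t < v p} \<le> p - u &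
   (let I = {t. t < m & k \<le> v t & v t < h p}; D = ({u..<p} - I) \<union> (I - {u..<p}) in
    D \<subseteq> {t. t < m & a \<le> v t & v t < b} \<union> Z & card D \<le> 34*x)))"

text \<open>
 \<open>\<mu> p\<close> is a threshold that separates the \<open>4Q\<close> positions before \<open>p\<close> from the \<open>4Q\<close> positions after it,
 up to fewer than \<open>x\<close> exceptions on either side.
\<close>

locale near_sorted =
 fixes m Q x B :: nat and v \<mu> :: "nat => nat"
 assumes inj: "inj_on v {..<m}"
  and vB: "p < m ==> v p < B"
  and x0: "0 < x" and xQ: "20 * x \<le> Q"
  and left: "p \<le> m ==> card {t \<in> {p - 4*Q..<p}. \<mu> p \<le> v t} < x"
  and right: "p \<le> m ==> card {t \<in> {p..<min m (p + 4*Q)}. v t < \<mu> p} < x"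
begin

text \<open>Two thirds of the \<open>4*Q\<close> positions before \<open>p\<close> hold larger
  values, so \<open>p\<close> stands too far to the right; \<open>LB\<close> is the mirror image.
  The number 8Q/3 has to lie above 2Q + x, for \<open>core_below\<close>, and below 4Q - x, for
  \<open>not_RB\<close>.\<close>

definition RB :: "nat => bool" where
 "RB p \<longleftrightarrow> p < m & 4*Q \<le> p & 8*Q \<le> 3 * card {t \<in> {p - 4*Q..<p}. v p < v t}"

definition LB :: "nat => bool" where
 "LB p \<longleftrightarrow> p < m & p + 4*Q < m & 8*Q \<le> 3 * card {t \<in> {Suc p..<Suc p + 4*Q}. v t < v p}"

lemma ex_outside:
 assumes "finite S" "card {t \<in> S. P t} + card {t \<in> S. R t} < card S"
 shows "\<exists>t\<in>S. \<not> P t & \<not> R t"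
proof (rule ccontr)
 assume "\<not> ?thesis"
 then have "S \<subseteq> {t \<in> S. P t} \<union> {t \<in> S. R t}" by auto
 then have "card S \<le> card ({t \<in> S. P t} \<union> {t \<in> S. R t})" using assms(1) by (intro card_mono) auto
 also have "... \<le> card {t \<in> S. P t} + card {t \<in> S. R t}" by (rule card_Un_le)
 finally show False using assms(2) by simp
qed

lemma card_sub: "finite T ==> S \<subseteq> T ==> card {t \<in> S. P t} \<le> card {t \<in> T. P t}"
 by (intro card_mono) auto

text \<open>Of the at least \<open>2*x\<close> positions in between, fewer than \<open>x\<close> lie
  below \<open>\<mu> p\<close> and fewer than \<open>x\<close> lie at or above
  \<open>\<mu> p'\<close>; a remaining one separates the two thresholds.\<close>

lemma mu_mono_near:
 assumes "p + 2*x \<le> p'" "p' \<le> m" "p' \<le> p + 4*Q"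
 shows "\<mu> p < \<mu> p'"
proof -
 let ?S = "{p..<p'}"
 have "card {t \<in> ?S. v t < \<mu> p} \<le> card {t \<in> {p..<min m (p + 4*Q)}. v t < \<mu> p}"
  by (rule card_sub) (use assms in auto)
 also have "... < x" using right[of p] assms by simp
 finally have 1: "card {t \<in> ?S. v t < \<mu> p} < x" .
 have "card {t \<in> ?S. \<mu> p' \<le> v t} \<le> card {t \<in> {p' - 4*Q..<p'}. \<mu> p' \<le> v t}"
  by (rule card_sub) (use assms in auto)
 also have "... < x" using left[of p'] assms by simp
 finally have 2: "card {t \<in> ?S. \<mu> p' \<le> v t} < x" .
 have "\<exists>t\<in>?S. \<not> v t < \<mu> p & \<not> \<mu> p' \<le> v t" by (rule ex_outside) (use 1 2 assms in auto)
 then show ?thesis by auto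
qed

lemma mu_mono: "p + 2*x \<le> p' ==> p' \<le> m ==> \<mu> p < \<mu> p'"
proof (induction "p' - p" arbitrary: p rule: less_induct)
 case less
 show ?case
 proof (cases "p' \<le> p + 4*Q")
  case True
  then show ?thesis using mu_mono_near less.prems by blast
 next
  case False
  have "\<mu> p < \<mu> (p + 2*x)" by (rule mu_mono_near) (use False less.prems xQ in auto)
  also have "... < \<mu> p'" by (rule less.hyps) (use False less.prems xQ x0 in auto)
  finally show ?thesis .
 qed
qed

text \<open>Among the \<open>4*Q\<close> positions before \<open>t\<close> one holds a value that is
  at most \<open>v t\<close> and not below the threshold at their start, since the exceptions of
  both kinds number less than 8Q/3 + x < 4Q. The additional \<open>2*x\<close> makes
  \<open>mu_mono\<close> applicable.\<close>

lemma not_RB: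
 assumes "t < m" "\<not> RB t" "p + 4*Q + 2*x \<le> t"
 shows "\<mu> p < v t"
proof -
 let ?S = "{t - 4*Q..<t}" and ?s = "t - 4*Q"
 have c: "3 * card {j \<in> ?S. v t < v j} < 8*Q" using assms by (auto simp: RB_def)
 have "card {j \<in> ?S. v j < \<mu> ?s} \<le> card {j \<in> {?s..<min m (?s + 4*Q)}. v j < \<mu> ?s}"
  by (rule card_sub) (use assms in auto)
 also have "... < x" using right[of ?s] assms by simp
 finally have d: "card {j \<in> ?S. v j < \<mu> ?s} < x" .
 have "\<exists>j\<in>?S. \<not> v t < v j & \<not> v j < \<mu> ?s"
  by (rule ex_outside) (use c d assms xQ x0 in auto)
 then obtain j where j: "j \<in> ?S" "v j \<le> v t" "\<mu> ?s \<le> v j" by auto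
 have "\<mu> p < \<mu> ?s" by (rule mu_mono) (use assms in auto)
 then show ?thesis using j by simp
qed

lemma not_LB:
 assumes "\<not> LB t" "Suc t + 4*Q + 2*x \<le> p" "p \<le> m"
 shows "v t < \<mu> p"
proof -
 let ?S = "{Suc t..<Suc t + 4*Q}" and ?s = "Suc t + 4*Q"
 have c: "3 * card {j \<in> ?S. v j < v t} < 8*Q" using assms x0 by (auto simp: LB_def)
 have "card {j \<in> ?S. \<mu> ?s \<le> v j} < x" using left[of ?s] assms by simp
 then have "\<exists>j\<in>?S. \<not> v j < v t & \<not> \<mu> ?s \<le> v j"
  by (intro ex_outside) (use c xQ x0 in auto)
 then obtain j where j: "j \<in> ?S" "v t \<le> v j" "v j < \<mu> ?s" by auto
 have "\<mu> ?s < \<mu> p" by (rule mu_mono) (use assms in auto)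
 then show ?thesis using j by simp
qed

lemma sorted_if_no_bad:
 assumes "\<And>p. \<not> RB p" "\<And>p. \<not> LB p"
 shows "dsorted (12*Q) m v"
 unfolding dsorted_def
proof (intro allI impI)
 fix i j assume *: "i + 12*Q < j" "j < m"
 \<comment> \<open>A threshold in the middle: reaching it from \<open>i\<close> and leaving it
   towards \<open>j\<close> takes 8Q + 4x + 1 positions, which fits into 12Q + 1.\<close>
 let ?c = "Suc i + 4*Q + 2*x"
 have "v i < \<mu> ?c" by (rule not_LB) (use assms * xQ in auto)
 also have "... < v j" by (rule not_RB) (use assms * xQ in auto)
 finally show "v i < v j" .
qed

section \<open>Blocks and their defects\<close>

definition bad :: "nat => bool" where "bad p \<longleftrightarrow> RB p \<or> LB p"

text \<open>\<open>lo u\<close> and \<open>hi u\<close> enclose the values that positions of the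
  block from \<open>u\<close> to \<open>u + 2*Q\<close> take unless they are bad, by
  \<open>not_RB\<close> and \<open>not_LB\<close>; 6Q is the block length 2Q plus the reach 4Q of
  \<open>not_LB\<close>. Near the ends of the list the defaults 0 and \<open>B\<close> impose
  nothing.\<close>

definition lo :: "nat => nat" where
 "lo u = (if u < 4*Q + 2*x then 0 else \<mu> (u - 4*Q - 2*x))"

definition hi :: "nat => nat" where
 "hi u = (if m < u + 6*Q + 2*x then B else \<mu> (u + 6*Q + 2*x))"

text \<open>The right-bad positions in the second half of the block, so that each of them has at
  least \<open>Q\<close> block positions before it. The sets \<open>strays\<close> and
  \<open>missing\<close> below measure the damage to the block: positions whose value has left the
  range, and bad positions from anywhere whose value falls into it.\<close>

definition core :: "nat => nat set" where
 "core u = {p. RB p & u + Q \<le> p & p < u + 2*Q}"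

definition strays :: "nat => nat set" where
 "strays u = {t. u \<le> t & t < u + 2*Q & t < m & \<not> (lo u \<le> v t & v t < hi u)}"

definition range_of :: "nat => nat set" where
 "range_of u = {t. t < m & lo u \<le> v t & v t < hi u}"

definition missing :: "nat => nat set" where
 "missing u = {t. bad t & lo u \<le> v t & v t < hi u}"

lemma bad_less: "bad t ==> t < m" by (auto simp: bad_def RB_def LB_def)

lemma fin_simps [simp]: "finite (core u)" "finite (strays u)" "finite (range_of u)" "finite (missing u)"
 by (rule finite_subset[of _ "{..<m}"];
   auto simp: core_def strays_def range_of_def missing_def RB_def dest: bad_less)+

text \<open>At least 8Q/3 of the \<open>4*Q\<close> positions before \<open>p\<close> hold larger
  values. At most 2Q of them are in the block, and if \<open>v p\<close> were not below
  \<open>\<mu> u\<close>, fewer than \<open>x\<close> could come from before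
  \<open>u\<close>.\<close>

lemma core_below:
 assumes "p \<in> core u"
 shows "v p < \<mu> u"
proof (rule ccontr)
 assume a: "\<not> v p < \<mu> u"
 have p: "p < m" "4*Q \<le> p" "8*Q \<le> 3 * card {t \<in> {p - 4*Q..<p}. v p < v t}" "u + Q \<le> p" "p < u + 2*Q"
  using assms by (auto simp: core_def RB_def)
 have l: "card {t \<in> {u - 4*Q..<u}. \<mu> u \<le> v t} < x" using left[of u] p by simp
 have "{t \<in> {p - 4*Q..<p}. v p < v t} \<subseteq> {t \<in> {u - 4*Q..<u}. \<mu> u \<le> v t} \<union> {u..<p}"
  using a p by auto
 then have "card {t \<in> {p - 4*Q..<p}. v p < v t} \<le> card ({t \<in> {u - 4*Q..<u}. \<mu> u \<le> v t} \<union> {u..<p})"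
  by (intro card_mono) auto
 also have "... \<le> card {t \<in> {u - 4*Q..<u}. \<mu> u \<le> v t} + card {u..<p}" by (rule card_Un_le)
 finally have "card {t \<in> {p - 4*Q..<p}. v p < v t} < x + 2*Q" using l p by simp
 then show False using p xQ x0 by simp
qed

text \<open>By \<open>core_below\<close> the whole core consists of exceptions to the threshold at
  \<open>u\<close>.\<close>

lemma card_core:
 assumes "u \<le> m"
 shows "card (core u) < x"
proof -
 have "core u \<subseteq> {t \<in> {u..<min m (u + 4*Q)}. v t < \<mu> u}"
  using core_below by (auto simp: core_def RB_def)
 then have "card (core u) \<le> card {t \<in> {u..<min m (u + 4*Q)}. v t < \<mu> u}" by (intro card_mono) auto
 then show ?thesis using right[OF assms] by simp
qed

lemma core_fraction:
 assumes "p \<in> core u"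
 shows "3 * card {t \<in> {u..<p}. v t < v p} \<le> p - u"
proof -
 have p: "p < m" "u + Q \<le> p" "p < u + 2*Q" using assms by (auto simp: core_def RB_def)
 have "{t \<in> {u..<p}. v t < v p} \<subseteq> {t \<in> {u..<min m (u + 4*Q)}. v t < \<mu> u}"
  using core_below[OF assms] p by auto
 then have "card {t \<in> {u..<p}. v t < v p} \<le> card {t \<in> {u..<min m (u + 4*Q)}. v t < \<mu> u}"
  by (intro card_mono) auto
 then show ?thesis using right[of u] p xQ by simp
qed

lemma strays_bad: "strays u \<subseteq> {t. bad t & u \<le> t & t < u + 2*Q}"
proof
 fix t assume t: "t \<in> strays u"
 then have t': "u \<le> t" "t < u + 2*Q" "t < m" by (auto simp: strays_def)
 have "bad t"
 proof (rule ccontr)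
  assume "\<not> bad t"
  then have nb: "\<not> RB t" "\<not> LB t" by (auto simp: bad_def)
  have "lo u \<le> v t"
  proof (cases "u < 4*Q + 2*x")
   case False
   then have "\<mu> (u - 4*Q - 2*x) < v t" by (intro not_RB) (use t' nb in auto)
   then show ?thesis using False by (simp add: lo_def)
  qed (simp add: lo_def)
  moreover have "v t < hi u"
  proof (cases "m < u + 6*Q + 2*x")
   case False
   then have "v t < \<mu> (u + 6*Q + 2*x)" by (intro not_LB) (use t' nb in auto)
   then show ?thesis using False by (simp add: hi_def)
  qed (use t' vB in "simp add: hi_def")
  ultimately show False using t by (auto simp: strays_def)
 qed
 then show "t \<in> {t. bad t & u \<le> t & t < u + 2*Q}" using t' by simp
qed

lemma card_range_of:
 assumes "u \<le> m"
 shows "card (range_of u) \<le> 18*Q + 8*x + card (missing u)"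
proof -
 have "range_of u \<subseteq> missing u \<union> {u - 8*Q - 4*x..<u + 10*Q + 4*x}"
 proof
  fix t assume t: "t \<in> range_of u"
  then have t': "t < m" "lo u \<le> v t" "v t < hi u" by (auto simp: range_of_def)
  show "t \<in> missing u \<union> {u - 8*Q - 4*x..<u + 10*Q + 4*x}"
  proof (cases "bad t")
   case True
   then show ?thesis using t' by (simp add: missing_def)
  next
   case False
   then have nb: "\<not> RB t" "\<not> LB t" by (auto simp: bad_def)
   have "u - 8*Q - 4*x \<le> t"
   proof (rule ccontr)
    assume a: "\<not> u - 8*Q - 4*x \<le> t"
    have "v t < \<mu> (u - 4*Q - 2*x)" by (rule not_LB) (use nb a assms in auto)
    then show False using t' a by (simp add: lo_def split: if_splits)
   qed
   moreover have "t < u + 10*Q + 4*x"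
   proof (rule ccontr)
    assume a: "\<not> t < u + 10*Q + 4*x"
    then have "\<mu> (u + 6*Q + 2*x) < v t" by (intro not_RB) (use nb t' in auto)
    then show False using t' a by (simp add: hi_def split: if_splits)
   qed
   ultimately show ?thesis by simp
  qed
 qed
 then have "card (range_of u) \<le> card (missing u \<union> {u - 8*Q - 4*x..<u + 10*Q + 4*x})"
  by (intro card_mono) auto
 also have "... \<le> card (missing u) + card {u - 8*Q - 4*x..<u + 10*Q + 4*x}" by (rule card_Un_le)
 also have "card {u - 8*Q - 4*x..<u + 10*Q + 4*x} \<le> 18*Q + 8*x" by simp
 finally show ?thesis by simp
qed

definition band :: "nat => nat => nat set" where
 "band u p = {t. t < m & \<mu> u \<le> v t & v t < \<mu> p}"

definition delta :: "nat => nat => nat set" where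
 "delta u p = ({u..<p} - band u p) \<union> (band u p - {u..<p})"

lemma band_range:
 assumes "p \<in> core u"
 shows "band u p \<subseteq> range_of u"
proof
 fix t assume t: "t \<in> band u p"
 have p: "p < m" "u + Q \<le> p" "p < u + 2*Q" using assms by (auto simp: core_def RB_def)
 have t': "t < m" "\<mu> u \<le> v t" "v t < \<mu> p" using t by (auto simp: band_def)
 have "lo u \<le> v t"
 proof (cases "u < 4*Q + 2*x")
  case False
  have "\<mu> (u - 4*Q - 2*x) < \<mu> u" by (rule mu_mono) (use p False in auto)
  then show ?thesis using t' False by (simp add: lo_def)
 qed (simp add: lo_def)
 moreover have "v t < hi u"
 proof (cases "m < u + 6*Q + 2*x")
  case False
  have "\<mu> p < \<mu> (u + 6*Q + 2*x)" by (rule mu_mono) (use p False in auto)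
  then show ?thesis using t' False by (simp add: hi_def)
 qed (use t' vB in "simp add: hi_def")
 ultimately show "t \<in> range_of u" using t' by (simp add: range_of_def)
qed

lemma delta_sub:
 assumes "p \<in> core u"
 shows "delta u p \<subseteq> range_of u \<union> strays u"
proof -
 have p: "p < m" "p < u + 2*Q" using assms by (auto simp: core_def RB_def)
 then have "{u..<p} \<subseteq> range_of u \<union> strays u" by (auto simp: range_of_def strays_def)
 then show ?thesis using band_range[OF assms] by (auto simp: delta_def)
qed

text \<open>The difference is covered by the exceptions to \<open>\<mu> u\<close> and
  \<open>\<mu> p\<close> on either side, four sets of fewer than \<open>x\<close>, by two margins of
  \<open>2*x\<close> in which positions that are not bad may still occur, and by
  \<open>missing\<close>.\<close>

lemma card_delta:
 assumes "p \<in> core u"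
 shows "card (delta u p) \<le> 8*x + card (missing u)"
proof -
 have p: "p < m" "u + Q \<le> p" "p < u + 2*Q" "4*Q \<le> p" using assms by (auto simp: core_def RB_def)
 let ?A1 = "{t \<in> {u..<min m (u + 4*Q)}. v t < \<mu> u}" and ?A2 = "{t \<in> {p - 4*Q..<p}. \<mu> p \<le> v t}"
 let ?A3 = "{t \<in> {p..<min m (p + 4*Q)}. v t < \<mu> p}" and ?A4 = "{t \<in> {u - 4*Q..<u}. \<mu> u \<le> v t}"
 let ?A5 = "{p + 4*Q..<p + 4*Q + 2*x}" and ?A6 = "{u - 4*Q - 2*x..<u - 4*Q}"
 have "delta u p \<subseteq> ?A1 \<union> (?A2 \<union> (?A3 \<union> (?A4 \<union> (?A5 \<union> (?A6 \<union> missing u)))))"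
 proof
  fix t assume t: "t \<in> delta u p"
  show "t \<in> ?A1 \<union> (?A2 \<union> (?A3 \<union> (?A4 \<union> (?A5 \<union> (?A6 \<union> missing u)))))"
  proof (cases "t \<in> {u..<p}")
   case True
   then have n: "\<not> (\<mu> u \<le> v t & v t < \<mu> p)" using t p by (auto simp: delta_def band_def)
   show ?thesis
   proof (cases "\<mu> u \<le> v t")
    case True
    have "p - 4*Q \<le> u" using p by linarith
    then have "t \<in> ?A2" using True n \<open>t \<in> {u..<p}\<close> by simp
    then show ?thesis by blast
   next
    case False
    have "t \<in> ?A1" using False \<open>t \<in> {u..<p}\<close> p by simp
    then show ?thesis by blast
   qed
  next
   case F: False
   then have tb: "t \<in> band u p" using t by (auto simp: delta_def)
   then have t': "t < m" "\<mu> u \<le> v t" "v t < \<mu> p" by (auto simp: band_def)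
   show ?thesis
   proof (cases "bad t")
    case True
    then have "t \<in> missing u" using band_range[OF assms] tb by (auto simp: missing_def range_of_def)
    then show ?thesis by blast
   next
    case nb: False
    have 1: "t < p + 4*Q + 2*x"
    proof (rule ccontr)
     assume "\<not> ?thesis"
     then have "\<mu> p < v t" using not_RB[of t p] t' nb by (simp add: bad_def)
     then show False using t' by simp
    qed
    have 2: "u - 4*Q - 2*x \<le> t"
    proof (rule ccontr)
     assume "\<not> ?thesis"
     then have "v t < \<mu> u" using not_LB[of t u] nb p by (simp add: bad_def)
     then show False using t' by simp
    qed
    consider "p \<le> t" "t < p + 4*Q" | "p + 4*Q \<le> t" | "t < u" "u - 4*Q \<le> t" | "t < u - 4*Q"
     using F by force
    then show ?thesis
    proof cases
     case 1
     then have "t \<in> ?A3" using t' by simp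
     then show ?thesis by blast
    next
     case 2
     then have "t \<in> ?A5" using 1 by simp
     then show ?thesis by blast
    next
     case 3
     then have "t \<in> ?A4" using t' by simp
     then show ?thesis by blast
    next
     case 4
     then have "t \<in> ?A6" using 2 by simp
     then show ?thesis by blast
    qed
   qed
  qed
 qed
 then have "card (delta u p) \<le> card (?A1 \<union> (?A2 \<union> (?A3 \<union> (?A4 \<union> (?A5 \<union> (?A6 \<union> missing u))))))"
  by (intro card_mono) auto
 also have "... \<le> card ?A1 + (card ?A2 + (card ?A3 + (card ?A4 + (card ?A5 + (card ?A6 + card (missing u))))))"
  by (intro order_trans[OF card_Un_le] add_left_mono order_refl)
 finally show ?thesis
  using right[of u] left[of p] right[of p] left[of u] p by simp
qed

text \<open>Averaging over the blocks that start at multiples of \<open>Q\<close>. Every right-bad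
  position is in exactly one core, every bad position is a stray of at most 2 blocks and belongs to
  \<open>missing\<close> for at most 11, and at most twice as many positions are bad as right-bad:
  26 = 2 * (2 + 11).\<close>

lemma good_block:
 assumes "card {p. LB p} \<le> card {p. RB p}" "RB p0"
 shows "\<exists>u\<le>m. core u ~= {} & card (strays u) + card (missing u) \<le> 26 * card (core u)"
proof (rule ccontr)
 assume neg: "\<not> ?thesis"
 have Q: "0 < Q" using x0 xQ by simp
 let ?W = "{w. w * Q \<le> m}"
 have "w \<le> w * Q" for w using Q by simp
 then have "?W \<subseteq> {..m}" using order_trans by blast
 then have finW: "finite ?W" by (rule finite_subset) simp
 let ?R = "{p. RB p}" and ?L = "{p. LB p}" and ?B = "{p. bad p}"
 have fin: "finite ?R" "finite ?L" "finite ?B"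
  by (rule finite_subset[of _ "{..<m}"]; auto simp: RB_def LB_def dest: bad_less)+
 have "card ?B \<le> card ?R + card ?L"
  unfolding bad_def Collect_disj_eq by (rule card_Un_le)
 then have B: "card ?B \<le> 2 * card ?R" using assms(1) by simp
 have core: "(\<Sum>w\<in>?W. card (core (w*Q))) = card ?R"
 proof -
  have "(\<Sum>w\<in>?W. card {p \<in> ?R. w*Q + Q \<le> p & p < w*Q + 2*Q}) = (\<Sum>p\<in>?R. 1)"
  proof (rule sum_multicount_gen[OF finW fin(1)], intro ballI)
   fix p assume p: "p \<in> ?R"
   then have p': "p < m" "4*Q \<le> p" by (auto simp: RB_def)
   \<comment> \<open>Being right-bad includes \<open>4*Q \<le> p\<close>, so the subtraction is not
     truncated.\<close>
   have "{w \<in> ?W. w*Q + Q \<le> p & p < w*Q + 2*Q} = {p div Q - 1}"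
   proof (intro equalityI subsetI)
    fix w assume "w \<in> {w \<in> ?W. w*Q + Q \<le> p & p < w*Q + 2*Q}"
    then have "(w + 1) * Q \<le> p" "p < (w + 2) * Q" by (auto simp: algebra_simps)
    then have "p div Q = w + 1" using Q
     by (intro div_nat_eqI) (auto simp: algebra_simps)
    then show "w \<in> {p div Q - 1}" by simp
   next
    fix w assume "w \<in> {p div Q - 1}"
    moreover have "4 \<le> p div Q" using p' Q by (simp add: less_eq_div_iff_mult_less_eq)
    ultimately have w: "w + 1 = p div Q" by simp
    have "(w + 1) * Q \<le> p" "p < (w + 2) * Q"
     using w Q div_times_less_eq_dividend[of p Q] dividend_less_div_times[of Q p]
     by (auto simp: algebra_simps) 
    then show "w \<in> {w \<in> ?W. w*Q + Q \<le> p & p < w*Q + 2*Q}" using p' by (auto simp: algebra_simps)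
   qed
   then show "card {w \<in> ?W. w*Q + Q \<le> p & p < w*Q + 2*Q} = 1" by simp
  qed
  then show ?thesis by (simp add: core_def Collect_conj_eq[symmetric])
 qed
 have strays: "(\<Sum>w\<in>?W. card (strays (w*Q))) \<le> 2 * card ?B"
 proof -
  have "(\<Sum>w\<in>?W. card (strays (w*Q))) \<le> (\<Sum>w\<in>?W. card {p \<in> ?B. w*Q \<le> p & p < w*Q + 2*Q})"
   by (intro sum_mono card_mono) (use fin strays_bad in "auto intro: finite_subset[of _ ?B]")
  also have "... = (\<Sum>p\<in>?B. card {w \<in> ?W. w*Q \<le> p & p < w*Q + 2*Q})"
   by (rule sum_multicount_gen[OF finW fin(3)]) simp
  also have "... \<le> (\<Sum>p\<in>?B. 2)"
  proof (rule sum_mono)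
   fix p
   have "{w \<in> ?W. w*Q \<le> p & p < w*Q + 2*Q} \<subseteq> {p div Q - 1, p div Q}"
   proof
    fix w assume "w \<in> {w \<in> ?W. w*Q \<le> p & p < w*Q + 2*Q}"
    then have "w*Q \<le> p" "p < (w + 2) * Q" by (auto simp: algebra_simps)
    then have "w \<le> p div Q" "p div Q < w + 2" using Q
     by (auto simp: less_eq_div_iff_mult_less_eq div_less_iff_less_mult)
    then show "w \<in> {p div Q - 1, p div Q}" by auto
   qed
   then have "card {w \<in> ?W. w*Q \<le> p & p < w*Q + 2*Q} \<le> card {p div Q - 1, p div Q}"
    by (intro card_mono) auto
   also have "... \<le> 2" by (simp add: card_insert_if)
   finally show "card {w \<in> ?W. w*Q \<le> p & p < w*Q + 2*Q} \<le> 2" .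
  qed
  finally show ?thesis by simp
 qed
 have missing: "(\<Sum>w\<in>?W. card (missing (w*Q))) \<le> 11 * card ?B"
 proof -
  have "(\<Sum>w\<in>?W. card (missing (w*Q))) = (\<Sum>w\<in>?W. card {p \<in> ?B. lo (w*Q) \<le> v p & v p < hi (w*Q)})"
   by (simp add: missing_def)
  also have "... = (\<Sum>p\<in>?B. card {w \<in> ?W. lo (w*Q) \<le> v p & v p < hi (w*Q)})"
   by (rule sum_multicount_gen[OF finW fin(3)]) simp
  also have "... \<le> (\<Sum>p\<in>?B. 11)"
  proof (rule sum_mono)
   fix p
   let ?S = "{w \<in> ?W. lo (w*Q) \<le> v p & v p < hi (w*Q)}"
   \<comment> \<open>The value ranges of blocks 11 apart are disjoint, as 11Q exceeds 4Q + 6Q plus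
     margins of 6x.\<close>
   have close: "w' \<le> w + 10" if "w \<in> ?S" "w' \<in> ?S" for w w'
   proof (rule ccontr)
    assume "\<not> w' \<le> w + 10"
    then have "w + 11 \<le> w'" by simp
    then have "(w + 11) * Q \<le> w' * Q" by (rule mult_le_mono1)
    then have le: "w * Q + 11 * Q \<le> w' * Q" by (simp add: algebra_simps)
    have w': "w' * Q \<le> m" using that by simp
    have "lo (w'*Q) \<le> v p" "v p < hi (w*Q)" using that by auto
    then have "\<mu> (w'*Q - 4*Q - 2*x) < \<mu> (w*Q + 6*Q + 2*x)"
     using le w' xQ by (auto simp: lo_def hi_def split: if_splits)
    moreover have "\<mu> (w*Q + 6*Q + 2*x) < \<mu> (w'*Q - 4*Q - 2*x)"
     by (rule mu_mono) (use le w' xQ in auto)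
    ultimately show False by simp
   qed
   show "card ?S \<le> 11"
   proof (cases "?S = {}")
    case False
    define w0 where "w0 = Min ?S"
    have finS: "finite ?S" using finW by simp
    have w0: "w0 \<in> ?S" unfolding w0_def using False finS by (rule Min_in[rotated])
    have "?S \<subseteq> {w0..w0 + 10}" using close[OF w0] finS by (auto simp: w0_def)
    then have "card ?S \<le> card {w0..w0 + 10}" by (intro card_mono) auto
    then show ?thesis by simp
   next
    case True
    show ?thesis unfolding True by simp
   qed
  qed
  finally show ?thesis by simp
 qed
 have "(\<Sum>w\<in>?W. card (strays (w*Q)) + card (missing (w*Q))) \<le> 26 * card ?R"
  using strays missing B by (simp add: sum.distrib)
 moreover have "(\<Sum>w\<in>?W. 26 * card (core (w*Q))) < (\<Sum>w\<in>?W. card (strays (w*Q)) + card (missing (w*Q)))"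
 proof (rule sum_strict_mono_ex1[OF finW])
  \<comment> \<open>Only blocks with a nonempty core violate the claim strictly; for the others the
    left side is 0.\<close>
  have *: "26 * card (core (w*Q)) < card (strays (w*Q)) + card (missing (w*Q))" if "w \<in> ?W" "core (w*Q) ~= {}" for w
  proof -
   have "\<not> card (strays (w*Q)) + card (missing (w*Q)) \<le> 26 * card (core (w*Q))" using neg that by blast
   then show ?thesis by simp
  qed
  show "\<forall>w\<in>?W. 26 * card (core (w*Q)) \<le> card (strays (w*Q)) + card (missing (w*Q))"
   using * by (metis card.empty le0 less_imp_le_nat mult_0_right)
  have "card ?R ~= 0" using assms(2) fin by auto
  then have "\<not> (\<forall>w\<in>?W. card (core (w*Q)) = 0)" using core by (metis (no_types, lifting) sum.neutral)
  then show "\<exists>w\<in>?W. 26 * card (core (w*Q)) < card (strays (w*Q)) + card (missing (w*Q))"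
   using * by fastforce
 qed
 ultimately show False using core by (simp add: sum_distrib_left[symmetric])
qed

text \<open>The constants come from \<open>good_block\<close>: 34x = 8x + 26x for the corrections,
  and 18Q + 34x <= 21Q for the range.\<close>

lemma core_structure:
 assumes "card {p. LB p} \<le> card {p. RB p}" "RB p0"
 shows "rstruct m Q x v"
proof -
 obtain u where u: "u \<le> m" "core u ~= {}" "card (strays u) + card (missing u) \<le> 26 * card (core u)"
  using good_block[OF assms] by blast
 have c: "card (core u) < x" by (rule card_core[OF u(1)])
 have "card (range_of u) \<le> 21*Q" using card_range_of[OF u(1)] u(3) c xQ by simp
 then have r: "card {t. t < m & lo u \<le> v t & v t < hi u} \<le> 21*Q" by (simp add: range_of_def)
 show ?thesis unfolding rstruct_def
 proof (rule exI[of _ u], rule exI[of _ "core u"], rule exI[of _ "strays u"], rule exI[of _ "lo u"],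
   rule exI[of _ "hi u"], rule exI[of _ "\<mu> u"], rule exI[of _ \<mu>], intro conjI ballI)
  show "core u \<subseteq> {..<m}" by (auto simp: core_def RB_def)
  show "strays u \<subseteq> {..<m}" by (auto simp: strays_def)
  fix p assume p: "p \<in> core u"
  show "u + Q \<le> p" "p < u + 2*Q" using p by (auto simp: core_def)
  show "3 * card {t \<in> {u..<p}. v t < v p} \<le> p - u" by (rule core_fraction[OF p])
  have "card (delta u p) \<le> 34*x" using card_delta[OF p] u(3) c by simp
  then show "let I = {t. t < m & \<mu> u \<le> v t & v t < \<mu> p}; D = ({u..<p} - I) \<union> (I - {u..<p}) in
    D \<subseteq> {t. t < m & lo u \<le> v t & v t < hi u} \<union> strays u & card D \<le> 34*x"
   using delta_sub[OF p] unfolding Let_def delta_def band_def range_of_def by simp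
 qed (use u c r in auto)
qed

end

section \<open>Existence of the thresholds\<close>

lemma near_sorted_exists:
 assumes inj: "inj_on v {..<m}" and vB: "\<And>p. p < m ==> v p < B" and xs: "0 < x" "20 * x \<le> Q" and m: "8*Q \<le> m"
  and near: "\<And>u k. u + 8*Q \<le> m ==>
   card {p \<in> {u..<u + card {p \<in> {u..<u + 8*Q}. v p < k}}. k \<le> v p} < x"
 shows "\<exists>\<mu>. near_sorted m Q x B v \<mu>"
proof -
 \<comment> \<open>The start of a window of \<open>8*Q\<close> positions around \<open>p\<close>,
   pushed inside the list near its ends.\<close>
 define ws where "ws p = min (p - 4*Q) (m - 8*Q)" for p
 let ?W = "%p. {ws p..<ws p + 8*Q}"
 \<comment> \<open>The threshold shall have as many window values below it as the window has
   positions before \<open>p\<close>. Then equally many values are misplaced on both sides of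
   \<open>p\<close>, and the hypothesis on misplacements to the left bounds either number.\<close>
 have "\<exists>k. p \<le> m --> card {t \<in> ?W p. v t < k} = p - ws p" for p
 proof (cases "p \<le> m")
  case True
  have injW: "inj_on v (?W p)" by (rule inj_on_subset[OF inj]) (use m in "auto simp: ws_def")
  have "card (v ` ?W p) = 8*Q" using card_image[OF injW] by simp
  moreover have "p \<le> ws p + 8*Q" using m True by (auto simp: ws_def)
  ultimately have "p - ws p \<le> card (v ` ?W p)" by simp
  from cut_exists[OF _ this] obtain k where k: "card {y \<in> v ` ?W p. y < k} = p - ws p" by auto
  have eq: "{y \<in> v ` ?W p. y < k} = v ` {t \<in> ?W p. v t < k}" by auto
  have "inj_on v {t \<in> ?W p. v t < k}" by (rule inj_on_subset[OF injW]) auto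
  then have "card {t \<in> ?W p. v t < k} = p - ws p"
   using k card_image unfolding eq by fastforce
  then show ?thesis by blast
 qed simp
 then obtain \<mu> where \<mu>: "\<And>p. p \<le> m ==> card {t \<in> ?W p. v t < \<mu> p} = p - ws p" by metis
 have left': "card {t \<in> {ws p..<p}. \<mu> p \<le> v t} < x" if "p \<le> m" for p
 proof -
  have "ws p + 8*Q \<le> m" using m by (simp add: ws_def)
  moreover have "ws p + (p - ws p) = p" using that m by (auto simp: ws_def)
  ultimately show ?thesis using near[of "ws p" "\<mu> p"] unfolding \<mu>[OF that] by simp
 qed
 have "near_sorted m Q x B v \<mu>"
 proof
  fix p assume p: "p \<le> m"
  have "card {t \<in> {p - 4*Q..<p}. \<mu> p \<le> v t} \<le> card {t \<in> {ws p..<p}. \<mu> p \<le> v t}"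
   by (intro card_mono) (auto simp: ws_def)
  then show "card {t \<in> {p - 4*Q..<p}. \<mu> p \<le> v t} < x" using left'[OF p] by simp
  have wp: "ws p \<le> p" "p \<le> ws p + 8*Q" using p m by (auto simp: ws_def)
  have "{t \<in> {p..<min m (p + 4*Q)}. v t < \<mu> p} \<subseteq> {t \<in> {p..<ws p + 8*Q}. v t < \<mu> p}"
   using m by (auto simp: ws_def)
  then have 1: "card {t \<in> {p..<min m (p + 4*Q)}. v t < \<mu> p} \<le> card {t \<in> {p..<ws p + 8*Q}. v t < \<mu> p}"
   by (intro card_mono) auto
  have "{t \<in> ?W p. v t < \<mu> p} = {t \<in> {ws p..<p}. v t < \<mu> p} \<union> {t \<in> {p..<ws p + 8*Q}. v t < \<mu> p}"
   using wp by auto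
  then have "card {t \<in> {ws p..<p}. v t < \<mu> p} + card {t \<in> {p..<ws p + 8*Q}. v t < \<mu> p} = p - ws p"
   using \<mu>[OF p] by (simp add: card_Un_disjoint disjoint_iff)
  moreover have "card {t \<in> {ws p..<p}. v t < \<mu> p} + card {t \<in> {ws p..<p}. \<mu> p \<le> v t} = card {ws p..<p}"
  proof -
   have "{ws p..<p} = {t \<in> {ws p..<p}. v t < \<mu> p} \<union> {t \<in> {ws p..<p}. \<mu> p \<le> v t}" by auto
   then have "card {ws p..<p} = card ({t \<in> {ws p..<p}. v t < \<mu> p} \<union> {t \<in> {ws p..<p}. \<mu> p \<le> v t})"
    by (rule arg_cong)
   then show ?thesis by (subst (asm) card_Un_disjoint) auto
  qed
  ultimately show "card {t \<in> {p..<min m (p + 4*Q)}. v t < \<mu> p} < x" using 1 left'[OF p] wp by simp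
 qed (use assms in auto)
 then show ?thesis by blast
qed

section \<open>Mirror symmetry\<close>

lemma card_mirror:
 assumes "\<And>t. t \<in> S ==> t < (m::nat)" "T = (%t. m - 1 - t) ` S"
 shows "card T = card S"
 unfolding assms(2) by (rule card_image) (auto simp: inj_on_def dest!: assms(1))

text \<open>Reversing positions and values together preserves which pairs are sorted, but exchanges
  left and right. This spares a separate treatment of \<open>LB\<close>.\<close>

lemma (in near_sorted) mirror:
 "near_sorted m Q x B (%p. B - 1 - v (m - 1 - p)) (%p. B - \<mu> (m - p))"
proof
 have mm: "m - 1 - p < m" if "p < m" for p using that by simp
 show "inj_on (%p. B - 1 - v (m - 1 - p)) {..<m}"
 proof (rule inj_onI)
  fix p p' assume *: "p \<in> {..<m}" "p' \<in> {..<m}" "B - 1 - v (m - 1 - p) = B - 1 - v (m - 1 - p')"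
  then have "v (m - 1 - p) = v (m - 1 - p')" using vB[OF mm, of p] vB[OF mm, of p'] by simp
  then have "m - 1 - p = m - 1 - p'" using inj * mm by (auto dest!: inj_onD)
  then show "p = p'" using * by auto
 qed
 show "B - 1 - v (m - 1 - p) < B" if "p < m" for p using vB[OF that] by simp
 have eq1: "B - \<mu> c \<le> B - 1 - v t \<longleftrightarrow> v t < \<mu> c" if "t < m" for t c using vB[OF that] by auto
 have eq2: "B - 1 - v t < B - \<mu> c \<longleftrightarrow> \<mu> c \<le> v t" if "t < m" for t c using vB[OF that] by auto
 show "card {t \<in> {p - 4*Q..<p}. B - \<mu> (m - p) \<le> B - 1 - v (m - 1 - t)} < x" if p: "p \<le> m" for p
 proof -
  let ?S = "{t \<in> {m - p..<min m (m - p + 4*Q)}. v t < \<mu> (m - p)}"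
  have "{t \<in> {p - 4*Q..<p}. B - \<mu> (m - p) \<le> B - 1 - v (m - 1 - t)} = (%t. m - 1 - t) ` ?S"
  proof (intro equalityI subsetI)
   fix t assume t: "t \<in> {t \<in> {p - 4*Q..<p}. B - \<mu> (m - p) \<le> B - 1 - v (m - 1 - t)}"
   then have "m - 1 - t \<in> ?S" using eq1[of "m - 1 - t"] p by auto
   moreover have "t = m - 1 - (m - 1 - t)" using t p by auto
   ultimately show "t \<in> (%t. m - 1 - t) ` ?S" by blast
  next
   fix t assume "t \<in> (%t. m - 1 - t) ` ?S"
   then obtain s where s: "t = m - 1 - s" "s \<in> ?S" by blast
   then have "m - 1 - t = s" by auto
   then show "t \<in> {t \<in> {p - 4*Q..<p}. B - \<mu> (m - p) \<le> B - 1 - v (m - 1 - t)}"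
    using s eq1[of s] p by auto
  qed
  then have c: "card {t \<in> {p - 4*Q..<p}. B - \<mu> (m - p) \<le> B - 1 - v (m - 1 - t)} = card ?S"
   by (intro card_mirror) auto
  show ?thesis unfolding c using right[of "m - p"] diff_le_self by blast
 qed
 show "card {t \<in> {p..<min m (p + 4*Q)}. B - 1 - v (m - 1 - t) < B - \<mu> (m - p)} < x" if p: "p \<le> m" for p
 proof -
  let ?S = "{t \<in> {m - p - 4*Q..<m - p}. \<mu> (m - p) \<le> v t}"
  have "{t \<in> {p..<min m (p + 4*Q)}. B - 1 - v (m - 1 - t) < B - \<mu> (m - p)} = (%t. m - 1 - t) ` ?S"
  proof (intro equalityI subsetI)
   fix t assume t: "t \<in> {t \<in> {p..<min m (p + 4*Q)}. B - 1 - v (m - 1 - t) < B - \<mu> (m - p)}"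
   then have "m - 1 - t \<in> ?S" using eq2[of "m - 1 - t"] p by auto
   moreover have "t = m - 1 - (m - 1 - t)" using t p by auto
   ultimately show "t \<in> (%t. m - 1 - t) ` ?S" by blast
  next
   fix t assume "t \<in> (%t. m - 1 - t) ` ?S"
   then obtain s where s: "t = m - 1 - s" "s \<in> ?S" by blast
   then have "m - 1 - t = s" by auto
   then show "t \<in> {t \<in> {p..<min m (p + 4*Q)}. B - 1 - v (m - 1 - t) < B - \<mu> (m - p)}"
    using s eq2[of s] p by auto
  qed
  then have c: "card {t \<in> {p..<min m (p + 4*Q)}. B - 1 - v (m - 1 - t) < B - \<mu> (m - p)} = card ?S"
   by (intro card_mirror) auto
  show ?thesis unfolding c using left[of "m - p"] diff_le_self by blast
 qed
qed (use x0 xQ in auto)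

lemma (in near_sorted) RB_mirror:
 assumes "p < m"
 shows "near_sorted.RB m Q (%p. B - 1 - v (m - 1 - p)) p \<longleftrightarrow> LB (m - 1 - p)"
proof -
 interpret R: near_sorted m Q x B "%p. B - 1 - v (m - 1 - p)" "%p. B - \<mu> (m - p)" by (rule mirror)
 have eq: "B - 1 - v s < B - 1 - v t \<longleftrightarrow> v t < v s" if "s < m" "t < m" for s t
  using vB[OF that(1)] vB[OF that(2)] by auto
 let ?S = "{t \<in> {Suc (m - 1 - p)..<Suc (m - 1 - p) + 4*Q}. v t < v (m - 1 - p)}"
 let ?T = "{t \<in> {p - 4*Q..<p}. B - 1 - v (m - 1 - p) < B - 1 - v (m - 1 - t)}"
 have c: "card ?T = card ?S" if "4*Q \<le> p"
 proof (rule card_mirror)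
  show "t < m" if "t \<in> ?S" for t
  proof -
   have "t < Suc (m - 1 - p) + 4*Q" using that by simp
   then show ?thesis using assms \<open>4*Q \<le> p\<close> by linarith
  qed
  show "?T = (%t. m - 1 - t) ` ?S"
  proof (intro equalityI subsetI)
   fix t assume t: "t \<in> ?T"
   then have "m - 1 - t \<in> ?S" using eq[of "m - 1 - p" "m - 1 - t"] assms by auto
   moreover have "t = m - 1 - (m - 1 - t)" using t assms by auto
   ultimately show "t \<in> (%t. m - 1 - t) ` ?S" by blast
  next
   fix t assume "t \<in> (%t. m - 1 - t) ` ?S"
   then obtain s where s: "t = m - 1 - s" "s \<in> ?S" by blast
   then have sm: "s < m" using assms \<open>4*Q \<le> p\<close> by auto
   then have "m - 1 - t = s" using s by auto
   then show "t \<in> ?T" using s sm eq[of "m - 1 - p" s] assms by auto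
  qed
 qed
 have e: "m - 1 - p + 4*Q < m \<longleftrightarrow> 4*Q \<le> p" "m - 1 - p < m" using assms by linarith+
 show ?thesis
 proof (cases "4*Q \<le> p")
  case True
  have "R.RB p \<longleftrightarrow> 8*Q \<le> 3 * card ?T" unfolding R.RB_def using True assms by blast
  moreover have "LB (m - 1 - p) \<longleftrightarrow> 8*Q \<le> 3 * card ?S" unfolding LB_def using True e by blast
  ultimately show ?thesis by (simp only: c[OF True])
 next
  case False
  then show ?thesis unfolding R.RB_def LB_def using e by blast
 qed
qed

lemma sorted_or_rstruct:
 assumes inj: "inj_on v {..<m}" and vB: "\<And>p. p < m ==> v p < B" and xs: "0 < x" "20 * x \<le> Q"
  and near: "\<And>u k. u + 8*Q \<le> m ==>
   card {p \<in> {u..<u + card {p \<in> {u..<u + 8*Q}. v p < k}}. k \<le> v p} < x"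
 shows "dsorted (12*Q) m v \<or> rstruct m Q x v \<or> rstruct m Q x (%p. B - 1 - v (m - 1 - p))"
proof (cases "8*Q \<le> m")
 case False
 then show ?thesis by (auto simp: dsorted_def)
next
 case True
 from near_sorted_exists[OF inj vB xs True near] obtain \<mu> where "near_sorted m Q x B v \<mu>" by blast
 then interpret near_sorted m Q x B v \<mu> .
 interpret R: near_sorted m Q x B "%p. B - 1 - v (m - 1 - p)" "%p. B - \<mu> (m - p)" by (rule mirror)
 have RL: "R.RB p \<longleftrightarrow> p < m & LB (m - 1 - p)" for p
 proof -
  have "R.RB p ==> p < m" by (simp only: R.RB_def)
  then show ?thesis using RB_mirror[of p] by blast
 qed
 \<comment> \<open>The mirror image of the mirror image agrees with \<open>v\<close> only below
   \<open>m\<close> and is not literally the same function, hence a third interpretation.\<close>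
 interpret RR: near_sorted m Q x B "%p. B - 1 - (B - 1 - v (m - 1 - (m - 1 - p)))" "%p. B - (B - \<mu> (m - (m - p)))"
  by (rule R.mirror)
 have RR: "RR.RB p \<longleftrightarrow> RB p" for p
 proof (cases "p < m")
  case True
  have "B - 1 - (B - 1 - v (m - 1 - (m - 1 - t))) = v t" if "t < m" for t
  proof -
   have "m - 1 - (m - 1 - t) = t" using that by simp
   then show ?thesis using vB[OF that] by simp
  qed
  then have "{t \<in> {p - 4*Q..<p}. B - 1 - (B - 1 - v (m - 1 - (m - 1 - p))) < B - 1 - (B - 1 - v (m - 1 - (m - 1 - t)))} =
   {t \<in> {p - 4*Q..<p}. v p < v t}" using True by auto
  then show ?thesis by (simp only: RR.RB_def RB_def)
 next
  case False
  then show ?thesis unfolding RR.RB_def RB_def by blast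
 qed
 have LR: "R.LB p \<longleftrightarrow> p < m & RB (m - 1 - p)" for p
 proof (cases "p < m")
  case True
  then have "m - 1 - p < m" "m - 1 - (m - 1 - p) = p" by auto
  then show ?thesis using R.RB_mirror[of "m - 1 - p"] RR[of "m - 1 - p"] True by simp
 next
  case False
  then show ?thesis unfolding R.LB_def by blast
 qed
 have img: "{p. p < m & P (m - 1 - p)} = (%t. m - 1 - t) ` {p. P p}" if "\<And>t. P t ==> t < m" for P
 proof (intro equalityI subsetI)
  fix p assume p: "p \<in> {p. p < m & P (m - 1 - p)}"
  then have "p = m - 1 - (m - 1 - p)" by auto
  then show "p \<in> (%t. m - 1 - t) ` {p. P p}" using p by blast
 next
  fix p assume "p \<in> (%t. m - 1 - t) ` {p. P p}"
  then obtain s where s: "p = m - 1 - s" "P s" by blast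
  then have "s < m" "m - 1 - p = s" using that[of s] by auto
  then show "p \<in> {p. p < m & P (m - 1 - p)}" using s by auto
 qed
 have c1: "card {p. R.RB p} = card {p. LB p}"
 proof -
  have less: "t < m" if "LB t" for t using that unfolding LB_def by blast
  have "{p. R.RB p} = {p. p < m & LB (m - 1 - p)}" using RL by blast
  also have "... = (%t. m - 1 - t) ` {p. LB p}" by (rule img[OF less])
  finally show ?thesis by (intro card_mirror) (use less in auto)
 qed
 have c2: "card {p. R.LB p} = card {p. RB p}"
 proof -
  have less: "t < m" if "RB t" for t using that unfolding RB_def by blast
  have "{p. R.LB p} = {p. p < m & RB (m - 1 - p)}" using LR by blast
  also have "... = (%t. m - 1 - t) ` {p. RB p}" by (rule img[OF less])
  finally show ?thesis by (intro card_mirror) (use less in auto)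
 qed
 have fin: "finite {p. RB p}" "finite {p. LB p}" "finite {p. R.RB p}"
  unfolding RB_def LB_def R.RB_def by simp_all
 show ?thesis
 proof (cases "(\<forall>p. \<not> RB p) & (\<forall>p. \<not> LB p)")
  case True
  then show ?thesis using sorted_if_no_bad by blast
 next
  case False
  then have pos: "0 < card {p. RB p} \<or> 0 < card {p. LB p}" using fin by (auto simp: card_gt_0_iff)
  show ?thesis
  \<comment> \<open>\<open>good_block\<close> asks for at least as many right-bad as left-bad
    positions; otherwise the mirror image has this property.\<close>
  proof (cases "card {p. LB p} \<le> card {p. RB p}")
   case True
   then have "0 < card {p. RB p}" using pos by linarith
   then obtain p0 where "RB p0" by (auto simp: card_gt_0_iff)
   then show ?thesis using core_structure[OF True] by blast
  next
   case F: False
   then have "0 < card {p. R.RB p}" using c1 by linarith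
   then obtain p0 where "R.RB p0" by (auto simp: card_gt_0_iff)
   then show ?thesis using R.core_structure[of p0] F c1 c2 by simp
  qed
 qed
qed

section \<open>Search with multiplicative weights\<close>

text \<open>The weighted median: at most half of the weight lies strictly to its left and less than
  half strictly to its right.\<close>

definition wmed :: "nat => (nat => nat) => nat" where
 "wmed K w = (LEAST x. (\<Sum>j<K. w j) < 2 * (\<Sum>j\<le>x. w j))"

lemma wmed_props:
 assumes "0 < (\<Sum>j<K. w j)"
 shows "wmed K w < K" "(\<Sum>j<K. w j) < 2 * (\<Sum>j\<le>wmed K w. w j)"
  "2 * (\<Sum>j<wmed K w. w j) \<le> (\<Sum>j<K. w j)"
proof -
 let ?P = "%x. (\<Sum>j<K. w j) < 2 * (\<Sum>j\<le>x. w j)"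
 have K: "0 < K" using assms by (cases K) auto
 then have "{..K - 1} = {..<K}" by auto
 then have "?P (K - 1)" using assms by simp
 then show "wmed K w < K" "?P (wmed K w)"
  unfolding wmed_def using Least_le[of ?P "K - 1"] LeastI[of ?P "K - 1"] K by auto
 show "2 * (\<Sum>j<wmed K w. w j) \<le> (\<Sum>j<K. w j)"
 proof (cases "wmed K w")
  case (Suc x)
  then have "\<not> ?P x" using not_less_Least[of x ?P] by (simp add: wmed_def)
  then show ?thesis using Suc by (simp add: lessThan_Suc_atMost)
 qed simp
qed

lemma wmed_unique:
 assumes "(\<Sum>j<K. w j) < 2 * (\<Sum>j\<le>x. w j)" "2 * (\<Sum>j<x. w j) \<le> (\<Sum>j<K. w j)"
 shows "wmed K w = x"
 unfolding wmed_def
proof (rule Least_equality)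
 fix y assume y: "(\<Sum>j<K. w j) < 2 * (\<Sum>j\<le>y. w j)"
 show "x \<le> y"
 proof (rule ccontr)
  assume "\<not> x \<le> y"
  then have "{..y} \<subseteq> {..<x}" by auto
  then have "(\<Sum>j\<le>y. w j) \<le> (\<Sum>j<x. w j)" by (intro sum_mono2) auto
  then show False using y assms(2) by simp
 qed
qed (rule assms(1))

text \<open>
 \<open>oc x r\<close> is the outcome of testing cell \<open>x\<close> in round \<open>r\<close>; \<open>True\<close> says that the item
 belongs to the left of the cell. The tested cell itself keeps its weight, so that the total grows
 at most by the factor \<open>3/2\<close>.
\<close>

primrec wts :: "nat => (nat => nat => bool) => nat => nat => nat" where
 "wts K oc 0 = (%_. 1)"
| "wts K oc (Suc r) = (%j. let x = wmed K (wts K oc r) in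
  if (if oc x r then j < x else x < j) then 2 * wts K oc r j else wts K oc r j)"

definition path :: "nat => (nat => nat => bool) => nat => nat" where
 "path K oc r = wmed K (wts K oc r)"

definition visits :: "nat => (nat => nat => bool) => nat => nat => nat" where
 "visits K oc T x = card {r. r < T & path K oc r = x}"

text \<open>The answer is the median of the visited cells, not the last cell: it lies in an interval
  as soon as more than half of the visits do, wherever the search happens to stop.\<close>

definition located :: "nat => (nat => nat => bool) => nat => nat" where
 "located K oc T = wmed K (visits K oc T)"

text \<open>Cell \<open>x\<close> stands for the block of \<open>T * A\<close> positions that ends
  before \<open>x * (T * A)\<close>. Round \<open>r\<close> uses the \<open>r\<close>-th group of
  \<open>A\<close> positions of the block, so a cell tested repeatedly is asked with new signals
  each time. Cell 0 has no block and sends the search to the right; cells beyond the list send it to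
  the left.\<close>

definition gcell_test :: "nat => (nat => nat => real) => nat => nat => (nat => nat) => nat => nat => bool" where
 "gcell_test A q T t L x r \<longleftrightarrow> 0 < x & (t < x * (T * A) \<or>
  0 < (\<Sum>k<A. q t (L ((x - 1) * (T * A) + r * A + k))))"

lemma wts_pos: "0 < wts K oc r j"
 by (induction r) (auto simp: Let_def)

lemma wts_sum_pos: "0 < K ==> 0 < (\<Sum>j<K. wts K oc r j)"
 by (rule sum_pos) (auto simp: wts_pos)

lemma path_less: "0 < K ==> path K oc r < K"
 unfolding path_def by (rule wmed_props(1)[OF wts_sum_pos])

lemma wts_growth:
 assumes "0 < K"
 shows "2 * (\<Sum>j<K. wts K oc (Suc r) j) \<le> 3 * (\<Sum>j<K. wts K oc r j)"
proof -
 let ?w = "wts K oc r"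
 define x where "x = wmed K ?w"
 note p = wmed_props[OF wts_sum_pos[OF assms, of oc r], folded x_def]
 define S where "S = (if oc x r then {..<x} else {Suc x..<K})"
 have "(\<Sum>j<K. wts K oc (Suc r) j) = (\<Sum>j<K. ?w j + (if j \<in> S then ?w j else 0))"
  by (rule sum.cong) (auto simp: Let_def x_def[symmetric] S_def)
 also have "... = (\<Sum>j<K. ?w j) + (\<Sum>j\<in>{..<K} \<inter> S. ?w j)"
  by (simp add: sum.distrib sum.If_cases)
 also have "{..<K} \<inter> S = S" using p(1) by (auto simp: S_def)
 finally have 1: "(\<Sum>j<K. wts K oc (Suc r) j) = (\<Sum>j<K. ?w j) + (\<Sum>j\<in>S. ?w j)" .
 have "2 * (\<Sum>j\<in>S. ?w j) \<le> (\<Sum>j<K. ?w j)"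
 proof (cases "oc x r")
  case True
  then show ?thesis using p(3) by (simp add: S_def)
 next
  case False
  have "{..<K} = {..x} \<union> {Suc x..<K}" using p(1) by auto
  then have "(\<Sum>j<K. ?w j) = (\<Sum>j\<le>x. ?w j) + (\<Sum>j\<in>{Suc x..<K}. ?w j)"
   by (metis (no_types, lifting) atLeastLessThan_iff atMost_iff disjoint_iff finite_atLeastLessThan
     finite_atMost not_less_eq_eq sum.union_disjoint)
  then show ?thesis using p(2) False by (simp add: S_def)
 qed
 then show ?thesis using 1 by simp
qed

lemma wts_total: "0 < K ==> 2 ^ r * (\<Sum>j<K. wts K oc r j) \<le> K * 3 ^ r"
proof (induction r)
 case (Suc r)
 have "2 ^ Suc r * (\<Sum>j<K. wts K oc (Suc r) j) \<le> 2 ^ r * (3 * (\<Sum>j<K. wts K oc r j))"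
  using wts_growth[OF Suc.prems, of oc r] by simp
 also have "... \<le> 3 * (K * 3 ^ r)" using Suc by simp
 finally show ?case by simp
qed simp

text \<open>From 3^5 = 243 < 256 = 2^8: a total that grows by 3/2 per round gains less than a factor
  2^3 in five rounds.\<close>

lemma three_pow: "0 < t ==> (3::nat) ^ (5 * t) < 2 ^ (8 * t)"
proof -
 assume "0 < t"
 then have "(243::nat) ^ t < 256 ^ t" by (intro power_strict_mono) auto
 then show ?thesis by (simp add: power_mult)
qed

text \<open>A potential argument. In \<open>T = 40 * t\<close> rounds the total weight stays below
  2^t * 2^(24t), so \<open>c1\<close> and \<open>c2\<close> are doubled fewer than 25t times each.
  Every round doubles both, or tests a cell between them and doubles one, or gives a wrong answer.
  As at most T/8 = 5t answers are wrong, 80t < 50t + g + 10t for the number g of visits between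
  \<open>c1\<close> and \<open>c2\<close>, which is therefore more than half.\<close>

lemma located_near:
 fixes K :: nat
 assumes c: "c1 < c2" "c2 < K" and T: "T = 40 * t" and t: "0 < t" "K \<le> 2 ^ t"
  and good: "8 * card {r. r < T & (path K oc r \<le> c1 & oc (path K oc r) r \<or>
    c2 \<le> path K oc r & \<not> oc (path K oc r) r)} \<le> T"
 shows "c1 \<le> located K oc T & located K oc T \<le> c2"
proof -
 let ?x = "path K oc"
 have K: "0 < K" using c by simp
 define dbl where "dbl c r \<longleftrightarrow> (if oc (?x r) r then c < ?x r else ?x r < c)" for c r
 define u where "u c R = card {r. r < R & dbl c r}" for c R
 have cardSuc: "card {r. r < Suc R & P r} = card {r. r < R & P r} + of_bool (P R)" for P and R :: nat
 proof -
  have "{r. r < Suc R & P r} = {r. r < R & P r} \<union> (if P R then {R} else {})"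
   by (auto simp: less_Suc_eq)
  then show ?thesis by simp
 qed
 have w: "wts K oc R c = 2 ^ u c R" for c R
  by (induction R) (auto simp: u_def cardSuc Let_def dbl_def path_def)
 have ub: "u c T < 5 * (5 * t)" if "c < K" for c
 proof (rule ccontr)
  assume "\<not> ?thesis"
  then have "25 * t \<le> u c T" by simp
  then have "(2::nat) ^ (25 * t) \<le> wts K oc T c" unfolding w by (intro power_increasing) auto
  also have "... \<le> (\<Sum>j<K. wts K oc T j)" using that by (intro member_le_sum) auto
  finally have "2 ^ T * 2 ^ (25 * t) \<le> K * 3 ^ T"
   using wts_total[OF K, of T oc] by (meson mult_le_mono2 order_trans)
  also have "... \<le> 2 ^ t * 3 ^ T" using t(2) by simp
  also have "3 ^ T = (3::nat) ^ (5 * (8 * t))" by (simp add: T)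
  also have "... < 2 ^ (8 * (8 * t))" by (rule three_pow) (use t in simp)
  finally have "(2::nat) ^ T * 2 ^ (25 * t) < 2 ^ t * 2 ^ (64 * t)" by simp
  then have "(2::nat) ^ (65 * t) < 2 ^ (65 * t)" by (simp add: T flip: power_add)
  then show False by simp
 qed
 let ?G = "%r. c1 \<le> ?x r & ?x r \<le> c2"
 let ?W = "%r. ?x r \<le> c1 & oc (?x r) r \<or> c2 \<le> ?x r & \<not> oc (?x r) r"
 define g where "g R = card {r. r < R & ?G r}" for R
 define e where "e R = card {r. r < R & ?W r}" for R
 have "2 * R \<le> u c1 R + u c2 R + g R + 2 * e R" for R
 proof (induction R)
  case (Suc R)
  have gen: "2 * R \<le> a + b + c + 2 * d ==> 2 \<le> a' + b' + c' + 2 * d' ==>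
   2 * Suc R \<le> (a + a') + (b + b') + (c + c') + 2 * (d + d')" for a b c d a' b' c' d' :: nat by simp
  have *: "2 \<le> of_bool (dbl c1 R) + of_bool (dbl c2 R) + of_bool (?G R) + 2 * (of_bool (?W R) :: nat)"
   using c(1) unfolding dbl_def by (cases "oc (?x R) R") (auto simp: not_le)
  show ?case unfolding u_def g_def e_def cardSuc
   by (rule gen[OF Suc[unfolded u_def g_def e_def] *])
 qed simp
 from this[of T] have "2 * T < 50 * t + g T + 2 * e T"
  using ub[of c1] ub[of c2] c by simp
 moreover have "8 * e T \<le> T" using good by (simp add: e_def)
 ultimately have g: "T < 2 * g T" by (simp add: T)
 have sumv: "(\<Sum>x\<in>S. visits K oc T x) = card {r. r < T & ?x r \<in> S}" if "finite S" for S
  using that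
 proof induction
  case (insert y S)
  have "{r. r < T & ?x r \<in> insert y S} = {r. r < T & ?x r = y} \<union> {r. r < T & ?x r \<in> S}" by auto
  moreover have "{r. r < T & ?x r = y} \<inter> {r. r < T & ?x r \<in> S} = {}" using insert by auto
  ultimately show ?case using insert by (simp add: visits_def card_Un_disjoint)
 qed simp
 have tot: "(\<Sum>x<K. visits K oc T x) = T"
  using sumv[of "{..<K}"] path_less[OF K] by simp
 have Tpos: "0 < T" using T t by simp
 note m = wmed_props[where K = K and w = "visits K oc T", unfolded tot, OF Tpos, folded located_def]
 let ?l = "located K oc T"
 have split: "card {r. r < T & P r} + card {r. r < T & \<not> P r} = T" for P
 proof -
  have "{..<T} = {r. r < T & P r} \<union> {r. r < T & \<not> P r}" by auto
  then have "T = card ({r. r < T & P r} \<union> {r. r < T & \<not> P r})" by (metis card_lessThan)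
  then show ?thesis by (subst (asm) card_Un_disjoint) auto
 qed
 have "c1 \<le> ?l"
 proof (rule ccontr)
  assume a: "\<not> c1 \<le> ?l"
  have "card {r. r < T & ?x r \<le> ?l} \<le> card {r. r < T & \<not> ?G r}" using a by (intro card_mono) auto
  then show False using m(2) sumv[of "{..?l}"] g split[of ?G] by (simp add: g_def)
 qed
 moreover have "?l \<le> c2"
 proof (rule ccontr)
  assume a: "\<not> ?l \<le> c2"
  have "card {r. r < T & ?G r} \<le> card {r. r < T & ?x r < ?l}" using a by (intro card_mono) auto
  then show False using m(3) sumv[of "{..<?l}"] g by (simp add: g_def)
 qed
 ultimately show ?thesis ..
qed

lemma path_cong:
 "(\<And>r x. r < R ==> oc x r = oc' x r) ==> wts K oc R = wts K oc' R"
 by (induction R) (auto simp: Let_def)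

section \<open>Dynamic programming over local orders\<close>

definition bmask :: "(nat => bool) => nat => nat" where
 "bmask P w = horner_sum of_bool 2 (map P [0..<w])"

lemma bit_bmask: "bit (bmask P w) k \<longleftrightarrow> k < w & P k"
 by (auto simp: bmask_def bit_horner_sum_bit_iff)

lemma bmask_less: "bmask P w < 2 ^ w"
 using horner_sum_of_bool_2_less[of "map P [0..<w]"] by (simp add: bmask_def)

text \<open>Without bit operations the machine clears a bit that is set by subtracting the power of
  2.\<close>

lemma bit_diff_pow: "bit (x::nat) k ==> bit (x - 2 ^ k) i \<longleftrightarrow> bit x i & i ~= k"
proof -
 assume b: "bit x k"
 have "int (unset_bit k x) = int x - 2 ^ k"
  using b by (simp add: of_nat_unset_bit_eq unset_bit_eq bit_of_nat_iff)
 then have "int (unset_bit k x + 2 ^ k) = int x" by simp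
 then have "unset_bit k x + 2 ^ k = x" by (simp only: of_nat_eq_iff)
 then have "x - 2 ^ k = unset_bit k x" by simp
 then show ?thesis by (auto simp: bit_unset_bit_iff)
qed

lemma not_bit_ge: "x < 2 ^ w ==> w \<le> i ==> \<not> bit (x::nat) i"
 by (metis bit_take_bit_iff not_le take_bit_nat_eq_self)

lemma bit_double_Suc: "bit (Suc (2 * M)) 0" "bit (Suc (2 * M)) (Suc i) \<longleftrightarrow> bit (M::nat) i"
 by (auto simp: bit_Suc bit_0)

text \<open>The last clause is locality seen from the other end: a position \<open>p\<close> with
  \<open>p + R < j\<close> that is still missing could no longer be placed within distance
  \<open>R\<close>.\<close>

definition rloc :: "nat => nat => nat => (nat => nat) => bool" where
 "rloc m R j xs \<longleftrightarrow> inj_on xs {..<j} & (\<forall>i<j. xs i < m & xs i \<le> i + R & i \<le> xs i + R) &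
  (\<forall>p<m. p + R < j --> p \<in> xs ` {..<j})"

text \<open>Position \<open>p\<close> is represented by \<open>p + R\<close>; the numbers below \<open>R\<close> count as occupied from the start.\<close>

definition occ :: "nat => nat => (nat => nat) => nat => bool" where
 "occ R j xs p \<longleftrightarrow> p < R \<or> p - R \<in> xs ` {..<j}"

text \<open>The state of the dynamic program. In the shifted numbering, locality forces positions
  below \<open>j\<close> to be occupied and those from \<open>j + 2*R\<close> on to be free, so
  \<open>2*R\<close> bits describe the occupied set.\<close>

definition code :: "nat => nat => (nat => nat) => nat" where
 "code R j xs = bmask (%k. occ R j xs (j + k)) (2 * R)"

text \<open>A pair is counted when its earlier item is placed, against everything still unplaced.
  The increment depends on the occupied set and the new item, not on the arrangement of the items
  placed before.\<close>

definition pscore :: "nat => (nat => nat => real) => nat => (nat => nat) => real" where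
 "pscore m W j xs = (\<Sum>i<j. \<Sum>p<m. if p \<in> xs ` {..i} then 0 else W (xs i) p)"

text \<open>\<open>M\<close> is the code after place \<open>j\<close> is filled. Shifted position
  \<open>j\<close> is occupied by then, so \<open>2 * M + 1\<close> describes the same set by a
  window of \<open>2*R + 1\<close> bits that starts at \<open>j\<close>.\<close>

definition placed :: "nat => nat => nat => nat => bool" where
 "placed R j M p \<longleftrightarrow> p + R < j \<or> p + R \<le> j + 2 * R & bit (2 * M + 1) (p + R - j)"

definition gain :: "nat => nat => (nat => nat => real) => nat => nat => nat => real" where
 "gain m R W j M k = (\<Sum>p<m. if placed R j M p then 0 else W (j + k - R) p)"

text \<open>If the item placed last occupies bit \<open>k\<close>, clearing this bit must give a
  code of \<open>2*R\<close> bits that is reachable one place earlier: the table is filled by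
  looking backwards from each code.\<close>

definition cand :: "nat => nat => (nat => nat => bool) => nat => nat => nat => bool" where
 "cand m R ok j M k \<longleftrightarrow> k \<le> 2 * R & bit (2 * M + 1) k & R \<le> j + k & j + k < m + R &
  2 * M + 1 - 2 ^ k < 2 ^ (2 * R) & ok j (2 * M + 1 - 2 ^ k)"

text \<open>The recursion for a single entry, separated from the machine: \<open>ok\<close> marks
  the reachable codes, \<open>Vt\<close> holds their best score and \<open>ch\<close> a maximizing
  choice.\<close>

definition dp_row :: "nat => nat => (nat => nat => real) => (nat => nat => bool) => (nat => nat => real) =>
  (nat => nat => nat) => nat => nat => bool" where
 "dp_row m R W ok Vt ch j M \<longleftrightarrow> (ok (Suc j) M \<longleftrightarrow> (\<exists>k. cand m R ok j M k)) &
  (ok (Suc j) M --> cand m R ok j M (ch (Suc j) M) &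
    Vt (Suc j) M = Vt j (2 * M + 1 - 2 ^ ch (Suc j) M) + gain m R W j M (ch (Suc j) M) &
    (\<forall>k. cand m R ok j M k --> Vt j (2 * M + 1 - 2 ^ k) + gain m R W j M k \<le> Vt (Suc j) M))"

primrec tback :: "nat => (nat => nat => nat) => nat => nat => nat => nat" where
 "tback R ch 0 M = (%_. 0)"
| "tback R ch (Suc j) M =
  (tback R ch j (2 * M + 1 - 2 ^ ch (Suc j) M))(j := j + ch (Suc j) M - R)"

section \<open>Soundness and completeness of the recursion\<close>

lemma occ_upper:
 assumes "rloc m R j xs" "occ R j xs p"
 shows "p < j + 2 * R"
proof (cases "p < R")
 case False
 then obtain i where "i < j" "p - R = xs i" using assms(2) by (auto simp: occ_def)
 moreover then have "xs i \<le> i + R" using assms(1) by (auto simp: rloc_def)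
 ultimately show ?thesis using False by linarith
qed simp

lemma occ_lower:
 assumes "rloc m R j xs" "p < j" "j \<le> m"
 shows "occ R j xs p"
proof (cases "p < R")
 case False
 then have "p - R < m" "p - R + R < j" using assms by auto
 then show ?thesis using assms(1) by (auto simp: rloc_def occ_def)
qed (simp add: occ_def)

lemma occ_Suc: "occ R (Suc j) xs p \<longleftrightarrow> occ R j xs p \<or> R \<le> p & p = xs j + R"
 by (auto simp: occ_def lessThan_Suc not_less)

lemma occ_cong: "(\<And>i. i < j ==> xs i = ys i) ==> occ R j xs p = occ R j ys p"
 by (auto simp: occ_def image_iff)

lemma pscore_cong:
 assumes "\<And>i. i < j ==> xs i = ys i"
 shows "pscore m W j xs = pscore m W j ys"
 unfolding pscore_def
proof (rule sum.cong[OF refl])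
 fix i assume "i \<in> {..<j}"
 then have "xs ` {..i} = ys ` {..i}" "xs i = ys i" using assms by (auto intro!: image_cong)
 then show "(\<Sum>p<m. if p \<in> xs ` {..i} then 0 else W (xs i) p) =
   (\<Sum>p<m. if p \<in> ys ` {..i} then 0 else W (ys i) p)" by (simp only:)
qed

lemma gain_eq:
 assumes "rloc m R (Suc j) xs" "2 * code R (Suc j) xs + 1 = F" "Suc j \<le> m" "k = xs j + R - j" "j \<le> xs j + R"
 shows "gain m R W j (code R (Suc j) xs) k = (\<Sum>p<m. if p \<in> xs ` {..j} then 0 else W (xs j) p)"
proof -
 have "placed R j (code R (Suc j) xs) p \<longleftrightarrow> p \<in> xs ` {..j}" if p: "p < m" for p
 proof -
  have o: "p \<in> xs ` {..j} \<longleftrightarrow> occ R (Suc j) xs (p + R)"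
   by (simp add: occ_def lessThan_Suc_atMost)
  consider "p + R < j" | "p + R = j" | i where "p + R = Suc j + i"
   by (metis add_Suc_right add_Suc_shift less_imp_Suc_add linorder_neqE_nat)
  then show ?thesis
  proof cases
   case 1
   then show ?thesis unfolding o placed_def using occ_lower[OF assms(1) _ assms(3), of "p + R"] by simp
  next
   case 2
   then show ?thesis unfolding o placed_def using occ_lower[OF assms(1) _ assms(3), of "p + R"]
    by (simp add: bit_double_Suc)
  next
   case 3
   then have "placed R j (code R (Suc j) xs) p \<longleftrightarrow> Suc i \<le> 2 * R & bit (code R (Suc j) xs) i"
    by (auto simp: placed_def bit_double_Suc)
   also have "... \<longleftrightarrow> i < 2 * R & occ R (Suc j) xs (p + R)" by (auto simp: code_def bit_bmask 3)
   also have "... \<longleftrightarrow> occ R (Suc j) xs (p + R)" using occ_upper[OF assms(1), of "p + R"] 3 by auto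
   finally show ?thesis unfolding o .
  qed
 qed
 moreover have "j + k - R = xs j" using assms by simp
 ultimately show ?thesis unfolding gain_def by (intro sum.cong) auto
qed

text \<open>Removing the item placed last inverts a transition: it clears bit \<open>k\<close> of
  \<open>2 * M + 1\<close>.\<close>

lemma step_down:
 assumes "rloc m R (Suc j) xs" "Suc j \<le> m"
 defines "k \<equiv> xs j + R - j" and "M \<equiv> code R (Suc j) xs"
 shows "rloc m R j xs" "bit (2 * M + 1) k" "k \<le> 2 * R" "R \<le> j + k" "j + k < m + R"
  "2 * M + 1 - 2 ^ k = code R j xs"
proof -
 have loc: "xs j < m" "xs j \<le> j + R" "j \<le> xs j + R" using assms(1) by (auto simp: rloc_def)
 then have jk: "j + k = xs j + R" by (simp add: k_def)
 show "k \<le> 2 * R" "R \<le> j + k" "j + k < m + R" using loc jk by auto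
 have new: "xs j \<notin> xs ` {..<j}"
 proof
  assume "xs j \<in> xs ` {..<j}"
  then obtain i where "i < j" "xs j = xs i" by blast
  moreover have "inj_on xs {..<Suc j}" using assms(1) by (simp add: rloc_def)
  ultimately show False using inj_onD[of xs "{..<Suc j}" j i] by simp
 qed
 show r: "rloc m R j xs"
  unfolding rloc_def
 proof (intro conjI allI impI)
  show "inj_on xs {..<j}" using assms(1) by (auto simp: rloc_def inj_on_def)
  fix p assume p: "p < m" "p + R < j"
  then have "p \<in> xs ` {..<Suc j}" using assms(1) by (simp add: rloc_def)
  moreover have "p ~= xs j" using p loc by auto
  ultimately show "p \<in> xs ` {..<j}" by (auto simp: lessThan_Suc)
 qed (use assms(1) in "auto simp: rloc_def")
 have full: "bit (2 * M + 1) i \<longleftrightarrow> occ R (Suc j) xs (j + i)" for i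
 proof (cases i)
  case 0
  then show ?thesis using occ_lower[OF assms(1) _ assms(2), of j] by (simp add: bit_double_Suc)
 next
  case (Suc i')
  then have "bit (2 * M + 1) i \<longleftrightarrow> i' < 2 * R & occ R (Suc j) xs (Suc j + i')"
   by (simp add: bit_double_Suc M_def code_def bit_bmask)
  also have "... \<longleftrightarrow> occ R (Suc j) xs (Suc j + i')" using occ_upper[OF assms(1), of "Suc j + i'"] by auto
  finally show ?thesis using Suc by simp
 qed
 have bk: "bit (2 * M + 1) k" unfolding full jk by (simp add: occ_Suc)
 then show "bit (2 * M + 1) k" .
 have nk: "\<not> occ R j xs (j + k)" unfolding jk occ_def using new by simp
 show "2 * M + 1 - 2 ^ k = code R j xs"
 proof (rule bit_eqI)
  fix i
  have "bit (2 * M + 1 - 2 ^ k) i \<longleftrightarrow> occ R (Suc j) xs (j + i) & i ~= k"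
   unfolding bit_diff_pow[OF bk] full ..
  also have "... \<longleftrightarrow> occ R j xs (j + i)" unfolding occ_Suc using jk nk by auto
  also have "... \<longleftrightarrow> bit (code R j xs) i"
   using occ_upper[OF r, of "j + i"] by (auto simp: code_def bit_bmask)
  finally show "bit (2 * M + 1 - 2 ^ k) i \<longleftrightarrow> bit (code R j xs) i" .
 qed
qed

text \<open>By induction along the list: each prefix supplies a candidate for the next entry, so the
  entry is at least the score of the prefix.\<close>

lemma dp_complete:
 assumes row: "\<And>j M. j < m ==> M < 2 ^ (2 * R) ==> dp_row m R W ok Vt ch j M"
  and base: "ok 0 (code R 0 (%_. 0))" "0 \<le> Vt 0 (code R 0 (%_. 0))"
 shows "rloc m R j xs ==> j \<le> m ==> ok j (code R j xs) & pscore m W j xs \<le> Vt j (code R j xs)"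
proof (induction j)
 case 0
 have "code R 0 xs = code R 0 (%_. 0)" by (simp add: code_def occ_def)
 then show ?case using base by (simp add: pscore_def)
next
 case (Suc j)
 define k where "k = xs j + R - j"
 define M where "M = code R (Suc j) xs"
 note s = step_down[OF Suc.prems(1,2), folded k_def M_def]
 have Ml: "M < 2 ^ (2 * R)" by (simp add: M_def code_def bmask_less)
 have IH: "ok j (code R j xs)" "pscore m W j xs \<le> Vt j (code R j xs)" using Suc.IH[OF s(1)] Suc.prems by auto
 have c: "cand m R ok j M k"
  unfolding cand_def using s IH by (auto simp: code_def bmask_less)
 have r: "dp_row m R W ok Vt ch j M" using row Suc.prems Ml by simp
 have "j \<le> xs j + R" using Suc.prems by (auto simp: rloc_def)
 then have g: "gain m R W j M k = (\<Sum>p<m. if p \<in> xs ` {..j} then 0 else W (xs j) p)"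
  unfolding M_def by (intro gain_eq[OF Suc.prems(1) refl Suc.prems(2) k_def])
 have "ok (Suc j) M" "Vt j (code R j xs) + gain m R W j M k \<le> Vt (Suc j) M"
  using r c s(6) unfolding dp_row_def by auto
 then show ?case using IH g by (simp add: pscore_def M_def)
qed

text \<open>Conversely, the traceback realizes every reachable entry. The occupied set is recovered
  from the code at each step, and this is what makes the traced list injective.\<close>

lemma dp_sound:
 assumes row: "\<And>j M. j < m ==> M < 2 ^ (2 * R) ==> dp_row m R W ok Vt ch j M"
  and base: "\<And>M. M < 2 ^ (2 * R) ==> ok 0 M ==> M = code R 0 (%_. 0) & Vt 0 M = 0"
 shows "M < 2 ^ (2 * R) ==> ok j M ==> j \<le> m ==>
  rloc m R j (tback R ch j M) & code R j (tback R ch j M) = M & pscore m W j (tback R ch j M) = Vt j M"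
proof (induction j arbitrary: M)
 case 0
 then show ?case using base[of M] by (auto simp: rloc_def pscore_def)
next
 case (Suc j)
 define k where "k = ch (Suc j) M"
 define P where "P = 2 * M + 1 - 2 ^ k"
 define ys where "ys = tback R ch j P"
 define xs where "xs = tback R ch (Suc j) M"
 have xs: "xs = ys(j := j + k - R)" by (simp add: xs_def ys_def P_def k_def)
 have r: "dp_row m R W ok Vt ch j M" using row Suc.prems by simp
 then have c: "cand m R ok j M k" "Vt (Suc j) M = Vt j P + gain m R W j M k"
  using Suc.prems unfolding dp_row_def P_def k_def by auto
 then have k: "k \<le> 2 * R" "bit (2 * M + 1) k" "R \<le> j + k" "j + k < m + R" "P < 2 ^ (2 * R)" "ok j P"
  unfolding cand_def P_def by auto
 have IH: "rloc m R j ys" "code R j ys = P" "pscore m W j ys = Vt j P"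
  using Suc.IH[OF k(5,6)] Suc.prems by (auto simp: ys_def)
 have bP: "bit P i \<longleftrightarrow> bit (2 * M + 1) i & i ~= k" for i
  unfolding P_def by (rule bit_diff_pow[OF k(2)])
 have oP: "bit P i \<longleftrightarrow> occ R j ys (j + i)" for i
  unfolding IH(2)[symmetric] code_def bit_bmask using occ_upper[OF IH(1), of "j + i"] by auto
 have nk: "\<not> occ R j ys (j + k)" using bP[of k] oP[of k] by simp
 have xj: "xs j + R = j + k" "xs j < m" using k by (auto simp: xs)
 have xi: "xs i = ys i" if "i < j" for i using that by (simp add: xs)
 have img: "xs ` {..<j} = ys ` {..<j}" using xi by (intro image_cong) auto
 have new: "xs j \<notin> ys ` {..<j}" using nk unfolding xj(1)[symmetric] occ_def by simp
 have bF: "bit (2 * M + 1) i \<longleftrightarrow> occ R (Suc j) xs (j + i)" for i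
 proof -
  have "occ R (Suc j) xs (j + i) \<longleftrightarrow> occ R j ys (j + i) \<or> i = k"
   unfolding occ_Suc using occ_cong[of j xs ys R "j + i"] xi xj k(3) by auto
  then show ?thesis using bP[of i] oP[of i] k(2) by auto
 qed
 have part: "rloc m R (Suc j) xs"
  unfolding rloc_def
 proof (intro conjI allI impI)
  show "inj_on xs {..<Suc j}"
  proof -
   have "inj_on xs {..<j}" using IH(1) xi by (auto simp: rloc_def inj_on_def)
   then show ?thesis using new img by (simp add: lessThan_Suc)
  qed
  fix i assume "i < Suc j"
  then consider "i < j" | "i = j" by linarith
  then show "xs i < m" "xs i \<le> i + R" "i \<le> xs i + R"
   by (cases; use IH(1) xi xj k in "auto simp: rloc_def")+
 next
  fix p assume p: "p < m" "p + R < Suc j"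
  show "p \<in> xs ` {..<Suc j}"
  proof (cases "p + R = j")
   case True
   have "bit (2 * M + 1) 0" by (simp add: bit_double_Suc)
   then have "occ R (Suc j) xs j" using bF[of 0] by simp
   then show ?thesis using True by (auto simp: occ_def)
  next
   case False
   then have "p \<in> ys ` {..<j}" using p IH(1) by (simp add: rloc_def)
   then have "p \<in> xs ` {..<j}" unfolding img .
   then show ?thesis by auto
  qed
 qed
 have cd: "code R (Suc j) xs = M"
 proof (rule bit_eqI)
  fix i
  have "bit (code R (Suc j) xs) i \<longleftrightarrow> i < 2 * R & bit (2 * M + 1) (Suc i)"
   unfolding code_def bit_bmask bF by simp
  also have "... \<longleftrightarrow> bit M i"
  proof -
   have "i < 2 * R" if "bit M i" using not_bit_ge[OF Suc.prems(1)] that by (meson leI)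
   then show ?thesis by (auto simp: bit_double_Suc)
  qed
  finally show "bit (code R (Suc j) xs) i \<longleftrightarrow> bit M i" .
 qed
 have "gain m R W j (code R (Suc j) xs) k = (\<Sum>p<m. if p \<in> xs ` {..j} then 0 else W (xs j) p)"
  by (rule gain_eq[OF part refl Suc.prems(3)]) (use xj in auto)
 then have "pscore m W (Suc j) xs = Vt (Suc j) M"
  using c(2) IH(3) pscore_cong[of j xs ys m W] xi unfolding cd by (simp add: pscore_def)
 then show ?case unfolding xs_def[symmetric] using part cd by blast
qed

lemma rloc_bij:
 assumes "rloc m R m xs"
 shows "bij_betw xs {..<m} {..<m}"
proof -
 have "inj_on xs {..<m}" "xs ` {..<m} \<subseteq> {..<m}" using assms by (auto simp: rloc_def)
 then show ?thesis by (simp add: bij_betw_def card_image card_subset_eq)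
qed

lemma pscore_full:
 assumes "bij_betw xs {..<m} {..<m}"
 shows "pscore m W m xs = list_score W m xs"
proof -
 have inj: "inj_on xs {..<m}" using assms by (simp add: bij_betw_def)
 have e: "(\<Sum>p<m. if p \<in> xs ` {..i} then 0 else W (xs i) p) = (\<Sum>j\<in>{Suc i..<m}. W (xs i) (xs j))" if "i < m" for i
 proof -
  have "(\<Sum>p<m. if p \<in> xs ` {..i} then 0 else W (xs i) p) =
    (\<Sum>j<m. if xs j \<in> xs ` {..i} then 0 else W (xs i) (xs j))"
   by (rule sum.reindex_bij_betw[OF assms, symmetric])
  also have "... = (\<Sum>j<m. if j \<in> {Suc i..<m} then W (xs i) (xs j) else 0)"
  proof (rule sum.cong[OF refl])
   fix j assume "j \<in> {..<m}"
   then have "xs j \<in> xs ` {..i} \<longleftrightarrow> j \<le> i" using that by (subst inj_on_image_mem_iff[OF inj]) auto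
   then show "(if xs j \<in> xs ` {..i} then 0 else W (xs i) (xs j)) =
     (if j \<in> {Suc i..<m} then W (xs i) (xs j) else 0)" using \<open>j \<in> {..<m}\<close> by auto
  qed
  also have "... = (\<Sum>j\<in>{..<m} \<inter> {Suc i..<m}. W (xs i) (xs j))" by (simp add: sum.inter_restrict)
  also have "{..<m} \<inter> {Suc i..<m} = {Suc i..<m}" by auto
  finally show ?thesis .
 qed
 have "pscore m W m xs = (\<Sum>i<m. \<Sum>j\<in>{Suc i..<m}. W (xs i) (xs j))"
  unfolding pscore_def by (rule sum.cong[OF refl], rule e) simp
 also have "... = list_score W m xs"
  unfolding list_score_def
  by (subst (1 2) sum.Sigma, simp, simp, simp, simp,
    rule sum.reindex_bij_witness[where i = prod.swap and j = prod.swap]) auto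
 finally show ?thesis .
qed

definition rlocal :: "nat => nat => (nat => nat) => bool" where
 "rlocal m R f \<longleftrightarrow> listing m f & (\<forall>i<m. f i \<le> i + R & i \<le> f i + R)"

lemma rlocal_rloc: "rlocal m R f ==> rloc m R m f"
 unfolding rlocal_def rloc_def listing_def using bij_betwE[of f "{..<m}" "{..<m}"]
 by (auto simp: bij_betw_def)

lemma rloc_rlocal: "rloc m R m f ==> rlocal m R f"
 using rloc_bij[of m R f] by (auto simp: rlocal_def rloc_def listing_def)

lemma code_start: "code R 0 xs = 2 ^ R - 1"
proof -
 have "code R 0 xs = bmask (%k. k < R) (2 * R)" by (simp add: code_def occ_def)
 also have "... = 2 ^ R - 1"
 proof (rule bit_eqI)
  show "bit (bmask (%k. k < R) (2 * R)) n \<longleftrightarrow> bit (2 ^ R - 1 :: nat) n" for n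
   unfolding mask_eq_exp_minus_1[symmetric] bit_bmask bit_mask_iff by auto
 qed
 finally show ?thesis .
qed

text \<open>When everything is placed, the window shows \<open>R\<close> occupied bits followed by
  \<open>R\<close> free ones, just as at the start, where the occupied bits are the numbers put in
  front. The first and the last code coincide.\<close>

lemma code_end: "rloc m R m xs ==> code R m xs = 2 ^ R - 1"
proof -
 assume r: "rloc m R m xs"
 have "occ R m xs (m + k) \<longleftrightarrow> k < R" if "k < 2 * R" for k
  using r rloc_bij[OF r] by (auto simp: occ_def bij_betw_def)
 then have "code R m xs = bmask (%k. k < R) (2 * R)"
  unfolding code_def bmask_def by (intro arg_cong[where f = "horner_sum of_bool 2"]) auto
 also have "... = code R 0 xs" by (simp add: code_def occ_def)
 finally show ?thesis by (simp add: code_start)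
qed

lemma dp_optimal:
 assumes row: "\<And>j M. j < m ==> M < 2 ^ (2 * R) ==> dp_row m R W ok Vt ch j M"
  and base: "\<And>M. M < 2 ^ (2 * R) ==> ok 0 M \<longleftrightarrow> M = 2 ^ R - 1" "Vt 0 (2 ^ R - 1) = 0"
 defines "f \<equiv> tback R ch m (2 ^ R - 1)"
 shows "rlocal m R f" "\<And>g. rlocal m R g ==> list_score W m g \<le> list_score W m f" "ok m (2 ^ R - 1)"
proof -
 have less: "(2::nat) ^ R - 1 < 2 ^ (2 * R)"
  using code_start[of R id] bmask_less by (metis code_def)
 have compl: "ok m (2 ^ R - 1) & list_score W m g \<le> Vt m (2 ^ R - 1)" if "rlocal m R g" for g
 proof -
  have r: "rloc m R m g" by (rule rlocal_rloc[OF that])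
  have "ok m (code R m g) & pscore m W m g \<le> Vt m (code R m g)"
   by (rule dp_complete[OF row _ _ r order_refl]) (use base less in "auto simp: code_start")
  then show ?thesis using pscore_full[OF rloc_bij[OF r]] by (simp add: code_end[OF r])
 qed
 have "rlocal m R id" by (auto simp: rlocal_def listing_def bij_betw_id)
 then show ok: "ok m (2 ^ R - 1)" using compl by blast
 have s: "rloc m R m f & code R m f = 2 ^ R - 1 & pscore m W m f = Vt m (2 ^ R - 1)"
  unfolding f_def by (rule dp_sound[OF row _ less ok order_refl]) (use base in "auto simp: code_start")
 then show "rlocal m R f" by (auto intro: rloc_rlocal)
 show "list_score W m g \<le> list_score W m f" if "rlocal m R g" for g
  using compl[OF that] s pscore_full[OF rloc_bij[of m R f]] by simp
qed

section \<open>Optimal orders are local\<close>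

text \<open>The pairs of a window that the list orders against the threshold \<open>k\<close>,
  written in their true orientation. Optimality makes their sum nonpositive by
  \<open>idopt_cut\<close>, bias makes it positive.\<close>

definition cut_pairs :: "(nat => nat) => nat list => nat => (nat \<times> nat) set" where
 "cut_pairs \<rho> xs k =
  (%(i, j). (xs ! i, xs ! j)) ` {(i, j). j < i & i < length xs & k \<le> \<rho> (xs ! j) & \<rho> (xs ! i) < k}"

definition fam1 :: "nat => (nat => nat) => nat => (nat \<times> nat) set set" where
 "fam1 n \<rho> Q = (%(xs, k). cut_pairs \<rho> xs k) `
  ({xs. set xs \<subseteq> {..<n} & length xs = 8*Q & distinct xs} \<times> {..n})"

definition band_of :: "(nat => nat) => nat => nat => nat => nat set" where
 "band_of \<rho> t a b = {c. c < t & a \<le> \<rho> c & \<rho> c < b}"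

definition sdiff :: "nat set => nat set => nat set" where
 "sdiff A B = (A - B) \<union> (B - A)"

definition near_bands :: "nat => (nat => nat) => nat => nat => nat set => nat set set" where
 "near_bands n \<rho> x t U = (%(k, h, D). sdiff D (band_of \<rho> t k h)) `
  ({..n} \<times> {..n} \<times> {D. D \<subseteq> U & card D \<le> 34*x})"

text \<open>A pattern joins every item of \<open>Y\<close> with a set of items standing before it.
  These sets are not chosen freely, which would cost a factor of about n^Q each, but as bands of the
  true order corrected on few items of one common small set: a band of at most 21Q items together
  with \<open>Z\<close>.\<close>

definition fam2 :: "nat => (nat => nat) => nat => nat => nat => nat => (nat \<times> nat) set set" where
 "fam2 n \<rho> Q x t y = (\<Union>a\<in>{..n}. \<Union>b\<in>{b\<in>{..n}. card (band_of \<rho> t a b) \<le> 21*Q}.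
  \<Union>Z\<in>{Z. Z \<subseteq> {..<n} & card Z \<le> 26*y}. \<Union>Y\<in>{Y. Y \<subseteq> {..<n} & card Y = y}.
  Sigma Y ` PiE Y (%_. near_bands n \<rho> x t (band_of \<rho> t a b \<union> Z)))"

definition upos :: "(nat => nat => real) => (nat \<times> nat) set => bool" where
 "upos q F \<longleftrightarrow> 0 < (\<Sum>(a, b)\<in>F. q a b)"

text \<open>The counterpart of \<open>distinct_pairs\<close> for sets: no two of the oriented pairs
  have the same two items.\<close>

definition opairs :: "nat => (nat \<times> nat) set => bool" where
 "opairs n F \<longleftrightarrow> F \<subseteq> {..<n} \<times> {..<n} & (\<forall>(a, b)\<in>F. a ~= b & (b, a) \<notin> F)"

definition mostly :: "(nat => nat) => (nat \<times> nat) set => bool" where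
 "mostly \<rho> F \<longleftrightarrow> 3 * card {(a, b)\<in>F. \<not> \<rho> a < \<rho> b} \<le> card F"

definition good1 :: "nat => (nat => nat) => (nat => nat => real) => nat => nat => bool" where
 "good1 n \<rho> q Q x \<longleftrightarrow> (\<forall>F\<in>fam1 n \<rho> Q. opairs n F --> mostly \<rho> F --> x\<^sup>2 \<le> card F --> card F \<le> 64 * Q\<^sup>2 --> upos q F)"

text \<open>All prefixes \<open>t\<close> occur, because the bands consist of items below
  \<open>t\<close> and every stage considers another prefix. The upper bounds on
  \<open>card F\<close> keep within the \<open>n\<close> pairs to which condition (a) is
  limited.\<close>

definition good2 :: "nat => (nat => nat) => (nat => nat => real) => nat => nat => bool" where
 "good2 n \<rho> q Q x \<longleftrightarrow> (\<forall>t\<le>n. \<forall>y<x. 0 < y --> (\<forall>F\<in>fam2 n \<rho> Q x t y.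
  opairs n F --> mostly \<rho> F --> y * Q \<le> card F --> card F \<le> 2 * y * Q --> upos q F))"

definition rev_order :: "nat => (nat => nat) => nat => nat" where
 "rev_order n \<rho> a = n - 1 - \<rho> a"

text \<open>The threshold cut of an optimal list has a nonpositive sum, so it has fewer than x^2
  pairs. As many values are misplaced on the right of the cut as on the left, and each left one
  forms a pair with each right one; hence the square of their number is below x^2.\<close>

lemma near_if_good1:
 assumes g: "good1 n \<rho> q Q x" and best: "best_listing q t L" and t: "t \<le> n"
  and anti: "antisym_on_lt n q" and x: "0 < x" and \<rho>: "\<And>a. a < n ==> \<rho> a < n"
  and u: "u + 8*Q \<le> t"
 shows "card {p \<in> {u..<u + card {p \<in> {u..<u + 8*Q}. \<rho> (L p) < k}}. k \<le> \<rho> (L p)} < x"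
proof (cases "k \<le> n")
 \<comment> \<open>No value reaches a threshold above \<open>n\<close>, and the family ranges over
   thresholds up to \<open>n\<close> only.\<close>
 case False
 have "\<rho> (L p) < n" if "p < t" for p
 proof -
  have "bij_betw L {..<t} {..<t}" using best by (simp add: best_listing_def listing_def)
  then have "L p < t" using bij_betwE that by fastforce
  then show ?thesis using \<rho> t by simp
 qed
 moreover have "card {p \<in> {u..<u + 8*Q}. \<rho> (L p) < k} \<le> 8*Q"
  by (rule order_trans[OF card_mono[of "{u..<u + 8*Q}"]]) auto
 ultimately have "\<not> k \<le> \<rho> (L p)" if "p \<in> {u..<u + card {p \<in> {u..<u + 8*Q}. \<rho> (L p) < k}}" for p
 proof -
  have "p < t" using that u \<open>card _ \<le> 8*Q\<close> by simp
  then show ?thesis using False \<open>\<And>p. p < t ==> \<rho> (L p) < n\<close> by fastforce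
 qed
 then have "{p \<in> {u..<u + card {p \<in> {u..<u + 8*Q}. \<rho> (L p) < k}}. k \<le> \<rho> (L p)} = {}"
  by blast
 then show ?thesis using x by (simp only: card.empty)
next
 case True
 define s where "s = card {p \<in> {u..<u + 8*Q}. \<rho> (L p) < k}"
 define xs where "xs = map L [u..<u + 8*Q]"
 have bij: "bij_betw L {..<t} {..<t}" using best by (simp add: best_listing_def listing_def)
 then have injL: "inj_on L {..<t}" and Lt: "\<And>p. p < t ==> L p < t" by (auto simp: bij_betw_def)
 have len: "length xs = 8*Q" by (simp add: xs_def)
 have nth: "xs ! i = L (u + i)" if "i < 8*Q" for i using that by (simp add: xs_def)
 have dist: "distinct xs" unfolding xs_def distinct_map
  using u by (auto intro: inj_on_subset[OF injL])
 have "L p < n" if "p < u + 8*Q" for p using Lt[of p] that u t by simp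
 then have setxs: "set xs \<subseteq> {..<n}" by (auto simp: xs_def)
 let ?I = "{(i, j). j < i & i < length xs & k \<le> \<rho> (xs ! j) & \<rho> (xs ! i) < k}"
 let ?F = "cut_pairs \<rho> xs k"
 have finI: "finite ?I" by (rule finite_subset[of _ "{..<length xs} \<times> {..<length xs}"]) auto
 have injI: "inj_on (%(i, j). (xs ! i, xs ! j)) ?I"
  using dist by (auto simp: inj_on_def nth_eq_iff_index_eq)
 have cardF: "card ?F = card ?I" unfolding cut_pairs_def by (rule card_image[OF injI])
 have fam: "?F \<in> fam1 n \<rho> Q" unfolding fam1_def using True setxs len dist by (force intro!: image_eqI[of _ _ "(xs, k)"])
 have op: "opairs n ?F"
 proof -
  have "xs ! i < n" if "i < length xs" for i using nth_mem[OF that] setxs by auto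
  then show ?thesis unfolding opairs_def cut_pairs_def by auto
 qed
 have mo: "mostly \<rho> ?F"
 proof -
  have "{(a, b)\<in>?F. \<not> \<rho> a < \<rho> b} = {}" by (auto simp: cut_pairs_def)
  then show ?thesis by (simp only: mostly_def card.empty)
 qed
 have le: "card ?F \<le> 64 * Q\<^sup>2"
 proof -
  have "card ?I \<le> card ({..<8*Q} \<times> {..<8*Q})" using len by (intro card_mono) auto
  then show ?thesis using cardF by (simp add: power2_eq_square)
 qed
 have "(\<Sum>(a, b)\<in>?F. q a b) = (\<Sum>(i, j)\<in>?I. q (xs ! i) (xs ! j))"
  unfolding cut_pairs_def by (subst sum.reindex[OF injI]) (auto intro!: sum.cong)
 also have "... = (\<Sum>(i, j) \<in> {(i, j). u \<le> j & j < i & i < u + 8*Q & j \<in> {p. k \<le> \<rho> (L p)} & i \<notin> {p. k \<le> \<rho> (L p)}}. q (L i) (L j))"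
  by (rule sum.reindex_bij_witness[where j = "%(i, j). (u + i, u + j)" and i = "%(i, j). (i - u, j - u)"])
   (auto simp: len nth not_le)
 also have "... \<le> 0"
 proof (rule idopt_cut[where w = "%i j. q (L i) (L j)"])
  show "antisym_on_lt t (%i j. q (L i) (L j))"
   using anti Lt t unfolding antisym_on_lt_def by (meson order_less_le_trans)
  show "idopt t (%i j. q (L i) (L j))" by (rule best_listing_idopt[OF best])
 qed (use u in auto)
 finally have "\<not> upos q ?F" by (simp add: upos_def)
 then have "\<not> x\<^sup>2 \<le> card ?F" using g fam op mo le unfolding good1_def by blast
 then have "card ?I < x\<^sup>2" unfolding cardF by simp
 define A where "A = {p \<in> {u..<u + s}. k \<le> \<rho> (L p)}"
 define B where "B = {p \<in> {u + s..<u + 8*Q}. \<rho> (L p) < k}"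
 have s8: "s \<le> 8*Q"
  unfolding s_def by (rule order_trans[OF card_mono[of "{u..<u + 8*Q}"]]) auto
 have "card A + card {p \<in> {u..<u + s}. \<rho> (L p) < k} = s"
 proof -
  have "{u..<u + s} = A \<union> {p \<in> {u..<u + s}. \<rho> (L p) < k}" by (auto simp: A_def)
  then have "card {u..<u + s} = card (A \<union> {p \<in> {u..<u + s}. \<rho> (L p) < k})" by (rule arg_cong)
  then show ?thesis by (subst (asm) card_Un_disjoint) (auto simp: A_def)
 qed
 moreover have "card B + card {p \<in> {u..<u + s}. \<rho> (L p) < k} = s"
 proof -
  have "{p \<in> {u..<u + 8*Q}. \<rho> (L p) < k} = B \<union> {p \<in> {u..<u + s}. \<rho> (L p) < k}"
   using s8 by (auto simp: B_def)
  then have "s = card (B \<union> {p \<in> {u..<u + s}. \<rho> (L p) < k})" by (simp only: s_def)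
  then show ?thesis by (subst (asm) card_Un_disjoint) (auto simp: B_def)
 qed
 ultimately have AB: "card B = card A" by simp
 have im: "(%(i, j). (i - u, j - u)) ` (B \<times> A) \<subseteq> ?I"
  by (auto simp: A_def B_def len nth)
 have "inj_on (%(i, j). (i - u, j - u)) (B \<times> A)"
  by (auto simp: inj_on_def A_def B_def)
 then have "card (B \<times> A) \<le> card ?I" by (rule card_inj_on_le[OF _ im finI])
 then have "(card A)\<^sup>2 < x\<^sup>2" using AB \<open>card ?I < x\<^sup>2\<close> by (simp add: card_cartesian_product power2_eq_square)
 then have "card A < x" using power_less_imp_less_base by blast
 then show ?thesis by (simp add: A_def s_def)
qed

text \<open>Moving any \<open>p\<close> of \<open>Y\<close> to place \<open>u\<close> cannot improve
  an optimal list, so the pairs between \<open>Y\<close> and the stretches from \<open>u\<close> to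
  \<open>p\<close> have a nonpositive sum. They belong to \<open>fam2\<close> and at least two
  thirds of them are oriented truly, so \<open>good2\<close> would make the sum positive.\<close>

lemma rstruct_bad_family:
 assumes rs: "rstruct t Q x (%p. \<rho> (L p))" and lst: "listing t L" and t: "t \<le> n"
  and \<rho>: "\<And>a. a < n ==> \<rho> a < n"
  and moves: "\<And>u p. u \<le> p ==> p < t ==> (\<Sum>b\<in>{u..<p}. q (L p) (L b)) \<le> 0"
  and anti: "inj_on \<rho> {..<n}"
 shows "\<not> good2 n \<rho> q Q x"
proof
 assume g: "good2 n \<rho> q Q x"
 obtain u Y Z a b k h where
  Y: "Y \<subseteq> {..<t}" "Y ~= {}" "card Y < x" and Z: "Z \<subseteq> {..<t}" "card Z \<le> 26 * card Y" and
  ab: "card {c. c < t & a \<le> \<rho> (L c) & \<rho> (L c) < b} \<le> 21*Q" and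
  P: "\<And>p. p \<in> Y ==> u + Q \<le> p & p < u + 2*Q & 3 * card {c \<in> {u..<p}. \<rho> (L c) < \<rho> (L p)} \<le> p - u" and
  D: "\<And>p. p \<in> Y ==> (let I = {c. c < t & k \<le> \<rho> (L c) & \<rho> (L c) < h p}; D = ({u..<p} - I) \<union> (I - {u..<p}) in
    D \<subseteq> {c. c < t & a \<le> \<rho> (L c) & \<rho> (L c) < b} \<union> Z & card D \<le> 34*x)"
  using rs unfolding rstruct_def by blast
 have bij: "bij_betw L {..<t} {..<t}" using lst by (simp add: listing_def)
 then have injL: "inj_on L {..<t}" and Lt: "\<And>p. p < t ==> L p < t" by (auto simp: bij_betw_def)
 have \<rho>n: "\<rho> (L p) < n" if "p < t" for p using Lt[OF that] \<rho> t by simp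
 \<comment> \<open>Thresholds beyond \<open>n\<close> are lowered to \<open>n\<close>, so that they
   come from the finite range of the family.\<close>
 have band: "L ` {c. c < t & a \<le> \<rho> (L c) & \<rho> (L c) < b} = band_of \<rho> t (min a n) (min b n)" for a b
 proof (intro equalityI subsetI)
  fix c assume "c \<in> L ` {c. c < t & a \<le> \<rho> (L c) & \<rho> (L c) < b}"
  then show "c \<in> band_of \<rho> t (min a n) (min b n)" using Lt \<rho>n by (auto simp: band_of_def)
 next
  fix c assume c: "c \<in> band_of \<rho> t (min a n) (min b n)"
  then obtain p where "p < t" "c = L p"
   using bij_betw_imp_surj_on[OF bij] by (auto simp: band_of_def)
  then show "c \<in> L ` {c. c < t & a \<le> \<rho> (L c) & \<rho> (L c) < b}"
   using c \<rho>n[of p] by (auto simp: band_of_def)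
 qed
 have Yt: "p < t" if "p \<in> Y" for p using that Y by auto
 define inv where "inv = the_inv_into {..<t} L"
 have inv: "inv (L p) = p" if "p < t" for p
  unfolding inv_def using the_inv_into_f_f[OF injL] that by simp
 define G where "G = (\<lambda>c\<in>L ` Y. L ` {u..<inv c})"
 let ?y = "card Y" and ?F = "Sigma (L ` Y) G"
 have finY: "finite Y" using Y finite_subset by blast
 have injY: "inj_on L Y" by (rule inj_on_subset[OF injL Y(1)])
 have Gp: "G (L p) = L ` {u..<p}" if "p \<in> Y" for p using that inv[OF Yt] by (simp add: G_def)
 have GpE: "G \<in> PiE (L ` Y) (%_. near_bands n \<rho> x t (band_of \<rho> t (min a n) (min b n) \<union> L ` Z))"
 proof (rule PiE_I)
  fix c assume "c \<in> L ` Y"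
  then obtain p where p: "p \<in> Y" "c = L p" by blast
  let ?I = "{c. c < t & k \<le> \<rho> (L c) & \<rho> (L c) < h p}"
  let ?D = "({u..<p} - ?I) \<union> (?I - {u..<p})"
  have d: "?D \<subseteq> {c. c < t & a \<le> \<rho> (L c) & \<rho> (L c) < b} \<union> Z" "card ?D \<le> 34*x"
   using D[OF p(1)] by (auto simp: Let_def)
  have sub: "?I \<subseteq> {..<t}" "{u..<p} \<subseteq> {..<t}" using Yt[OF p(1)] by auto
  have "L ` ?D = sdiff (L ` {u..<p}) (L ` ?I)"
  proof -
   have "L ` ({u..<p} - ?I) = L ` {u..<p} - L ` ?I"
    by (rule inj_on_image_set_diff[OF injL]) (use sub in blast)+
   moreover have "L ` (?I - {u..<p}) = L ` ?I - L ` {u..<p}"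
    by (rule inj_on_image_set_diff[OF injL]) (use sub in blast)+
   ultimately show ?thesis by (simp only: sdiff_def image_Un)
  qed
  \<comment> \<open>Taking the symmetric difference with a fixed set is an involution, which
    recovers the stretch from the correction and the band.\<close>
  then have "sdiff (L ` ?D) (L ` ?I) = L ` {u..<p}" by (auto simp: sdiff_def)
  then have "G c = sdiff (L ` ?D) (band_of \<rho> t (min k n) (min (h p) n))"
   unfolding p(2) Gp[OF p(1)] band by simp
  moreover have "L ` ?D \<subseteq> band_of \<rho> t (min a n) (min b n) \<union> L ` Z"
   unfolding band[symmetric] image_Un[symmetric] by (rule image_mono[OF d(1)])
  moreover have "card (L ` ?D) \<le> 34*x"
   by (rule order_trans[OF card_image_le d(2)]) (use sub in "auto intro: finite_subset")
  ultimately show "G c \<in> near_bands n \<rho> x t (band_of \<rho> t (min a n) (min b n) \<union> L ` Z)"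
   unfolding near_bands_def by (force intro!: image_eqI[of _ _ "(min k n, min (h p) n, L ` ?D)"])
 qed (simp add: G_def)
 have cab: "card (band_of \<rho> t (min a n) (min b n)) \<le> 21*Q"
  unfolding band[symmetric] by (rule order_trans[OF card_image_le ab]) simp
 have cZ: "card (L ` Z) \<le> 26 * ?y"
  by (rule order_trans[OF card_image_le Z(2)]) (use Z finite_subset in blast)
 have sub: "L ` Z \<subseteq> {..<n}" "L ` Y \<subseteq> {..<n}" using Lt Y Z t by fastforce+
 have fam: "?F \<in> fam2 n \<rho> Q x t ?y"
  unfolding fam2_def
  apply (rule UN_I[of "min a n"], simp)
  apply (rule UN_I[of "min b n"], use cab in simp)
  apply (rule UN_I[of "L ` Z"], use cZ sub in simp)
  apply (rule UN_I[of "L ` Y"], use sub card_image[OF injY] in simp)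
  apply (rule imageI[OF GpE])
  done
 have cG: "card (G (L p)) = p - u" if "p \<in> Y" for p
  unfolding Gp[OF that] using card_image[OF inj_on_subset[OF injL, of "{u..<p}"]] Yt[OF that] by force
 have finG: "\<forall>c\<in>L ` Y. finite (G c)" using Gp by auto
 have cF: "card ?F = (\<Sum>p\<in>Y. p - u)"
  using card_SigmaI[OF _ finG] finY cG by (simp add: sum.reindex[OF injY])
 have lo: "?y * Q \<le> card ?F" unfolding cF
  using sum_bounded_below[of Y Q "%p. p - u"] P by fastforce
 have hi: "card ?F \<le> 2 * ?y * Q" unfolding cF
  using sum_bounded_above[of Y "%p. p - u" "2 * Q"] P by fastforce
 have mo: "mostly \<rho> ?F"
 proof -
  have "{(c, d)\<in>?F. \<not> \<rho> c < \<rho> d} = Sigma (L ` Y) (%c. {d \<in> G c. \<not> \<rho> c < \<rho> d})" by auto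
  then have "card {(c, d)\<in>?F. \<not> \<rho> c < \<rho> d} = (\<Sum>p\<in>Y. card {d \<in> G (L p). \<not> \<rho> (L p) < \<rho> d})"
   using card_SigmaI[of "L ` Y" "%c. {d \<in> G c. \<not> \<rho> c < \<rho> d}"] finG finY by (simp add: sum.reindex[OF injY])
  also have "3 * ... \<le> (\<Sum>p\<in>Y. p - u)"
   unfolding sum_distrib_left
  proof (rule sum_mono)
   fix p assume p: "p \<in> Y"
   have "{d \<in> G (L p). \<not> \<rho> (L p) < \<rho> d} = L ` {c \<in> {u..<p}. \<rho> (L c) < \<rho> (L p)}"
   proof -
    have "\<rho> (L c) ~= \<rho> (L p)" if "c \<in> {u..<p}" for c
    proof
     have ct: "c < t" "c < p" using that Yt[OF p] by auto
     assume "\<rho> (L c) = \<rho> (L p)"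
     then show False using inj_onD[OF anti, of "L c" "L p"] inj_onD[OF injL, of c p] Lt[OF ct(1)] Lt[OF Yt[OF p]] Yt[OF p] ct t by simp
    qed
    then have e: "\<not> \<rho> (L p) < \<rho> (L c) \<longleftrightarrow> \<rho> (L c) < \<rho> (L p)" if "c \<in> {u..<p}" for c
     using that by (meson less_asym linorder_neqE_nat)
    have "{d \<in> L ` {u..<p}. \<not> \<rho> (L p) < \<rho> d} = L ` {c \<in> {u..<p}. \<not> \<rho> (L p) < \<rho> (L c)}" by fast
    also have "{c \<in> {u..<p}. \<not> \<rho> (L p) < \<rho> (L c)} = {c \<in> {u..<p}. \<rho> (L c) < \<rho> (L p)}"
     using e by (intro Collect_cong conj_cong refl)
    finally show ?thesis unfolding Gp[OF p] .
   qed
   then have "card {d \<in> G (L p). \<not> \<rho> (L p) < \<rho> d} \<le> card {c \<in> {u..<p}. \<rho> (L c) < \<rho> (L p)}"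
    using card_image_le[of "{c \<in> {u..<p}. \<rho> (L c) < \<rho> (L p)}" L] by simp
   then show "3 * card {d \<in> G (L p). \<not> \<rho> (L p) < \<rho> d} \<le> p - u" using P[OF p] by linarith
  qed
  finally show ?thesis unfolding mostly_def cF .
 qed
 have op: "opairs n ?F"
  unfolding opairs_def
 proof (intro conjI ballI)
  show "?F \<subseteq> {..<n} \<times> {..<n}"
  proof
   fix z assume "z \<in> ?F"
   then obtain p c where "p \<in> Y" "c \<in> {u..<p}" "z = (L p, L c)" using Gp by auto
   then show "z \<in> {..<n} \<times> {..<n}" using Lt[of p] Lt[of c] Yt[of p] t by auto
  qed
 next
  fix z assume "z \<in> ?F"
  then obtain p c where z: "p \<in> Y" "c \<in> {u..<p}" "z = (L p, L c)" using Gp by auto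
  have 1: "c < t" "p < t" "c < p" using z Yt[of p] by auto
  then have "L p ~= L c" using inj_onD[OF injL, of p c] by auto
  moreover have "(L c, L p) \<notin> ?F"
  proof
   assume "(L c, L p) \<in> ?F"
   then obtain p' c' where "p' \<in> Y" "c' \<in> {u..<p'}" "L c = L p'" "L p = L c'" using Gp by auto
   moreover from this have "c = p'" "p = c'"
    using 1 Yt[of p'] inj_onD[OF injL, of c p'] inj_onD[OF injL, of p c'] by auto
   ultimately show False using 1 by auto
  qed
  ultimately show "case z of (a, b) => a ~= b & (b, a) \<notin> ?F" using z by simp
 qed
 have "(\<Sum>(c, d)\<in>?F. q c d) = (\<Sum>c\<in>L ` Y. \<Sum>d\<in>G c. q c d)"
  by (rule sum.Sigma[symmetric]) (use finY finG in auto)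
 also have "... = (\<Sum>p\<in>Y. \<Sum>c\<in>{u..<p}. q (L p) (L c))"
  unfolding sum.reindex[OF injY]
 proof (rule sum.cong[OF refl])
  fix p assume p: "p \<in> Y"
  have "inj_on L {u..<p}" by (rule inj_on_subset[OF injL]) (use Yt[OF p] in auto)
  then show "((%c. \<Sum>d\<in>G c. q c d) \<circ> L) p = (\<Sum>c\<in>{u..<p}. q (L p) (L c))"
   by (simp add: Gp[OF p] sum.reindex)
 qed
 also have "... \<le> 0" by (rule sum_nonpos, rule moves) (use P Yt in fastforce)+
 finally have "\<not> upos q ?F" by (simp add: upos_def)
 moreover have "0 < ?y" using Y(2) finY by (simp add: card_gt_0_iff)
 ultimately show False using g fam op mo lo hi t Y(3) unfolding good2_def by blast
qed

theorem best_listing_sorted: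
 assumes g: "good1 n \<pi> q Q x" "good2 n \<pi> q Q x" "good2 n (rev_order n \<pi>) (%a b. q b a) Q x"
  and best: "best_listing q t L" and t: "t \<le> n"
  and anti: "antisym_on_lt n q" and x: "0 < x" "20 * x \<le> Q" and \<pi>: "\<pi> permutes {..<n}"
 shows "dsorted (12*Q) t (%p. \<pi> (L p))"
proof -
 have \<pi>n: "\<pi> a < n" if "a < n" for a using permutes_in_image[OF \<pi>, of a] that by simp
 have inj\<pi>: "inj_on \<pi> {..<n}" using permutes_inj_on[OF \<pi>] .
 have lst: "listing t L" using best by (simp add: best_listing_def)
 then have bij: "bij_betw L {..<t} {..<t}" by (simp add: listing_def)
 then have injL: "inj_on L {..<t}" and Lt: "\<And>p. p < t ==> L p < t" by (auto simp: bij_betw_def)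
 have inj: "inj_on (%p. \<pi> (L p)) {..<t}"
 proof (rule inj_onI)
  fix p p' assume *: "p \<in> {..<t}" "p' \<in> {..<t}" "\<pi> (L p) = \<pi> (L p')"
  then have "L p = L p'" using inj\<pi> Lt[of p] Lt[of p'] t by (auto dest!: inj_onD)
  then show "p = p'" using * injL by (auto dest: inj_onD)
 qed
 have an: "antisym_on_lt t (%i j. q (L i) (L j))"
  using anti Lt t unfolding antisym_on_lt_def by (meson order_less_le_trans)
 note opt = best_listing_idopt[OF best]
 have "dsorted (12*Q) t (%p. \<pi> (L p)) \<or> rstruct t Q x (%p. \<pi> (L p)) \<or> rstruct t Q x (%p. n - 1 - \<pi> (L (t - 1 - p)))"
  by (rule sorted_or_rstruct[OF inj _ x near_if_good1[OF g(1) best t anti x(1) \<pi>n]])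
   (use \<pi>n less_le_trans[OF Lt t] in auto)
 moreover have "\<not> rstruct t Q x (%p. \<pi> (L p))"
  using rstruct_bad_family[OF _ lst t \<pi>n _ inj\<pi>, of Q x q] idopt_move_left[OF an opt] g(2) by blast
 \<comment> \<open>This is the same structure in the reversed list, for which moves to the right
   become moves to the left and the arguments of \<open>q\<close> are exchanged.\<close>
 moreover have "\<not> rstruct t Q x (%p. n - 1 - \<pi> (L (t - 1 - p)))"
 proof
  assume "rstruct t Q x (%p. n - 1 - \<pi> (L (t - 1 - p)))"
  then have "rstruct t Q x (%p. rev_order n \<pi> (L (t - 1 - p)))" by (simp add: rev_order_def)
  then have "\<not> good2 n (rev_order n \<pi>) (%a b. q b a) Q x"
  proof (rule rstruct_bad_family[OF _ _ t])
   have "bij_betw (%p. t - 1 - p) {..<t} {..<t}"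
    by (rule bij_betw_byWitness[where f' = "%p. t - 1 - p"]) auto
   from bij_betw_trans[OF this bij] show "listing t (%p. L (t - 1 - p))"
    by (simp add: listing_def o_def)
   show "rev_order n \<pi> a < n" if "a < n" for a using that by (simp add: rev_order_def)
   show "inj_on (rev_order n \<pi>) {..<n}"
   proof (rule inj_onI)
    fix a b assume "a \<in> {..<n}" "b \<in> {..<n}" "rev_order n \<pi> a = rev_order n \<pi> b"
    then have "\<pi> a = \<pi> b" using \<pi>n[of a] \<pi>n[of b] by (simp add: rev_order_def)
    then show "a = b" using \<open>a \<in> _\<close> \<open>b \<in> _\<close> inj\<pi> by (auto dest: inj_onD)
   qed
   fix u p assume up: "u \<le> p" "p < t"
   have "(\<Sum>b\<in>{Suc (t - 1 - p)..<t - u}. q (L b) (L (t - 1 - p))) \<le> 0"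
    using idopt_move_right[OF an opt, of "t - 1 - p" "t - u"] up by simp
   also have "(\<Sum>b\<in>{Suc (t - 1 - p)..<t - u}. q (L b) (L (t - 1 - p))) =
     (\<Sum>b\<in>{u..<p}. q (L (t - 1 - b)) (L (t - 1 - p)))"
    by (rule sum.reindex_bij_witness[where i = "%b. t - 1 - b" and j = "%b. t - 1 - b"]) (use up in auto)
   finally show "(\<Sum>b\<in>{u..<p}. q (L (t - 1 - b)) (L (t - 1 - p))) \<le> 0" .
  qed
  then show False using g(3) by blast
 qed
 ultimately show ?thesis by blast
qed

section \<open>Counting\<close>

lemma fam1_card: "finite (fam1 n \<rho> Q)" "card (fam1 n \<rho> Q) \<le> n ^ (8*Q) * (n + 1)"
proof -
 let ?A = "{xs. set xs \<subseteq> {..<n} & length xs = 8*Q & distinct xs}"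
 let ?B = "{xs. set xs \<subseteq> {..<n} & length xs = 8*Q}"
 have finB: "finite ?B" by (rule finite_lists_length_eq) simp
 have sub: "?A \<subseteq> ?B" by auto
 have finA: "finite ?A" by (rule finite_subset[OF sub finB])
 then show "finite (fam1 n \<rho> Q)" unfolding fam1_def by simp
 have "card (fam1 n \<rho> Q) \<le> card (?A \<times> {..n})" unfolding fam1_def
  by (rule card_image_le) (use finA in simp)
 also have "... = card ?A * (n + 1)" by (simp add: card_cartesian_product)
 also have "... \<le> card ?B * (n + 1)" by (rule mult_le_mono1[OF card_mono[OF finB sub]])
 also have "card ?B = n ^ (8*Q)" using card_lists_length_eq[of "{..<n}" "8*Q"] by simp
 finally show "card (fam1 n \<rho> Q) \<le> n ^ (8*Q) * (n + 1)" .
qed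

text \<open>Expand \<open>(1 + z) ^ card U\<close> over all subsets and keep the small ones, each of
  which contributes at least \<open>z ^ d\<close>.\<close>

lemma card_small_subsets:
 fixes z :: real
 assumes "finite U" "0 < z" "z \<le> 1"
 shows "real (card {D. D \<subseteq> U & card D \<le> d}) * z ^ d \<le> (1 + z) ^ card U"
proof -
 have "(1 + z) ^ card U = (\<Prod>x\<in>U. z + 1)" by (simp add: add.commute)
 also have "... = (\<Sum>X\<in>Pow U. (\<Prod>x\<in>X. z) * (\<Prod>x\<in>U - X. 1))" by (rule prod_add[OF assms(1)])
 also have "... = (\<Sum>X\<in>Pow U. z ^ card X)" by simp
 also have "... \<ge> (\<Sum>X\<in>{D. D \<subseteq> U & card D \<le> d}. z ^ card X)"
  by (rule sum_mono2) (use assms in auto)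
 also have "(\<Sum>X\<in>{D. D \<subseteq> U & card D \<le> d}. z ^ card X) \<ge> (\<Sum>X\<in>{D. D \<subseteq> U & card D \<le> d}. z ^ d)"
  by (rule sum_mono) (use assms in "auto intro: power_decreasing")
 finally show ?thesis by simp
qed

lemma one_plus_le_powr: "0 \<le> z ==> 1 + z \<le> 2 powr (2 * z)" for z :: real
proof -
 assume z: "0 \<le> z"
 have "1 + z \<le> exp z" by (rule exp_ge_add_one_self)
 also have "exp z \<le> exp (2 * z * ln 2)"
  using z mult_left_mono[of "1/2" "ln (2::real)" "2 * z"] ln2_ge_two_thirds by simp
 also have "... = 2 powr (2 * z)" by (simp add: powr_def)
 finally show ?thesis .
qed

text \<open>The choice z = 2^(-h). The parameter \<open>h\<close> balances \<open>h\<close> bits per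
  chosen item against 2 * 2^(-h) bits per element of the ground set; with \<open>h\<close> about log
  (1/\<gamma>) both fit under \<gamma> Q.\<close>

lemma card_small_subsets_pow2:
 assumes "finite U" "card U \<le> N"
 shows "real (card {D. D \<subseteq> U & card D \<le> d}) \<le> 2 powr (2 * real N / 2 ^ h + real (h * d))"
proof -
 let ?z = "1 / 2 ^ h :: real"
 have z: "0 < ?z" "?z \<le> 1" by auto
 have "real (card {D. D \<subseteq> U & card D \<le> d}) * ?z ^ d \<le> (1 + ?z) ^ card U"
  by (rule card_small_subsets[OF assms(1) z])
 also have "... \<le> (1 + ?z) ^ N" by (rule power_increasing[OF assms(2)]) simp
 also have "... \<le> (2 powr (2 * ?z)) ^ N" by (intro power_mono one_plus_le_powr) auto
 also have "... = 2 powr (2 * real N / 2 ^ h)" by (simp add: powr_power algebra_simps)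
 finally have "real (card {D. D \<subseteq> U & card D \<le> d}) * ?z ^ d * 2 ^ (h * d) \<le> 2 powr (2 * real N / 2 ^ h) * 2 ^ (h * d)"
  by (rule mult_right_mono) simp
 moreover have "?z ^ d * 2 ^ (h * d) = 1" by (simp add: power_divide power_mult)
 ultimately have "real (card {D. D \<subseteq> U & card D \<le> d}) \<le> 2 powr (2 * real N / 2 ^ h) * 2 ^ (h * d)"
  by (simp only: mult.assoc mult_1_right)
 then show ?thesis by (simp add: powr_add powr_realpow del: of_nat_mult)
qed

text \<open>The choice z = 1/(n + 1), with e <= 3.\<close>

lemma card_small_subsets_n:
 assumes "1 \<le> n"
 shows "real (card {D. D \<subseteq> {..<n} & card D \<le> d}) \<le> 3 * real (n + 1) ^ d"
proof -
 let ?z = "1 / real (n + 1)"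
 have "real (card {D. D \<subseteq> {..<n} & card D \<le> d}) * ?z ^ d \<le> (1 + ?z) ^ card {..<n}"
  by (rule card_small_subsets) auto
 also have "... \<le> exp ?z ^ n" by (simp, intro power_mono exp_ge_add_one_self) auto
 also have "... = exp (real n * ?z)" by (rule exp_of_nat_mult[symmetric])
 also have "... \<le> exp 1" by (simp add: field_simps)
 also have "... \<le> 3" by (rule exp_le)
 finally show ?thesis by (simp add: power_divide field_simps)
qed

lemma near_bands_card:
 assumes "finite U" "real (card {D. D \<subseteq> U & card D \<le> 34*x}) \<le> N"
 shows "finite (near_bands n \<rho> x t U)" "real (card (near_bands n \<rho> x t U)) \<le> real (n + 1) ^ 2 * N"
proof -
 let ?S = "{D. D \<subseteq> U & card D \<le> 34*x}"
 have fin: "finite ?S" by (rule finite_subset[of _ "Pow U"]) (use assms in auto)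
 then show "finite (near_bands n \<rho> x t U)" unfolding near_bands_def by simp
 have "card (near_bands n \<rho> x t U) \<le> card ({..n} \<times> {..n} \<times> ?S)"
  unfolding near_bands_def by (rule card_image_le) (use fin in simp)
 also have "... = (n + 1)^2 * card ?S" by (simp add: card_cartesian_product power2_eq_square algebra_simps)
 finally have "real (card (near_bands n \<rho> x t U)) \<le> real ((n + 1)^2 * card ?S)" by (simp only: of_nat_le_iff)
 also have "... \<le> real (n + 1) ^ 2 * N" using assms(2) by (simp add: mult_left_mono)
 finally show "real (card (near_bands n \<rho> x t U)) \<le> real (n + 1) ^ 2 * N" .
qed

lemma real_card_UN_le:
 assumes "finite I" "\<And>i. i \<in> I ==> finite (A i) & real (card (A i)) \<le> B" "real (card I) \<le> C" "0 \<le> B"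
 shows "finite (\<Union>i\<in>I. A i) & real (card (\<Union>i\<in>I. A i)) \<le> C * B"
proof
 show "finite (\<Union>i\<in>I. A i)" using assms by auto
 have "real (card (\<Union>i\<in>I. A i)) \<le> real (\<Sum>i\<in>I. card (A i))"
  by (rule of_nat_mono[OF card_UN_le[OF assms(1)]])
 also have "... \<le> (\<Sum>i\<in>I. B)" unfolding of_nat_sum by (rule sum_mono) (use assms in auto)
 also have "... \<le> C * B" using assms(3,4) by (simp add: mult_right_mono)
 finally show "real (card (\<Union>i\<in>I. A i)) \<le> C * B" .
qed

text \<open>The exponent 35 per element of \<open>Y\<close> consists of 26 for \<open>Z\<close>, 1
  for \<open>Y\<close>, 2 for the two ends of its band, and 6 for the common range and the factors 3
  * 3, since 9 (n+1)^2 <= (n+1)^6 and y >= 1. The ground set of the corrections has at most 21Q +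
  26y <= 23Q elements.\<close>

lemma fam2_card:
 assumes n: "1 \<le> n" and y: "0 < y" "y < x" and xQ: "20 * x \<le> Q" and N1: "1 \<le> N"
  and N: "\<And>U :: nat set. finite U ==> card U \<le> 23*Q ==> real (card {D. D \<subseteq> U & card D \<le> 34*x}) \<le> N"
 shows "finite (fam2 n \<rho> Q x t y) & real (card (fam2 n \<rho> Q x t y)) \<le> (real (n + 1) ^ 35 * N) ^ y"
proof -
 let ?n = "real (n + 1)"
 define BB where "BB = (?n ^ 2 * N) ^ y"
 have BB: "0 \<le> BB" using N1 by (simp add: BB_def)
 have inner: "finite (Sigma Y ` PiE Y (%_. near_bands n \<rho> x t (band_of \<rho> t a b \<union> Z))) &
   real (card (Sigma Y ` PiE Y (%_. near_bands n \<rho> x t (band_of \<rho> t a b \<union> Z)))) \<le> BB"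
  if "card (band_of \<rho> t a b) \<le> 21*Q" "Z \<subseteq> {..<n}" "card Z \<le> 26*y" "Y \<subseteq> {..<n}" "card Y = y" for a b Z Y
 proof -
  let ?U = "band_of \<rho> t a b \<union> Z"
  have finU: "finite ?U" using that finite_subset by (auto simp: band_of_def)
  have "card ?U \<le> 21*Q + 26*y" using card_Un_le[of "band_of \<rho> t a b" Z] that by linarith
  then have U23: "card ?U \<le> 23*Q" using y xQ by linarith
  have nb: "finite (near_bands n \<rho> x t ?U)" "real (card (near_bands n \<rho> x t ?U)) \<le> ?n ^ 2 * N"
   using near_bands_card[OF finU N[OF finU U23]] by auto
  have finY: "finite Y" using that finite_subset by blast
  have finP: "finite (PiE Y (%_. near_bands n \<rho> x t ?U))" by (intro finite_PiE finY nb(1))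
  have "card (Sigma Y ` PiE Y (%_. near_bands n \<rho> x t ?U)) \<le> card (PiE Y (%_. near_bands n \<rho> x t ?U))"
   by (rule card_image_le[OF finP])
  also have "... = card (near_bands n \<rho> x t ?U) ^ y" using that by (simp add: card_PiE[OF finY])
  finally have "real (card (Sigma Y ` PiE Y (%_. near_bands n \<rho> x t ?U))) \<le> real (card (near_bands n \<rho> x t ?U)) ^ y"
   by (metis of_nat_le_iff of_nat_power)
  also have "... \<le> BB" unfolding BB_def by (rule power_mono[OF nb(2)]) simp
  finally show ?thesis using finP by simp
 qed
 have small: "finite {D. D \<subseteq> {..<n} & P D}" for P by (rule finite_subset[of _ "Pow {..<n}"]) auto
 have cY: "real (card {Y. Y \<subseteq> {..<n} & card Y = y}) \<le> 3 * ?n ^ y"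
 proof -
  have "card {Y. Y \<subseteq> {..<n} & card Y = y} \<le> card {Y. Y \<subseteq> {..<n} & card Y \<le> y}"
   by (rule card_mono[OF small]) auto
  then show ?thesis using card_small_subsets_n[OF n, of y] by linarith
 qed
 have "finite (fam2 n \<rho> Q x t y) &
   real (card (fam2 n \<rho> Q x t y)) \<le> ?n * (?n * ((3 * ?n ^ (26*y)) * ((3 * ?n ^ y) * BB)))"
  unfolding fam2_def
 proof (intro real_card_UN_le)
  show "real (card {..n}) \<le> ?n" by simp
  show "real (card {b \<in> {..n}. card (band_of \<rho> t a b) \<le> 21 * Q}) \<le> ?n" for a
  proof -
   have "card {b \<in> {..n}. card (band_of \<rho> t a b) \<le> 21 * Q} \<le> card {..n}" by (rule card_mono) auto
   then show ?thesis by simp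
  qed
  show "real (card {Z. Z \<subseteq> {..<n} & card Z \<le> 26 * y}) \<le> 3 * ?n ^ (26 * y)"
   by (rule card_small_subsets_n[OF n])
 qed (use inner cY small BB in auto)
 moreover have "?n * (?n * ((3 * ?n ^ (26*y)) * ((3 * ?n ^ y) * BB))) \<le> (?n ^ 35 * N) ^ y"
 proof -
  have n2: "2 \<le> ?n" using n by simp
  have "?n * (?n * ((3 * ?n ^ (26*y)) * ((3 * ?n ^ y) * BB))) = 9 * ?n ^ 2 * ?n ^ (27 * y) * BB"
   by (simp add: power_add[symmetric] power2_eq_square)
  also have "... = 9 * ?n ^ 2 * ?n ^ (29 * y) * N ^ y"
   by (simp add: BB_def power_mult_distrib power_mult[symmetric] power_add[symmetric])
  also have "9 * ?n ^ 2 \<le> ?n ^ 6"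
  proof -
   have "(9::real) \<le> 2 ^ 4" by simp
   also have "... \<le> ?n ^ 4" by (rule power_mono[OF n2]) simp
   finally have "9 * ?n ^ 2 \<le> ?n ^ 4 * ?n ^ 2" by (rule mult_right_mono) simp
   then show ?thesis by (simp add: power_add[symmetric])
  qed
  also have "?n ^ 6 \<le> ?n ^ (6 * y)" by (rule power_increasing) (use y n2 in auto)
  finally have "?n * (?n * ((3 * ?n ^ (26*y)) * ((3 * ?n ^ y) * BB))) \<le> ?n ^ (6 * y) * ?n ^ (29 * y) * N ^ y"
   using N1 by (simp add: mult_right_mono)
  also have "... = (?n ^ 35 * N) ^ y"
   by (simp add: power_mult_distrib power_mult[symmetric] power_add[symmetric])
  finally show ?thesis .
 qed
 ultimately show ?thesis by linarith
qed

section \<open>The program\<close>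

primrec mv :: "cmd => nat set" where
 "mv Skip = {}" | "mv (Assign i e) = {i}" | "mv (AStore k a e) = {}" | "mv (RAssign i e) = {}"
| "mv (RAStore k a e) = {}" | "mv (Out a e) = {}" | "mv (Insp i a b) = {}"
| "mv (SeqC c1 c2) = mv c1 \<union> mv c2" | "mv (IfC b c1 c2) = mv c1 \<union> mv c2" | "mv (For i e c) = insert i (mv c)"

primrec ma :: "cmd => nat set" where
 "ma Skip = {}" | "ma (Assign i e) = {}" | "ma (AStore k a e) = {k}" | "ma (RAssign i e) = {}"
| "ma (RAStore k a e) = {}" | "ma (Out a e) = {}" | "ma (Insp i a b) = {}"
| "ma (SeqC c1 c2) = ma c1 \<union> ma c2" | "ma (IfC b c1 c2) = ma c1 \<union> ma c2" | "ma (For i e c) = ma c"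

primrec mra :: "cmd => nat set" where
 "mra Skip = {}" | "mra (Assign i e) = {}" | "mra (AStore k a e) = {}" | "mra (RAssign i e) = {}"
| "mra (RAStore k a e) = {k}" | "mra (Out a e) = {}" | "mra (Insp i a b) = {}"
| "mra (SeqC c1 c2) = mra c1 \<union> mra c2" | "mra (IfC b c1 c2) = mra c1 \<union> mra c2" | "mra (For i e c) = mra c"

definition frame :: "cmd => hstate => hstate => bool" where
 "frame c h h' \<longleftrightarrow> (\<forall>i. i \<notin> mv c --> nvar h' i = nvar h i) & (\<forall>k. k \<notin> ma c --> narr h' k = narr h k) &
  (\<forall>k. k \<notin> mra c --> rarr h' k = rarr h k)"

lemma frame_sem: "frame c h (sem q c h)"
proof (induction c arbitrary: h)
 case (SeqC c1 c2)
 show ?case using SeqC[of h] SeqC(2)[of "sem q c1 h"] by (auto simp: frame_def)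
next
 case (IfC b c1 c2)
 show ?case using IfC[of h] by (auto simp: frame_def)
next
 case (For i e c)
 show ?case unfolding sem.simps
  by (rule fold_upt_induct[where I = "%k y. frame (For i e c) h y"])
   (use For in "auto simp: frame_def")
qed (auto simp: frame_def)

lemma frame_nvar: "frame c h h' ==> i \<notin> mv c ==> nvar h' i = nvar h i"
 and frame_narr: "frame c h h' ==> k \<notin> ma c ==> narr h' k = narr h k"
 and frame_rarr: "frame c h h' ==> k \<notin> mra c ==> rarr h' k = rarr h k"
 by (auto simp: frame_def)

lemma sem_nvar: "i \<notin> mv c ==> nvar (sem q c h) i = nvar h i"
 and sem_narr: "k \<notin> ma c ==> narr (sem q c h) k = narr h k"
 and sem_rarr: "k \<notin> mra c ==> rarr (sem q c h) k = rarr h k"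
 using frame_sem[of c h q] by (auto simp: frame_def)

text \<open>The frame condition is available in every round, so that an invariant mentions only what
  the loop changes.\<close>

lemma For_frame_rule:
 assumes "eval e h = N" "N \<le> nvar h 2" "I 0 h"
  "\<And>k h'. k < N ==> I k h' ==> frame (For i e c) h h' ==> I (Suc k) (sem q c (setv i k h'))"
 shows "I N (sem q (For i e c) h)"
proof -
 have "I N (sem q (For i e c) h) & frame (For i e c) h (sem q (For i e c) h)"
 proof (rule For_rule[where I = "%k h'. I k h' & frame (For i e c) h h'", OF assms(1,2)])
  show "I 0 h & frame (For i e c) h h" using assms(3) by (simp add: frame_def)
  fix k h' assume k: "k < N" and *: "I k h' & frame (For i e c) h h'"
  have "frame c (setv i k h') (sem q c (setv i k h'))" by (rule frame_sem)
  then have "frame (For i e c) h (sem q c (setv i k h'))" using * by (auto simp: frame_def)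
  then show "I (Suc k) (sem q c (setv i k h')) & frame (For i e c) h (sem q c (setv i k h'))"
   using assms(4) k * by blast
 qed
 then show ?thesis ..
qed

primrec scal :: "nat => exp => exp" where
 "scal 0 e = Nm 0"
| "scal (Suc k) e = Plus e (scal k e)"

lemma eval_scal [simp]: "eval (scal k e) h = k * eval e h"
 by (induction k) auto

lemma wfe_scal [simp]: "wfe e ==> wfe (scal k e)"
 by (induction k) auto

abbreviation rzero :: rexp where "rzero \<equiv> RMinus (RV 0) (RV 0)"

fun seqs :: "cmd list => cmd" where
 "seqs [] = Skip"
| "seqs [c] = c"
| "seqs (c # cs) = SeqC c (seqs cs)"

text \<open>
 Arrays: \<open>0\<close> the current list, \<open>1\<close> the weights of the cells, \<open>2\<close> the numbers of visits, \<open>3\<close> the list with the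
 new item, \<open>4\<close> the powers of \<open>2\<close>, \<open>5\<close> and \<open>6\<close> reachability and choices of the dynamic program, \<open>7\<close> the bits
 of a mask. Real arrays: \<open>0\<close> the inspected values, \<open>1\<close> the values of the dynamic program.
 Variables: \<open>5\<close> the new item \<open>t\<close>, \<open>10\<close> a cell, \<open>11\<close> the cell length, \<open>13\<close> the number of rounds,
 \<open>14\<close> the radius \<open>R\<close>, \<open>17\<close> half the width of the inspected range, \<open>19\<close> the insertion point,
 \<open>27\<close> the number of masks, \<open>28\<close> the approximate position.
\<close>

definition med :: "nat => cmd" where
 "med a = seqs [Assign 24 (Nm 0), For 6 (Plus (Vr 0) (Nm 2)) (Assign 24 (Plus (Vr 24) (Ar a (Vr 6)))),
  Assign 9 (Nm 0), Assign 10 (Nm 0),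
  For 6 (Plus (Vr 0) (Nm 2)) (IfC (BLess (Vr 24) (Plus (Vr 9) (Vr 9))) Skip
   (SeqC (Assign 9 (Plus (Vr 9) (Ar a (Vr 6)))) (Assign 10 (Vr 6))))]"

definition mul :: "nat => nat => nat => cmd" where
 "mul r i j = SeqC (Assign r (Nm 0)) (For 6 (Vr i) (Assign r (Plus (Vr r) (Vr j))))"

text \<open>Variables 16, 11 and 12 hold x * (T * A), T * A and r * A, so the items asked are those
  of \<open>gcell_test\<close>.\<close>

definition probe :: cmd where
 "probe = seqs [RAssign 1 rzero,
  For 8 (Vr 1) (SeqC (Insp 0 (Vr 5) (Ar 0 (Plus (Plus (Minus (Vr 16) (Vr 11)) (Vr 12)) (Vr 8))))
   (RAssign 1 (RPlus (RV 1) (RV 0)))),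
  IfC (BRLess rzero (RV 1)) (Assign 15 (Nm 1)) (Assign 15 (Nm 0))]"

definition test_cell :: cmd where
 "test_cell = seqs [mul 16 10 11, mul 12 23 1,
  IfC (BLess (Nm 0) (Vr 10)) (IfC (BLess (Vr 5) (Vr 16)) (Assign 15 (Nm 1)) probe) (Assign 15 (Nm 0))]"

definition double :: cmd where
 "double = For 7 (Plus (Vr 0) (Nm 2)) (IfC (BLess (Nm 0) (Vr 15))
  (IfC (BLess (Vr 7) (Vr 10)) (AStore 1 (Vr 7) (Plus (Ar 1 (Vr 7)) (Ar 1 (Vr 7)))) Skip)
  (IfC (BLess (Vr 10) (Vr 7)) (AStore 1 (Vr 7) (Plus (Ar 1 (Vr 7)) (Ar 1 (Vr 7)))) Skip))"

definition search_round :: cmd where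
 "search_round = seqs [med 1, AStore 2 (Vr 10) (Plus (Ar 2 (Vr 10)) (Nm 1)), test_cell, double]"

definition search :: cmd where
 "search = seqs [For 6 (Plus (Vr 0) (Nm 2)) (SeqC (AStore 1 (Vr 6) (Nm 1)) (AStore 2 (Vr 6) (Nm 0))),
  For 23 (Vr 13) search_round, med 2, mul 16 10 11,
  IfC (BLess (Vr 16) (Vr 5)) (Assign 28 (Vr 16)) (Assign 28 (Vr 5))]"

text \<open>Both orientations are stored, the second as the negative of the first: each signal is
  inspected once and the table is antisymmetric by construction.\<close>

definition inspect :: cmd where
 "inspect = For 6 (Vr 5)
  (IfC (BAnd (BNot (BLess (Plus (Vr 6) (Vr 17)) (Vr 28))) (BNot (BLess (Plus (Vr 28) (Vr 17)) (Vr 6))))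
   (seqs [Insp 0 (Vr 5) (Ar 0 (Vr 6)), RAStore 0 (Plus (TCap (Vr 5)) (Ar 0 (Vr 6))) (RV 0),
    RAStore 0 (Plus (TCap (Ar 0 (Vr 6))) (Vr 5)) (RMinus rzero (RV 0))]) Skip)"

definition best_point :: cmd where
 "best_point = For 6 (Plus (Vr 5) (Nm 1)) (seqs [RAssign 1 rzero,
  For 7 (Vr 5) (IfC (BLess (Vr 7) (Vr 6))
   (RAssign 1 (RPlus (RV 1) (RAr 0 (Plus (TCap (Ar 0 (Vr 7))) (Vr 5)))))
   (RAssign 1 (RPlus (RV 1) (RAr 0 (Plus (TCap (Vr 5)) (Ar 0 (Vr 7))))))),
  IfC (BAnd (BLess (Nm 0) (Vr 6)) (BNot (BRLess (RV 2) (RV 1)))) Skip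
   (SeqC (RAssign 2 (RV 1)) (Assign 19 (Vr 6)))])"

definition insert_item :: cmd where
 "insert_item = For 6 (Plus (Vr 5) (Nm 1)) (IfC (BLess (Vr 6) (Vr 19)) (AStore 3 (Vr 6) (Ar 0 (Vr 6)))
  (IfC (BLess (Vr 19) (Vr 6)) (AStore 3 (Vr 6) (Ar 0 (Minus (Vr 6) (Nm 1)))) (AStore 3 (Vr 6) (Vr 5))))"

definition dp_start :: cmd where
 "dp_start = seqs [Assign 20 (Plus (Vr 5) (Nm 1)), For 21 (Vr 27) (AStore 5 (Vr 21) (Nm 0)),
  AStore 5 (Minus (Ar 4 (Vr 14)) (Nm 1)) (Nm 1), RAStore 1 (Minus (Ar 4 (Vr 14)) (Nm 1)) rzero]"

text \<open>The binary expansion from the highest bit down, by comparing with powers of 2 and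
  subtracting them.\<close>

definition dp_bits :: cmd where
 "dp_bits = seqs [Assign 22 (Plus (Plus (Vr 21) (Vr 21)) (Nm 1)), Assign 29 (Vr 22),
  For 6 (Plus (Plus (Vr 14) (Vr 14)) (Nm 1)) (seqs [Assign 8 (Minus (Plus (Vr 14) (Vr 14)) (Vr 6)),
   IfC (BLess (Vr 29) (Ar 4 (Vr 8))) (AStore 7 (Vr 8) (Nm 0))
    (SeqC (AStore 7 (Vr 8) (Nm 1)) (Assign 29 (Minus (Vr 29) (Ar 4 (Vr 8)))))])]"

definition dp_gain :: cmd where
 "dp_gain = For 6 (Vr 20) (IfC (BLess (Plus (Vr 6) (Vr 14)) (Vr 7)) Skip
  (IfC (BAnd (BNot (BLess (Plus (Vr 7) (Plus (Vr 14) (Vr 14))) (Plus (Vr 6) (Vr 14))))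
    (BLess (Nm 0) (Ar 7 (Minus (Plus (Vr 6) (Vr 14)) (Vr 7))))) Skip
   (RAssign 1 (RPlus (RV 1) (RAr 0 (Plus (TCap (Ar 3 (Minus (Plus (Vr 7) (Vr 8)) (Vr 14)))) (Ar 3 (Vr 6))))))))"

definition row_next :: exp where "row_next = Plus (TCap (Plus (Vr 7) (Nm 1))) (Vr 21)"

definition dp_try :: cmd where
 "dp_try = seqs [Assign 25 (Minus (Vr 22) (Ar 4 (Vr 8))),
  IfC (BAnd (BLess (Nm 0) (Ar 7 (Vr 8))) (BAnd (BNot (BLess (Plus (Vr 7) (Vr 8)) (Vr 14)))
    (BAnd (BLess (Plus (Vr 7) (Vr 8)) (Plus (Vr 20) (Vr 14))) (BAnd (BLess (Vr 25) (Vr 27))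
     (BLess (Nm 0) (Ar 5 (Plus (TCap (Vr 7)) (Vr 25))))))))
   (seqs [RAssign 1 (RAr 1 (Plus (TCap (Vr 7)) (Vr 25))), dp_gain,
    IfC (BAnd (BLess (Nm 0) (Ar 5 row_next)) (BNot (BRLess (RAr 1 row_next) (RV 1)))) Skip
     (seqs [RAStore 1 row_next (RV 1), AStore 6 row_next (Vr 8), AStore 5 row_next (Nm 1)])]) Skip]"

definition dp_cell :: cmd where
 "dp_cell = seqs [dp_bits, AStore 5 row_next (Nm 0), For 8 (Plus (Plus (Vr 14) (Vr 14)) (Nm 1)) dp_try]"

definition dp_trace :: cmd where
 "dp_trace = seqs [Assign 21 (Minus (Ar 4 (Vr 14)) (Nm 1)),
  For 6 (Vr 20) (seqs [Assign 7 (Minus (Minus (Vr 20) (Nm 1)) (Vr 6)), Assign 8 (Ar 6 row_next),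
   AStore 0 (Vr 7) (Ar 3 (Minus (Plus (Vr 7) (Vr 8)) (Vr 14))),
   Assign 21 (Minus (Plus (Plus (Vr 21) (Vr 21)) (Nm 1)) (Ar 4 (Vr 8)))])]"

definition dp :: cmd where
 "dp = seqs [dp_start, For 7 (Vr 20) (For 21 (Vr 27) dp_cell), dp_trace]"

definition stage :: cmd where
 "stage = seqs [search, inspect, best_point, insert_item, dp]"

text \<open>This runs under a provisional cap that is linear in \<open>n\<close>, because the
  definitive cap \<open>2 ^ (200 * G)\<close> is itself the result of a computation, the last entry
  of the table of powers. \<open>Vr 3\<close> becomes the bit length of \<open>n\<close>.\<close>

definition init1 :: "nat => nat => cmd" where
 "init1 c n0 = seqs [Assign 3 (Nm 0), Assign 18 (Nm 1),
  For 6 (Plus (Vr 0) (Nm 1)) (IfC (BLess (Vr 18) (Plus (Vr 0) (Nm 1)))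
   (SeqC (Assign 18 (Plus (Vr 18) (Vr 18))) (Assign 3 (Plus (Vr 3) (Nm 1)))) Skip),
  Assign 4 (scal c (Vr 3)), IfC (BLess (Vr 0) (Nm n0)) (Assign 4 (Plus (Vr 4) (Nm n0))) Skip,
  Assign 18 (Nm 1),
  For 6 (Plus (scal 200 (Vr 4)) (Nm 1)) (SeqC (AStore 4 (Vr 6) (Vr 18)) (Assign 18 (Plus (Vr 18) (Vr 18)))),
  Assign 30 (Ar 4 (scal 200 (Vr 4)))]"

definition init2 :: cmd where
 "init2 = seqs [Assign 13 (scal 40 (Vr 4)), Assign 14 (scal 80 (Vr 4)), Assign 27 (Ar 4 (scal 160 (Vr 4))),
  mul 11 13 1, Assign 17 (Plus (scal 300 (Vr 4)) (scal 4 (Vr 11)))]"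

definition finish :: cmd where
 "finish = For 6 (Vr 0) (Out (Ar 0 (Vr 6)) (Vr 6))"

definition main :: cmd where
 "main = seqs [init2, For 5 (Vr 0) stage, finish]"

text \<open>An upper bound for \<open>200 * G + 1\<close> and for \<open>n + 1\<close>, the numbers
  of rounds during initialization, that needs additions only.\<close>

definition cap0 :: "nat => nat => exp" where
 "cap0 c n0 = Plus (scal (200 * c + 1) (Plus (Vr 0) (Nm 1))) (Nm (200 * n0 + 1))"

lemmas prog_defs = med_def mul_def probe_def test_cell_def double_def search_round_def search_def inspect_def
 best_point_def insert_item_def dp_start_def dp_bits_def dp_gain_def row_next_def dp_try_def dp_cell_def
 dp_trace_def dp_def stage_def

lemma wf_init1: "wfc (init1 c n0)" by (simp add: init1_def wfv_def)
lemma wf_stage: "wfc stage" by (simp add: prog_defs wfv_def)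
lemma wf_main: "wfc main"
 using wf_stage by (simp add: main_def init2_def mul_def finish_def wfv_def)

subsection \<open>Search\<close>

lemma idx_inj [simp]:
 fixes i i' j j' c :: nat
 assumes "j < c" "j' < c"
 shows "i * c + j = i' * c + j' \<longleftrightarrow> i = i' & j = j'"
proof -
 have "(i * c + j) div c = i" "(i' * c + j') div c = i'" using assms by auto
 then show ?thesis by auto
qed

lemma med_spec:
 assumes "nvar h 0 + 2 \<le> nvar h 2" "0 < (\<Sum>j<nvar h 0 + 2. narr h a j)"
 shows "nvar (sem q (med a) h) 10 = wmed (nvar h 0 + 2) (narr h a)"
proof -
 let ?b = "IfC (BLess (Vr 24) (Plus (Vr 9) (Vr 9))) Skip
   (SeqC (Assign 9 (Plus (Vr 9) (Ar a (Vr 6)))) (Assign 10 (Vr 6)))"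
 let ?K = "nvar h 0 + 2" and ?w = "narr h a"
 define y where "y = wmed ?K ?w"
 note y = wmed_props[OF assms(2), folded y_def]
 let ?l1 = "For 6 (Plus (Vr 0) (Nm 2)) (Assign 24 (Plus (Vr 24) (Ar a (Vr 6))))"
 let ?l2 = "For 6 (Plus (Vr 0) (Nm 2)) ?b"
 define h1 where "h1 = sem q ?l1 (setv 24 0 h)"
 have f1: "frame ?l1 (setv 24 0 h) h1" unfolding h1_def by (rule frame_sem)
 have "nvar h1 24 = (\<Sum>j<?K. ?w j)"
  unfolding h1_def
  by (rule For_frame_rule[where I = "%k h'. nvar h' 24 = (\<Sum>j<k. ?w j)"])
   (use assms in "auto dest: frame_narr[where k = a]")
 define h2 where "h2 = setv 10 0 (setv 9 0 h1)"
 have h2: "nvar h2 24 = (\<Sum>j<?K. ?w j)" "nvar h2 0 = nvar h 0" "nvar h2 2 = nvar h 2" "narr h2 a = ?w"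
  using \<open>nvar h1 24 = _\<close> f1 by (auto simp: h2_def frame_def)
 have "nvar (sem q ?l2 h2) 9 = (\<Sum>j<min ?K (Suc y). ?w j) & nvar (sem q ?l2 h2) 10 = min ?K (Suc y) - 1"
 proof (rule For_frame_rule[where I = "%k h'. nvar h' 9 = (\<Sum>j<min k (Suc y). ?w j) & nvar h' 10 = min k (Suc y) - 1"])
  show "eval (Plus (Vr 0) (Nm 2)) h2 = ?K" "?K \<le> nvar h2 2" using h2 assms by auto
  show "nvar h2 9 = (\<Sum>j<min 0 (Suc y). ?w j) & nvar h2 10 = min 0 (Suc y) - 1" by (simp add: h2_def)
  fix k h' assume k: "k < ?K" and I: "nvar h' 9 = (\<Sum>j<min k (Suc y). ?w j) & nvar h' 10 = min k (Suc y) - 1"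
   and f: "frame ?l2 h2 h'"
  have h': "nvar h' 24 = (\<Sum>j<?K. ?w j)" "narr h' a = ?w" using f h2 by (auto simp: frame_def)
  show "nvar (sem q ?b (setv 6 k h')) 9 = (\<Sum>j<min (Suc k) (Suc y). ?w j) &
   nvar (sem q ?b (setv 6 k h')) 10 = min (Suc k) (Suc y) - 1"
  proof (cases "k \<le> y")
   case True
   have "(\<Sum>j<k. ?w j) \<le> (\<Sum>j<y. ?w j)" by (rule sum_mono2) (use True in auto)
   then have "\<not> (\<Sum>j<?K. ?w j) < 2 * (\<Sum>j<k. ?w j)" using y(3) by linarith
   then show ?thesis using I h' True by (simp add: min_absorb1 mult_2)
  next
   case False
   then have "(\<Sum>j<?K. ?w j) < 2 * nvar h' 9" using y(2) I by (simp add: min_absorb2 lessThan_Suc_atMost)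
   then show ?thesis using I h' False by (simp add: min_absorb2 mult_2)
  qed
 qed
 then have "nvar (sem q ?l2 h2) 10 = y" using y(1) by (simp add: min_absorb2)
 moreover have "sem q (med a) h = sem q ?l2 h2" by (simp add: med_def h2_def h1_def)
 ultimately show ?thesis by (simp add: y_def)
qed

lemma mul_spec:
 assumes "nvar h i \<le> nvar h 2" "i ~= r" "j ~= r" "j ~= 6" "r ~= 2" "r ~= 6"
 shows "nvar (sem q (mul r i j) h) r = nvar h i * nvar h j"
proof -
 have "nvar (sem q (For 6 (Vr i) (Assign r (Plus (Vr r) (Vr j)))) (setv r 0 h)) r = nvar h i * nvar h j"
  by (rule For_frame_rule[where I = "%k h'. nvar h' r = k * nvar h j"])
   (use assms in "auto dest: frame_nvar[where i = j]")
 then show ?thesis by (simp add: mul_def)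
qed

declare sem.simps(10) [simp del]

lemma wmed_cong:
 assumes "\<And>j. j < K ==> w j = w' j" "0 < (\<Sum>j<K. w j)"
 shows "wmed K w = wmed K w'"
proof (rule wmed_unique[symmetric])
 note p = wmed_props[OF assms(2)]
 have s: "(\<Sum>j<K. w' j) = (\<Sum>j<K. w j)" using assms(1) by (intro sum.cong) auto
 have "(\<Sum>j\<le>wmed K w. w' j) = (\<Sum>j\<le>wmed K w. w j)" using assms(1) p(1) by (intro sum.cong) auto
 then show "(\<Sum>j<K. w' j) < 2 * (\<Sum>j\<le>wmed K w. w' j)" using p(2) s by simp
 have "(\<Sum>j<wmed K w. w' j) = (\<Sum>j<wmed K w. w j)" using assms(1) p(1) by (intro sum.cong) auto
 then show "2 * (\<Sum>j<wmed K w. w' j) \<le> (\<Sum>j<K. w' j)" using p(3) s by simp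
qed

text \<open>A stage inspects only signals between the new item and earlier ones. The sample bound
  uses the number of these signals, the independence argument their location.\<close>

definition grow :: "nat => (nat => nat) => nat => hstate => hstate => bool" where
 "grow t L B h h' \<longleftrightarrow> (\<exists>S. S \<subseteq> (%p. {t, L p}) ` {..<t} & card S \<le> B & seen h' = seen h \<union> S)"

lemma grow_same: "seen h' = seen h ==> grow t L B h h'"
 unfolding grow_def by (intro exI[of _ "{}"]) auto

lemma grow_trans: "grow t L B h h' ==> grow t L B' h' h'' ==> B + B' \<le> B'' ==> grow t L B'' h h''"
 unfolding grow_def
proof (elim exE conjE)
 fix S S' assume a: "S \<subseteq> (%p. {t, L p}) ` {..<t}" "card S \<le> B" "seen h' = seen h \<union> S"
  "S' \<subseteq> (%p. {t, L p}) ` {..<t}" "card S' \<le> B'" "seen h'' = seen h' \<union> S'" "B + B' \<le> B''"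
 show "\<exists>S. S \<subseteq> (%p. {t, L p}) ` {..<t} & card S \<le> B'' & seen h'' = seen h \<union> S"
  using a card_Un_le[of S S'] by (intro exI[of _ "S \<union> S'"]) auto
qed

lemma grow_insert: "p < t ==> seen h' = insert {t, L p} (seen h) ==> grow t L 1 h h'"
 unfolding grow_def by (intro exI[of _ "{{t, L p}}"]) auto

lemma cblind_mul: "cblind (mul r i j)" by (simp add: mul_def)
lemma cblind_med: "cblind (med a)" by (simp add: med_def)

locale insertion =
 fixes q :: "nat => nat => real" and n A cp G t :: nat and L :: "nat => nat"
 assumes cp: "n + 2 \<le> cp" "160 * G + 1 \<le> cp" "2 ^ (160 * G) \<le> cp" and tn: "t < n"
begin

abbreviation "K \<equiv> n + 2"
abbreviation "T \<equiv> 40 * G"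
abbreviation "H \<equiv> 300 * G + 4 * (T * A)"
abbreviation "oc \<equiv> gcell_test A q T t L"
abbreviation "loc \<equiv> min (located K oc T * (T * A)) t"

definition core :: "hstate => bool" where
 "core h \<longleftrightarrow> nvar h 0 = n & nvar h 1 = A & nvar h 2 = cp & nvar h 5 = t & nvar h 11 = T * A &
  nvar h 13 = T & nvar h 14 = 80 * G & nvar h 17 = H & nvar h 27 = 2 ^ (160 * G) &
  narr h 0 = L & (\<forall>k\<le>160*G. narr h 4 k = 2 ^ k)"

lemma core_frame: "core h ==> frame c h h' ==> mv c \<inter> {0,1,2,5,11,13,14,17,27} = {} ==> ma c \<inter> {0,4} = {} ==> core h'"
proof -
 assume a: "core h" "frame c h h'" "mv c \<inter> {0,1,2,5,11,13,14,17,27} = {}" "ma c \<inter> {0,4} = {}"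
 have "nvar h' i = nvar h i" if "i \<in> {0,1,2,5,11,13,14,17,27}" for i
  using a that by (intro frame_nvar) auto
 moreover have "narr h' k = narr h k" if "k \<in> {0,4}" for k
  using a that by (intro frame_narr) auto
 ultimately show "core h'" using a(1) by (simp add: core_def)
qed

lemma core_sem: "core h ==> mv c \<inter> {0,1,2,5,11,13,14,17,27} = {} ==> ma c \<inter> {0,4} = {} ==> core (sem q c h)"
 by (rule core_frame[OF _ frame_sem])

lemma probe_spec:
 assumes h: "core h" and b: "nvar h 16 - nvar h 11 + nvar h 12 + A \<le> t"
 defines "b \<equiv> nvar h 16 - nvar h 11 + nvar h 12"
 shows "nvar (sem q probe h) 15 = of_bool (0 < (\<Sum>k<A. q t (L (b + k)))) & grow t L A h (sem q probe h)"
proof -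
 let ?b = "SeqC (Insp 0 (Vr 5) (Ar 0 (Plus (Plus (Minus (Vr 16) (Vr 11)) (Vr 12)) (Vr 8))))
   (RAssign 1 (RPlus (RV 1) (RV 0)))"
 let ?l = "For 8 (Vr 1) ?b"
 let ?h = "h\<lparr>rvar := (rvar h)(1 := 0)\<rparr>"
 \<comment> \<open>The test lies inside the list, so \<open>A\<close> is below the cap and the loop
   is not truncated, although the cap does not depend on \<open>A\<close>.\<close>
 have A: "A \<le> nvar h 2" using b tn cp h by (simp add: core_def)
 have "rvar (sem q ?l ?h) 1 = (\<Sum>k<A. q t (L (b + k))) & grow t L A h (sem q ?l ?h)"
 proof (rule For_frame_rule[where I = "%k h'. rvar h' 1 = (\<Sum>i<k. q t (L (b + i))) & grow t L k h h'"])
  show "eval (Vr 1) ?h = A" "A \<le> nvar ?h 2" using h A by (auto simp: core_def)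
  show "rvar ?h 1 = (\<Sum>i<0. q t (L (b + i))) & grow t L 0 h ?h" by (simp add: grow_same)
  fix k h' assume k: "k < A" and I: "rvar h' 1 = (\<Sum>i<k. q t (L (b + i))) & grow t L k h h'" and f: "frame ?l ?h h'"
  have v: "nvar h' 5 = t" "nvar h' 16 - nvar h' 11 + nvar h' 12 = b" "narr h' 0 = L"
   using f h by (auto simp: frame_def core_def b_def)
  have "grow t L (Suc k) h (sem q ?b (setv 8 k h'))"
   by (rule grow_trans[OF conjunct2[OF I] grow_insert[of "b + k"]]) (use v k b in "auto simp: b_def")
  then show "rvar (sem q ?b (setv 8 k h')) 1 = (\<Sum>i<Suc k. q t (L (b + i))) &
   grow t L (Suc k) h (sem q ?b (setv 8 k h'))"
   using I v by simp
 qed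
 then show ?thesis by (auto simp: probe_def grow_def)
qed

lemma test_cell_spec:
 assumes h: "core h" and x: "nvar h 10 = x" "x < K" and r: "nvar h 23 = r" "r < T"
 shows "nvar (sem q test_cell h) 15 = of_bool (oc x r) & grow t L A h (sem q test_cell h)"
proof -
 define h1 where "h1 = sem q (mul 16 10 11) h"
 define h2 where "h2 = sem q (mul 12 23 1) h1"
 have c1: "core h1" unfolding h1_def by (rule core_sem[OF h]) (auto simp: mul_def)
 have c2: "core h2" unfolding h2_def by (rule core_sem[OF c1]) (auto simp: mul_def)
 have "nvar h1 16 = x * (T * A)" unfolding h1_def by (subst mul_spec) (use h x cp in "auto simp: core_def")
 then have 16: "nvar h2 16 = x * (T * A)" unfolding h2_def by (subst sem_nvar) (auto simp: mul_def)
 have "nvar h1 23 = r" "nvar h1 10 = x" unfolding h1_def by (subst sem_nvar; use r x in "simp add: mul_def")+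
 then have 12: "nvar h2 12 = r * A" "nvar h2 10 = x" unfolding h2_def
  by (subst mul_spec, use c1 r cp in "auto simp: core_def")[1]
   (subst sem_nvar, use \<open>nvar h1 10 = x\<close> in "auto simp: mul_def")
 have s: "seen h2 = seen h" unfolding h1_def h2_def by (simp only: cblind_seen cblind_mul)
 have eq: "sem q test_cell h = sem q (IfC (BLess (Nm 0) (Vr 10)) (IfC (BLess (Vr 5) (Vr 16)) (Assign 15 (Nm 1)) probe)
   (Assign 15 (Nm 0))) h2" by (simp add: test_cell_def h1_def h2_def)
 have v: "nvar h2 5 = t" "nvar h2 11 = T * A" using c2 by (auto simp: core_def)
 consider "x = 0" | "0 < x" "t < x * (T * A)" | "0 < x" "x * (T * A) \<le> t" by linarith
 then show ?thesis
 proof cases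
  case 1
  have "sem q test_cell h = setv 15 0 h2" unfolding eq using 12 1 by simp
  then show ?thesis using 1 s by (simp add: gcell_test_def grow_same)
 next
  case 2
  have "sem q test_cell h = setv 15 1 h2" unfolding eq using 12 16 v 2 by simp
  then show ?thesis using 2 s by (simp add: gcell_test_def grow_same)
 next
  case 3
  have e: "x * (T * A) - T * A = (x - 1) * (T * A)" by (simp add: diff_mult_distrib)
  have "(r + 1) * A \<le> T * A" using r by (intro mult_right_mono) auto
  then have rA: "r * A + A \<le> T * A" by simp
  have "x * (T * A) = (x - 1) * (T * A) + T * A" using 3(1) by (cases x) auto
  then have b: "nvar h2 16 - nvar h2 11 + nvar h2 12 + A \<le> t"
   unfolding 12 16 v e using 3(2) rA by linarith
  have eq3: "sem q test_cell h = sem q probe h2"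
   unfolding eq using 12 16 v 3 by (simp only: sem.simps beval.simps eval.simps if_True if_False not_less[symmetric] simp_thms)
  have g: "oc x r \<longleftrightarrow> 0 < (\<Sum>k<A. q t (L ((x-1)*(T*A)+r*A+k)))"
   unfolding gcell_test_def using 3 by (simp only: not_less[symmetric] simp_thms)
  show ?thesis using probe_spec[OF c2 b] unfolding eq3 g 12 16 v e grow_def s .
 qed
qed

lemma double_spec:
 assumes h: "core h"
 shows "\<forall>j<K. narr (sem q double h) 1 j = (if (if 0 < nvar h 15 then j < nvar h 10 else nvar h 10 < j)
   then 2 * narr h 1 j else narr h 1 j)" (is "\<forall>j<K. _ = ?f j")
proof -
 let ?b = "IfC (BLess (Nm 0) (Vr 15))
  (IfC (BLess (Vr 7) (Vr 10)) (AStore 1 (Vr 7) (Plus (Ar 1 (Vr 7)) (Ar 1 (Vr 7)))) Skip)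
  (IfC (BLess (Vr 10) (Vr 7)) (AStore 1 (Vr 7) (Plus (Ar 1 (Vr 7)) (Ar 1 (Vr 7)))) Skip)"
 have *: "(\<forall>j<K. narr (sem q double h) 1 j = ?f j) & (\<forall>j\<ge>K. narr (sem q double h) 1 j = narr h 1 j)"
  unfolding double_def
 proof (rule For_frame_rule[where I = "%k h'. (\<forall>j<k. narr h' 1 j = ?f j) & (\<forall>j\<ge>k. narr h' 1 j = narr h 1 j)"])
  fix k h'
  assume I: "(\<forall>j<k. narr h' 1 j = ?f j) & (\<forall>j\<ge>k. narr h' 1 j = narr h 1 j)"
   and f: "frame (For 7 (Plus (Vr 0) (Nm 2)) ?b) h h'"
  have v: "nvar h' 15 = nvar h 15" "nvar h' 10 = nvar h 10" using f by (auto simp: frame_def)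
  show "(\<forall>j<Suc k. narr (sem q ?b (setv 7 k h')) 1 j = ?f j) &
  (\<forall>j\<ge>Suc k. narr (sem q ?b (setv 7 k h')) 1 j = narr h 1 j)"
   using I by (simp add: v less_Suc_eq mult_2)
 qed (use h cp in "auto simp: core_def")
 then show ?thesis by blast
qed

definition rinv :: "hstate => nat => hstate => bool" where
 "rinv h0 r h \<longleftrightarrow> (\<forall>j<K. narr h 1 j = wts K oc r j) & (\<forall>j<K. narr h 2 j = visits K oc r j) & grow t L (r * A) h0 h"

lemma visits_Suc: "visits K oc (Suc r) x = visits K oc r x + of_bool (path K oc r = x)" for K oc
proof -
 have "{i. i < Suc r & path K oc i = x} = {i. i < r & path K oc i = x} \<union> (if path K oc r = x then {r} else {})"
  by (auto simp: less_Suc_eq)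
 then show ?thesis by (auto simp: visits_def card_Un_disjoint)
qed

lemma search_round_spec:
 assumes h: "core h" and r: "nvar h 23 = r" "r < T" and I: "rinv h0 r h"
 shows "rinv h0 (Suc r) (sem q search_round h)"
proof -
 define h1 where "h1 = sem q (med 1) h"
 define x where "x = path K oc r"
 have xK: "x < K" unfolding x_def by (rule path_less) simp
 have 1: "0 < (\<Sum>j<K. wts K oc r j)" by (rule wts_sum_pos) simp
 have 2: "(\<Sum>j<K. wts K oc r j) = (\<Sum>j<K. narr h 1 j)"
  using I by (intro sum.cong) (auto simp: rinv_def)
 have "nvar h1 10 = wmed (nvar h 0 + 2) (narr h 1)"
  unfolding h1_def by (rule med_spec) (use 1 2 h cp in "auto simp: core_def")
 also have "... = wmed K (narr h 1)" using h by (simp add: core_def)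
 also have "... = x" unfolding x_def path_def
  by (rule wmed_cong) (use I 1 2 in "auto simp: rinv_def")
 finally have h1x: "nvar h1 10 = x" .
 have c1: "core h1" unfolding h1_def by (rule core_sem[OF h]) (auto simp: med_def)
 have n1: "nvar h1 23 = r" unfolding h1_def by (subst sem_nvar) (use r in "auto simp: med_def")
 have a1: "narr h1 1 = narr h 1" "narr h1 2 = narr h 2" unfolding h1_def by (rule sem_narr, simp add: med_def)+
 have s1: "seen h1 = seen h" unfolding h1_def by (rule cblind_seen[OF cblind_med])
 define h2 where "h2 = sem q (AStore 2 (Vr 10) (Plus (Ar 2 (Vr 10)) (Nm 1))) h1"
 have c2: "core h2" unfolding h2_def by (rule core_sem[OF c1]) auto
 have v2: "nvar h2 10 = x" "nvar h2 23 = r" "seen h2 = seen h" "narr h2 1 = narr h 1"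
  "narr h2 2 = (narr h 2)(x := narr h 2 x + 1)"
  using h1x n1 s1 a1 by (auto simp: h2_def)
 define h3 where "h3 = sem q test_cell h2"
 note t3 = test_cell_spec[OF c2 v2(1) xK v2(2) r(2), folded h3_def]
 have c3: "core h3" unfolding h3_def by (rule core_sem[OF c2]) (auto simp: test_cell_def mul_def probe_def)
 have v3: "nvar h3 10 = x" "narr h3 1 = narr h2 1" "narr h3 2 = narr h2 2"
  using v2 unfolding h3_def by (auto simp: sem_nvar sem_narr test_cell_def mul_def probe_def)
 define h4 where "h4 = sem q double h3"
 have e: "sem q search_round h = h4" by (simp add: search_round_def h1_def h2_def h3_def h4_def)
 have "narr h4 1 j = wts K oc (Suc r) j" if "j < K" for j
  unfolding h4_def using double_spec[OF c3] that t3 v3 v2 I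
  by (simp add: rinv_def Let_def x_def path_def)
 moreover have "narr h4 2 j = visits K oc (Suc r) j" if "j < K" for j
 proof -
  have "narr h4 2 = narr h3 2" unfolding h4_def by (rule sem_narr) (auto simp: double_def)
  then show ?thesis using that v3 v2 I by (simp add: rinv_def visits_Suc x_def)
 qed
 moreover have "grow t L (Suc r * A) h0 h4"
 proof (rule grow_trans[where h' = h3 and B' = 0])
  have "seen h4 = seen h3" unfolding h4_def by (rule cblind_seen) (simp add: double_def)
  then show "grow t L 0 h3 h4" by (rule grow_same)
  have "grow t L A h h3" using t3 v2 by (simp add: grow_def)
  then show "grow t L (Suc r * A) h0 h3" using I by (auto simp: rinv_def elim: grow_trans)
 qed simp
 ultimately show ?thesis by (simp add: rinv_def e)
qed

lemma search_spec:
 assumes h: "core h" and G: "0 < G"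
 shows "nvar (sem q search h) 28 = loc & grow t L (T * A) h (sem q search h)"
proof -
 let ?l1 = "For 6 (Plus (Vr 0) (Nm 2)) (SeqC (AStore 1 (Vr 6) (Nm 1)) (AStore 2 (Vr 6) (Nm 0)))"
 define h1 where "h1 = sem q ?l1 h"
 have "(\<forall>j<K. narr h1 1 j = 1) & (\<forall>j<K. narr h1 2 j = 0)"
  unfolding h1_def
  by (rule For_frame_rule[where I = "%k h'. (\<forall>j<k. narr h' 1 j = 1) & (\<forall>j<k. narr h' 2 j = 0)"])
   (use h cp in "auto simp: core_def less_Suc_eq")
 then have r0: "rinv h 0 h1"
  unfolding rinv_def by (auto simp: visits_def h1_def intro!: grow_same cblind_seen simp del: sem.simps)
 have c1: "core h1" unfolding h1_def by (rule core_sem[OF h]) auto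
 let ?l2 = "For 23 (Vr 13) search_round"
 define h2 where "h2 = sem q ?l2 h1"
 have m2: "mv ?l2 \<inter> {0,1,2,5,11,13,14,17,27} = {}" "ma ?l2 \<inter> {0,4} = {}"
  by (auto simp: search_round_def med_def test_cell_def mul_def probe_def double_def)
 have r2: "rinv h T h2" unfolding h2_def
 proof (rule For_frame_rule[where I = "%k h'. rinv h k h'"])
  show "eval (Vr 13) h1 = T" "T \<le> nvar h1 2" using c1 cp by (auto simp: core_def)
  show "rinv h 0 h1" by (rule r0)
  fix k h' assume k: "k < T" "rinv h k h'" "frame ?l2 h1 h'"
  have "core h'" by (rule core_frame[OF c1 k(3) m2])
  then have "core (setv 23 k h')" by (simp add: core_def)
  moreover have "rinv h k (setv 23 k h')" using k(2) by (simp add: rinv_def grow_def)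
  ultimately show "rinv h (Suc k) (sem q search_round (setv 23 k h'))" using k(1) by (intro search_round_spec) auto
 qed
 have c2: "core h2" unfolding h2_def by (rule core_sem[OF c1 m2])
 define h3 where "h3 = sem q (med 2) h2"
 have c3: "core h3" unfolding h3_def by (rule core_sem[OF c2]) (auto simp: med_def)
 have 2: "(\<Sum>j<K. narr h2 2 j) = (\<Sum>j<K. visits K oc T j)"
  using r2 by (intro sum.cong) (auto simp: rinv_def)
 have "0 < visits K oc T (path K oc 0)"
  unfolding visits_def by (subst card_gt_0_iff) (use G in "auto intro!: exI[of _ 0]")
 also have "... \<le> (\<Sum>j<K. visits K oc T j)"
  by (rule member_le_sum) (auto simp: path_less)
 finally have 1: "0 < (\<Sum>j<K. visits K oc T j)" .
 have "nvar h3 10 = wmed (nvar h2 0 + 2) (narr h2 2)"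
  unfolding h3_def by (rule med_spec) (use 1 2 c2 cp in "auto simp: core_def")
 also have "... = wmed K (narr h2 2)" using c2 by (simp add: core_def)
 also have "... = located K oc T" unfolding located_def
  by (rule wmed_cong) (use r2 1 2 in "auto simp: rinv_def")
 finally have x: "nvar h3 10 = located K oc T" .
 have xK: "located K oc T < K" unfolding located_def using wmed_props(1)[OF 1] .
 define h4 where "h4 = sem q (mul 16 10 11) h3"
 have c4: "core h4" unfolding h4_def by (rule core_sem[OF c3]) (auto simp: mul_def)
 have "nvar h4 16 = located K oc T * (T * A)"
  unfolding h4_def by (subst mul_spec) (use x xK cp c3 in "auto simp: core_def")
 moreover have e: "sem q search h = sem q (IfC (BLess (Vr 16) (Vr 5)) (Assign 28 (Vr 16)) (Assign 28 (Vr 5))) h4"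
  by (simp add: search_def h1_def h2_def h3_def h4_def)
 moreover have "seen h4 = seen h2" unfolding h4_def h3_def by (simp only: cblind_seen cblind_mul cblind_med)
 ultimately show ?thesis using c4 r2 by (auto simp: core_def rinv_def grow_def)
qed

end

text \<open>Signals are inspected with the newer, larger item first, and the other orientation is
  the negative. Off the diagonal the table is thus antisymmetric for any \<open>q\<close>, and on
  known pairs it agrees with an antisymmetric \<open>q\<close>. Unknown pairs count as 0.\<close>

definition qtab :: "(nat => nat => real) => nat set set => nat => nat => real" where
 "qtab q E i j = (if {i, j} \<in> E then (if j < i then q i j else - q j i) else 0)"

definition tabulated :: "(nat => nat => real) => nat => nat set set => hstate => bool" where
 "tabulated q c E h \<longleftrightarrow> (\<forall>i<c. \<forall>j<c. rarr h 0 (i * c + j) = qtab q E i j)"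

definition ins :: "(nat => nat) => nat => nat => nat => nat" where
 "ins L t b p = (if p < b then L p else if b < p then L (p - 1) else t)"

definition slot_score :: "(nat => nat => real) => (nat => nat) => nat => nat => real" where
 "slot_score w L t p = (\<Sum>j<t. if j < p then w (L j) t else w t (L j))"

section \<open>Inspection around the located place, best slot, insertion\<close>

context insertion
begin

abbreviation close :: "nat => bool" where
 "close p \<equiv> \<not> p + H < loc & \<not> loc + H < p"

definition new_pairs :: "nat => nat set set" where
 "new_pairs k = (%p. {t, L p}) ` {p. p < k & close p}"

lemma new_pairs_Suc: "new_pairs (Suc k) = (if close k then insert {t, L k} (new_pairs k) else new_pairs k)"
proof -
 have "{p. p < Suc k & close p} = (if close k then insert k {p. p < k & close p} else {p. p < k & close p})"
  by (auto simp: less_Suc_eq)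
 then show ?thesis by (simp add: new_pairs_def)
qed

lemma qtab_insert:
 assumes "tabulated q cp E h" "b < t"
  "rarr h' 0 = (rarr h 0)(t * cp + b := q t b, b * cp + t := - q t b)"
 shows "tabulated q cp (insert {t, b} E) h'"
 unfolding tabulated_def
proof (intro allI impI)
 fix i j assume ij: "i < cp" "j < cp"
 have tb: "t < cp" "b < cp" using tn cp assms(2) by auto
 have *: "rarr h 0 (i * cp + j) = qtab q E i j" using assms(1) ij by (simp add: tabulated_def)
 show "rarr h' 0 (i * cp + j) = qtab q (insert {t, b} E) i j"
  unfolding assms(3) using tb ij assms(2) * by (auto simp: qtab_def doubleton_eq_iff)
qed

lemma inspect_spec:
 assumes h: "core h" and 28: "nvar h 28 = loc" and tab: "tabulated q cp E h" and L: "listing t L"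
 shows "tabulated q cp (E \<union> new_pairs t) (sem q inspect h) & grow t L (2 * H + 1) h (sem q inspect h)"
proof -
 let ?b = "IfC (BAnd (BNot (BLess (Plus (Vr 6) (Vr 17)) (Vr 28))) (BNot (BLess (Plus (Vr 28) (Vr 17)) (Vr 6))))
   (seqs [Insp 0 (Vr 5) (Ar 0 (Vr 6)), RAStore 0 (Plus (TCap (Vr 5)) (Ar 0 (Vr 6))) (RV 0),
    RAStore 0 (Plus (TCap (Ar 0 (Vr 6))) (Vr 5)) (RMinus rzero (RV 0))]) Skip"
 have "tabulated q cp (E \<union> new_pairs t) (sem q inspect h) & seen (sem q inspect h) = seen h \<union> new_pairs t"
  unfolding inspect_def
 proof (rule For_frame_rule[where I = "%k h'. tabulated q cp (E \<union> new_pairs k) h' & seen h' = seen h \<union> new_pairs k"])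
  show "eval (Vr 5) h = t" "t \<le> nvar h 2" using h cp tn by (auto simp: core_def)
  show "tabulated q cp (E \<union> new_pairs 0) h & seen h = seen h \<union> new_pairs 0"
   using tab by (simp add: new_pairs_def)
  fix k h' assume k: "k < t" and I: "tabulated q cp (E \<union> new_pairs k) h' & seen h' = seen h \<union> new_pairs k"
   and f: "frame (For 6 (Vr 5) ?b) h h'"
  have v: "nvar h' 5 = t" "narr h' 0 = L" "nvar h' 17 = H" "nvar h' 28 = loc" "nvar h' 2 = cp"
   using f h 28 by (auto simp: frame_def core_def)
  show "tabulated q cp (E \<union> new_pairs (Suc k)) (sem q ?b (setv 6 k h')) &
   seen (sem q ?b (setv 6 k h')) = seen h \<union> new_pairs (Suc k)"
  proof (cases "close k")
   case False
   then have "sem q ?b (setv 6 k h') = setv 6 k h'" using v by auto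
   moreover have "new_pairs (Suc k) = new_pairs k" using False unfolding new_pairs_Suc by (rule if_not_P)
   ultimately show ?thesis using I by (simp add: tabulated_def)
  next
   case True
   have b: "beval (BAnd (BNot (BLess (Plus (Vr 6) (Vr 17)) (Vr 28))) (BNot (BLess (Plus (Vr 28) (Vr 17)) (Vr 6)))) (setv 6 k h')"
    using True v by simp
   have "L k < t" using L k by (auto simp: listing_def bij_betw_def)
   then have "tabulated q cp (insert {t, L k} (E \<union> new_pairs k)) (sem q ?b (setv 6 k h'))"
    unfolding sem.simps if_P[OF b] by (intro qtab_insert[OF conjunct1[OF I]]) (simp_all add: v)
   moreover have "seen (sem q ?b (setv 6 k h')) = insert {t, L k} (seen h')"
    unfolding sem.simps if_P[OF b] by (simp add: v)
   moreover have "new_pairs (Suc k) = insert {t, L k} (new_pairs k)" using True unfolding new_pairs_Suc by (rule if_P)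
   ultimately show ?thesis using I by simp
  qed
 qed
 moreover have "card (new_pairs t) \<le> 2 * H + 1"
 proof -
  have "{p. p < t & close p} \<subseteq> {loc - H..loc + H}" by auto
  then have "card {p. p < t & close p} \<le> card {loc - H..loc + H}" by (intro card_mono) auto
  also have "... \<le> 2 * H + 1" by simp
  finally show ?thesis unfolding new_pairs_def using card_image_le[of "{p. p < t & close p}" "%p. {t, L p}"] by simp
 qed
 ultimately show ?thesis by (auto simp: grow_def new_pairs_def intro!: exI[of _ "new_pairs t"])
qed

lemma best_point_spec:
 assumes h: "core h"
 defines "g \<equiv> slot_score (%i j. rarr h 0 (i * cp + j)) L t"
 shows "nvar (sem q best_point h) 19 \<le> t & (\<forall>p\<le>t. g p \<le> g (nvar (sem q best_point h) 19))"
proof -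
 let ?b = "IfC (BLess (Vr 7) (Vr 6))
   (RAssign 1 (RPlus (RV 1) (RAr 0 (Plus (TCap (Ar 0 (Vr 7))) (Vr 5)))))
   (RAssign 1 (RPlus (RV 1) (RAr 0 (Plus (TCap (Vr 5)) (Ar 0 (Vr 7))))))"
 let ?l = "For 7 (Vr 5) ?b"
 let ?c = "IfC (BAnd (BLess (Nm 0) (Vr 6)) (BNot (BRLess (RV 2) (RV 1)))) Skip
   (SeqC (RAssign 2 (RV 1)) (Assign 19 (Vr 6)))"
 let ?I = "%k h'. 0 < k --> nvar h' 19 < k & rvar h' 2 = g (nvar h' 19) & (\<forall>p<k. g p \<le> rvar h' 2)"
 have "?I (Suc t) (sem q best_point h)"
  unfolding best_point_def
 proof (rule For_frame_rule[where I = ?I])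
  show "eval (Plus (Vr 5) (Nm 1)) h = Suc t" "Suc t \<le> nvar h 2" using h cp tn by (auto simp: core_def)
  show "?I 0 h" by simp
  fix k h' assume k: "k < Suc t" and I: "?I k h'" and f: "frame (For 6 (Plus (Vr 5) (Nm 1)) (seqs [RAssign 1 rzero, ?l, ?c])) h h'"
  have v: "nvar h' 5 = t" "narr h' 0 = L" "nvar h' 2 = cp" "rarr h' 0 = rarr h 0"
   using f h by (auto simp: frame_def core_def)
  define h1 where "h1 = (setv 6 k h')\<lparr>rvar := (rvar h')(1 := 0)\<rparr>"
  have v1: "nvar h1 5 = t" "narr h1 0 = L" "nvar h1 2 = cp" "rarr h1 0 = rarr h 0" "nvar h1 6 = k" "rvar h1 1 = 0"
   using v by (auto simp: h1_def)
  define h2 where "h2 = sem q ?l h1"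
  have f2: "frame ?l h1 h2" unfolding h2_def by (rule frame_sem)
  have "rvar h2 1 = (\<Sum>j<t. if j < k then rarr h 0 (L j * cp + t) else rarr h 0 (t * cp + L j)) & rvar h2 2 = rvar h' 2"
   unfolding h2_def
  proof (rule For_frame_rule[where I = "%i h''. rvar h'' 1 = (\<Sum>j<i. if j < k then rarr h 0 (L j * cp + t)
    else rarr h 0 (t * cp + L j)) & rvar h'' 2 = rvar h' 2"])
   show "eval (Vr 5) h1 = t" "t \<le> nvar h1 2" using v1 cp tn by auto
   show "rvar h1 1 = (\<Sum>j<0. if j < k then rarr h 0 (L j * cp + t) else rarr h 0 (t * cp + L j)) & rvar h1 2 = rvar h' 2"
    by (simp add: h1_def)
  next
   fix i h'' assume i: "i < t" and I: "rvar h'' 1 = (\<Sum>j<i. if j < k then rarr h 0 (L j * cp + t)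
    else rarr h 0 (t * cp + L j)) & rvar h'' 2 = rvar h' 2" and f: "frame ?l h1 h''"
   have "nvar h'' 5 = t" "narr h'' 0 = L" "nvar h'' 2 = cp" "rarr h'' 0 = rarr h 0" "nvar h'' 6 = k"
    using f v1 by (auto simp: frame_def)
   then show "rvar (sem q ?b (setv 7 i h'')) 1 =
    (\<Sum>j<Suc i. if j < k then rarr h 0 (L j * cp + t) else rarr h 0 (t * cp + L j)) &
    rvar (sem q ?b (setv 7 i h'')) 2 = rvar h' 2"
    using I by simp
  qed
  then have s: "rvar h2 1 = g k" "rvar h2 2 = rvar h' 2" by (auto simp: g_def slot_score_def)
  have v2: "nvar h2 6 = k" "nvar h2 19 = nvar h' 19" using f2 by (auto simp: frame_def h1_def)
  have e: "sem q (seqs [RAssign 1 rzero, ?l, ?c]) (setv 6 k h') = sem q ?c h2"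
   by (simp add: h2_def h1_def)
  have "?I (Suc k) (sem q ?c h2)"
  proof (cases "0 < k & \<not> rvar h' 2 < g k")
   case True
   then have "sem q ?c h2 = h2" using s v2 by simp
   then show ?thesis using True I s v2 by (auto simp: less_Suc_eq)
  next
   case False
   then have c: "nvar (sem q ?c h2) 19 = k" "rvar (sem q ?c h2) 2 = g k" using s v2 by auto
   have "g p \<le> g k" if "p < k" for p
    using I that False by (auto intro: order_trans[OF _ less_imp_le])
   then show ?thesis using c by (simp add: less_Suc_eq)
  qed
  then show "?I (Suc k) (sem q (seqs [RAssign 1 rzero, ?l, ?c]) (setv 6 k h'))" unfolding e .
 qed
 then show ?thesis by (auto simp: less_Suc_eq_le)
qed

lemma insert_item_spec:
 assumes h: "core h" and b: "nvar h 19 = b" "b \<le> t"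
 shows "\<forall>p\<le>t. narr (sem q insert_item h) 3 p = ins L t b p"
proof -
 let ?b = "IfC (BLess (Vr 6) (Vr 19)) (AStore 3 (Vr 6) (Ar 0 (Vr 6)))
  (IfC (BLess (Vr 19) (Vr 6)) (AStore 3 (Vr 6) (Ar 0 (Minus (Vr 6) (Nm 1)))) (AStore 3 (Vr 6) (Vr 5)))"
 have "\<forall>p<Suc t. narr (sem q insert_item h) 3 p = ins L t b p"
  unfolding insert_item_def
 proof (rule For_frame_rule[where I = "%k h'. \<forall>p<k. narr h' 3 p = ins L t b p"])
  fix k h' assume k: "k < Suc t" and I: "\<forall>p<k. narr h' 3 p = ins L t b p"
   and f: "frame (For 6 (Plus (Vr 5) (Nm 1)) ?b) h h'"
  have v: "nvar h' 5 = t" "narr h' 0 = L" "nvar h' 19 = b" using f h b by (auto simp: frame_def core_def)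
  show "\<forall>p<Suc k. narr (sem q ?b (setv 6 k h')) 3 p = ins L t b p"
   using I v by (auto simp: less_Suc_eq ins_def)
 qed (use h cp tn in "auto simp: core_def")
 then show ?thesis by (simp add: less_Suc_eq_le)
qed

end

subsection \<open>The dynamic program\<close>

text \<open>An entry refers to the level before it only through codes below
  \<open>2 ^ (2 * R)\<close>, which are the stored ones.\<close>

lemma dp_row_cong:
 assumes "\<And>M'. M' < 2 ^ (2 * R) ==> ok' j M' = ok j M' & Vt' j M' = Vt j M'"
  and "ok' (Suc j) M = ok (Suc j) M" "Vt' (Suc j) M = Vt (Suc j) M" "ch' (Suc j) M = ch (Suc j) M"
 shows "dp_row m R W ok' Vt' ch' j M \<longleftrightarrow> dp_row m R W ok Vt ch j M"
proof -
 have "cand m R ok' j M = cand m R ok j M"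
  using assms(1) by (auto simp: cand_def fun_eq_iff)
 moreover have "Vt' j (2 * M + 1 - 2 ^ k) = Vt j (2 * M + 1 - 2 ^ k)" if "cand m R ok j M k" for k
  using that assms(1) by (simp add: cand_def)
 ultimately show ?thesis using assms(2-4) unfolding dp_row_def by (auto simp del: diff_mult_distrib)
qed

locale dprog =
 fixes q :: "nat => nat => real" and m R cp :: nat and L' :: "nat => nat" and Qr :: "nat => real"
 assumes cp: "m \<le> cp" "2 * R + 1 \<le> cp" "2 ^ (2 * R) \<le> cp"
begin

definition W :: "nat => nat => real" where "W p p' = Qr (L' p * cp + L' p')"

definition dcore :: "hstate => bool" where
 "dcore h \<longleftrightarrow> nvar h 2 = cp & nvar h 14 = R & nvar h 20 = m & nvar h 27 = 2 ^ (2 * R) &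
  (\<forall>p<m. narr h 3 p = L' p) & (\<forall>k\<le>2*R. narr h 4 k = 2 ^ k) & rarr h 0 = Qr"

lemma dcore_frame: "dcore h ==> frame c h h' ==> mv c \<inter> {2,14,20,27} = {} ==> ma c \<inter> {3,4} = {} ==> 0 \<notin> mra c ==> dcore h'"
proof -
 assume a: "dcore h" "frame c h h'" "mv c \<inter> {2,14,20,27} = {}" "ma c \<inter> {3,4} = {}" "0 \<notin> mra c"
 have "nvar h' i = nvar h i" if "i \<in> {2,14,20,27}" for i
  using a that by (intro frame_nvar) auto
 moreover have "narr h' k = narr h k" if "k \<in> {3,4}" for k
  using a that by (intro frame_narr) auto
 moreover have "rarr h' 0 = rarr h 0" using a by (intro frame_rarr)
 ultimately show "dcore h'" using a(1) by (simp add: dcore_def)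
qed

lemma dcore_sem: "dcore h ==> mv c \<inter> {2,14,20,27} = {} ==> ma c \<inter> {3,4} = {} ==> 0 \<notin> mra c ==> dcore (sem q c h)"
 by (rule dcore_frame[OF _ frame_sem])

abbreviation okf :: "hstate => nat => nat => bool" where "okf h j M \<equiv> 0 < narr h 5 (j * cp + M)"
abbreviation chf :: "hstate => nat => nat => nat" where "chf h j M \<equiv> narr h 6 (j * cp + M)"
abbreviation Vf :: "hstate => nat => nat => real" where "Vf h j M \<equiv> rarr h 1 (j * cp + M)"

lemma mod_pow_Suc: "(N::nat) mod 2 ^ Suc b = (if bit N b then 2 ^ b else 0) + N mod 2 ^ b"
proof -
 have "N mod 2 ^ Suc b = N mod (2 ^ b * 2)" by (simp add: mult.commute)
 also have "... = 2 ^ b * (N div 2 ^ b mod 2) + N mod 2 ^ b" by (rule mod_mult2_eq)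
 also have "... = (if bit N b then 2 ^ b else 0) + N mod 2 ^ b"
  by (simp add: bit_iff_odd odd_iff_mod_2_eq_one)
 finally show ?thesis .
qed

definition binv :: "nat => hstate => bool" where
 "binv M h \<longleftrightarrow> dcore h & nvar h 21 = M & nvar h 22 = 2 * M + 1 & (\<forall>k\<le>2*R. narr h 7 k = of_bool (bit (2 * M + 1) k))"

lemma dp_bits_spec:
 assumes h: "dcore h" and M: "nvar h 21 = M" "M < 2 ^ (2 * R)"
 shows "binv M (sem q dp_bits h)"
proof -
 let ?N = "2 * M + 1"
 let ?b = "seqs [Assign 8 (Minus (Plus (Vr 14) (Vr 14)) (Vr 6)),
   IfC (BLess (Vr 29) (Ar 4 (Vr 8))) (AStore 7 (Vr 8) (Nm 0))
    (SeqC (AStore 7 (Vr 8) (Nm 1)) (Assign 29 (Minus (Vr 29) (Ar 4 (Vr 8)))))]"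
 let ?l = "For 6 (Plus (Plus (Vr 14) (Vr 14)) (Nm 1)) ?b"
 define h1 where "h1 = setv 29 ?N (setv 22 ?N h)"
 have c1: "dcore h1" using h by (simp add: h1_def dcore_def)
 have e: "sem q dp_bits h = sem q ?l h1" using M by (simp add: dp_bits_def h1_def mult_2)
 have "nvar (sem q ?l h1) 29 = ?N mod 2 ^ (2 * R + 1 - (2 * R + 1)) &
   (\<forall>k. 2 * R + 1 - (2 * R + 1) \<le> k --> k \<le> 2 * R --> narr (sem q ?l h1) 7 k = of_bool (bit ?N k))"
 proof (rule For_frame_rule[where I = "%i h'. nvar h' 29 = ?N mod 2 ^ (2 * R + 1 - i) &
   (\<forall>k. 2 * R + 1 - i \<le> k --> k \<le> 2 * R --> narr h' 7 k = of_bool (bit ?N k))"])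
  show "eval (Plus (Plus (Vr 14) (Vr 14)) (Nm 1)) h1 = 2 * R + 1" "2 * R + 1 \<le> nvar h1 2"
   using c1 cp by (auto simp: dcore_def)
  have "?N < 2 ^ (2 * R + 1)" using M by simp
  then show "nvar h1 29 = ?N mod 2 ^ (2 * R + 1 - 0) &
   (\<forall>k. 2 * R + 1 - 0 \<le> k --> k \<le> 2 * R --> narr h1 7 k = of_bool (bit ?N k))"
   by (simp add: h1_def)
 next
  fix i h' assume i: "i < 2 * R + 1" and I: "nvar h' 29 = ?N mod 2 ^ (2 * R + 1 - i) &
   (\<forall>k. 2 * R + 1 - i \<le> k --> k \<le> 2 * R --> narr h' 7 k = of_bool (bit ?N k))" and f: "frame ?l h1 h'"
  define b where "b = 2 * R - i"
  have bR: "b \<le> 2 * R" "2 * R + 1 - i = Suc b" "2 * R + 1 - Suc i = b" using i by (auto simp: b_def)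
  have "dcore h'" by (rule dcore_frame[OF c1 f]) auto
  then have v: "nvar h' 14 = R" "narr h' 4 b = 2 ^ b" using bR by (auto simp: dcore_def)
  define h2 where "h2 = setv 8 b (setv 6 i h')"
  have e2: "sem q ?b (setv 6 i h') = sem q (IfC (BLess (Vr 29) (Ar 4 (Vr 8))) (AStore 7 (Vr 8) (Nm 0))
    (SeqC (AStore 7 (Vr 8) (Nm 1)) (Assign 29 (Minus (Vr 29) (Ar 4 (Vr 8)))))) h2"
   using v by (simp add: h2_def b_def mult_2)
  have v2: "nvar h2 29 = ?N mod 2 ^ Suc b" "narr h2 4 b = 2 ^ b" "nvar h2 8 = b" "narr h2 7 = narr h' 7"
   using I v bR by (auto simp: h2_def)
  have I2: "\<forall>k. b < k --> k \<le> 2 * R --> narr h' 7 k = of_bool (bit ?N k)" using I bR by (simp add: Suc_le_eq)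
  have I3: "narr h' 7 k = of_bool (bit ?N k)" if "b \<le> k" "k ~= b" "k \<le> 2 * R" for k using I2 that by auto
  show "nvar (sem q ?b (setv 6 i h')) 29 = ?N mod 2 ^ (2 * R + 1 - Suc i) &
   (\<forall>k. 2 * R + 1 - Suc i \<le> k --> k \<le> 2 * R --> narr (sem q ?b (setv 6 i h')) 7 k = of_bool (bit ?N k))"
  proof (cases "bit ?N b")
   case True
   then have "\<not> ?N mod 2 ^ Suc b < 2 ^ b" "?N mod 2 ^ Suc b - 2 ^ b = ?N mod 2 ^ b"
    using mod_pow_Suc[of ?N b] by auto
   then show ?thesis unfolding e2 bR(3) using v2 I3 True by (simp del: power_Suc)
  next
   case False
   then have "?N mod 2 ^ Suc b < 2 ^ b" "?N mod 2 ^ Suc b = ?N mod 2 ^ b"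
    using mod_pow_Suc[of ?N b] by auto
   then show ?thesis unfolding e2 bR(3) using v2 I3 False by (simp del: power_Suc)
  qed
 qed
 moreover have "dcore (sem q ?l h1)" by (rule dcore_sem[OF c1]) auto
 moreover have "nvar (sem q ?l h1) 21 = M" "nvar (sem q ?l h1) 22 = ?N"
  using M by (subst sem_nvar; simp add: h1_def)+
 ultimately show ?thesis unfolding e binv_def by auto
qed

lemma dp_gain_spec:
 assumes h: "binv M h" and v: "nvar h 7 = j" "nvar h 8 = k" "R \<le> j + k" "j + k < m + R"
 shows "rvar (sem q dp_gain h) 1 = rvar h 1 + gain m R W j M k"
proof -
 let ?b = "IfC (BLess (Plus (Vr 6) (Vr 14)) (Vr 7)) Skip
  (IfC (BAnd (BNot (BLess (Plus (Vr 7) (Plus (Vr 14) (Vr 14))) (Plus (Vr 6) (Vr 14))))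
    (BLess (Nm 0) (Ar 7 (Minus (Plus (Vr 6) (Vr 14)) (Vr 7))))) Skip
   (RAssign 1 (RPlus (RV 1) (RAr 0 (Plus (TCap (Ar 3 (Minus (Plus (Vr 7) (Vr 8)) (Vr 14)))) (Ar 3 (Vr 6)))))))"
 let ?g = "%p. if placed R j M p then 0 else W (j + k - R) p"
 have c: "dcore h" using h by (simp add: binv_def)
 have "rvar (sem q dp_gain h) 1 = rvar h 1 + (\<Sum>p<m. ?g p)"
  unfolding dp_gain_def
 proof (rule For_frame_rule[where I = "%i h'. rvar h' 1 = rvar h 1 + (\<Sum>p<i. ?g p)"])
  show "eval (Vr 20) h = m" "m \<le> nvar h 2" using c cp by (auto simp: dcore_def)
  show "rvar h 1 = rvar h 1 + (\<Sum>p<0. ?g p)" by simp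
  fix p h' assume p: "p < m" and I: "rvar h' 1 = rvar h 1 + (\<Sum>p<p. ?g p)" and f: "frame (For 6 (Vr 20) ?b) h h'"
  have "dcore h'" by (rule dcore_frame[OF c f]) auto
  moreover have "nvar h' 7 = j" "nvar h' 8 = k" "narr h' 7 = narr h 7" using f v by (auto simp: frame_def)
  moreover have "j + k - R < m" using v by auto
  ultimately have w: "nvar h' 7 = j" "nvar h' 8 = k" "nvar h' 14 = R" "nvar h' 2 = cp" "narr h' 3 p = L' p"
   "narr h' 3 (j + k - R) = L' (j + k - R)" "rarr h' 0 = Qr"
   "\<And>i. i \<le> 2 * R ==> narr h' 7 i = of_bool (bit (2 * M + 1) i)"
   using p h by (auto simp: dcore_def binv_def)
  define P where "P = beval (BAnd (BNot (BLess (Plus (Vr 7) (Plus (Vr 14) (Vr 14))) (Plus (Vr 6) (Vr 14))))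
    (BLess (Nm 0) (Ar 7 (Minus (Plus (Vr 6) (Vr 14)) (Vr 7))))) (setv 6 p h')"
  have P: "P \<longleftrightarrow> p + R \<le> j + 2 * R & bit (2 * M + 1) (p + R - j)"
   unfolding P_def using w(1-4) w(8)[of "p + R - j"] by (auto simp: mult_2 not_less)
  show "rvar (sem q ?b (setv 6 p h')) 1 = rvar h 1 + (\<Sum>p<Suc p. ?g p)"
  proof (cases "p + R < j")
   case True
   then show ?thesis using w I by (simp add: placed_def)
  next
   case False
   then have *: "sem q ?b (setv 6 p h') = (if P then setv 6 p h' else sem q (RAssign 1 (RPlus (RV 1)
     (RAr 0 (Plus (TCap (Ar 3 (Minus (Plus (Vr 7) (Vr 8)) (Vr 14)))) (Ar 3 (Vr 6)))))) (setv 6 p h'))"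
    using w by (simp add: P_def)
   have pl: "placed R j M p \<longleftrightarrow> P" unfolding P placed_def using False by simp
   show ?thesis unfolding * sum.lessThan_Suc pl using w I by (simp add: W_def)
  qed
 qed
 then show ?thesis by (simp add: gain_def)
qed

text \<open>The invariant of the loop over \<open>k\<close>: the recursion restricted to the
  candidates tried so far.\<close>

definition partial :: "(nat => nat => bool) => (nat => nat => real) => (nat => nat => nat) => nat => nat => nat => bool" where
 "partial ok Vt ch j M i \<longleftrightarrow> (ok (Suc j) M \<longleftrightarrow> (\<exists>k<i. cand m R ok j M k)) &
  (ok (Suc j) M --> cand m R ok j M (ch (Suc j) M) &
    Vt (Suc j) M = Vt j (2 * M + 1 - 2 ^ ch (Suc j) M) + gain m R W j M (ch (Suc j) M) &
    (\<forall>k<i. cand m R ok j M k --> Vt j (2 * M + 1 - 2 ^ k) + gain m R W j M k \<le> Vt (Suc j) M))"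

lemma partial_full: "partial ok Vt ch j M (2 * R + 1) ==> dp_row m R W ok Vt ch j M"
proof -
 have "cand m R ok j M k \<longleftrightarrow> k < 2 * R + 1 & cand m R ok j M k" for k by (auto simp: cand_def)
 then show "partial ok Vt ch j M (2 * R + 1) ==> dp_row m R W ok Vt ch j M"
  unfolding partial_def dp_row_def by metis
qed

text \<open>The work on one code writes a single cell of each table; as rows have length
  \<open>cp\<close>, at least \<open>2 ^ (2 * R)\<close>, no other entry is affected.\<close>

definition only :: "nat => hstate => hstate => bool" where
 "only x h h' \<longleftrightarrow> (\<forall>i. i ~= x --> narr h' 5 i = narr h 5 i & narr h' 6 i = narr h 6 i & rarr h' 1 i = rarr h 1 i)"


lemma onlyD:
 assumes "only x h h'" "i ~= x"
 shows "narr h' 5 i = narr h 5 i" "narr h' 6 i = narr h 6 i" "rarr h' 1 i = rarr h 1 i"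
 using assms by (auto simp: only_def)

lemma only_trans: "only x h h' ==> only x h' h'' ==> only x h h''"
 by (simp add: only_def)

abbreviation part :: "hstate => nat => nat => nat => bool" where
 "part h \<equiv> partial (okf h) (Vf h) (chf h)"

lemma cand_only:
 assumes "only (Suc j * cp + M) h h'" "M < 2 ^ (2 * R)"
 shows "cand m R (okf h') j M = cand m R (okf h) j M"
proof -
 have "okf h' j M' = okf h j M'" if "M' < 2 ^ (2 * R)" for M'
  using assms that cp by (subst onlyD(1)[OF assms(1)]) auto
 then show ?thesis by (auto simp: cand_def fun_eq_iff)
qed

definition cinv :: "nat => nat => hstate => hstate => nat => bool" where
 "cinv j M h0 h i \<longleftrightarrow> binv M h & nvar h 7 = j & part h j M i & only (Suc j * cp + M) h0 h"

lemma binv_frame: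
 assumes "binv M h" "frame c h h'" "mv c \<inter> {2,14,20,27,21,22} = {}" "ma c \<inter> {3,4,7} = {}" "0 \<notin> mra c"
 shows "binv M h'"
proof -
 have "dcore h'" by (rule dcore_frame[OF _ assms(2)]) (use assms in "auto simp: binv_def")
 moreover have "nvar h' 21 = nvar h 21" "nvar h' 22 = nvar h 22" "narr h' 7 = narr h 7"
  using assms by (auto intro!: frame_nvar[OF assms(2)] frame_narr[OF assms(2)])
 ultimately show ?thesis using assms(1) by (simp add: binv_def)
qed

lemma dp_try_spec:
 assumes I: "cinv j M h0 h k" and k: "nvar h 8 = k" "k < 2 * R + 1" and M: "M < 2 ^ (2 * R)"
 shows "cinv j M h0 (sem q dp_try h) (Suc k)"
proof -
 let ?x = "Suc j * cp + M" and ?M = "2 * M + 1 - 2 ^ k"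
 let ?test = "BAnd (BLess (Nm 0) (Ar 7 (Vr 8))) (BAnd (BNot (BLess (Plus (Vr 7) (Vr 8)) (Vr 14)))
    (BAnd (BLess (Plus (Vr 7) (Vr 8)) (Plus (Vr 20) (Vr 14))) (BAnd (BLess (Vr 25) (Vr 27))
     (BLess (Nm 0) (Ar 5 (Plus (TCap (Vr 7)) (Vr 25)))))))"
 let ?upd = "IfC (BAnd (BLess (Nm 0) (Ar 5 row_next)) (BNot (BRLess (RAr 1 row_next) (RV 1)))) Skip
     (seqs [RAStore 1 row_next (RV 1), AStore 6 row_next (Vr 8), AStore 5 row_next (Nm 1)])"
 have b: "binv M h" and p: "part h j M k" and o: "only ?x h0 h" and j: "nvar h 7 = j"
  using I by (auto simp: cinv_def)
 have c: "dcore h" using b by (simp add: binv_def)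
 define h1 where "h1 = setv 25 ?M h"
 have e: "sem q dp_try h = sem q (IfC ?test (seqs [RAssign 1 (RAr 1 (Plus (TCap (Vr 7)) (Vr 25))), dp_gain, ?upd]) Skip) h1"
  using b c k by (simp add: dp_try_def h1_def binv_def dcore_def)
 have b1: "binv M h1" using b by (simp add: h1_def binv_def dcore_def)
 have test: "beval ?test h1 \<longleftrightarrow> cand m R (okf h) j M k"
  using b c k j by (auto simp: h1_def binv_def dcore_def cand_def not_less)
 show ?thesis
 proof (cases "cand m R (okf h) j M k")
  case False
  then have nt: "\<not> beval ?test h1" using test by simp
  have "sem q dp_try h = h1" unfolding e sem.simps(9) if_not_P[OF nt] by simp
  moreover have "part h1 j M (Suc k)"
   using p False by (auto simp: partial_def h1_def less_Suc_eq)
  moreover have "only ?x h0 h1" "nvar h1 7 = j" using o j by (auto simp: only_def h1_def)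
  ultimately show ?thesis using b1 by (simp add: cinv_def)
 next
  case True
  define v where "v = Vf h j ?M + gain m R W j M k"
  define h2 where "h2 = h1\<lparr>rvar := (rvar h1)(1 := Vf h j ?M)\<rparr>"
  define h3 where "h3 = sem q dp_gain h2"
  have e3: "sem q dp_try h = sem q ?upd h3"
  proof -
   have yt: "beval ?test h1" using test True by simp
   have "eval (Plus (TCap (Vr 7)) (Vr 25)) h1 = j * cp + ?M"
    using j c by (simp add: h1_def dcore_def)
   then have "sem q (RAssign 1 (RAr 1 (Plus (TCap (Vr 7)) (Vr 25)))) h1 = h2"
    by (simp add: h2_def h1_def del: eval.simps)
   then show ?thesis unfolding e
    by (subst sem.simps(9), subst if_P[OF yt]) (simp only: seqs.simps sem.simps(8) h3_def)
  qed
  have b2: "binv M h2" using b1 by (simp add: h2_def binv_def dcore_def)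
  have v2: "nvar h2 7 = j" "nvar h2 8 = k" "rvar h2 1 = Vf h j ?M" by (auto simp: h2_def h1_def j k)
  have r3: "rvar h3 1 = v" unfolding h3_def v_def
   by (subst dp_gain_spec[OF b2 v2(1,2)]) (use True v2 in "auto simp: cand_def")
  have f3: "frame dp_gain h2 h3" unfolding h3_def by (rule frame_sem)
  have b3: "binv M h3" by (rule binv_frame[OF b2 f3]) (auto simp: dp_gain_def)
  have v3: "nvar h3 7 = j" "nvar h3 8 = k" "nvar h3 21 = M" "nvar h3 2 = cp" "narr h3 5 = narr h 5"
   "narr h3 6 = narr h 6" "rarr h3 1 = rarr h 1"
   using f3 v2 b3 by (auto simp: frame_def dp_gain_def h2_def h1_def binv_def dcore_def)
  have x: "eval row_next h3 = ?x" using v3 by (simp add: row_next_def)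
  have xj: "j * cp + M' ~= ?x" if "M' < 2 ^ (2 * R)" for M'
   using that M cp by simp
  show ?thesis
  proof (cases "okf h (Suc j) M & \<not> Vf h (Suc j) M < v")
   case keep: True
   then have "sem q dp_try h = h3" unfolding e3 using x v3 r3 by simp
   moreover have "part h3 j M (Suc k)"
    using p keep True unfolding partial_def v3 less_Suc_eq by (auto simp: v_def)
   moreover have "only ?x h0 h3" using o v3 by (simp add: only_def)
   ultimately show ?thesis using b3 v3 by (simp add: cinv_def)
  next
   case change: False
   define h4 where "h4 = sem q dp_try h"
   have "h4 = sem q (seqs [RAStore 1 row_next (RV 1), AStore 6 row_next (Vr 8), AStore 5 row_next (Nm 1)]) h3"
   proof -
    have nt: "\<not> beval (BAnd (BLess (Nm 0) (Ar 5 row_next)) (BNot (BRLess (RAr 1 row_next) (RV 1)))) h3"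
     using change x v3 r3 by auto
    show ?thesis unfolding h4_def e3 by (subst sem.simps(9), subst if_not_P[OF nt]) (rule refl)
   qed
   then have h4: "h4 = h3\<lparr>rarr := (rarr h3)(1 := (rarr h3 1)(?x := v)), narr := (narr h3)(6 := (narr h3 6)(?x := k),
     5 := (narr h3 5)(?x := 1))\<rparr>"
    using x v3 r3 by (simp add: row_next_def)
   have o4: "only ?x h h4" unfolding h4 only_def using v3 by simp
   have c4: "cand m R (okf h4) j M = cand m R (okf h) j M" by (rule cand_only[OF o4 M])
   have V4: "Vf h4 j (2 * M + 1 - 2 ^ k') = Vf h j (2 * M + 1 - 2 ^ k')" if "cand m R (okf h) j M k'" for k'
    by (rule onlyD(3)[OF o4 xj]) (use that in "simp add: cand_def")
   have new: "okf h4 (Suc j) M" "chf h4 (Suc j) M = k" "Vf h4 (Suc j) M = v" unfolding h4 by simp_all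
   have le: "Vf h j (2 * M + 1 - 2 ^ k') + gain m R W j M k' \<le> v" if "k' < Suc k" "cand m R (okf h) j M k'" for k'
   proof (cases "k' = k")
    case False
    then have "okf h (Suc j) M" "Vf h j (2 * M + 1 - 2 ^ k') + gain m R W j M k' \<le> Vf h (Suc j) M"
     using p that unfolding partial_def less_Suc_eq by blast+
    then show ?thesis using change by auto
   qed (simp add: v_def)
   have "part h4 j M (Suc k)"
    unfolding partial_def c4 new using True V4 le new by (auto simp: v_def)
   moreover have "binv M h4" using b3 unfolding h4 by (simp add: binv_def dcore_def)
   moreover have "nvar h4 7 = j" unfolding h4 using v3 by simp
   ultimately show ?thesis using only_trans[OF o o4] by (simp add: cinv_def h4_def)
  qed
 qed
qed

lemma dp_cell_spec:
 assumes h: "dcore h" and M: "nvar h 21 = M" "M < 2 ^ (2 * R)" and j: "nvar h 7 = j"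
 shows "dp_row m R W (okf (sem q dp_cell h)) (Vf (sem q dp_cell h)) (chf (sem q dp_cell h)) j M &
  only (Suc j * cp + M) h (sem q dp_cell h)"
proof -
 let ?x = "Suc j * cp + M"
 define h1 where "h1 = sem q dp_bits h"
 have b1: "binv M h1" unfolding h1_def by (rule dp_bits_spec[OF h M])
 have f1: "frame dp_bits h h1" unfolding h1_def by (rule frame_sem)
 have v1: "nvar h1 7 = j" "nvar h1 21 = M" "nvar h1 2 = cp" "narr h1 5 = narr h 5" "narr h1 6 = narr h 6" "rarr h1 1 = rarr h 1"
  using f1 j b1 by (auto simp: frame_def dp_bits_def binv_def dcore_def)
 define h2 where "h2 = sem q (AStore 5 row_next (Nm 0)) h1"
 have h2: "h2 = h1\<lparr>narr := (narr h1)(5 := (narr h1 5)(?x := 0))\<rparr>"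
  using v1 by (simp add: h2_def row_next_def)
 have i0: "cinv j M h h2 0"
  using b1 v1 unfolding h2 by (auto simp: cinv_def binv_def dcore_def partial_def only_def)
 let ?l = "For 8 (Plus (Plus (Vr 14) (Vr 14)) (Nm 1)) dp_try"
 have "cinv j M h (sem q ?l h2) (2 * R + 1)"
 proof (rule For_frame_rule[where I = "%k h'. cinv j M h h' k"])
  show "eval (Plus (Plus (Vr 14) (Vr 14)) (Nm 1)) h2 = 2 * R + 1" "2 * R + 1 \<le> nvar h2 2"
   using i0 cp by (auto simp: cinv_def binv_def dcore_def)
  fix k h' assume k: "k < 2 * R + 1" "cinv j M h h' k"
  have "cinv j M h (setv 8 k h') k" using k(2) by (simp add: cinv_def binv_def dcore_def only_def)
  then show "cinv j M h (sem q dp_try (setv 8 k h')) (Suc k)" using k(1) M(2) by (intro dp_try_spec) auto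
 qed (rule i0)
 then show ?thesis by (auto simp: dp_cell_def h1_def h2_def cinv_def intro: partial_full)
qed

text \<open>Level 0 is initialized, and the recursion holds for the entries processed so far in
  lexicographic order; index \<open>j\<close> of \<open>dp_row\<close> produces level
  \<open>Suc j\<close>.\<close>

definition tinv :: "nat => nat => hstate => bool" where
 "tinv k i h \<longleftrightarrow> (\<forall>M<2^(2*R). okf h 0 M \<longleftrightarrow> M = 2 ^ R - 1) & Vf h 0 (2 ^ R - 1) = 0 &
  (\<forall>j M. M < 2 ^ (2 * R) --> j < k \<or> j = k & M < i --> dp_row m R W (okf h) (Vf h) (chf h) j M)"

lemma pow_R: "2 ^ R - 1 < (2::nat) ^ (2 * R)"
proof -
 have "(2::nat) ^ R \<le> 2 ^ (2 * R)" by (rule power_increasing) auto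
 then show ?thesis using zero_less_power[of "2::nat" R] by linarith
qed

text \<open>The cell just written has level \<open>Suc k\<close> and code \<open>i\<close>. The
  recursion of an entry processed earlier refers to other cells only, hence persists.\<close>

lemma tinv_step:
 assumes I: "tinv k i h" and i: "i < 2 ^ (2 * R)" and o: "only (Suc k * cp + i) h h'"
  and row: "dp_row m R W (okf h') (Vf h') (chf h') k i"
 shows "tinv k (Suc i) h'"
proof -
 have eq: "okf h' j M = okf h j M" "Vf h' j M = Vf h j M" "chf h' j M = chf h j M"
  if "M < 2 ^ (2 * R)" "j ~= Suc k \<or> M ~= i" for j M
 proof -
  have "j * cp + M ~= Suc k * cp + i" using that i cp by (subst idx_inj) auto
  then show "okf h' j M = okf h j M" "Vf h' j M = Vf h j M" "chf h' j M = chf h j M"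
   using onlyD[OF o, of "j * cp + M"] by (simp_all only: not_False_eq_True)
 qed
 show ?thesis unfolding tinv_def
 proof (intro conjI allI impI)
  show "okf h' 0 M \<longleftrightarrow> M = 2 ^ R - 1" if "M < 2 ^ (2 * R)" for M
   using I that eq(1)[of M 0] by (simp add: tinv_def)
  show "Vf h' 0 (2 ^ R - 1) = 0" using I eq(2)[OF pow_R, of 0] by (simp add: tinv_def)
  fix j M assume M: "M < 2 ^ (2 * R)" and jM: "j < k \<or> j = k & M < Suc i"
  show "dp_row m R W (okf h') (Vf h') (chf h') j M"
  proof (cases "j = k & M = i")
   case False
   then have "dp_row m R W (okf h) (Vf h) (chf h) j M" using I M jM by (auto simp: tinv_def less_Suc_eq)
   moreover have "dp_row m R W (okf h') (Vf h') (chf h') j M \<longleftrightarrow> dp_row m R W (okf h) (Vf h) (chf h) j M"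
   proof (rule dp_row_cong)
    have jk: "j ~= Suc k" and jM': "Suc j ~= Suc k \<or> M ~= i" using jM False by auto
    show "okf h' j M' = okf h j M' & Vf h' j M' = Vf h j M'" if "M' < 2 ^ (2 * R)" for M'
     using eq(1)[OF that disjI1[OF jk]] eq(2)[OF that disjI1[OF jk]] ..
    show "okf h' (Suc j) M = okf h (Suc j) M" "Vf h' (Suc j) M = Vf h (Suc j) M" "chf h' (Suc j) M = chf h (Suc j) M"
     by (rule eq[OF M jM'])+
   qed
   ultimately show ?thesis by simp
  qed (use row in simp)
 qed
qed

lemma tinv_next: "tinv k (2 ^ (2 * R)) h ==> tinv (Suc k) 0 h"
 unfolding tinv_def less_Suc_eq by auto

lemma dp_table_spec:
 assumes h: "dcore h" and I: "tinv 0 0 h"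
 shows "tinv m 0 (sem q (For 7 (Vr 20) (For 21 (Vr 27) dp_cell)) h)"
proof (rule For_frame_rule[where I = "%k h'. tinv k 0 h'"])
 have m: "mv dp_cell \<inter> {2,14,20,27,7} = {}" "ma dp_cell \<inter> {3,4} = {}" "0 \<notin> mra dp_cell"
  by (auto simp: dp_cell_def dp_bits_def dp_try_def dp_gain_def)
 show "eval (Vr 20) h = m" "m \<le> nvar h 2" using h cp by (auto simp: dcore_def)
 show "tinv 0 0 h" by (rule I)
 fix k h' assume k: "k < m" and I: "tinv k 0 h'" and f: "frame (For 7 (Vr 20) (For 21 (Vr 27) dp_cell)) h h'"
 have c: "dcore h'" by (rule dcore_frame[OF h f]) (use m in auto)
 define h1 where "h1 = setv 7 k h'"
 have c1: "dcore h1" using c by (simp add: h1_def dcore_def)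
 have "tinv k (2 ^ (2 * R)) (sem q (For 21 (Vr 27) dp_cell) h1)"
 proof (rule For_frame_rule[where I = "%i h'. tinv k i h'"])
  show "eval (Vr 27) h1 = 2 ^ (2 * R)" "2 ^ (2 * R) \<le> nvar h1 2" using c1 cp by (auto simp: dcore_def)
  show "tinv k 0 h1" using I by (simp add: tinv_def h1_def)
  fix i h'' assume i: "i < 2 ^ (2 * R)" and I: "tinv k i h''" and f: "frame (For 21 (Vr 27) dp_cell) h1 h''"
  have "dcore h''" by (rule dcore_frame[OF c1 f]) (use m in auto)
  then have c2: "dcore (setv 21 i h'')" by (simp add: dcore_def)
  have "nvar h'' 7 = nvar h1 7" by (rule frame_nvar[OF f]) (use m in auto)
  then have "nvar (setv 21 i h'') 7 = k" by (simp add: h1_def)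
  from dp_cell_spec[OF c2 _ i this] have d: "dp_row m R W (okf (sem q dp_cell (setv 21 i h'')))
   (Vf (sem q dp_cell (setv 21 i h''))) (chf (sem q dp_cell (setv 21 i h''))) k i"
   "only (Suc k * cp + i) (setv 21 i h'') (sem q dp_cell (setv 21 i h''))" by auto
  show "tinv k (Suc i) (sem q dp_cell (setv 21 i h''))"
   by (rule tinv_step[OF _ i d(2,1)]) (use I in "simp add: tinv_def")
 qed
 then show "tinv (Suc k) 0 (sem q (For 21 (Vr 27) dp_cell) (setv 7 k h'))"
  unfolding h1_def by (rule tinv_next)
qed

lemma dp_trace_spec:
 assumes h: "dcore h" and I: "tinv m 0 h"
 defines "f \<equiv> tback R (chf h) m (2 ^ R - 1)"
 shows "rlocal m R f" "\<And>g. rlocal m R g ==> list_score W m g \<le> list_score W m f"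
  "\<forall>p<m. narr (sem q dp_trace h) 0 p = L' (f p)"
proof -
 have row: "dp_row m R W (okf h) (Vf h) (chf h) j M" if "j < m" "M < 2 ^ (2 * R)" for j M
  using I that by (simp add: tinv_def)
 have base: "\<And>M. M < 2 ^ (2 * R) ==> okf h 0 M \<longleftrightarrow> M = 2 ^ R - 1" "Vf h 0 (2 ^ R - 1) = 0"
  using I unfolding tinv_def by blast+
 note opt = dp_optimal[OF row base]
 show "rlocal m R f" unfolding f_def by (rule opt(1))
 show "\<And>g. rlocal m R g ==> list_score W m g \<le> list_score W m f" unfolding f_def by (rule opt(2))
 let ?b = "seqs [Assign 7 (Minus (Minus (Vr 20) (Nm 1)) (Vr 6)), Assign 8 (Ar 6 row_next),
   AStore 0 (Vr 7) (Ar 3 (Minus (Plus (Vr 7) (Vr 8)) (Vr 14))),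
   Assign 21 (Minus (Plus (Plus (Vr 21) (Vr 21)) (Nm 1)) (Ar 4 (Vr 8)))]"
 define h1 where "h1 = setv 21 (2 ^ R - 1) h"
 have c1: "dcore h1" using h by (simp add: h1_def dcore_def)
 have e: "sem q dp_trace h = sem q (For 6 (Vr 20) ?b) h1"
  using h by (simp add: dp_trace_def h1_def dcore_def)
 \<comment> \<open>The trace runs from the last place downwards: what remains is the traceback from
   the current code, what has been read off is in array 0.\<close>
 let ?I = "%i h'. nvar h' 21 < 2 ^ (2 * R) & okf h (m - i) (nvar h' 21) &
  (\<forall>p<m - i. tback R (chf h) (m - i) (nvar h' 21) p = f p) & (\<forall>p<m. m - i \<le> p --> narr h' 0 p = L' (f p))"
 have "?I m (sem q dp_trace h)" unfolding e
 proof (rule For_frame_rule[where I = ?I])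
  show "eval (Vr 20) h1 = m" "m \<le> nvar h1 2" using c1 cp by (auto simp: dcore_def)
  show "?I 0 h1" using opt(3) pow_R by (simp add: h1_def f_def)
  fix i h' assume i: "i < m" and I: "?I i h'" and fr: "frame (For 6 (Vr 20) ?b) h1 h'"
  have "dcore h'" by (rule dcore_frame[OF c1 fr]) auto
  then have v: "nvar h' 2 = cp" "nvar h' 20 = m" "nvar h' 14 = R" "\<And>p. p < m ==> narr h' 3 p = L' p"
   "\<And>k. k \<le> 2 * R ==> narr h' 4 k = 2 ^ k" by (auto simp: dcore_def)
  have a6: "narr h' 6 = narr h 6" using fr by (auto simp: frame_def h1_def)
  define M where "M = nvar h' 21"
  obtain j where j: "m - i = Suc j" using i by (metis Suc_diff_Suc)
  have j': "m - 1 - i = j" "m - Suc i = j" "j < m" using j by auto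
  define k where "k = chf h (Suc j) M"
  have M: "M < 2 ^ (2 * R)" "okf h (Suc j) M" using I j by (auto simp: M_def)
  then have cd: "cand m R (okf h) j M k" using row[OF j'(3) M(1)] by (simp add: dp_row_def k_def)
  then have k: "k \<le> 2 * R" "j + k - R < m" "2 * M + 1 - 2 ^ k < 2 ^ (2 * R)" "okf h j (2 * M + 1 - 2 ^ k)"
   by (auto simp: cand_def)
  have s: "nvar (sem q ?b (setv 6 i h')) 21 = 2 * M + 1 - 2 ^ k"
   "narr (sem q ?b (setv 6 i h')) 0 = (narr h' 0)(j := L' (j + k - R))"
   using v k j' by (simp_all add: row_next_def a6 M_def k_def mult_2)
  have tb: "tback R (chf h) (Suc j) M = (tback R (chf h) j (2 * M + 1 - 2 ^ k))(j := j + k - R)"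
   by (simp add: k_def)
  have If: "\<forall>p<Suc j. tback R (chf h) (Suc j) M p = f p" using I j by (simp add: M_def)
  then have fj: "f j = j + k - R" by (auto simp: tb simp del: tback.simps)
  have "\<forall>p<j. tback R (chf h) j (2 * M + 1 - 2 ^ k) p = f p"
   using If by (auto simp: tb less_Suc_eq simp del: tback.simps)
  then show "?I (Suc i) (sem q ?b (setv 6 i h'))"
   unfolding s j' using k I fj j by (auto simp: Suc_le_eq)
 qed
 then show "\<forall>p<m. narr (sem q dp_trace h) 0 p = L' (f p)" by simp
qed

end

lemma (in dprog) dp_start_spec:
 assumes h: "dcore (setv 20 m h)" and 5: "nvar h 5 + 1 = m"
 shows "dcore (sem q dp_start h)" "tinv 0 0 (sem q dp_start h)"
proof -
 define h1 where "h1 = setv 20 m h"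
 let ?l = "For 21 (Vr 27) (AStore 5 (Vr 21) (Nm 0))"
 define h2 where "h2 = sem q ?l h1"
 have c1: "dcore h1" using h by (simp add: h1_def)
 have c2: "dcore h2" unfolding h2_def by (rule dcore_sem[OF c1]) auto
 have z: "\<forall>M<2^(2*R). narr h2 5 M = 0"
  unfolding h2_def
  by (rule For_frame_rule[where I = "%k h'. \<forall>M<k. narr h' 5 M = 0"])
   (use c1 cp in "auto simp: dcore_def less_Suc_eq")
 have a: "narr h2 4 R = 2 ^ R" using c2 by (auto simp: dcore_def)
 have e: "sem q dp_start h = h2\<lparr>narr := (narr h2)(5 := (narr h2 5)(2 ^ R - 1 := 1)), rarr := (rarr h2)(1 := (rarr h2 1)(2 ^ R - 1 := 0))\<rparr>"
 proof -
  have "nvar h2 14 = R" using c2 by (simp add: dcore_def)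
  moreover have "sem q dp_start h = sem q (SeqC (AStore 5 (Minus (Ar 4 (Vr 14)) (Nm 1)) (Nm 1))
    (RAStore 1 (Minus (Ar 4 (Vr 14)) (Nm 1)) rzero)) h2"
   using 5 by (simp add: dp_start_def h2_def h1_def)
  ultimately show ?thesis using a by simp
 qed
 show "dcore (sem q dp_start h)" unfolding e using c2 by (simp add: dcore_def)
 show "tinv 0 0 (sem q dp_start h)" unfolding e tinv_def using z by auto
qed

lemma (in dprog) dp_spec:
 assumes h: "dcore (setv 20 m h)" and 5: "nvar h 5 + 1 = m"
 obtains f where "rlocal m R f" "\<forall>g. rlocal m R g --> list_score W m g \<le> list_score W m f"
  "\<forall>p<m. narr (sem q dp h) 0 p = L' (f p)"
proof -
 define h1 where "h1 = sem q dp_start h"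
 define h2 where "h2 = sem q (For 7 (Vr 20) (For 21 (Vr 27) dp_cell)) h1"
 note s = dp_start_spec[OF h 5, folded h1_def]
 have c2: "dcore h2" unfolding h2_def
  by (rule dcore_sem[OF s(1)]) (auto simp: dp_cell_def dp_bits_def dp_try_def dp_gain_def)
 have t2: "tinv m 0 h2" unfolding h2_def by (rule dp_table_spec[OF s])
 have "sem q dp h = sem q dp_trace h2" by (simp add: dp_def h2_def h1_def)
 then show thesis using dp_trace_spec[OF c2 t2] that by metis
qed

section \<open>A stage as a whole\<close>

lemma ins_listing:
 assumes "listing t L" "b \<le> t"
 shows "listing (Suc t) (ins L t b)"
proof -
 have L: "inj_on L {..<t}" "L ` {..<t} = {..<t}" using assms(1) by (auto simp: listing_def bij_betw_def)
 have Lt: "L p < t" if "p < t" for p using L(2) that by blast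
 have "inj_on (ins L t b) {..<Suc t}"
 proof (rule inj_onI)
  fix p p' assume p: "p \<in> {..<Suc t}" "p' \<in> {..<Suc t}" "ins L t b p = ins L t b p'"
  have *: "ins L t b x = t \<longleftrightarrow> x = b" if "x < Suc t" for x
  proof -
   consider "x < b" | "x = b" | "b < x" by linarith
   then show ?thesis
   proof cases
    case 1
    then show ?thesis using Lt[of x] assms(2) by (simp add: ins_def)
   next
    case 3
    moreover have "x - 1 < t" using that 3 by linarith
    ultimately show ?thesis using Lt[of "x - 1"] by (simp add: ins_def)
   qed (simp add: ins_def)
  qed
  show "p = p'"
  proof (cases "p = b \<or> p' = b")
   case True
   have pl: "p < Suc t" "p' < Suc t" using p(1,2) by simp_all
   have "p = b \<longleftrightarrow> p' = b"
    unfolding *[OF pl(1), symmetric] *[OF pl(2), symmetric] p(3) by (rule refl)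
   then show ?thesis using True by blast
  next
   case False
   define d where "d x = (if x < b then x else x - 1)" for x
   have i: "ins L t b x = L (d x) & d x < t" if "x < Suc t" "x ~= b" for x
   proof (cases "x < b")
    case True
    then show ?thesis using assms(2) by (simp add: ins_def d_def)
   next
    case False
    then have "b < x" "x - 1 < t" using that by linarith+
    then show ?thesis using False by (simp add: ins_def d_def)
   qed
   have "L (d p) = L (d p')" "d p < t" "d p' < t" using p i[of p] i[of p'] False by auto
   then have "d p = d p'" using inj_onD[OF L(1)] by simp
   then show ?thesis using False unfolding d_def by (cases "p < b"; cases "p' < b") auto
  qed
 qed
 moreover have "ins L t b ` {..<Suc t} \<subseteq> {..<Suc t}"
 proof
  fix y assume "y \<in> ins L t b ` {..<Suc t}"
  then obtain p where p: "p < Suc t" "y = ins L t b p" by auto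
  consider "p < b" | "p = b" | "b < p" by linarith
  then show "y \<in> {..<Suc t}"
  proof cases
   case 1
   then show ?thesis using p assms(2) Lt[of p] by (simp add: ins_def)
  next
   case 3
   then have "p - 1 < t" using p(1) by linarith
   then show ?thesis using p(2) 3 Lt[of "p - 1"] by (simp add: ins_def)
  qed (simp add: p ins_def)
 qed
 ultimately show ?thesis unfolding listing_def bij_betw_def
  using endo_inj_surj[of "{..<Suc t}" "ins L t b"] by auto
qed

definition near_pairs :: "(nat => nat => real) => nat => nat => nat => nat => (nat => nat) => nat set set" where
 "near_pairs q n A G t L = (let T = 40 * G; H = 300 * G + 4 * (T * A);
   l = min (located (n + 2) (gcell_test A q T t L) T * (T * A)) t
  in (%p. {t, L p}) ` {p. p < t & l \<le> p + H & p \<le> l + H})"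

text \<open>All that correctness uses of a stage, free of program states: \<open>b\<close> is a best
  slot and \<open>f\<close> a best local rearrangement, both for the values known by then. Ties are
  left open.\<close>

definition stage_step :: "(nat => nat => real) => nat => nat => (nat => nat) => nat set set => (nat => nat) => bool" where
 "stage_step q G t L E L2 \<longleftrightarrow> (\<exists>b f. b \<le> t &
  (\<forall>p\<le>t. slot_score (qtab q E) L t p \<le> slot_score (qtab q E) L t b) & rlocal (Suc t) (80 * G) f &
  (\<forall>g. rlocal (Suc t) (80 * G) g -->
    list_score (%p p'. qtab q E (ins L t b p) (ins L t b p')) (Suc t) g \<le>
    list_score (%p p'. qtab q E (ins L t b p) (ins L t b p')) (Suc t) f) &
  (\<forall>p\<le>t. L2 p = ins L t b (f p)))"

lemma stage_step_listing:
 assumes "stage_step q G t L E L2" "listing t L"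
 shows "listing (Suc t) L2"
proof -
 obtain b f where b: "b \<le> t" "rlocal (Suc t) (80 * G) f" "\<forall>p\<le>t. L2 p = ins L t b (f p)"
  using assms(1) unfolding stage_step_def by blast
 have "listing (Suc t) f" using b(2) by (simp add: rlocal_def)
 then have "bij_betw (ins L t b \<circ> f) {..<Suc t} {..<Suc t}"
  using ins_listing[OF assms(2) b(1)] unfolding listing_def by (rule bij_betw_trans)
 moreover have "bij_betw (ins L t b \<circ> f) {..<Suc t} {..<Suc t} \<longleftrightarrow> bij_betw L2 {..<Suc t} {..<Suc t}"
  by (rule bij_betw_cong) (use b(3) in "auto simp: less_Suc_eq_le")
 ultimately show ?thesis by (simp add: listing_def)
qed

definition env :: "nat => nat => nat => nat => hstate => bool" where
 "env n A cp G h \<longleftrightarrow> nvar h 0 = n & nvar h 1 = A & nvar h 2 = cp & nvar h 11 = 40 * G * A &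
  nvar h 13 = 40 * G & nvar h 14 = 80 * G & nvar h 17 = 300 * G + 4 * (40 * G * A) & nvar h 27 = 2 ^ (160 * G) &
  (\<forall>k\<le>160*G. narr h 4 k = 2 ^ k)"

lemma (in insertion) stage_spec:
 assumes h: "core h" and tab: "tabulated q cp E h" and L: "listing t L" and G: "0 < G"
 defines "h' \<equiv> sem q stage h" and "E' \<equiv> E \<union> near_pairs q n A G t L"
 shows "stage_step q G t L E' (narr h' 0)" "tabulated q cp E' h'" "grow t L (T * A + (2 * H + 1)) h h'" "env n A cp G h'"
proof -
 define h1 where "h1 = sem q search h"
 define h2 where "h2 = sem q inspect h1"
 define h3 where "h3 = sem q best_point h2"
 define h4 where "h4 = sem q insert_item h3"
 have e: "h' = sem q dp h4" by (simp add: h'_def stage_def h1_def h2_def h3_def h4_def)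
 have Enew: "E' = E \<union> new_pairs t"
  by (simp add: E'_def near_pairs_def new_pairs_def Let_def not_less min_le_iff_disj)
 have c1: "core h1" unfolding h1_def by (rule core_sem[OF h])
  (auto simp: search_def search_round_def med_def test_cell_def mul_def probe_def double_def)
 have t1: "tabulated q cp E h1"
 proof -
  have "rarr h1 0 = rarr h 0" unfolding h1_def
   by (rule sem_rarr) (auto simp: search_def search_round_def med_def test_cell_def mul_def probe_def double_def)
  then show ?thesis using tab by (simp add: tabulated_def)
 qed
 note s1 = search_spec[OF h G, folded h1_def]
 note s2 = inspect_spec[OF c1 conjunct1[OF s1] t1 L, folded h2_def]
 have c2: "core h2" unfolding h2_def by (rule core_sem[OF c1]) (auto simp: inspect_def)
 note s3 = best_point_spec[OF c2, folded h3_def]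
 have c3: "core h3" unfolding h3_def by (rule core_sem[OF c2]) (auto simp: best_point_def)
 define b where "b = nvar h3 19"
 have bt: "b \<le> t" using s3 by (simp add: b_def)
 note s4 = insert_item_spec[OF c3 b_def[symmetric] bt, folded h4_def]
 have c4: "core h4" unfolding h4_def by (rule core_sem[OF c3]) (auto simp: insert_item_def)
 have "rarr h3 0 = rarr h2 0" unfolding h3_def by (rule sem_rarr) (auto simp: best_point_def)
 moreover have "rarr h4 0 = rarr h3 0" unfolding h4_def by (rule sem_rarr) (auto simp: insert_item_def)
 moreover have "rarr h' 0 = rarr h4 0" unfolding e
  by (rule sem_rarr) (auto simp: dp_def dp_start_def dp_cell_def dp_bits_def dp_try_def dp_gain_def dp_trace_def)
 ultimately have r: "rarr h4 0 = rarr h2 0" "rarr h' 0 = rarr h2 0" by simp_all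
 have t2: "tabulated q cp E' h2" using s2 by (simp add: Enew)
 then show "tabulated q cp E' h'" using r by (simp add: tabulated_def)
 have Q: "rarr h2 0 (i * cp + j) = qtab q E' i j" if "i \<le> t" "j \<le> t" for i j
  using t2 that tn cp by (auto simp: tabulated_def)
 have Lt: "L p < t" if "p < t" for p using L that by (auto simp: listing_def bij_betw_def)
 have c5: "env n A cp G h4" using c4 by (simp add: core_def env_def)
 have "nvar h' i = nvar h4 i" if "i \<in> {0,1,2,11,13,14,17,27}" for i unfolding e
  by (rule sem_nvar) (use that in "auto simp: dp_def dp_start_def dp_cell_def dp_bits_def dp_try_def dp_gain_def dp_trace_def")
 moreover have "narr h' 4 = narr h4 4" unfolding e
  by (rule sem_narr) (auto simp: dp_def dp_start_def dp_cell_def dp_bits_def dp_try_def dp_gain_def dp_trace_def)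
 ultimately show "env n A cp G h'" using c5 by (simp add: env_def)
 have "seen h' = seen h4" unfolding e
  by (rule cblind_seen) (simp add: dp_def dp_start_def dp_cell_def dp_bits_def dp_try_def dp_gain_def dp_trace_def)
 moreover have "seen h4 = seen h3" unfolding h4_def by (rule cblind_seen) (simp add: insert_item_def)
 moreover have "seen h3 = seen h2" unfolding h3_def by (rule cblind_seen) (simp add: best_point_def)
 ultimately have "seen h' = seen h2" by simp
 moreover have "grow t L (T * A + (2 * H + 1)) h h2"
  by (rule grow_trans[OF conjunct2[OF s1] conjunct2[OF s2]]) simp
 ultimately show "grow t L (T * A + (2 * H + 1)) h h'" by (simp add: grow_def)
 interpret D: dprog q "Suc t" "80 * G" cp "ins L t b" "rarr h2 0"
  by unfold_locales (use cp tn in auto)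
 have "D.dcore (setv 20 (Suc t) h4)"
  using c4 s4 r unfolding D.dcore_def core_def by (auto simp: less_Suc_eq_le)
 moreover have "nvar h4 5 + 1 = Suc t" using c4 by (simp add: core_def)
 ultimately obtain f where f: "rlocal (Suc t) (80 * G) f"
  "\<forall>g. rlocal (Suc t) (80 * G) g --> list_score D.W (Suc t) g \<le> list_score D.W (Suc t) f"
  "\<forall>p<Suc t. narr h' 0 p = ins L t b (f p)"
  unfolding e by (rule D.dp_spec)
 have il: "listing (Suc t) (ins L t b)" by (rule ins_listing[OF L bt])
 have W: "list_score D.W (Suc t) g = list_score (%p p'. qtab q E' (ins L t b p) (ins L t b p')) (Suc t) g"
  if "listing (Suc t) g" for g
  unfolding list_score_def
 proof (intro sum.cong refl)
  fix j i assume "j \<in> {..<Suc t}" "i \<in> {..<j}"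
  then have "i < j" "j < Suc t" by auto
  then have "g i < Suc t" "g j < Suc t" using that by (auto simp: listing_def bij_betw_def)
  then have "ins L t b (g i) < Suc t" "ins L t b (g j) < Suc t" using il by (auto simp: listing_def bij_betw_def)
  then show "D.W (g i) (g j) = qtab q E' (ins L t b (g i)) (ins L t b (g j))"
   unfolding D.W_def by (intro Q) auto
 qed
 have sl: "slot_score (%i j. rarr h2 0 (i * cp + j)) L t p = slot_score (qtab q E') L t p" for p
  unfolding slot_score_def using Lt by (intro sum.cong) (auto intro!: Q less_imp_le)
 show "stage_step q G t L E' (narr h' 0)" unfolding stage_step_def
  using bt s3 f W by (intro exI[of _ b] exI[of _ f]) (auto simp: sl b_def[symmetric] rlocal_def less_Suc_eq_le)
qed

subsection \<open>The whole run\<close>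

definition hst :: "(nat => nat => real) => hstate => nat => hstate" where
 "hst q h0 t = fold (%k h. sem q stage (setv 5 k h)) [0..<t] h0"

lemma hst_0 [simp]: "hst q h0 0 = h0"
 and hst_Suc: "hst q h0 (Suc t) = sem q stage (setv 5 t (hst q h0 t))"
 by (simp_all add: hst_def)

lemma hst_sem: "t \<le> nvar h0 2 ==> hst q h0 t = sem q (For 5 (Nm t) stage) h0"
 by (simp add: hst_def sem.simps(10))

definition order_at :: "(nat => nat => real) => hstate => nat => nat => nat" where
 "order_at q h0 t = narr (hst q h0 t) 0"

definition known :: "(nat => nat => real) => nat => nat => nat => hstate => nat => nat set set" where
 "known q n A G h0 t = (\<Union>s<t. near_pairs q n A G s (order_at q h0 s))"

lemma known_Suc: "known q n A G h0 (Suc t) = known q n A G h0 t \<union> near_pairs q n A G t (order_at q h0 t)"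
 by (auto simp: known_def less_Suc_eq)

text \<open>The search inspects at most \<open>T * A\<close> signals, the range around the located
  place at most \<open>2 * H + 1\<close>.\<close>

definition samples :: "nat => nat => nat" where
 "samples G A = 40 * G * A + (2 * (300 * G + 4 * (40 * G * A)) + 1)"

locale run =
 fixes q :: "nat => nat => real" and n A cp G :: nat and h0 :: hstate
 assumes cp: "n + 2 \<le> cp" "160 * G + 1 \<le> cp" "2 ^ (160 * G) \<le> cp" and G: "0 < G"
  and h0: "env n A cp G h0" "rarr h0 0 = (%_. 0)" "seen h0 = {}"
begin

text \<open>The factor \<open>t - 1\<close> matters: item 0 inspects nothing, so the count is 0 for
  n = 1, where the allowed number C n log n is 0 as well.\<close>

lemma hst_inv:
 "t \<le> n ==> env n A cp G (hst q h0 t) & listing t (order_at q h0 t) &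
  tabulated q cp (known q n A G h0 t) (hst q h0 t) & seen (hst q h0 t) \<subseteq> item_pairs t &
  card (seen (hst q h0 t)) \<le> (t - 1) * samples G A"
proof (induction t)
 case 0
 show ?case using h0 by (auto simp: order_at_def listing_def bij_betw_def tabulated_def known_def qtab_def)
next
 case (Suc t)
 let ?L = "order_at q h0 t"
 define h where "h = setv 5 t (hst q h0 t)"
 interpret I: insertion q n A cp G t ?L by unfold_locales (use cp Suc.prems in auto)
 have IH: "env n A cp G (hst q h0 t)" "listing t ?L" "tabulated q cp (known q n A G h0 t) (hst q h0 t)"
  "seen (hst q h0 t) \<subseteq> item_pairs t" "card (seen (hst q h0 t)) \<le> (t - 1) * samples G A" using Suc by auto
 have c: "I.core h" unfolding I.core_def using IH(1) by (simp add: env_def h_def order_at_def)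
 have tab: "tabulated q cp (known q n A G h0 t) h" using IH(3) by (simp add: tabulated_def h_def)
 have e: "hst q h0 (Suc t) = sem q stage h" by (simp add: hst_Suc h_def)
 note s = I.stage_spec[OF c tab IH(2) G, folded e known_Suc]
 from s(3) obtain S where S: "S \<subseteq> (%p. {t, ?L p}) ` {..<t}" "card S \<le> samples G A"
  "seen (hst q h0 (Suc t)) = seen (hst q h0 t) \<union> S"
  unfolding grow_def samples_def h_def by auto
 have Lt: "?L p < t" if "p < t" for p using IH(2) that by (auto simp: listing_def bij_betw_def)
 have "S \<subseteq> item_pairs (Suc t)" using S(1) Lt by (fastforce simp: item_pairs_def)
 moreover have "item_pairs t \<subseteq> item_pairs (Suc t)" by (auto simp: item_pairs_def)
 ultimately have sub: "seen (hst q h0 (Suc t)) \<subseteq> item_pairs (Suc t)" using S(3) IH(4) by blast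
 have "card (seen (hst q h0 (Suc t))) \<le> (Suc t - 1) * samples G A"
 proof (cases "t = 0")
  case True
  then have "S = {}" "seen (hst q h0 t) = {}" using S(1) h0 by auto
  then show ?thesis using S(3) by simp
 next
  case False
  have "card (seen (hst q h0 (Suc t))) \<le> card (seen (hst q h0 t)) + card S" unfolding S(3) by (rule card_Un_le)
  also have "... \<le> (t - 1) * samples G A + samples G A" using IH(5) S(2) by (rule add_mono)
  also have "... = (Suc t - 1) * samples G A" using False by (cases t) auto
  finally show ?thesis .
 qed
 then show ?case using s sub stage_step_listing[OF s(1) IH(2)] by (simp add: order_at_def)
qed

lemma hst_step:
 assumes "t < n"
 shows "stage_step q G t (order_at q h0 t) (known q n A G h0 (Suc t)) (order_at q h0 (Suc t))"
proof -
 let ?L = "order_at q h0 t"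
 define h where "h = setv 5 t (hst q h0 t)"
 interpret I: insertion q n A cp G t ?L by unfold_locales (use cp assms in auto)
 note IH = hst_inv[of t]
 have c: "I.core h" unfolding I.core_def using IH assms by (simp add: env_def h_def order_at_def)
 have tab: "tabulated q cp (known q n A G h0 t) h" using IH assms by (simp add: tabulated_def h_def)
 have e: "hst q h0 (Suc t) = sem q stage h" by (simp add: hst_Suc h_def)
 show ?thesis using I.stage_spec(1)[OF c tab _ G, folded e known_Suc] IH assms by (simp add: order_at_def[of q h0 "Suc t"])
qed

text \<open>All signals seen so far are among the first \<open>t\<close> items, so the list is a
  function of these; the signals of item \<open>t\<close> are untouched when its stage
  begins.\<close>

lemma hst_agree:
 assumes "t \<le> n" "agree q q' (item_pairs t)"
 shows "hst q' h0 t = hst q h0 t"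
proof -
 have t: "t \<le> nvar h0 2" using assms(1) cp h0 by (simp add: env_def)
 have "agree q q' (seen (hst q h0 t))"
  using hst_inv[OF assms(1)] assms(2) by (blast intro: agree_subset)
 then show ?thesis unfolding hst_sem[OF t] by (rule sem_agree)
qed

lemma finish_spec: "\<forall>p<n. outp (sem q finish (hst q h0 n)) (order_at q h0 n p) = p"
 "seen (sem q finish (hst q h0 n)) = seen (hst q h0 n)"
proof -
 let ?h = "hst q h0 n" and ?L = "order_at q h0 n"
 have e: "env n A cp G ?h" and L: "listing n ?L" using hst_inv[of n] by auto
 show "\<forall>p<n. outp (sem q finish ?h) (?L p) = p"
  unfolding finish_def
 proof (rule For_frame_rule[where I = "%k h'. \<forall>p<k. outp h' (?L p) = p"])
  show "eval (Vr 0) ?h = n" "n \<le> nvar ?h 2" using e cp by (auto simp: env_def)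
  show "\<forall>p<0. outp ?h (?L p) = p" by simp
  fix k h' assume k: "k < n" and I: "\<forall>p<k. outp h' (?L p) = p" and f: "frame (For 6 (Vr 0) (Out (Ar 0 (Vr 6)) (Vr 6))) ?h h'"
  have a: "narr h' 0 = ?L" using f by (simp add: frame_def order_at_def)
  have "?L p ~= ?L k" if "p < k" for p
   using L that k by (auto simp: listing_def bij_betw_def inj_on_def)
  then show "\<forall>p<Suc k. outp (sem q (Out (Ar 0 (Vr 6)) (Vr 6)) (setv 6 k h')) (?L p) = p"
   using I a by (auto simp: less_Suc_eq)
 qed
 show "seen (sem q finish ?h) = seen ?h" by (rule cblind_seen) (simp add: finish_def)
qed

end

section \<open>The signals\<close>

locale signal_model =
 fixes n :: nat and \<pi> :: "nat => nat" and M :: "'s measure" and D :: "nat => nat => 's => real"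
  and \<gamma> :: real and A :: nat
 assumes perm: "\<pi> permutes {..<n}"
  and dens: "signal_densities n M D"
  and biased: "strongly_biased \<gamma> A n \<pi> M D"
  and \<gamma>: "0 < \<gamma>" "\<gamma> \<le> 1"
begin

abbreviation "\<Omega> \<equiv> signals n \<pi> M D"
abbreviation "law \<equiv> signal_law \<pi> M D"
abbreviation "pairs \<equiv> item_pairs n"

lemma finite_pairs: "finite pairs"
 by (rule finite_subset[of _ "Pow {..<n}"]) (auto simp: item_pairs_def)

lemma pair_in: "a < n ==> b < n ==> a ~= b ==> {a, b} \<in> pairs"
 by (simp add: item_pairs_def)

lemma pairE:
 assumes "e \<in> pairs"
 obtains a b where "a < n" "b < n" "a < b" "e = {a, b}" "Min e = a" "Max e = b"
proof -
 from assms obtain a b where "e = {a, b}" "a ~= b" "a < n" "b < n"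
  by (auto simp: item_pairs_def card_2_iff)
 then show ?thesis using that[of a b] that[of b a] by (cases "a < b") (auto simp: insert_commute min_def max_def)
qed

lemma law_sets [simp, measurable_cong]: "sets (law e) = sets M"
 by (simp add: signal_law_def Let_def)

lemma law_space [simp]: "space (law e) = space M"
 by (simp add: signal_law_def Let_def)

lemma law_prob: "e \<in> pairs ==> prob_space (law e)"
proof -
 assume "e \<in> pairs"
 then obtain a b where "a < n" "b < n" "a < b" "e = {a, b}" "Min e = a" "Max e = b" by (rule pairE)
 then have "a < n" "b < n" "a ~= b" "Min e = a" "Max e = b" by auto
 moreover have "prob_space (density M (%s. ennreal (D x y s)))" if "x < n" "y < n" "x ~= y" for x y
  using dens that unfolding signal_densities_def by blast
 ultimately show ?thesis by (cases "\<pi> a < \<pi> b") (simp_all add: signal_law_def)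
qed

sublocale prob_space \<Omega>
 unfolding signals_def by (rule prob_space_PiM) (rule law_prob)

section \<open>Independence of disjoint groups of signals\<close>

lemma coords_indep: "indep_vars law (%e s. s e) pairs"
\<comment> \<open>The characterization of independence by product laws is applied to a nonempty
  index set.\<close>
proof (cases "pairs = {}")
 case True
 then show ?thesis by (simp add: indep_vars_def2 indep_sets_def)
next
 case False
 have rv: "(%s. s e) \<in> measurable \<Omega> (law e)" if "e \<in> pairs" for e
  unfolding signals_def using that by measurable
 have "distr \<Omega> (PiM pairs law) (%s. \<lambda>e\<in>pairs. s e) = distr \<Omega> \<Omega> (%s. s)"
  unfolding signals_def by (rule distr_cong) (auto simp: space_PiM PiE_restrict)
 also have "... = \<Omega>" by (rule distr_id)
 also have "... = PiM pairs (%e. distr \<Omega> (law e) (%s. s e))"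
  unfolding signals_def
  by (rule PiM_cong) (auto intro!: distr_PiM_component[symmetric] finite_pairs law_prob)
 finally show ?thesis by (subst indep_vars_iff_distr_eq_PiM'[OF False rv]) auto
qed

text \<open>Events determined by the signals in \<open>I\<close>. Stability under
  \<open>restrict\<close> is demanded at every point, so that an event can be transported between
  product spaces.\<close>

definition local_pred :: "nat set set => ((nat set => 's) => bool) => bool" where
 "local_pred I P \<longleftrightarrow> I \<subseteq> pairs & Measurable.pred (PiM I law) P & (\<forall>s. P (restrict s I) = P s)"

lemma local_pred_mono:
 assumes "local_pred I P" "I \<subseteq> J" "J \<subseteq> pairs"
 shows "local_pred J P"
proof -
 have "(%s. P (restrict s I)) = P" using assms(1) by (auto simp: local_pred_def)
 moreover have "Measurable.pred (PiM J law) (%s. P (restrict s I))"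
 proof -
  have "Measurable.pred (PiM I law) P" using assms(1) unfolding local_pred_def by blast
  from measurable_compose[OF measurable_restrict_subset[OF assms(2)] this] show ?thesis .
 qed
 moreover have "P (restrict s J) = P s" for s
 proof -
  have "P (restrict s J) = P (restrict (restrict s J) I)" using assms(1) unfolding local_pred_def by blast
  also have "restrict (restrict s J) I = restrict s I" using assms(2) by (auto simp: restrict_def fun_eq_iff)
  also have "P (restrict s I) = P s" using assms(1) unfolding local_pred_def by blast
  finally show ?thesis .
 qed
 ultimately show ?thesis using assms(3) by (simp add: local_pred_def)
qed

lemma local_pred_const: "I \<subseteq> pairs ==> local_pred I (%_. c)"
 by (simp add: local_pred_def)

lemma local_pred_not: "local_pred I P ==> local_pred I (%s. \<not> P s)"
 unfolding local_pred_def by (auto intro: pred_intros_logic)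

lemma local_pred_conj: "local_pred I P ==> local_pred I R ==> local_pred I (%s. P s & R s)"
 by (auto simp: local_pred_def)

lemma local_pred_ball:
 assumes "finite S" "\<And>i. i \<in> S ==> local_pred I (P i)" "I \<subseteq> pairs"
 shows "local_pred I (%s. \<forall>i\<in>S. P i s)"
 using assms by (induction S) (auto intro: local_pred_const local_pred_conj)

lemma local_pred_measurable:
 assumes "local_pred I P"
 shows "{s \<in> space \<Omega>. P s} \<in> sets \<Omega>"
 using local_pred_mono[OF assms, of pairs] assms by (auto simp: local_pred_def signals_def pred_def)

lemma indep_local:
 assumes "local_pred I P" "local_pred J R" "I \<inter> J = {}"
 shows "prob {s \<in> space \<Omega>. P s & R s} = prob {s \<in> space \<Omega>. P s} * prob {s \<in> space \<Omega>. R s}"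
proof -
 have sub: "I \<subseteq> pairs" "J \<subseteq> pairs" using assms by (auto simp: local_pred_def)
 have ind: "indep_var (PiM I law) (%s. restrict (%i. s i) I) (PiM J law) (%s. restrict (%i. s i) J)"
  by (rule indep_var_restrict[OF coords_indep assms(3) sub])
 let ?P = "{x \<in> space (PiM I law). P x}" and ?R = "{x \<in> space (PiM J law). R x}"
 have sets: "?P \<in> sets (PiM I law)" "?R \<in> sets (PiM J law)"
  using assms by (auto simp: local_pred_def pred_def)
 have rs: "restrict s I \<in> space (PiM I law)" "restrict s J \<in> space (PiM J law)" if "s \<in> space \<Omega>" for s
  using that sub by (auto simp: signals_def space_PiM)
 have P: "P (restrict s I) = P s" "R (restrict s J) = R s" for s
  using assms by (auto simp: local_pred_def)
 have "prob ((%s. (restrict s I, restrict s J)) -` (?P \<times> ?R) \<inter> space \<Omega>) =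
   prob ((%s. restrict s I) -` ?P \<inter> space \<Omega>) * prob ((%s. restrict s J) -` ?R \<inter> space \<Omega>)"
  using indep_varD[OF ind sets] by simp
 moreover have "(%s. (restrict s I, restrict s J)) -` (?P \<times> ?R) \<inter> space \<Omega> = {s \<in> space \<Omega>. P s & R s}"
  using rs P by auto
 moreover have "(%s. restrict s I) -` ?P \<inter> space \<Omega> = {s \<in> space \<Omega>. P s}" using rs P by auto
 moreover have "(%s. restrict s J) -` ?R \<inter> space \<Omega> = {s \<in> space \<Omega>. R s}" using rs P by auto
 ultimately show ?thesis by simp
qed

lemma indep_local_all:
 assumes "finite S" "\<And>r. r \<in> S ==> local_pred (I r) (P r)"
  "\<And>r r'. r \<in> S ==> r' \<in> S ==> r ~= r' ==> I r \<inter> I r' = {}"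
 shows "prob {s \<in> space \<Omega>. \<forall>r\<in>S. P r s} = (\<Prod>r\<in>S. prob {s \<in> space \<Omega>. P r s})"
 using assms
proof (induction S)
 case empty
 then show ?case by (simp add: prob_space)
next
 case (insert r S)
 have sub: "(\<Union>r\<in>S. I r) \<subseteq> pairs" using insert.prems by (auto simp: local_pred_def)
 have "local_pred (\<Union>r\<in>S. I r) (%s. \<forall>r\<in>S. P r s)"
 proof (rule local_pred_ball[OF insert.hyps(1) _ sub])
  show "local_pred (\<Union>r\<in>S. I r) (P r')" if "r' \<in> S" for r'
   by (rule local_pred_mono[OF insert.prems(1) _ sub]) (use that in auto)
 qed
 then have "prob {s \<in> space \<Omega>. P r s & (\<forall>r\<in>S. P r s)} = prob {s \<in> space \<Omega>. P r s} * prob {s \<in> space \<Omega>. \<forall>r\<in>S. P r s}"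
  by (intro indep_local[of "I r"]) (use insert in auto)
 then show ?case using insert by simp
qed

section \<open>Log-likelihood ratios and positive sums\<close>

lemma llr_measurable_local:
 assumes "I \<subseteq> pairs" "a < n" "b < n" "a ~= b" "{a, b} \<in> I"
 shows "(%s. llr D s a b) \<in> borel_measurable (PiM I law)"
proof -
 have [measurable]: "D a b \<in> borel_measurable M" "D b a \<in> borel_measurable M"
  using dens assms by (auto simp: signal_densities_def)
 have [measurable]: "(%s. s {a, b}) \<in> measurable (PiM I law) M"
 proof -
  have "(%s. s {a, b}) \<in> measurable (PiM I law) (law {a, b})"
   by (rule measurable_component_singleton[OF assms(5)])
  then show ?thesis unfolding measurable_cong_sets[OF refl law_sets] .
 qed
 show ?thesis unfolding llr_def by measurable
qed

lemma llr_restrict: "{a, b} \<in> I ==> llr D (restrict s I) a b = llr D s a b"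
 by (simp add: llr_def)

text \<open>The densities of the two orientations vanish together; where they do, both logarithms
  take the default value 0.\<close>

lemma llr_antisym:
 assumes "s \<in> space \<Omega>" "a < n" "b < n"
 shows "llr D s a b = - llr D s b a"
proof (cases "a = b")
 case False
 have sp: "s {a, b} \<in> space M"
  using assms pair_in[OF assms(2,3) False] by (auto simp: signals_def space_PiM PiE_def)
 define x where "x = D a b (s {a, b})"
 define y where "y = D b a (s {a, b})"
 have nn: "0 \<le> x" "0 \<le> y" "x = 0 \<longleftrightarrow> y = 0"
  using dens assms False sp unfolding signal_densities_def x_def y_def by auto
 have "llr D s a b = log 2 (x / y)" "llr D s b a = log 2 (y / x)"
  by (auto simp: llr_def x_def y_def insert_commute)
 then show ?thesis using nn by (cases "x = 0") (auto simp: log_divide, simp add: log_def)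
next
 case True
 have "log 2 (z / z) = 0" for z :: real by (cases "z = 0") (auto simp: log_def)
 then show ?thesis using True by (simp add: llr_def)
qed

lemma llr_antisym_on: "s \<in> space \<Omega> ==> antisym_on_lt n (llr D s)"
 unfolding antisym_on_lt_def using llr_antisym by blast

definition pairs_of :: "(nat \<times> nat) set => nat set set" where
 "pairs_of F = (%(a, b). {a, b}) ` F"

lemma upos_local:
 assumes "opairs n F" "pairs_of F \<subseteq> I" "I \<subseteq> pairs"
 shows "local_pred I (%s. upos (llr D s) F)"
proof -
 have F: "a < n & b < n & a ~= b & {a, b} \<in> I" if "(a, b) \<in> F" for a b
  using that assms by (auto simp: opairs_def pairs_of_def)
 have [measurable]: "(%s. \<Sum>(a, b)\<in>F. llr D s a b) \<in> borel_measurable (PiM I law)"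
  using F assms(3) by (auto intro!: borel_measurable_sum llr_measurable_local)
 have "(\<Sum>(a, b)\<in>F. llr D (restrict s I) a b) = (\<Sum>(a, b)\<in>F. llr D s a b)" for s
  by (rule sum.cong) (use F in "auto simp: llr_restrict")
 then show ?thesis using assms(3) unfolding local_pred_def upos_def by simp
qed

lemma pairs_of_sub: "opairs n F ==> pairs_of F \<subseteq> pairs"
 by (auto simp: pairs_of_def opairs_def intro!: pair_in)

lemma upos_measurable: "opairs n F ==> {s \<in> space \<Omega>. upos (llr D s) F} \<in> sets \<Omega>"
 by (rule local_pred_measurable[OF upos_local[OF _ order_refl pairs_of_sub]])

text \<open>\<open>strongly_biased\<close> speaks of enumerated pairs, whereas the patterns are
  sets.\<close>

lemma enum_opairs:
 assumes "opairs n F"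
 obtains a b where "distinct_pairs n (card F) a b" "bij_betw (%k. (a k, b k)) {..<card F} F"
proof -
 have fin: "finite F" using assms finite_subset unfolding opairs_def by blast
 obtain h where h: "bij_betw h {..<card F} F" using ex_bij_betw_nat_finite[OF fin] by (auto simp: atLeast0LessThan)
 let ?a = "%k. fst (h k)" and ?b = "%k. snd (h k)"
 have hF: "(?a k, ?b k) \<in> F" if "k < card F" for k using bij_betwE[OF h] that by auto
 have "distinct_pairs n (card F) ?a ?b"
  unfolding distinct_pairs_def
 proof (intro conjI allI impI inj_onI)
  fix k assume "k < card F"
  then show "?a k < n" "?b k < n" "?a k ~= ?b k" using hF assms by (force simp: opairs_def)+
 next
  fix k l assume kl: "k \<in> {..<card F}" "l \<in> {..<card F}" "{?a k, ?b k} = {?a l, ?b l}"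
  then consider "h k = h l" | "(?b k, ?a k) = h l" by (auto simp: doubleton_eq_iff prod_eq_iff)
  then show "k = l"
  proof cases
   case 1
   then show ?thesis using kl bij_betw_imp_inj_on[OF h] by (auto dest: inj_onD)
  next
   case 2
   then have "(?b k, ?a k) \<in> F" using kl hF[of l] by auto
   then show ?thesis using hF[of k] kl assms by (auto simp: opairs_def)
  qed
 qed
 moreover have "bij_betw (%k. (?a k, ?b k)) {..<card F} F" using h by simp
 ultimately show ?thesis by (rule that)
qed

lemma prob_not_upos:
 assumes "opairs n F" "prob {s \<in> space \<Omega>. upos (llr D s) F} > 1 - c"
 shows "prob {s \<in> space \<Omega>. \<not> upos (llr D s) F} \<le> c"
 using prob_neg[OF upos_measurable[OF assms(1)]] assms(2) by simp

lemma upos_prob_large: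
 assumes F: "opairs n F" "mostly \<pi> F" and m: "log 2 (real n) / \<gamma> < real (card F)" "card F \<le> n"
 shows "prob {s \<in> space \<Omega>. \<not> upos (llr D s) F} \<le> 2 powr (- (\<gamma> * real (card F)))"
proof (rule prob_not_upos[OF F(1)])
 obtain a b where ab: "distinct_pairs n (card F) a b" "bij_betw (%k. (a k, b k)) {..<card F} F"
  using enum_opairs[OF F(1)] .
 have fin: "finite F" using F(1) finite_subset unfolding opairs_def by blast
 have "card {k. k < card F & \<pi> (a k) < \<pi> (b k)} = card {(a, b) \<in> F. \<pi> a < \<pi> b}"
 proof -
  have img: "(%k. (a k, b k)) ` {k. k < card F & \<pi> (a k) < \<pi> (b k)} = {(a, b) \<in> F. \<pi> a < \<pi> b}"
  proof (intro equalityI subsetI)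
   fix z assume z: "z \<in> {(a, b) \<in> F. \<pi> a < \<pi> b}"
   then have "z \<in> (%k. (a k, b k)) ` {..<card F}" using bij_betw_imp_surj_on[OF ab(2)] by blast
   then show "z \<in> (%k. (a k, b k)) ` {k. k < card F & \<pi> (a k) < \<pi> (b k)}" using z by auto
  qed (use bij_betwE[OF ab(2)] in auto)
  have "inj_on (%k. (a k, b k)) {k. k < card F & \<pi> (a k) < \<pi> (b k)}"
   by (rule inj_on_subset[OF bij_betw_imp_inj_on[OF ab(2)]]) auto
  then show ?thesis unfolding img[symmetric] by (rule card_image[symmetric])
 qed
 moreover have "card F = card {(a, b) \<in> F. \<pi> a < \<pi> b} + card {(a, b) \<in> F. \<not> \<pi> a < \<pi> b}"
  by (subst card_Un_disjoint[symmetric]) (use fin in "auto intro!: arg_cong[where f = card] finite_subset[OF _ fin]")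
 ultimately have "real (card {k. k < card F & \<pi> (a k) < \<pi> (b k)}) \<ge> 2 / 3 * real (card F)"
  using F(2) unfolding mostly_def by linarith
 then have "prob_positive_sum n \<pi> M D (card F) a b > 1 - 2 powr (- (\<gamma> * real (card F)))"
  using biased m ab(1) unfolding strongly_biased_def by blast
 moreover have "(\<Sum>k<card F. llr D s (a k) (b k)) = (\<Sum>(a, b)\<in>F. llr D s a b)" for s
  using sum.reindex_bij_betw[OF ab(2), of "%(a, b). llr D s a b"] by simp
 ultimately show "prob {s \<in> space \<Omega>. upos (llr D s) F} > 1 - 2 powr (- (\<gamma> * real (card F)))"
  by (simp add: prob_positive_sum_def upos_def)
qed

lemma upos_prob_const:
 assumes F: "opairs n F" "\<And>a b. (a, b) \<in> F ==> \<pi> a < \<pi> b" "card F = A"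
 shows "prob {s \<in> space \<Omega>. \<not> upos (llr D s) F} \<le> 1 / 1000"
proof (rule prob_not_upos[OF F(1)])
 obtain a b where ab: "distinct_pairs n (card F) a b" "bij_betw (%k. (a k, b k)) {..<card F} F"
  using enum_opairs[OF F(1)] .
 have "\<pi> (a k) < \<pi> (b k)" if "k < A" for k using bij_betwE[OF ab(2)] that F(2,3) by auto
 then have "prob_positive_sum n \<pi> M D A a b > 1 - 1 / 10 ^ 3"
  using biased ab(1) F(3) unfolding strongly_biased_def by blast
 moreover have "(\<Sum>k<A. llr D s (a k) (b k)) = (\<Sum>(a, b)\<in>F. llr D s a b)" for s
  using sum.reindex_bij_betw[OF ab(2), of "%(a, b). llr D s a b"] F(3) by simp
 ultimately show "prob {s \<in> space \<Omega>. upos (llr D s) F} > 1 - 1 / 1000"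
  by (simp add: prob_positive_sum_def upos_def)
qed

text \<open>An empty sum is not positive, so condition (b) itself excludes
  \<open>A = 0\<close>.\<close>

lemma A_pos: "0 < A"
proof (rule ccontr)
 assume "\<not> 0 < A"
 then have "A = 0" by simp
 moreover have "distinct_pairs n 0 (%_. 0) (%_. 0)" by (simp add: distinct_pairs_def)
 ultimately have "prob_positive_sum n \<pi> M D 0 (%_. 0) (%_. 0) > 1 - 1 / 10 ^ 3"
  using biased unfolding strongly_biased_def by blast
 then show False by (simp add: prob_positive_sum_def)
qed

end

section \<open>Reversal of the true order\<close>

lemma upos_converse: "upos (%a b. q b a) F \<longleftrightarrow> upos q (F\<inverse>)"
proof -
 have "(\<Sum>(a, b)\<in>F. q b a) = (\<Sum>(a, b)\<in>F\<inverse>. q a b)"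
  by (rule sum.reindex_bij_witness[where i = prod.swap and j = prod.swap]) auto
 then show ?thesis by (simp add: upos_def)
qed

lemma opairs_converse: "opairs n F ==> opairs n (F\<inverse>)"
 by (auto simp: opairs_def)

text \<open>Reversing the order together with all pairs changes nothing, so the mirrored patterns
  need no bias assumption of their own.\<close>

lemma mostly_converse:
 assumes "opairs n F" "\<And>a. a < n ==> \<pi> a < n" "mostly (rev_order n \<pi>) F"
 shows "mostly \<pi> (F\<inverse>)"
proof -
 have r: "rev_order n \<pi> a < rev_order n \<pi> b \<longleftrightarrow> \<pi> b < \<pi> a" if "(a, b) \<in> F" for a b
 proof -
  have "a < n" "b < n" using that assms(1) by (auto simp: opairs_def)
  then show ?thesis using assms(2)[of a] assms(2)[of b] by (auto simp: rev_order_def)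
 qed
 have "{(a, b) \<in> F\<inverse>. \<not> \<pi> a < \<pi> b} = {(a, b) \<in> F. \<not> rev_order n \<pi> a < rev_order n \<pi> b}\<inverse>"
  using r by auto
 then have "card {(a, b) \<in> F\<inverse>. \<not> \<pi> a < \<pi> b} = card {(a, b) \<in> F. \<not> rev_order n \<pi> a < rev_order n \<pi> b}"
  by (simp only: card_inverse)
 then show ?thesis using assms(3) unfolding mostly_def card_inverse by (simp only:)
qed

context signal_model
begin

lemma \<pi>_less: "a < n ==> \<pi> a < n"
 using permutes_in_image[OF perm, of a] by simp

section \<open>Union bounds over the two families\<close>

lemma prob_union_le:
 assumes "finite I" "\<And>i. i \<in> I ==> {s \<in> space \<Omega>. P i s} \<in> sets \<Omega>"
  "\<And>i. i \<in> I ==> prob {s \<in> space \<Omega>. P i s} \<le> c" "real (card I) \<le> k" "0 \<le> c"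
 shows "{s \<in> space \<Omega>. \<exists>i\<in>I. P i s} \<in> sets \<Omega>" "prob {s \<in> space \<Omega>. \<exists>i\<in>I. P i s} \<le> k * c"
proof -
 have eq: "{s \<in> space \<Omega>. \<exists>i\<in>I. P i s} = (\<Union>i\<in>I. {s \<in> space \<Omega>. P i s})" by auto
 show "{s \<in> space \<Omega>. \<exists>i\<in>I. P i s} \<in> sets \<Omega>" unfolding eq by (rule sets.finite_UN[OF assms(1,2)])
 have "prob (\<Union>i\<in>I. {s \<in> space \<Omega>. P i s}) \<le> (\<Sum>i\<in>I. prob {s \<in> space \<Omega>. P i s})"
  by (rule finite_measure_subadditive_finite[OF assms(1)]) (use assms(2) in auto)
 also have "... \<le> (\<Sum>i\<in>I. c)" by (rule sum_mono) (rule assms(3))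
 also have "... \<le> k * c" using assms(4,5) by (simp add: mult_right_mono)
 finally show "prob {s \<in> space \<Omega>. \<exists>i\<in>I. P i s} \<le> k * c" unfolding eq .
qed

lemma not_upos_measurable: "opairs n F ==> {s \<in> space \<Omega>. \<not> upos (llr D s) F} \<in> sets \<Omega>"
 by (rule local_pred_measurable[OF local_pred_not[OF upos_local[OF _ order_refl pairs_of_sub]]])

lemma prob_good1:
 assumes "64 * Q\<^sup>2 \<le> n" "log 2 (real n) / \<gamma> < real (x\<^sup>2)"
 shows "{s \<in> space \<Omega>. \<not> good1 n \<pi> (llr D s) Q x} \<in> sets \<Omega>"
  "prob {s \<in> space \<Omega>. \<not> good1 n \<pi> (llr D s) Q x} \<le> real n ^ (8*Q) * real (n + 1) * 2 powr (- (\<gamma> * real (x\<^sup>2)))"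
proof -
 let ?I = "{F \<in> fam1 n \<pi> Q. opairs n F & mostly \<pi> F & x\<^sup>2 \<le> card F & card F \<le> 64 * Q\<^sup>2}"
 have eq: "\<not> good1 n \<pi> q Q x \<longleftrightarrow> (\<exists>F\<in>?I. \<not> upos q F)" for q by (auto simp: good1_def)
 have fin: "finite ?I" using fam1_card(1) by simp
 have card: "real (card ?I) \<le> real n ^ (8*Q) * real (n + 1)"
 proof -
  have "card ?I \<le> card (fam1 n \<pi> Q)" by (rule card_mono[OF fam1_card(1)]) auto
  also have "... \<le> n ^ (8*Q) * (n + 1)" by (rule fam1_card(2))
  finally have "real (card ?I) \<le> real (n ^ (8*Q) * (n + 1))" by (simp only: of_nat_le_iff)
  then show ?thesis by (simp only: of_nat_mult of_nat_power)
 qed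
 have p: "prob {s \<in> space \<Omega>. \<not> upos (llr D s) F} \<le> 2 powr (- (\<gamma> * real (x\<^sup>2)))" if "F \<in> ?I" for F
 proof -
  have F: "opairs n F" "mostly \<pi> F" "x\<^sup>2 \<le> card F" "card F \<le> 64 * Q\<^sup>2" using that by auto
  then have xF: "real (x\<^sup>2) \<le> real (card F)" by (simp only: of_nat_le_iff)
  then have "log 2 (real n) / \<gamma> < real (card F)" using assms(2) by linarith
  then have "prob {s \<in> space \<Omega>. \<not> upos (llr D s) F} \<le> 2 powr (- (\<gamma> * real (card F)))"
   using F assms(1) by (intro upos_prob_large) auto
  also have "... \<le> 2 powr (- (\<gamma> * real (x\<^sup>2)))"
   using \<gamma> xF by (simp add: mult_left_mono)
  finally show ?thesis .
 qed
 show "{s \<in> space \<Omega>. \<not> good1 n \<pi> (llr D s) Q x} \<in> sets \<Omega>"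
  unfolding eq by (rule prob_union_le(1)[OF fin _ p card]) (auto intro: not_upos_measurable)
 show "prob {s \<in> space \<Omega>. \<not> good1 n \<pi> (llr D s) Q x} \<le> real n ^ (8*Q) * real (n + 1) * 2 powr (- (\<gamma> * real (x\<^sup>2)))"
  unfolding eq by (rule prob_union_le(2)[OF fin _ p card]) (auto intro: not_upos_measurable)
qed

text \<open>Stated for any order \<open>\<rho>\<close> and values \<open>qq\<close>, to serve for
  the list and for its mirror image. A pattern over \<open>y\<close> items has at least
  \<open>y * Q\<close> pairs, so family size times error probability is at most
  \<open>e ^ y\<close>, hence at most \<open>e\<close>; the sums over \<open>y\<close> and the
  prefixes give the other factors.\<close>

lemma prob_good2:
 assumes up: "\<And>F. opairs n F ==> mostly \<rho> F ==> log 2 (real n) / \<gamma> < real (card F) ==> card F \<le> n ==>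
   {s \<in> space \<Omega>. \<not> upos (qq s) F} \<in> sets \<Omega> &
   prob {s \<in> space \<Omega>. \<not> upos (qq s) F} \<le> 2 powr (- (\<gamma> * real (card F)))"
  and n: "1 \<le> n" and x: "20 * x \<le> Q" and Q: "2 * x * Q \<le> n" "log 2 (real n) / \<gamma> < real Q"
  and N: "1 \<le> N" "\<And>U :: nat set. finite U ==> card U \<le> 23*Q ==> real (card {D. D \<subseteq> U & card D \<le> 34*x}) \<le> N"
  and eps: "real (n + 1) ^ 35 * N * 2 powr (- (\<gamma> * real Q)) \<le> e" "e \<le> 1"
 shows "{s \<in> space \<Omega>. \<not> good2 n \<rho> (qq s) Q x} \<in> sets \<Omega>"
  "prob {s \<in> space \<Omega>. \<not> good2 n \<rho> (qq s) Q x} \<le> real (n + 1) * (real x * e)"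
proof -
 have e0: "0 \<le> e" by (rule order_trans[OF _ eps(1)]) (use N in auto)
 let ?I = "%t y. {F \<in> fam2 n \<rho> Q x t y. opairs n F & mostly \<rho> F & y * Q \<le> card F & card F \<le> 2 * y * Q}"
 have eq: "{s \<in> space \<Omega>. \<not> good2 n \<rho> (qq s) Q x} =
   {s \<in> space \<Omega>. \<exists>t\<in>{..n}. \<exists>y\<in>{0<..<x}. \<exists>F\<in>?I t y. \<not> upos (qq s) F}"
  by (rule Collect_cong, simp only: good2_def Bex_def Ball_def mem_Collect_eq greaterThanLessThan_iff atMost_iff) blast
 have inner: "{s \<in> space \<Omega>. \<exists>F\<in>?I t y. \<not> upos (qq s) F} \<in> sets \<Omega> & prob {s \<in> space \<Omega>. \<exists>F\<in>?I t y. \<not> upos (qq s) F} \<le> e"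
  if y: "y \<in> {0<..<x}" for t y
 proof -
  have c: "finite (fam2 n \<rho> Q x t y)" "real (card (fam2 n \<rho> Q x t y)) \<le> (real (n + 1) ^ 35 * N) ^ y"
   using fam2_card[OF n _ _ x N, of y \<rho> t] y by auto
  have fin: "finite (?I t y)" using c(1) by simp
  have "card (?I t y) \<le> card (fam2 n \<rho> Q x t y)" by (rule card_mono[OF c(1)]) auto
  then have card: "real (card (?I t y)) \<le> (real (n + 1) ^ 35 * N) ^ y" using c(2) by linarith
  have F: "{s \<in> space \<Omega>. \<not> upos (qq s) F} \<in> sets \<Omega> &
   prob {s \<in> space \<Omega>. \<not> upos (qq s) F} \<le> (2 powr (- (\<gamma> * real Q))) ^ y" if "F \<in> ?I t y" for F
  proof -
   have F: "opairs n F" "mostly \<rho> F" "y * Q \<le> card F" "card F \<le> 2 * y * Q" using that by auto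
   have yQ: "real y * real Q \<le> real (card F)" using F(3) by (metis of_nat_le_iff of_nat_mult)
   have "real Q \<le> real y * real Q" using y mult_right_mono[of 1 "real y" "real Q"] by simp
   then have "log 2 (real n) / \<gamma> < real (card F)" using Q(2) yQ by linarith
   moreover have "2 * y * Q \<le> 2 * x * Q" using y by simp
   then have "card F \<le> n" using F(4) Q(1) by linarith
   ultimately have m: "{s \<in> space \<Omega>. \<not> upos (qq s) F} \<in> sets \<Omega>"
     "prob {s \<in> space \<Omega>. \<not> upos (qq s) F} \<le> 2 powr (- (\<gamma> * real (card F)))"
    using up[OF F(1,2)] by auto
   have "2 powr (- (\<gamma> * real (card F))) \<le> 2 powr (- (\<gamma> * real Q) * real y)"
    using \<gamma> mult_left_mono[OF yQ, of \<gamma>] by (simp add: algebra_simps)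
   also have "... = (2 powr (- (\<gamma> * real Q))) ^ y" by (simp add: powr_power mult.commute)
   finally show ?thesis using m by auto
  qed
  have "prob {s \<in> space \<Omega>. \<exists>F\<in>?I t y. \<not> upos (qq s) F} \<le> (real (n + 1) ^ 35 * N) ^ y * (2 powr (- (\<gamma> * real Q))) ^ y"
   by (rule prob_union_le(2)[OF fin _ _ card]) (use F in auto)
  also have "... = (real (n + 1) ^ 35 * N * 2 powr (- (\<gamma> * real Q))) ^ y" by (simp add: power_mult_distrib)
  also have "... \<le> e ^ y" by (rule power_mono[OF eps(1)]) (use N in auto)
  also have "... \<le> e" using power_decreasing[of 1 y e] e0 eps(2) y by simp
  finally have "prob {s \<in> space \<Omega>. \<exists>F\<in>?I t y. \<not> upos (qq s) F} \<le> e" .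
  moreover have "{s \<in> space \<Omega>. \<exists>F\<in>?I t y. \<not> upos (qq s) F} \<in> sets \<Omega>"
   by (rule prob_union_le(1)[where c = "(2 powr (- (\<gamma> * real Q))) ^ y", OF fin _ _ card]) (use F in auto)
  ultimately show ?thesis by blast
 qed
 have mid: "{s \<in> space \<Omega>. \<exists>y\<in>{0<..<x}. \<exists>F\<in>?I t y. \<not> upos (qq s) F} \<in> sets \<Omega> &
  prob {s \<in> space \<Omega>. \<exists>y\<in>{0<..<x}. \<exists>F\<in>?I t y. \<not> upos (qq s) F} \<le> real x * e" for t
 proof -
  note pu = prob_union_le[where I = "{0<..<x}" and P = "%y s. \<exists>F\<in>?I t y. \<not> upos (qq s) F"
    and c = e and k = "real x"]
  show ?thesis by (intro conjI; rule pu) (use inner e0 in auto)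
 qed
 note outer = prob_union_le[where I = "{..n}" and P = "%t s. \<exists>y\<in>{0<..<x}. \<exists>F\<in>?I t y. \<not> upos (qq s) F"
   and c = "real x * e" and k = "real (n + 1)"]
 show "{s \<in> space \<Omega>. \<not> good2 n \<rho> (qq s) Q x} \<in> sets \<Omega>"
  by (subst eq, rule outer(1)) (use mid e0 in auto)
 show "prob {s \<in> space \<Omega>. \<not> good2 n \<rho> (qq s) Q x} \<le> real (n + 1) * (real x * e)"
  by (subst eq, rule outer(2)) (use mid e0 in auto)
qed

lemma good2_hyp:
 assumes "opairs n F" "mostly \<pi> F" "log 2 (real n) / \<gamma> < real (card F)" "card F \<le> n"
 shows "{s \<in> space \<Omega>. \<not> upos (llr D s) F} \<in> sets \<Omega> &
   prob {s \<in> space \<Omega>. \<not> upos (llr D s) F} \<le> 2 powr (- (\<gamma> * real (card F)))"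
 using upos_prob_large[OF assms] not_upos_measurable[OF assms(1)] by simp

lemma good2_hyp_rev:
 assumes "opairs n F" "mostly (rev_order n \<pi>) F" "log 2 (real n) / \<gamma> < real (card F)" "card F \<le> n"
 shows "{s \<in> space \<Omega>. \<not> upos (%a b. llr D s b a) F} \<in> sets \<Omega> &
   prob {s \<in> space \<Omega>. \<not> upos (%a b. llr D s b a) F} \<le> 2 powr (- (\<gamma> * real (card F)))"
proof -
 have eq: "upos (%a b. llr D s b a) F \<longleftrightarrow> upos (llr D s) (F\<inverse>)" for s by (rule upos_converse)
 show ?thesis unfolding eq
  using good2_hyp[OF opairs_converse[OF assms(1)] mostly_converse[OF assms(1) \<pi>_less assms(2)]] assms(3,4)
  by (simp add: card_inverse)
qed


subsection \<open>Searching for a new item in a sorted list\<close>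

abbreviation "cell_test \<equiv> gcell_test A"

text \<open>The signals that round \<open>r\<close> may use, whichever cell it tests; for different
  rounds these sets are disjoint.\<close>

definition slot :: "nat => nat => (nat => nat) => nat => nat set set" where
 "slot T t L r = {{t, L p} | p. p < t & (p mod (T * A)) div A = r}"

definition less_rank :: "nat => (nat => nat) => nat" where
 "less_rank t L = card {p. p < t & \<pi> (L p) < \<pi> t}"

text \<open>Up to \<open>lcell\<close> a tested block lies so far before the true place of
  \<open>t\<close>, and from \<open>rcell\<close> on so far behind it, that
  \<open>rank_sorted\<close> decides all its items. The cap \<open>t + 1\<close> keeps
  \<open>rcell\<close> below the number \<open>n + 2\<close> of cells; cells from there on lie
  beyond the list and are always answered correctly.\<close>

definition lcell :: "nat => nat => nat => (nat => nat) => nat" where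
 "lcell d T t L = (less_rank t L - d - 1) div (T * A)"

definition rcell :: "nat => nat => nat => (nat => nat) => nat" where
 "rcell d T t L = min ((less_rank t L + d) div (T * A) + 2) (t + 1)"

definition wrong :: "nat => nat => nat => bool => bool" where
 "wrong c1 c2 x b \<longleftrightarrow> x \<le> c1 & b \<or> c2 \<le> x & \<not> b"

definition bad_search :: "nat => nat => nat => (nat => nat) => (nat => nat => real) => bool" where
 "bad_search d T t L q \<longleftrightarrow> (let oc = cell_test q T t L in
  T < 8 * card {r. r < T & wrong (lcell d T t L) (rcell d T t L) (path (n + 2) oc r) (oc (path (n + 2) oc r) r)})"

text \<open>The event that the signals between the true place and some slot at distance at least
  \<open>e\<close> add up to the wrong sign. All such slots are included, because the slot chosen is
  not known beforehand.\<close>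

definition bad_insert :: "nat => nat => (nat => nat) => (nat => nat => real) => bool" where
 "bad_insert e t L q \<longleftrightarrow> (\<exists>p\<le>t. less_rank t L + e \<le> p & \<not> upos q ((%p'. (t, L p')) ` {less_rank t L..<p}) \<or>
  p + e \<le> less_rank t L & \<not> upos q ((%p'. (L p', t)) ` {p..<less_rank t L}))"

lemma less_rank_le: "less_rank t L \<le> t"
 unfolding less_rank_def using card_mono[of "{..<t}" "{p. p < t & \<pi> (L p) < \<pi> t}"] by auto

text \<open>Were the item at \<open>p\<close> on the wrong side of \<open>t\<close>, so would be all
  items more than \<open>d\<close> places beyond it, which contradicts the number of items before
  \<open>t\<close>.\<close>

lemma rank_sorted:
 assumes lst: "listing t L" and srt: "dsorted d t (%p. \<pi> (L p))" and t: "t < n" and p: "p < t"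
 shows "p + d + 1 < less_rank t L ==> \<pi> (L p) < \<pi> t" "less_rank t L + d < p ==> \<pi> t < \<pi> (L p)"
proof -
 have bij: "bij_betw L {..<t} {..<t}" using lst by (simp add: listing_def)
 have Lt: "L p < t" if "p < t" for p using bij_betwE[OF bij] that by auto
 have ne: "\<pi> (L p) ~= \<pi> t"
 proof
  assume "\<pi> (L p) = \<pi> t"
  then have "L p = t" using permutes_inj[OF perm] by (auto dest: injD)
  then show False using Lt[OF p] by simp
 qed
 show "\<pi> (L p) < \<pi> t" if r: "p + d + 1 < less_rank t L"
 proof (rule ccontr)
  assume "\<not> \<pi> (L p) < \<pi> t"
  then have g: "\<pi> t < \<pi> (L p)" using ne by simp
  have "{p'. p' < t & \<pi> (L p') < \<pi> t} \<subseteq> {..p + d}"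
  proof
   fix p' assume p': "p' \<in> {p'. p' < t & \<pi> (L p') < \<pi> t}"
   show "p' \<in> {..p + d}"
   proof (rule ccontr)
    assume "p' \<notin> {..p + d}"
    then have "\<pi> (L p) < \<pi> (L p')" using srt p' by (auto simp: dsorted_def)
    then show False using g p' by auto
   qed
  qed
  then have "less_rank t L \<le> card {..p + d}" unfolding less_rank_def by (intro card_mono) auto
  then show False using r by simp
 qed
 show "\<pi> t < \<pi> (L p)" if r: "less_rank t L + d < p"
 proof (rule ccontr)
  assume "\<not> \<pi> t < \<pi> (L p)"
  then have g: "\<pi> (L p) < \<pi> t" using ne by simp
  have "{..<p - d} \<subseteq> {p'. p' < t & \<pi> (L p') < \<pi> t}"
  proof
   fix p' assume p': "p' \<in> {..<p - d}"
   then have "p' + d < p" by simp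
   then have "\<pi> (L p') < \<pi> (L p)" using srt p by (auto simp: dsorted_def)
   then show "p' \<in> {p'. p' < t & \<pi> (L p') < \<pi> t}" using g \<open>p' + d < p\<close> p by auto
  qed
  then have "card {..<p - d} \<le> less_rank t L" unfolding less_rank_def by (intro card_mono) auto
  then show False using r by simp
 qed
qed

lemma star_opairs:
 assumes "listing t L" "t < n" "S \<subseteq> {..<t}"
 shows "opairs n ((%p. (t, L p)) ` S)" "opairs n ((%p. (L p, t)) ` S)"
  "card ((%p. (t, L p)) ` S) = card S" "card ((%p. (L p, t)) ` S) = card S"
proof -
 have bij: "bij_betw L {..<t} {..<t}" using assms by (simp add: listing_def)
 then have Lt: "L p < t" if "p \<in> S" for p using bij_betwE[OF bij] that assms by blast
 show "opairs n ((%p. (t, L p)) ` S)" "opairs n ((%p. (L p, t)) ` S)"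
  using Lt assms(2) by (force simp: opairs_def)+
 have "inj_on L S" using bij assms(3) by (auto simp: bij_betw_def intro: inj_on_subset)
 then show "card ((%p. (t, L p)) ` S) = card S" "card ((%p. (L p, t)) ` S) = card S"
  by (auto intro!: card_image simp: inj_on_def)
qed

definition star :: "nat => nat set set" where
 "star t = {{t, c} | c. c < t}"

lemma star_sub: "t < n ==> star t \<subseteq> pairs"
 by (auto simp: star_def intro!: pair_in)

lemma star_pairs_of:
 assumes "listing t L" "S \<subseteq> {..<t}"
 shows "pairs_of ((%p. (t, L p)) ` S) \<subseteq> star t" "pairs_of ((%p. (L p, t)) ` S) \<subseteq> star t"
proof -
 have bij: "bij_betw L {..<t} {..<t}" using assms by (simp add: listing_def)
 then have Lt: "L p < t" if "p \<in> S" for p using bij_betwE[OF bij] that assms by blast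
 then show "pairs_of ((%p. (t, L p)) ` S) \<subseteq> star t" "pairs_of ((%p. (L p, t)) ` S) \<subseteq> star t"
  by (auto simp: pairs_of_def star_def insert_commute)
qed

lemma bad_insert_local:
 assumes "listing t L" "t < n"
 shows "local_pred (star t) (%s. bad_insert e t L (llr D s))"
proof -
 let ?F1 = "%p. (%p'. (t, L p')) ` {less_rank t L..<p}" and ?F2 = "%p. (%p'. (L p', t)) ` {p..<less_rank t L}"
 have "local_pred (star t) (%s. \<forall>p\<in>{..t}. \<not> (less_rank t L + e \<le> p & \<not> upos (llr D s) (?F1 p)) &
   \<not> (p + e \<le> less_rank t L & \<not> upos (llr D s) (?F2 p)))"
 proof (rule local_pred_ball[OF _ _ star_sub[OF assms(2)]])
  fix p assume p: "p \<in> {..t}"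
  have S: "{less_rank t L..<p} \<subseteq> {..<t}" "{p..<less_rank t L} \<subseteq> {..<t}" using p less_rank_le[of t L] by auto
  have c: "local_pred (star t) (%_. b)" for b by (rule local_pred_const[OF star_sub[OF assms(2)]])
  have "local_pred (star t) (%s. upos (llr D s) (?F1 p))" "local_pred (star t) (%s. upos (llr D s) (?F2 p))"
   using star_opairs[OF assms S(1)] star_opairs[OF assms S(2)] star_pairs_of[OF assms(1) S(1)]
    star_pairs_of[OF assms(1) S(2)] star_sub[OF assms(2)] by (auto intro!: upos_local)
  then show "local_pred (star t) (%s. \<not> (less_rank t L + e \<le> p & \<not> upos (llr D s) (?F1 p)) &
   \<not> (p + e \<le> less_rank t L & \<not> upos (llr D s) (?F2 p)))"
   by (intro local_pred_conj local_pred_not c)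
 qed simp
 from local_pred_not[OF this] show ?thesis
  by (rule back_subst[of "local_pred (star t)"]) (auto simp: bad_insert_def)
qed

text \<open>Only the \<open>d + 1\<close> places next to the rank can be ordered wrongly, at most a
  third of the \<open>e\<close> or more pairs, so condition (a) applies to every slot.\<close>

lemma prob_bad_insert:
 assumes lst: "listing t L" and srt: "dsorted d t (%p. \<pi> (L p))" and t: "t < n"
  and e: "3 * (d + 1) \<le> e" "log 2 (real n) / \<gamma> < real e"
 shows "prob {s \<in> space \<Omega>. bad_insert e t L (llr D s)} \<le> real (n + 1) * 2 powr (- (\<gamma> * real e))"
proof -
 let ?r = "less_rank t L"
 let ?F1 = "%p. (%p'. (t, L p')) ` {?r..<p}" and ?F2 = "%p. (%p'. (L p', t)) ` {p..<?r}"
 define P where "P p s \<longleftrightarrow> (?r + e \<le> p & \<not> upos (llr D s) (?F1 p)) \<or> (p + e \<le> ?r & \<not> upos (llr D s) (?F2 p))" for p s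
 have eq: "bad_insert e t L (llr D s) \<longleftrightarrow> (\<exists>p\<in>{..t}. P p s)" for s
  by (auto simp: bad_insert_def P_def)
 have e0: "0 < e" using e by simp
 have main: "{s \<in> space \<Omega>. P p s} \<in> sets \<Omega> & prob {s \<in> space \<Omega>. P p s} \<le> 2 powr (- (\<gamma> * real e))" if p: "p \<le> t" for p
 proof -
  have S: "{?r..<p} \<subseteq> {..<t}" "{p..<?r} \<subseteq> {..<t}" using p less_rank_le[of t L] by auto
  consider "?r + e \<le> p" | "p + e \<le> ?r" | "p < ?r + e" "?r < p + e" by linarith
  then show ?thesis
  proof cases
   case 1
   note op = star_opairs(1)[OF lst t S(1)] and cd = star_opairs(3)[OF lst t S(1)]
   have eqP: "P p s \<longleftrightarrow> \<not> upos (llr D s) (?F1 p)" for s using 1 e0 by (auto simp: P_def)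
   have mo: "mostly \<pi> (?F1 p)"
   proof -
    have "{(a, b) \<in> ?F1 p. \<not> \<pi> a < \<pi> b} \<subseteq> (%p'. (t, L p')) ` {?r..?r + d}"
    proof
     fix z assume "z \<in> {(a, b) \<in> ?F1 p. \<not> \<pi> a < \<pi> b}"
     then obtain p' where p': "p' \<in> {?r..<p}" "z = (t, L p')" "\<not> \<pi> t < \<pi> (L p')" by auto
     then have "p' \<le> ?r + d" using rank_sorted(2)[OF lst srt t, of p'] p by (meson S(1) lessThan_iff linorder_not_less subsetD)
     then show "z \<in> (%p'. (t, L p')) ` {?r..?r + d}" using p' by auto
    qed
    then have "card {(a, b) \<in> ?F1 p. \<not> \<pi> a < \<pi> b} \<le> card ((%p'. (t, L p')) ` {?r..?r + d})"
     by (intro card_mono) auto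
    also have "... \<le> card {?r..?r + d}" by (rule card_image_le) simp
    finally show ?thesis using e(1) 1 unfolding mostly_def cd by simp
   qed
   have "real e \<le> real (p - ?r)" using 1 by linarith
   then have "prob {s \<in> space \<Omega>. \<not> upos (llr D s) (?F1 p)} \<le> 2 powr (- (\<gamma> * real (p - ?r)))"
    using upos_prob_large[OF op mo] e(2) p t cd by simp
   also have "... \<le> 2 powr (- (\<gamma> * real e))" using \<open>real e \<le> _\<close> \<gamma> by (simp add: mult_left_mono)
   finally show ?thesis unfolding eqP using not_upos_measurable[OF op] by simp
  next
   case 2
   note op = star_opairs(2)[OF lst t S(2)] and cd = star_opairs(4)[OF lst t S(2)]
   have eqP: "P p s \<longleftrightarrow> \<not> upos (llr D s) (?F2 p)" for s using 2 e0 by (auto simp: P_def)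
   have mo: "mostly \<pi> (?F2 p)"
   proof -
    have "{(a, b) \<in> ?F2 p. \<not> \<pi> a < \<pi> b} \<subseteq> (%p'. (L p', t)) ` {?r - d - 1..<?r}"
    proof
     fix z assume "z \<in> {(a, b) \<in> ?F2 p. \<not> \<pi> a < \<pi> b}"
     then obtain p' where p': "p' \<in> {p..<?r}" "z = (L p', t)" "\<not> \<pi> (L p') < \<pi> t" by auto
     then have "p' < t" using S(2) by blast
     then have "\<not> p' + d + 1 < ?r" using rank_sorted(1)[OF lst srt t] p'(3) by blast
     then show "z \<in> (%p'. (L p', t)) ` {?r - d - 1..<?r}" using p' by auto
    qed
    then have "card {(a, b) \<in> ?F2 p. \<not> \<pi> a < \<pi> b} \<le> card ((%p'. (L p', t)) ` {?r - d - 1..<?r})"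
     by (intro card_mono) auto
    also have "... \<le> card {?r - d - 1..<?r}" by (rule card_image_le) simp
    finally show ?thesis using e(1) 2 unfolding mostly_def cd by simp
   qed
   have "real e \<le> real (?r - p)" using 2 by linarith
   then have "prob {s \<in> space \<Omega>. \<not> upos (llr D s) (?F2 p)} \<le> 2 powr (- (\<gamma> * real (?r - p)))"
    using upos_prob_large[OF op mo] e(2) p t cd less_rank_le[of t L] by simp
   also have "... \<le> 2 powr (- (\<gamma> * real e))" using \<open>real e \<le> _\<close> \<gamma> by (simp add: mult_left_mono)
   finally show ?thesis unfolding eqP using not_upos_measurable[OF op] by simp
  next
   case 3
   then have "\<not> P p s" for s by (auto simp: P_def)
   then show ?thesis by simp
  qed
 qed
 show ?thesis unfolding eq by (rule prob_union_le(2)) (use main t in auto)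
qed

end

section \<open>Adaptive tests resolved by answer patterns\<close>

definition pat :: "nat => (nat => bool) => nat => nat" where
 "pat K b = path K (%_. b)"

lemma wts_pattern:
 "(\<And>r. r < R ==> oc (pat K b r) r = b r) ==> wts K oc R = wts K (%_. b) R"
proof (induction R)
 case (Suc R)
 then have "wts K oc R = wts K (%_. b) R" "oc (pat K b R) R = b R" by auto
 then show ?case by (auto simp: Let_def pat_def path_def)
qed simp

lemma path_pattern: "(\<And>r. r < R ==> oc (pat K b r) r = b r) ==> path K oc R = pat K b R"
 using wts_pattern[of R oc K b] by (simp add: path_def pat_def)

context signal_model
begin

lemma cell_test_upos:
 assumes "listing t L" "0 < x" "x * (T * A) \<le> t" "r < T"
 defines "S \<equiv> {(x - 1) * (T * A) + r * A..<(x - 1) * (T * A) + r * A + A}"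
 shows "cell_test q T t L x r \<longleftrightarrow> upos q ((%p. (t, L p)) ` S)" "S \<subseteq> {..<t}" "card S = A"
  "\<And>p. p \<in> S ==> (x - 1) * (T * A) \<le> p & p < x * (T * A) & (p mod (T * A)) div A = r"
proof -
 have rA: "r * A + A \<le> T * A" using assms(4) by (metis Suc_leI add.commute mult_Suc mult_le_mono1)
 have x: "(x - 1) * (T * A) + T * A = x * (T * A)" using assms(2) by (cases x) auto
 show p: "(x - 1) * (T * A) \<le> p & p < x * (T * A) & (p mod (T * A)) div A = r" if "p \<in> S" for p
 proof -
  define k where "k = p - ((x - 1) * (T * A) + r * A)"
  have k: "k < A" "p = (x - 1) * (T * A) + (r * A + k)" using that unfolding S_def k_def by auto
  then have "r * A + k < T * A" using rA by linarith
  moreover then have "p mod (T * A) = r * A + k" using k(2) by simp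
  moreover have "(r * A + k) div A = r" using k(1) by simp
  ultimately show ?thesis using k(2) x by simp
 qed
 then show S: "S \<subseteq> {..<t}" using assms(3) by fastforce
 show "card S = A" by (simp add: S_def)
 have bij: "bij_betw L {..<t} {..<t}" using assms(1) by (simp add: listing_def)
 have "inj_on L S" using bij S by (auto simp: bij_betw_def intro: inj_on_subset)
 then have "inj_on (%p. (t, L p)) S" by (auto simp: inj_on_def)
 then have "(\<Sum>(a, b)\<in>(%p. (t, L p)) ` S. q a b) = (\<Sum>p\<in>S. q t (L p))" by (simp add: sum.reindex)
 also have "... = (\<Sum>k<A. q t (L ((x - 1) * (T * A) + r * A + k)))"
  unfolding S_def by (rule sum.reindex_bij_witness[where i = "%k. (x - 1) * (T * A) + r * A + k"
     and j = "%p. p - ((x - 1) * (T * A) + r * A)"]) auto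
 finally show "cell_test q T t L x r \<longleftrightarrow> upos q ((%p. (t, L p)) ` S)"
  using assms(2,3) by (simp add: gcell_test_def upos_def)
qed

lemma slot_star: "listing t L ==> slot T t L r \<subseteq> star t"
 by (auto simp: slot_def star_def listing_def dest: bij_betwE)

lemma cell_test_local:
 assumes "listing t L" "t < n" "r < T"
 shows "local_pred (slot T t L r) (%s. cell_test (llr D s) T t L x r)"
proof -
 have sp: "slot T t L r \<subseteq> pairs" using slot_star[OF assms(1)] star_sub[OF assms(2)] by blast
 show ?thesis
 proof (cases "0 < x & x * (T * A) \<le> t")
  case True
  note c = cell_test_upos[OF assms(1) conjunct1[OF True] conjunct2[OF True] assms(3)]
  show ?thesis unfolding c(1)
  proof (rule upos_local[OF star_opairs(1)[OF assms(1,2) c(2)] _ sp])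
   show "pairs_of ((%p. (t, L p)) ` {(x - 1) * (T * A) + r * A..<(x - 1) * (T * A) + r * A + A}) \<subseteq> slot T t L r"
    using c(2,4) unfolding pairs_of_def slot_def by fastforce
  qed
 next
  case False
  then have "(%s. cell_test (llr D s) T t L x r) = (%_. 0 < x)" by (auto simp: gcell_test_def)
  then show ?thesis using local_pred_const[OF sp] by simp
 qed
qed

lemma slot_disjoint:
 assumes "listing t L" "r ~= r'"
 shows "slot T t L r \<inter> slot T t L r' = {}"
proof -
 have bij: "bij_betw L {..<t} {..<t}" using assms(1) by (simp add: listing_def)
 have "p = p'" if "{t, L p} = {t, L p'}" "p < t" "p' < t" for p p'
 proof -
  have "L p < t" "L p' < t" using bij_betwE[OF bij] that by auto
  then have "L p = L p'" using that(1) by (auto simp: doubleton_eq_iff)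
  then show ?thesis using bij that by (auto simp: bij_betw_def dest: inj_onD)
 qed
 then show ?thesis using assms(2) unfolding slot_def by blast
qed

text \<open>Cell 0 and the cells beyond the list have fixed answers, which are never wrong. For the
  others all \<open>A\<close> items lie on one side of \<open>t\<close> and condition (b) applies;
  if they precede \<open>t\<close>, the pairs are reversed by antisymmetry.\<close>

lemma wrong_prob:
 assumes lst: "listing t L" and srt: "dsorted d t (%p. \<pi> (L p))" and t: "t < n" and r: "r < T"
  and w: "wrong (lcell d T t L) (rcell d T t L) x b"
 shows "prob {s \<in> space \<Omega>. cell_test (llr D s) T t L x r = b} \<le> 1 / 1000"
proof (cases "0 < x & x * (T * A) \<le> t")
 case False
 have TA: "0 < T * A" using r A_pos by simp
 then have "x \<le> x * (T * A)" by simp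
 have "\<not> (cell_test q T t L x r = b)" for q
 proof (cases b)
  case True
  then have x: "x \<le> lcell d T t L" using w by (auto simp: wrong_def rcell_def)
  then have "x * (T * A) \<le> less_rank t L - d - 1"
   unfolding lcell_def by (metis div_times_less_eq_dividend mult_le_mono1 order_trans)
  then have "x * (T * A) \<le> t" using less_rank_le[of t L] by linarith
  then have "x = 0" using False by simp
  then show ?thesis using True by (simp add: gcell_test_def)
 next
  case b: False
  then have "rcell d T t L \<le> x" using w by (auto simp: wrong_def)
  then have "0 < x" by (simp add: rcell_def)
  then show ?thesis using False b by (simp add: gcell_test_def)
 qed
 then show ?thesis by simp
next
 case True
 note c = cell_test_upos[OF lst conjunct1[OF True] conjunct2[OF True] r]
 let ?S = "{(x - 1) * (T * A) + r * A..<(x - 1) * (T * A) + r * A + A}"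
 note op = star_opairs[OF lst t c(2)]
 have TA: "0 < T * A" using r A_pos by simp
 have St: "p < t" if "p \<in> ?S" for p using c(2) that by blast
 show ?thesis
 proof (cases b)
  case b: False
  then have x: "rcell d T t L \<le> x" using w by (auto simp: wrong_def)
  have "x \<le> x * (T * A)" using TA by simp
  then have "x < t + 1" using conjunct2[OF True] by linarith
  then have "(less_rank t L + d) div (T * A) + 2 \<le> x" using x by (auto simp: rcell_def min_def split: if_splits)
  then have "(less_rank t L + d) div (T * A) + 1 \<le> x - 1" by simp
  then have "((less_rank t L + d) div (T * A) + 1) * (T * A) \<le> (x - 1) * (T * A)" by (rule mult_le_mono1)
  moreover have "less_rank t L + d < ((less_rank t L + d) div (T * A) + 1) * (T * A)"
   using dividend_less_div_times[OF TA, of "less_rank t L + d"] by simp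
  ultimately have "less_rank t L + d < (x - 1) * (T * A)" by linarith
  then have gt: "\<pi> t < \<pi> (L p)" if "p \<in> ?S" for p
   using rank_sorted(2)[OF lst srt t St[OF that]] c(4)[OF that] by linarith
  have "prob {s \<in> space \<Omega>. \<not> upos (llr D s) ((%p. (t, L p)) ` ?S)} \<le> 1 / 1000"
   by (rule upos_prob_const[OF op(1)]) (use gt op(3) c(3) in auto)
  then show ?thesis unfolding c(1) using b by simp
 next
  case b: True
  have "x \<le> lcell d T t L"
  proof (rule ccontr)
   assume "\<not> x \<le> lcell d T t L"
   then show False using w b by (auto simp: wrong_def)
  qed
  then have "x * (T * A) \<le> less_rank t L - d - 1"
   unfolding lcell_def by (metis div_times_less_eq_dividend mult_le_mono1 order_trans)
  then have lt: "\<pi> (L p) < \<pi> t" if "p \<in> ?S" for p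
   using rank_sorted(1)[OF lst srt t St[OF that]] c(4)[OF that] by linarith
  have Lt: "L p < n" if "p \<in> ?S" for p
  proof -
   have "L p < t" using lst St[OF that] bij_betwE by (fastforce simp: listing_def)
   then show ?thesis using t by simp
  qed
  have neg: "\<not> upos (llr D s) ((%p. (L p, t)) ` ?S)" if "s \<in> space \<Omega>" "upos (llr D s) ((%p. (t, L p)) ` ?S)" for s
  proof -
   have "inj_on L ?S" using lst c(2) by (auto simp: listing_def bij_betw_def intro: inj_on_subset)
   then have i: "inj_on (%p. (t, L p)) ?S" "inj_on (%p. (L p, t)) ?S" by (auto simp: inj_on_def)
   have "(\<Sum>p\<in>?S. llr D s (L p) t) = (\<Sum>p\<in>?S. - llr D s t (L p))"
    by (rule sum.cong[OF refl]) (rule llr_antisym[OF that(1) Lt t])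
   then show ?thesis using that(2) i by (simp add: upos_def sum.reindex sum_negf)
  qed
  have "prob {s \<in> space \<Omega>. upos (llr D s) ((%p. (t, L p)) ` ?S)}
    \<le> prob {s \<in> space \<Omega>. \<not> upos (llr D s) ((%p. (L p, t)) ` ?S)}"
   by (rule finite_measure_mono) (use neg not_upos_measurable[OF op(2)] in auto)
  also have "... \<le> 1 / 1000"
   by (rule upos_prob_const[OF op(2)]) (use lt op(4) c(3) in auto)
  finally show ?thesis unfolding c(1) using b by simp
 qed
qed

text \<open>The cell tested in a round depends on the answers before it. Fixing the sequence
  \<open>b\<close> of answers makes the cells deterministic, and a union over all
  \<open>2 ^ T\<close> sequences takes the place of a martingale argument.\<close>

lemma bad_search_pattern:
 "bad_search d T t L q \<longleftrightarrow> (\<exists>b\<in>PiE {..<T} (%_. UNIV).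
  T < 8 * card {r. r < T & wrong (lcell d T t L) (rcell d T t L) (pat (n + 2) b r) (b r)} &
  (\<forall>r\<in>{..<T}. cell_test q T t L (pat (n + 2) b r) r = b r))"
 (is "_ \<longleftrightarrow> (\<exists>b\<in>_. ?B b & ?E b)")
proof -
 let ?oc = "cell_test q T t L" and ?K = "n + 2"
 have same: "path ?K ?oc r = pat ?K b r" if "?E b" "r < T" for b r
  by (rule path_pattern) (use that in auto)
 have cong: "{r. r < T & wrong (lcell d T t L) (rcell d T t L) (path ?K ?oc r) (?oc (path ?K ?oc r) r)} =
   {r. r < T & wrong (lcell d T t L) (rcell d T t L) (pat ?K b r) (b r)}" if "?E b" for b
  using same[OF that] that by (intro Collect_cong conj_cong refl) auto
 show ?thesis
 proof
  assume bad: "bad_search d T t L q"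
  define b where "b = (\<lambda>r\<in>{..<T}. ?oc (path ?K ?oc r) r)"
  have "wts ?K ?oc R = wts ?K (%_. b) R" if "R \<le> T" for R
   using that by (induction R) (auto simp: Let_def b_def path_def)
  then have "path ?K ?oc r = pat ?K b r" if "r < T" for r
   using that by (simp add: path_def pat_def)
  then have E: "?E b" by (simp add: b_def)
  have "?B b" using bad unfolding bad_search_def Let_def cong[OF E] .
  moreover have "b \<in> PiE {..<T} (%_. UNIV)" by (simp add: b_def)
  ultimately show "\<exists>b\<in>PiE {..<T} (%_. UNIV). ?B b & ?E b" using E by blast
 next
  assume "\<exists>b\<in>PiE {..<T} (%_. UNIV). ?B b & ?E b"
  then obtain b where "?B b" "?E b" by blast
  then show "bad_search d T t L q" unfolding bad_search_def Let_def cong[OF \<open>?E b\<close>] by blast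
 qed
qed

lemma local_pred_bex:
 assumes "finite S" "\<And>i. i \<in> S ==> local_pred I (P i)" "I \<subseteq> pairs"
 shows "local_pred I (%s. \<exists>i\<in>S. P i s)"
 using local_pred_not[OF local_pred_ball[OF assms(1) local_pred_not[OF assms(2)] assms(3)]] by simp

lemma local_pred_eq: "local_pred I P ==> local_pred I (%s. P s = c)"
 by (cases c) (auto intro: local_pred_not)

lemma bad_search_local:
 assumes "listing t L" "t < n"
 shows "local_pred (star t) (%s. bad_search d T t L (llr D s))"
 unfolding bad_search_pattern
 by (intro local_pred_bex local_pred_conj local_pred_ball local_pred_const local_pred_eq
   local_pred_mono[OF cell_test_local slot_star] finite_PiE star_sub assms) auto

text \<open>For a fixed pattern the wrong rounds, at least 5g of them, use disjoint signals and are
  independent, each of probability at most 1/1000. Over 2^(40g) patterns this leaves (2^40 /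
  10^15)^g, which is below 2^(-g).\<close>

lemma prob_bad_search:
 assumes lst: "listing t L" and srt: "dsorted d t (%p. \<pi> (L p))" and t: "t < n" and T: "T = 40 * g"
 shows "prob {s \<in> space \<Omega>. bad_search d T t L (llr D s)} \<le> 2 powr (- real g)"
proof -
 let ?W = "%b. {r. r < T & wrong (lcell d T t L) (rcell d T t L) (pat (n + 2) b r) (b r)}"
 let ?I = "{b \<in> PiE {..<T} (%_. UNIV :: bool set). T < 8 * card (?W b)}"
 let ?E = "%b s. \<forall>r\<in>{..<T}. cell_test (llr D s) T t L (pat (n + 2) b r) r = b r"
 have eq: "bad_search d T t L (llr D s) \<longleftrightarrow> (\<exists>b\<in>?I. ?E b s)" for s
  unfolding bad_search_pattern by blast
 have finP: "finite (PiE {..<T} (%_. UNIV :: bool set))" by (intro finite_PiE) auto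
 then have fin: "finite ?I" by simp
 have cp: "card (PiE {..<T} (%_. UNIV :: bool set)) = 2 ^ T" by (subst card_PiE) auto
 have "card ?I \<le> 2 ^ T" unfolding cp[symmetric] by (rule card_mono[OF finP]) auto
 then have "real (card ?I) \<le> real (2 ^ T)" by (rule of_nat_mono)
 then have card: "real (card ?I) \<le> 2 ^ T" by simp
 have loc: "local_pred (slot T t L r) (%s. cell_test (llr D s) T t L x r = c)" if "r < T" for r x c
  by (rule local_pred_eq[OF cell_test_local[OF lst t that]])
 have E: "{s \<in> space \<Omega>. ?E b s} \<in> sets \<Omega> & prob {s \<in> space \<Omega>. ?E b s} \<le> (1 / 1000) ^ (5 * g)" if b: "b \<in> ?I" for b
 proof
  show "{s \<in> space \<Omega>. ?E b s} \<in> sets \<Omega>"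
   by (rule local_pred_measurable[where I = "star t"], rule local_pred_ball)
    (use local_pred_mono[OF loc slot_star[OF lst] star_sub[OF t]] star_sub[OF t] in auto)
  have sub: "?W b \<subseteq> {..<T}" by auto
  have finW: "finite (?W b)" using finite_subset[OF sub] by simp
  have "prob {s \<in> space \<Omega>. ?E b s} \<le> prob {s \<in> space \<Omega>. \<forall>r\<in>?W b. cell_test (llr D s) T t L (pat (n + 2) b r) r = b r}"
  proof (rule finite_measure_mono)
   show "{s \<in> space \<Omega>. \<forall>r\<in>?W b. cell_test (llr D s) T t L (pat (n + 2) b r) r = b r} \<in> sets \<Omega>"
    by (rule local_pred_measurable[where I = "star t"], rule local_pred_ball[OF finW])
     (use local_pred_mono[OF loc slot_star[OF lst] star_sub[OF t]] star_sub[OF t] in auto)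
  qed auto
  also have "... = (\<Prod>r\<in>?W b. prob {s \<in> space \<Omega>. cell_test (llr D s) T t L (pat (n + 2) b r) r = b r})"
   by (rule indep_local_all[OF finW loc slot_disjoint[OF lst]]) auto
  also have "... \<le> (\<Prod>r\<in>?W b. 1 / 1000)"
   by (rule prod_mono) (use wrong_prob[OF lst srt t] in auto)
  also have "... = (1 / 1000) ^ card (?W b)" by simp
  also have "... \<le> (1 / 1000) ^ (5 * g)"
  proof -
   have "5 * g \<le> card (?W b)" using b T by simp
   then show ?thesis by (intro power_decreasing) auto
  qed
  finally show "prob {s \<in> space \<Omega>. ?E b s} \<le> (1 / 1000) ^ (5 * g)" .
 qed
 have "prob {s \<in> space \<Omega>. bad_search d T t L (llr D s)} \<le> 2 ^ T * (1 / 1000) ^ (5 * g)"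
  unfolding eq by (rule prob_union_le(2)[OF fin _ _ card]) (use E in auto)
 also have "... = (2 ^ 40 * (1 / 1000) ^ 5) ^ g" unfolding T power_mult power_mult_distrib ..
 also have "... \<le> (1 / 2) ^ g" by (rule power_mono) (simp_all add: power_divide)
 also have "... = 2 powr (- real g)" 
  by (simp add: powr_minus powr_realpow power_one_over inverse_eq_divide)
 finally show ?thesis .
qed

text \<open>
 The list \<open>X s\<close> depends only on the signals among the items below \<open>t\<close>, so it is independent of the
 signals between \<open>t\<close> and these items.
\<close>

lemma prob_fresh:
 assumes t: "t < n" and fin: "finite \<L>" and X: "\<And>s. s \<in> space \<Omega> ==> X s \<in> \<L>"
  and Xl: "\<And>L. L \<in> \<L> ==> local_pred (item_pairs t) (%s. X s = L)"
  and P: "\<And>L. L \<in> \<L> ==> local_pred (star t) (%s. P L s)"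
  and c: "\<And>L. L \<in> \<L> ==> G L ==> prob {s \<in> space \<Omega>. P L s} \<le> c" "0 \<le> c"
 shows "{s \<in> space \<Omega>. G (X s) & P (X s) s} \<in> sets \<Omega>"
  "prob {s \<in> space \<Omega>. G (X s) & P (X s) s} \<le> c"
proof -
 let ?I = "{L \<in> \<L>. G L}"
 have disj: "item_pairs t \<inter> star t = {}" by (auto simp: item_pairs_def star_def)
 have eq: "{s \<in> space \<Omega>. G (X s) & P (X s) s} = (\<Union>L\<in>?I. {s \<in> space \<Omega>. X s = L & P L s})"
  using X by auto
 have sub: "item_pairs t \<subseteq> pairs" using t by (auto simp: item_pairs_def)
 have m: "{s \<in> space \<Omega>. X s = L & P L s} \<in> sets \<Omega>" if "L \<in> \<L>" for L
  by (rule local_pred_measurable[where I = pairs], rule local_pred_conj)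
   (use local_pred_mono[OF Xl[OF that] sub] local_pred_mono[OF P[OF that] star_sub[OF t]] in auto)
 show "{s \<in> space \<Omega>. G (X s) & P (X s) s} \<in> sets \<Omega>"
  unfolding eq by (rule sets.finite_UN) (use fin m in auto)
 have mX: "{s \<in> space \<Omega>. X s = L} \<in> sets \<Omega>" if "L \<in> \<L>" for L
  by (rule local_pred_measurable[OF Xl[OF that]])
 have "prob {s \<in> space \<Omega>. G (X s) & P (X s) s} \<le> (\<Sum>L\<in>?I. prob {s \<in> space \<Omega>. X s = L & P L s})"
  unfolding eq by (rule finite_measure_subadditive_finite) (use fin m in auto)
 also have "... = (\<Sum>L\<in>?I. prob {s \<in> space \<Omega>. X s = L} * prob {s \<in> space \<Omega>. P L s})"
  by (rule sum.cong[OF refl], rule indep_local[OF Xl P disj]) auto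
 also have "... \<le> (\<Sum>L\<in>?I. prob {s \<in> space \<Omega>. X s = L} * c)"
  by (rule sum_mono, rule mult_left_mono) (use c in auto)
 also have "... = (\<Sum>L\<in>?I. prob {s \<in> space \<Omega>. X s = L}) * c" by (simp add: sum_distrib_right)
 also have "(\<Sum>L\<in>?I. prob {s \<in> space \<Omega>. X s = L}) = prob (\<Union>L\<in>?I. {s \<in> space \<Omega>. X s = L})"
  by (rule finite_measure_finite_Union[symmetric]) (use fin mX in "auto simp: disjoint_family_on_def")
 also have "... * c \<le> 1 * c" by (rule mult_right_mono) (use c in auto)
 finally show "prob {s \<in> space \<Omega>. G (X s) & P (X s) s} \<le> c" by simp
qed

text \<open>The error consists of \<open>d + 1\<close> for the sortedness of the list and two cell
  lengths for the position within the cells.\<close>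

lemma search_result:
 assumes lst: "listing t L" and srt: "dsorted d t (%p. \<pi> (L p))" and t: "t < n"
  and T: "T = 40 * g" "0 < g" "n + 2 \<le> 2 ^ g"
  and good: "\<not> bad_search d T t L q"
 defines "x \<equiv> located (n + 2) (cell_test q T t L) T"
 shows "less_rank t L \<le> min (x * (T * A)) t + d + 1 + 2 * (T * A)"
  "min (x * (T * A)) t \<le> less_rank t L + d + 1 + 2 * (T * A)"
proof -
 let ?c1 = "lcell d T t L" and ?c2 = "rcell d T t L" and ?r = "less_rank t L" and ?W = "T * A"
 have W: "0 < ?W" using T A_pos by simp
 have lr: "?r \<le> t" by (rule less_rank_le)
 have c1le: "?c1 * ?W \<le> ?r - d - 1" unfolding lcell_def by (rule div_times_less_eq_dividend)
 have "?c1 \<le> ?c1 * ?W" using W by simp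
 then have "?c1 \<le> t" using c1le lr by linarith
 moreover have "?c1 \<le> (?r + d) div ?W" unfolding lcell_def by (rule div_le_mono) simp
 ultimately have c12: "?c1 < ?c2" by (simp add: rcell_def)
 have c2K: "?c2 < n + 2" using t by (simp add: rcell_def)
 have "?c1 \<le> x & x \<le> ?c2" unfolding x_def
  by (rule located_near[OF c12 c2K T(1,2,3)])
   (use good in "auto simp: bad_search_def Let_def wrong_def not_less")
 then have x: "?c1 \<le> x" "x \<le> ?c2" by auto
 have "?r - d - 1 < ?c1 * ?W + ?W"
  unfolding lcell_def using dividend_less_div_times[OF W, of "?r - d - 1"] by simp
 also have "?c1 * ?W \<le> x * ?W" using x(1) by (rule mult_le_mono1)
 finally show "?r \<le> min (x * ?W) t + d + 1 + 2 * ?W" using lr by linarith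
 have "x \<le> (?r + d) div ?W + 2" using x(2) by (simp add: rcell_def)
 then have "x * ?W \<le> ((?r + d) div ?W + 2) * ?W" by (rule mult_le_mono1)
 also have "... = (?r + d) div ?W * ?W + 2 * ?W" by (simp add: distrib_right)
 also have "... \<le> ?r + d + 2 * ?W" using div_times_less_eq_dividend[of "?r + d" ?W] by simp
 finally show "min (x * ?W) t \<le> ?r + d + 1 + 2 * ?W" by simp
qed

end

subsection \<open>The program as a machine program\<close>

definition ell :: "nat => nat" where "ell n = (LEAST l. n + 1 \<le> 2 ^ l)"

lemma ell_le: "n + 1 \<le> 2 ^ ell n"
proof -
 have "n + 1 \<le> 2 ^ n" by (simp add: Suc_leI)
 then show ?thesis unfolding ell_def by (rule LeastI)
qed

lemma ell_upper: "1 \<le> n ==> 2 ^ ell n \<le> 2 * n"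
proof (cases "ell n")
 case (Suc l)
 have "\<not> n + 1 \<le> 2 ^ l" using not_less_Least[of l "%l. n + 1 \<le> 2 ^ l"] Suc by (simp add: ell_def)
 then show ?thesis using Suc by simp
qed auto

lemma ell_pos: "1 \<le> n ==> 0 < ell n"
 using ell_le[of n] by (cases "ell n") auto

text \<open>For \<open>n < n0\<close> the radius exceeds \<open>n\<close>: every pair is inspected
  and every rearrangement is local, so no probability enters.\<close>

definition radius :: "nat => nat => nat => nat" where
 "radius c n0 n = c * ell n + (if n < n0 then n0 else 0)"

definition start :: "nat => nat => hstate" where
 "start n A = \<lparr>nvar = (%_. 0)(0 := n, 1 := A), narr = (%_ _. 0), rvar = (%_. 0), rarr = (%_ _. 0),
  outp = (%_. 0), seen = {}\<rparr>"

definition cap1 :: "nat => nat => nat => nat" where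
 "cap1 c n0 n = (200 * c + 1) * (n + 1) + 200 * n0 + 1"

lemma eval_cap0: "eval (cap0 c n0) h = cap1 c n0 (nvar h 0)"
 by (simp add: cap0_def cap1_def)

lemma init1_spec:
 assumes h: "nvar h 0 = n" "nvar h 2 = cap1 c n0 n"
 defines "G \<equiv> radius c n0 n"
 shows "nvar (sem q (init1 c n0) h) 4 = G & nvar (sem q (init1 c n0) h) 30 = 2 ^ (200 * G) &
  (\<forall>k\<le>200*G. narr (sem q (init1 c n0) h) 4 k = 2 ^ k)"
proof -
 let ?b = "IfC (BLess (Vr 18) (Plus (Vr 0) (Nm 1)))
   (SeqC (Assign 18 (Plus (Vr 18) (Vr 18))) (Assign 3 (Plus (Vr 3) (Nm 1)))) Skip"
 let ?l1 = "For 6 (Plus (Vr 0) (Nm 1)) ?b"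
 define h1 where "h1 = setv 18 1 (setv 3 0 h)"
 define h2 where "h2 = sem q ?l1 h1"
 have *: "nvar h2 18 = 2 ^ nvar h2 3 & (n + 1 \<le> 2 ^ nvar h2 3 \<or> nvar h2 3 = n + 1) & nvar h2 3 \<le> n + 1 &
   (\<forall>l<nvar h2 3. \<not> n + 1 \<le> 2 ^ l)"
  unfolding h2_def
 proof (rule For_frame_rule[where I = "%k h'. nvar h' 18 = 2 ^ nvar h' 3 & (n + 1 \<le> 2 ^ nvar h' 3 \<or> nvar h' 3 = k) &
   nvar h' 3 \<le> k & (\<forall>l<nvar h' 3. \<not> n + 1 \<le> 2 ^ l)"])
  show "eval (Plus (Vr 0) (Nm 1)) h1 = n + 1" "n + 1 \<le> nvar h1 2" using h by (auto simp: h1_def cap1_def)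
  fix k h' assume k: "k < n + 1" and I: "nvar h' 18 = 2 ^ nvar h' 3 & (n + 1 \<le> 2 ^ nvar h' 3 \<or> nvar h' 3 = k) &
   nvar h' 3 \<le> k & (\<forall>l<nvar h' 3. \<not> n + 1 \<le> 2 ^ l)" and f: "frame ?l1 h1 h'"
  have v: "nvar h' 0 = n" using f h by (auto simp: frame_def h1_def)
  show "nvar (sem q ?b (setv 6 k h')) 18 = 2 ^ nvar (sem q ?b (setv 6 k h')) 3 &
   (n + 1 \<le> 2 ^ nvar (sem q ?b (setv 6 k h')) 3 \<or> nvar (sem q ?b (setv 6 k h')) 3 = Suc k) &
   nvar (sem q ?b (setv 6 k h')) 3 \<le> Suc k & (\<forall>l<nvar (sem q ?b (setv 6 k h')) 3. \<not> n + 1 \<le> 2 ^ l)"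
  proof (cases "2 ^ nvar h' 3 < n + 1")
   case True
   then show ?thesis using I v by (auto simp: less_Suc_eq)
  next
   case False
   then show ?thesis using I v by auto
  qed
 qed (simp add: h1_def)
 have "n + 1 \<le> 2 ^ (n + 1)" using less_exp[of "n + 1"] by linarith
 then have "n + 1 \<le> 2 ^ nvar h2 3" using * by auto
 then have ell: "nvar h2 3 = ell n" unfolding ell_def
 proof (rule Least_equality[symmetric])
  fix l assume "n + 1 \<le> (2::nat) ^ l"
  then show "nvar h2 3 \<le> l" using * by (meson not_less)
 qed
 have ell_n: "ell n \<le> n + 1" using * ell by simp
 have f2: "frame ?l1 h1 h2" unfolding h2_def by (rule frame_sem)
 have v2: "nvar h2 0 = n" "nvar h2 2 = cap1 c n0 n" using f2 h by (auto simp: frame_def h1_def)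
 define h3 where "h3 = setv 18 1 (setv 4 G (if n < n0 then setv 4 (c * ell n) h2 else h2))"
 let ?l2 = "For 6 (Plus (scal 200 (Vr 4)) (Nm 1)) (SeqC (AStore 4 (Vr 6) (Vr 18)) (Assign 18 (Plus (Vr 18) (Vr 18))))"
 have e: "sem q (init1 c n0) h = sem q (Assign 30 (Ar 4 (scal 200 (Vr 4)))) (sem q ?l2 h3)"
 proof -
  have "sem q (init1 c n0) h = sem q (seqs [Assign 4 (scal c (Vr 3)), IfC (BLess (Vr 0) (Nm n0)) (Assign 4 (Plus (Vr 4) (Nm n0))) Skip,
  Assign 18 (Nm 1), ?l2, Assign 30 (Ar 4 (scal 200 (Vr 4)))]) h2"
   by (simp add: init1_def h2_def h1_def)
  also have "... = sem q (Assign 30 (Ar 4 (scal 200 (Vr 4)))) (sem q ?l2 h3)"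
   using v2 ell by (simp add: h3_def G_def radius_def)
  finally show ?thesis .
 qed
 have v3: "nvar h3 4 = G" "nvar h3 2 = cap1 c n0 n" "nvar h3 18 = 1" using v2 by (auto simp: h3_def)
 have "c * ell n \<le> c * (n + 1)" by (rule mult_le_mono2[OF ell_n])
 then have "200 * G + 1 \<le> 200 * (c * (n + 1)) + 200 * n0 + 1" by (simp add: G_def radius_def)
 then have Gc: "200 * G + 1 \<le> cap1 c n0 n" by (simp add: cap1_def algebra_simps)
 have "nvar (sem q ?l2 h3) 18 = 2 ^ (200 * G + 1) & (\<forall>k<200 * G + 1. narr (sem q ?l2 h3) 4 k = 2 ^ k)"
  by (rule For_frame_rule[where I = "%i h'. nvar h' 18 = 2 ^ i & (\<forall>k<i. narr h' 4 k = 2 ^ k)"])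
   (use v3 Gc in "auto simp: less_Suc_eq")
 moreover have "nvar (sem q ?l2 h3) 4 = G" using v3 by (subst sem_nvar) auto
 ultimately show ?thesis unfolding e by simp
qed

lemma init2_spec:
 assumes h: "nvar h 0 = n" "nvar h 1 = A" "nvar h 2 = cp" "nvar h 4 = G" "\<forall>k\<le>200*G. narr h 4 k = 2 ^ k"
  and cp: "40 * G \<le> cp"
 shows "env n A cp G (sem q init2 h)"
proof -
 define h1 where "h1 = setv 27 (2 ^ (160 * G)) (setv 14 (80 * G) (setv 13 (40 * G) h))"
 define h2 where "h2 = sem q (mul 11 13 1) h1"
 have e: "sem q init2 h = setv 17 (300 * nvar h2 4 + 4 * nvar h2 11) h2"
  using h by (simp add: init2_def h2_def h1_def)
 have v: "nvar h2 i = nvar h1 i" if "i ~= 11" "i ~= 6" for i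
  unfolding h2_def by (rule sem_nvar) (use that in "auto simp: mul_def")
 have a: "narr h2 4 = narr h1 4" unfolding h2_def by (rule sem_narr) (auto simp: mul_def)
 have "nvar h2 11 = 40 * G * A" unfolding h2_def by (subst mul_spec) (use h cp in "auto simp: h1_def")
 then show ?thesis unfolding e env_def using v a h by (simp add: h1_def)
qed

definition program :: "nat => nat => prog" where
 "program c n0 = Seq (cc (Assign 2 (cap0 c n0)) 0) (Seq (cc (init1 c n0) 0) (Seq (cc (Assign 2 (Vr 30)) 0) (cc main 0)))"

text \<open>Initialization inspects nothing, so its result may be computed with the signal values 0;
  it is the same state for all signals.\<close>

definition ready :: "nat => nat => nat => nat => hstate" where
 "ready c n0 n A = (let h = sem (%_ _. 0) (init1 c n0) (setv 2 (cap1 c n0 n) (start n A)) in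
  sem (%_ _. 0) init2 (setv 2 (nvar h 30) h))"

text \<open>The quadratic term is the initialization under the provisional cap, whose loops are not
  nested. The main part runs under the cap \<open>2 ^ (200 * radius c n0 n)\<close>.\<close>

definition cost :: "nat => nat => nat => nat" where
 "cost c n0 n = ecst (cap0 c n0) + 2 + (ccst (init1 c n0) * (cap1 c n0 n + 1) ^ 2 + (4 * (cap1 c n0 n + 1) +
  ccst main * (2 ^ (200 * radius c n0 n) + 1) ^ cdep main))"

lemma assign_ok:
 assumes "wfe e" "rel h st" "i < 64" "i ~= 0"
 shows "ex q \<omega> (cc (Assign i e) 0) st (ecst e * (nvar h 2 + 1) + 2) (rel (setv i (eval e h) h))"
 unfolding cc.simps
 apply (rule ex_Seq[OF ce_ok[OF assms(1,2)]])
 apply (rule ex_DoSeq)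
  apply (rule ex_Do[OF _ order_refl])
  apply (use assms in "auto simp: sim_def rel_def")[1]
 apply (rule order_refl)
 apply simp
 done

lemma sem_unseen:
 assumes "cblind c" "seen h = {}"
 shows "sem q c h = sem q' c h"
 by (rule sem_agree) (use cblind_seen[OF assms(1), of q' h] assms(2) in "simp add: agree_def")

lemma ready_run:
 assumes "1 \<le> n" "1 \<le> c"
 shows "run n A (2 ^ (200 * radius c n0 n)) (radius c n0 n) (ready c n0 n A)"
proof -
 define G where "G = radius c n0 n"
 define h where "h = setv 2 (cap1 c n0 n) (start n A)"
 define h1 where "h1 = sem (%_ _. 0) (init1 c n0) h"
 define h2 where "h2 = setv 2 (nvar h1 30) h1"
 have r: "ready c n0 n A = sem (%_ _. 0) init2 h2" by (simp add: ready_def Let_def h2_def h1_def h_def)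
 have s: "nvar h1 4 = G & nvar h1 30 = 2 ^ (200 * G) & (\<forall>k\<le>200*G. narr h1 4 k = 2 ^ k)"
  unfolding h1_def G_def by (rule init1_spec) (auto simp: h_def start_def)
 have v: "nvar h1 0 = n" "nvar h1 1 = A" "rarr h1 0 = (%_. 0)" "seen h1 = {}"
  unfolding h1_def by (subst sem_nvar sem_rarr cblind_seen; simp add: init1_def h_def start_def)+
 have "1 * ell n \<le> c * ell n" by (rule mult_le_mono1[OF assms(2)])
 then have "ell n \<le> c * ell n" by (simp only: mult_1)
 then have "ell n \<le> G" unfolding G_def radius_def by (rule trans_le_add1)
 then have G: "ell n \<le> G" "0 < G" using ell_pos[OF assms(1)] by auto
 have less: "k < 2 ^ k" for k :: nat by (rule less_exp)
 have p160: "160 * G + 1 \<le> 2 ^ (160 * G)" using Suc_leI[OF less[of "160 * G"]] by (simp only: Suc_eq_plus1)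
 have mono: "(2::nat) ^ (160 * G) \<le> 2 ^ (200 * G)" by (rule power_increasing) auto
 have "n + 2 \<le> 2 ^ ell n + 2 ^ ell n" using ell_le[of n] by linarith
 also have "... = 2 ^ (ell n + 1)" by simp
 also have "... \<le> 2 ^ (200 * G)" using G by (intro power_increasing) auto
 finally have n2: "n + 2 \<le> 2 ^ (200 * G)" .
 have "40 * G \<le> 2 ^ (200 * G)" using p160 mono by linarith
 then have "env n A (2 ^ (200 * G)) G (ready c n0 n A)"
  unfolding r by (intro init2_spec) (use s v in "auto simp: h2_def")
 moreover have "rarr (ready c n0 n A) 0 = (%_. 0)" "seen (ready c n0 n A) = {}"
  unfolding r using v by (subst sem_rarr cblind_seen; simp add: init2_def mul_def h2_def)+
 moreover have "160 * G + 1 \<le> 2 ^ (200 * G)" using p160 mono by linarith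
 ultimately show ?thesis unfolding G_def[symmetric] using n2 mono G(2) by unfold_locales
qed

lemma program_exec:
 assumes "1 \<le> n" "1 \<le> c"
 shows "ex q \<omega> (program c n0) (initial_state n A) (cost c n0 n) (rel (sem q finish (hst q (ready c n0 n A) n)))"
proof -
 define G where "G = radius c n0 n"
 define h where "h = setv 2 (cap1 c n0 n) (start n A)"
 define h1 where "h1 = sem q (init1 c n0) h"
 define h2 where "h2 = setv 2 (nvar h1 30) h1"
 interpret run q n A "2 ^ (200 * G)" G "ready c n0 n A" unfolding G_def by (rule ready_run[OF assms])
 have s0: "seen h = {}" by (simp add: h_def start_def)
 have b1: "cblind (init1 c n0)" by (simp add: init1_def)
 have b2: "cblind init2" by (simp add: init2_def mul_def)
 have h1: "h1 = sem (%_ _. 0) (init1 c n0) h" unfolding h1_def by (rule sem_unseen[OF b1 s0])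
 have "seen h2 = {}" unfolding h2_def h1_def using cblind_seen[OF b1, of q h] s0 by simp
 from sem_unseen[OF b2 this, of q "%_ _. 0"] have r: "ready c n0 n A = sem q init2 h2"
  by (simp add: ready_def Let_def h2_def h1 h_def)
 have c2: "nvar (ready c n0 n A) 2 = 2 ^ (200 * G)" "nvar (ready c n0 n A) 0 = n" using h0 by (auto simp: env_def)
 have e: "sem q main h2 = sem q finish (hst q (ready c n0 n A) n)"
  using c2 cp(1) by (simp add: main_def r[symmetric] hst_def sem.simps(10))
 have v1: "nvar h1 2 = cap1 c n0 n" unfolding h1_def by (subst sem_nvar) (auto simp: init1_def h_def)
 have v2: "nvar h2 2 = 2 ^ (200 * G)"
 proof -
  have "nvar h1 30 = 2 ^ (200 * G)"
   unfolding h1_def G_def using init1_spec[of h n c n0 q] by (simp add: h_def start_def)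
  then show ?thesis by (simp add: h2_def)
 qed
 have "rel (start n A) (initial_state n A)" by (auto simp: rel_def start_def initial_state_def)
 note A1 = assign_ok[OF _ this, of "cap0 c n0" 2 q \<omega>]
 have d: "cdep (init1 c n0) \<le> 2" by (simp add: init1_def)
 show ?thesis unfolding program_def cost_def
 proof (rule ex_Seq[OF A1])
  show "wfe (cap0 c n0)" by (simp add: cap0_def)
  show "ecst (cap0 c n0) * (nvar (start n A) 2 + 1) + 2 + (ccst (init1 c n0) * (cap1 c n0 n + 1) ^ 2 + (4 * (cap1 c n0 n + 1) +
  ccst main * (2 ^ (200 * radius c n0 n) + 1) ^ cdep main)) \<le> ecst (cap0 c n0) + 2 + (ccst (init1 c n0) * (cap1 c n0 n + 1) ^ 2 + (4 * (cap1 c n0 n + 1) +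
  ccst main * (2 ^ (200 * radius c n0 n) + 1) ^ cdep main))" by (simp add: start_def)
  fix st assume "rel (setv 2 (eval (cap0 c n0) (start n A)) (start n A)) st"
  then have rs: "rel h st" by (simp add: h_def eval_cap0 start_def)
  show "ex q \<omega> (Seq (cc (init1 c n0) 0) (Seq (cc (Assign 2 (Vr 30)) 0) (cc main 0))) st
   (ccst (init1 c n0) * (cap1 c n0 n + 1) ^ 2 + (4 * (cap1 c n0 n + 1) +
    ccst main * (2 ^ (200 * radius c n0 n) + 1) ^ cdep main)) (rel (sem q finish (hst q (ready c n0 n A) n)))"
  proof (rule ex_Seq[OF cc_ok[OF wf_init1 rs]])
   have "(nvar h 2 + 1) ^ cdep (init1 c n0) \<le> (cap1 c n0 n + 1) ^ 2"
    using d by (simp add: h_def power_increasing)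
   then show "ccst (init1 c n0) * (nvar h 2 + 1) ^ cdep (init1 c n0) + (4 * (cap1 c n0 n + 1) +
     ccst main * (2 ^ (200 * radius c n0 n) + 1) ^ cdep main) \<le> ccst (init1 c n0) * (cap1 c n0 n + 1) ^ 2 +
     (4 * (cap1 c n0 n + 1) + ccst main * (2 ^ (200 * radius c n0 n) + 1) ^ cdep main)"
    by (intro add_mono mult_left_mono) auto
   fix st1 assume "rel (sem q (init1 c n0) h) st1 & (\<forall>k\<ge>64. k < 64 + 0 --> regs st1 k = regs st k)"
   then have rs: "rel h1 st1" by (simp add: h1_def)
   show "ex q \<omega> (Seq (cc (Assign 2 (Vr 30)) 0) (cc main 0)) st1
    (4 * (cap1 c n0 n + 1) + ccst main * (2 ^ (200 * radius c n0 n) + 1) ^ cdep main)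
    (rel (sem q finish (hst q (ready c n0 n A) n)))"
   proof (rule ex_Seq[OF assign_ok[OF _ rs, of "Vr 30"]])
    fix st2 assume "rel (setv 2 (eval (Vr 30) h1) h1) st2"
    then have rs: "rel h2 st2" by (simp add: h2_def)
    show "ex q \<omega> (cc main 0) st2 (ccst main * (2 ^ (200 * radius c n0 n) + 1) ^ cdep main)
     (rel (sem q finish (hst q (ready c n0 n A) n)))"
     by (rule ex_mono[OF cc_ok[OF wf_main rs]]) (auto simp: v2 G_def e)
   qed (auto simp: v1)
  qed
 qed auto
qed

section \<open>Correctness\<close>

text \<open>A rearrangement that moves nothing by more than \<open>R\<close> keeps all pairs at
  distance above \<open>2*R\<close> in order. Values that vanish at smaller distances therefore
  contribute the same to every local rearrangement.\<close>

lemma local_list_score: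
 assumes h: "rlocal m R h" and w: "\<And>p p'. p < m ==> p' < m ==> p \<le> p' + 2 * R ==> p' \<le> p + 2 * R ==> p ~= p' ==> w p p' = 0"
 shows "list_score w m h = (\<Sum>(p, p')\<in>{(p, p'). p < m & p' < m & p + 2 * R < p'}. w p p')"
proof -
 have inj: "inj_on h {..<m}" and img: "h ` {..<m} = {..<m}" using h by (auto simp: rlocal_def listing_def bij_betw_def)
 have lt: "h i < m" if "i < m" for i using img that by blast
 have loc: "h i \<le> i + R" "i \<le> h i + R" if "i < m" for i using h that by (auto simp: rlocal_def)
 let ?S = "{(i, j). i < m & j < m & h i + 2 * R < h j}" and ?T = "{(i, j). j < m & i < j}"
 have fin: "finite ?T" by (rule finite_subset[of _ "{..<m} \<times> {..<m}"]) auto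
 have "list_score w m h = (\<Sum>(i, j)\<in>?T. w (h i) (h j))"
 proof -
  have "list_score w m h = (\<Sum>(j, i)\<in>(SIGMA j:{..<m}. {..<j}). w (h i) (h j))"
   unfolding list_score_def by (subst sum.Sigma) auto
  also have "... = (\<Sum>(i, j)\<in>?T. w (h i) (h j))"
   by (rule sum.reindex_bij_witness[of _ prod.swap prod.swap]) auto
  finally show ?thesis .
 qed
 also have "... = (\<Sum>(i, j)\<in>?S. w (h i) (h j))"
 proof (rule sum.mono_neutral_right[OF fin])
  show "?S \<subseteq> ?T"
  proof
   fix z assume "z \<in> ?S"
   then obtain i j where z: "z = (i, j)" "i < m" "j < m" "h i + 2 * R < h j" by auto
   then show "z \<in> ?T" using loc[of i] loc[of j] by auto
  qed
  show "\<forall>z\<in>?T - ?S. (case z of (i, j) => w (h i) (h j)) = 0"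
  proof
   fix z assume "z \<in> ?T - ?S"
   then obtain i j where z: "z = (i, j)" "i < j" "j < m" "\<not> h i + 2 * R < h j" by auto
   then have im: "i < m" by simp
   have "h i ~= h j" using inj_onD[OF inj, of i j] im z by auto
   moreover have "h i \<le> h j + 2 * R" "h j \<le> h i + 2 * R"
    using loc[OF im] loc[OF z(3)] z(2,4) by linarith+
   ultimately have "w (h i) (h j) = 0" using w lt[OF im] lt[OF z(3)] by blast
   then show "(case z of (i, j) => w (h i) (h j)) = 0" using z(1) by simp
  qed
 qed
 also have "... = (\<Sum>(p, p')\<in>{(p, p'). p < m & p' < m & p + 2 * R < p'}. w p p')"
 proof -
  let ?U = "{(p, p'). p < m & p' < m & p + 2 * R < p'}" and ?f = "%z. (h (fst z), h (snd z))"
  have "bij_betw ?f ?S ?U"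
   unfolding bij_betw_def
  proof
   show "inj_on ?f ?S" using inj by (auto simp: inj_on_def)
   show "?f ` ?S = ?U"
   proof (intro equalityI subsetI)
    fix z assume z: "z \<in> ?U"
    then have "fst z \<in> h ` {..<m}" "snd z \<in> h ` {..<m}" unfolding img by auto
    then obtain i j where "i < m" "j < m" "fst z = h i" "snd z = h j" by (elim imageE) auto
    then show "z \<in> ?f ` ?S" using z by (intro image_eqI[of _ _ "(i, j)"]) auto
   next
    fix z assume "z \<in> ?f ` ?S"
    then obtain i j where "i < m" "j < m" "h i + 2 * R < h j" "z = (h i, h j)" by auto
    then show "z \<in> ?U" using lt[of i] lt[of j] by simp
   qed
  qed
  from sum.reindex_bij_betw[OF this, of "%z. w (fst z) (snd z)"] show ?thesis
   by (simp add: case_prod_unfold)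
 qed
 finally show ?thesis .
qed

lemma list_score_add: "list_score (%a b. u a b + v a b) m h = list_score u m h + list_score v m h"
 by (simp add: list_score_def sum.distrib)

lemma listing_factor:
 assumes "listing m L" "listing m Z"
 obtains g where "listing m g" "\<And>i. i < m ==> Z i = L (g i)"
proof
 have L: "bij_betw L {..<m} {..<m}" and Z: "bij_betw Z {..<m} {..<m}" using assms by (auto simp: listing_def)
 show "listing m (the_inv_into {..<m} L \<circ> Z)"
  unfolding listing_def using bij_betw_trans[OF Z bij_betw_the_inv_into[OF L]] .
 show "Z i = L ((the_inv_into {..<m} L \<circ> Z) i)" if "i < m" for i
 proof -
  have "Z i \<in> L ` {..<m}" using L Z that by (auto simp: bij_betw_def)
  then show ?thesis using L by (simp add: bij_betw_def f_the_inv_into_f)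
 qed
qed

text \<open>Split \<open>q\<close> into the known values and the rest. If all pairs within 160G = 2
  * 80G places are known, the rest is constant on local rearrangements, so a maximizer of the known
  part maximizes \<open>q\<close> among them; and an optimal list \<open>Z\<close> is one of
  them.\<close>

lemma stage_best:
 assumes step: "stage_step q G t L E L2" and L: "listing t L" and anti: "antisym_on_lt n q" and t: "t < n"
  and near: "\<And>b p p'. b \<le> t ==> \<forall>p\<le>t. slot_score (qtab q E) L t p \<le> slot_score (qtab q E) L t b ==>
   p < p' ==> p' \<le> t ==> p' \<le> p + 160 * G ==> {ins L t b p, ins L t b p'} \<in> E"
  and opt: "best_listing q (Suc t) Z"
  and loc: "\<And>b g. b \<le> t ==> \<forall>p\<le>t. slot_score (qtab q E) L t p \<le> slot_score (qtab q E) L t b ==>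
   listing (Suc t) g ==> (\<And>i. i < Suc t ==> Z i = ins L t b (g i)) ==> rlocal (Suc t) (80 * G) g"
 shows "best_listing q (Suc t) L2"
proof -
 obtain b f where b: "b \<le> t" "\<forall>p\<le>t. slot_score (qtab q E) L t p \<le> slot_score (qtab q E) L t b"
  and f: "rlocal (Suc t) (80 * G) f" "\<forall>p\<le>t. L2 p = ins L t b (f p)"
  and best: "\<forall>g. rlocal (Suc t) (80 * G) g -->
    list_score (%p p'. qtab q E (ins L t b p) (ins L t b p')) (Suc t) g \<le>
    list_score (%p p'. qtab q E (ins L t b p) (ins L t b p')) (Suc t) f"
  using step unfolding stage_step_def by blast
 let ?L' = "ins L t b"
 define W where "W p p' = qtab q E (?L' p) (?L' p')" for p p'
 define w where "w p p' = q (?L' p) (?L' p') - W p p'" for p p'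
 have L': "listing (Suc t) ?L'" by (rule ins_listing[OF L b(1)])
 have inj: "inj_on ?L' {..<Suc t}" and img: "?L' ` {..<Suc t} = {..<Suc t}" using L' by (auto simp: listing_def bij_betw_def)
 have w0: "w p p' = 0" if "p < Suc t" "p' < Suc t" "p \<le> p' + 2 * (80 * G)" "p' \<le> p + 2 * (80 * G)" "p ~= p'" for p p'
 proof -
  have "{?L' p, ?L' p'} \<in> E"
  proof (cases "p < p'")
   case True
   then show ?thesis using near[OF b, of p p'] that by simp
  next
   case False
   then show ?thesis using near[OF b, of p' p] that by (simp add: insert_commute)
  qed
  moreover have "?L' p ~= ?L' p'" using inj that by (auto simp: inj_on_def)
  moreover have "?L' x < n" if "x < Suc t" for x
  proof -
   have "?L' x \<in> {..<Suc t}" using img that by blast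
   then show ?thesis using t by simp
  qed
  then have "q (?L' p) (?L' p') = - q (?L' p') (?L' p)"
   using anti that(1,2) unfolding antisym_on_lt_def by blast
  ultimately have "W p p' = q (?L' p) (?L' p')" unfolding W_def qtab_def by simp
  then show ?thesis by (simp add: w_def)
 qed
 have sc: "list_score q (Suc t) (%i. ?L' (h i)) = list_score W (Suc t) h +
   (\<Sum>(p, p')\<in>{(p, p'). p < Suc t & p' < Suc t & p + 2 * (80 * G) < p'}. w p p')" if "rlocal (Suc t) (80 * G) h" for h
 proof -
  have "list_score q (Suc t) (%i. ?L' (h i)) = list_score (%p p'. W p p' + w p p') (Suc t) h"
   by (simp add: list_score_def w_def)
  also have "... = list_score W (Suc t) h + list_score w (Suc t) h" by (rule list_score_add)
  also have "list_score w (Suc t) h = (\<Sum>(p, p')\<in>{(p, p'). p < Suc t & p' < Suc t & p + 2 * (80 * G) < p'}. w p p')"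
   by (rule local_list_score[OF that w0])
  finally show ?thesis .
 qed
 have Ol: "listing (Suc t) Z" using opt by (simp add: best_listing_def)
 obtain g where g: "listing (Suc t) g" "\<And>i. i < Suc t ==> Z i = ?L' (g i)" using listing_factor[OF L' Ol] by blast
 have gl: "rlocal (Suc t) (80 * G) g" by (rule loc[OF b g])
 have "list_score q (Suc t) Z = list_score q (Suc t) (%i. ?L' (g i))" by (rule list_score_cong) (use g in auto)
 also have "... \<le> list_score q (Suc t) (%i. ?L' (f i))"
 proof -
  have "(%p p'. qtab q E (?L' p) (?L' p')) = W" by (simp add: W_def fun_eq_iff)
  then show ?thesis unfolding sc[OF gl] sc[OF f(1)] using best gl by simp
 qed
 also have "... = list_score q (Suc t) L2" by (rule list_score_cong) (use f in auto)
 finally have "list_score q (Suc t) Z \<le> list_score q (Suc t) L2" .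
 then show ?thesis using opt stage_step_listing[OF step L] unfolding best_listing_def by fastforce
qed

lemma slot_score_diff:
 assumes "r \<le> b" "b \<le> t"
 shows "slot_score w L t b - slot_score w L t r = (\<Sum>j\<in>{r..<b}. w (L j) t - w t (L j))"
proof -
 have "slot_score w L t b - slot_score w L t r = (\<Sum>j<t. if j \<in> {r..<b} then w (L j) t - w t (L j) else 0)"
  unfolding slot_score_def sum_subtractf[symmetric] using assms by (intro sum.cong refl) auto
 also have "... = (\<Sum>j\<in>{..<t} \<inter> {r..<b}. w (L j) t - w t (L j))" by (rule sum.inter_restrict[symmetric]) simp
 also have "{..<t} \<inter> {r..<b} = {r..<b}" using assms by auto
 finally show ?thesis .
qed

text \<open>With \<open>n \<le> G\<close> the inspected range covers the whole list, and no position
  is farther than the radius from any other.\<close>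

lemma small_correct:
 assumes anti: "antisym_on_lt n q" and nG: "n \<le> G"
  and step: "\<And>t. t < n ==> stage_step q G t (Lf t) (\<Union>s<Suc t. near_pairs q n A G s (Lf s)) (Lf (Suc t))"
  and lst: "\<And>t. t \<le> n ==> listing t (Lf t)"
 shows "t \<le> n ==> best_listing q t (Lf t)"
proof (induction t)
 case 0
 then show ?case using lst[of 0] by (simp add: best_listing_def list_score_def)
next
 case (Suc t)
 then have t: "t < n" by simp
 obtain Z where Z: "best_listing q (Suc t) Z" using best_listing_exists by blast
 show ?case
 proof (rule stage_best[OF step[OF t] lst[OF less_imp_le[OF t]] anti t _ Z])
  fix b p p' assume b: "b \<le> t" and p: "p < p'" "p' \<le> t"
  have E: "{u, v} \<in> (\<Union>s<Suc t. near_pairs q n A G s (Lf s))" if "v < u" "u \<le> t" for u v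
  proof -
   have "Lf u ` {..<u} = {..<u}" using lst[of u] that t by (auto simp: listing_def bij_betw_def)
   then have "v \<in> Lf u ` {..<u}" using that(1) by simp
   then obtain x where x: "x < u" "v = Lf u x" by (elim imageE) simp
   have *: "l \<le> u ==> l \<le> x + (300 * G + k) & x \<le> l + (300 * G + k)" for l k using x(1) that t nG by linarith
   have "{u, v} \<in> near_pairs q n A G u (Lf u)" unfolding near_pairs_def Let_def x(2)
    by (rule imageI, rule CollectI, rule conjI[OF x(1)], rule *, rule min.cobounded2)
   then show ?thesis using that by auto
  qed
  have il: "inj_on (ins (Lf t) t b) {..<Suc t}" "ins (Lf t) t b ` {..<Suc t} = {..<Suc t}"
   using ins_listing[OF lst[OF less_imp_le[OF t]] b] by (auto simp: listing_def bij_betw_def)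
  have "ins (Lf t) t b p ~= ins (Lf t) t b p'" using inj_onD[OF il(1), of p p'] p by auto
  moreover have "ins (Lf t) t b p \<in> {..<Suc t}" "ins (Lf t) t b p' \<in> {..<Suc t}"
   by (subst il(2)[symmetric], rule imageI, use p in simp)+
  then have "ins (Lf t) t b p \<le> t" "ins (Lf t) t b p' \<le> t" by simp_all
  ultimately consider "ins (Lf t) t b p < ins (Lf t) t b p'" "ins (Lf t) t b p' \<le> t"
   | "ins (Lf t) t b p' < ins (Lf t) t b p" "ins (Lf t) t b p \<le> t" by linarith
  then show "{ins (Lf t) t b p, ins (Lf t) t b p'} \<in> (\<Union>s<Suc t. near_pairs q n A G s (Lf s))"
  proof cases
   case 1
   then show ?thesis by (subst insert_commute) (rule E)
  next
   case 2
   then show ?thesis by (rule E)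
  qed
 next
  fix g assume g: "listing (Suc t) g"
  have "g i < Suc t" if "i < Suc t" for i using g that by (auto simp: listing_def bij_betw_def)
  then show "rlocal (Suc t) (80 * G) g" using g t nG by (fastforce simp: rlocal_def)
 qed
qed

section \<open>Ranks among the first items\<close>

definition rk :: "(nat => nat) => nat => nat => nat" where
 "rk \<pi> m i = card {i'. i' < m & \<pi> i' < \<pi> i}"

lemma sorted_rk:
 assumes L: "listing m L" and s: "dsorted d m (%p. \<pi> (L p))" and p: "p < m"
 shows "p \<le> rk \<pi> m (L p) + d" "rk \<pi> m (L p) \<le> p + d"
proof -
 have inj: "inj_on L {..<m}" and img: "L ` {..<m} = {..<m}" using L by (auto simp: listing_def bij_betw_def)
 have eq: "{i'. i' < m & \<pi> i' < \<pi> (L p)} = L ` {p'. p' < m & \<pi> (L p') < \<pi> (L p)}"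
 proof (intro equalityI subsetI)
  fix i assume i: "i \<in> {i'. i' < m & \<pi> i' < \<pi> (L p)}"
  then have "i \<in> L ` {..<m}" using img by simp
  then show "i \<in> L ` {p'. p' < m & \<pi> (L p') < \<pi> (L p)}" using i by auto
 next
  fix i assume "i \<in> L ` {p'. p' < m & \<pi> (L p') < \<pi> (L p)}"
  then obtain x where x: "x < m" "\<pi> (L x) < \<pi> (L p)" "i = L x" by auto
  moreover have "L x \<in> {..<m}" using img x(1) by blast
  ultimately show "i \<in> {i'. i' < m & \<pi> i' < \<pi> (L p)}" by simp
 qed
 have r: "rk \<pi> m (L p) = card {p'. p' < m & \<pi> (L p') < \<pi> (L p)}"
  unfolding rk_def eq by (rule card_image) (rule inj_on_subset[OF inj], auto)
 have "{..<p - d} \<subseteq> {p'. p' < m & \<pi> (L p') < \<pi> (L p)}" using s p unfolding dsorted_def by auto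
 then have "card {..<p - d} \<le> rk \<pi> m (L p)" unfolding r by (intro card_mono) auto
 then show "p \<le> rk \<pi> m (L p) + d" by simp
 have "{p'. p' < m & \<pi> (L p') < \<pi> (L p)} \<subseteq> {..p + d} - {p}"
 proof
  fix x assume x: "x \<in> {p'. p' < m & \<pi> (L p') < \<pi> (L p)}"
  have "\<not> p + d < x"
  proof
   assume "p + d < x"
   then have "\<pi> (L p) < \<pi> (L x)" using s x unfolding dsorted_def by blast
   then show False using x by simp
  qed
  then show "x \<in> {..p + d} - {p}" using x by auto
 qed
 then have "rk \<pi> m (L p) \<le> card ({..p + d} - {p})" unfolding r by (intro card_mono) auto
 then show "rk \<pi> m (L p) \<le> p + d" by simp
qed

lemma rk_split:
 assumes "m' \<le> m"
 shows "rk \<pi> m i = rk \<pi> m' i + card {i'. m' \<le> i' & i' < m & \<pi> i' < \<pi> i}"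
proof -
 have "{i'. i' < m & \<pi> i' < \<pi> i} = {i'. i' < m' & \<pi> i' < \<pi> i} \<union> {i'. m' \<le> i' & i' < m & \<pi> i' < \<pi> i}"
  using assms by auto
 from arg_cong[OF this, of card] show ?thesis
  unfolding rk_def by (subst (asm) card_Un_disjoint) auto
qed

lemma rk_diff:
 assumes "m' \<le> m" "\<pi> b \<le> \<pi> a"
 shows "rk \<pi> m' a + rk \<pi> m b \<le> rk \<pi> m' b + rk \<pi> m a" "rk \<pi> m b \<le> rk \<pi> m a"
proof -
 have "card {i'. m' \<le> i' & i' < m & \<pi> i' < \<pi> b} \<le> card {i'. m' \<le> i' & i' < m & \<pi> i' < \<pi> a}"
  using assms(2) by (intro card_mono) auto
 then show "rk \<pi> m' a + rk \<pi> m b \<le> rk \<pi> m' b + rk \<pi> m a"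
  using rk_split[OF assms(1), of \<pi> a] rk_split[OF assms(1), of \<pi> b] by simp
 show "rk \<pi> m b \<le> rk \<pi> m a" unfolding rk_def
  using assms(2) by (intro card_mono) auto
qed

text \<open>Removing items can only bring two ranks closer together. Hence two items that are near
  each other now were near when the later of them was inserted, and their signal was inspected
  then.\<close>

lemma rk_near:
 assumes "m' \<le> m" "rk \<pi> m a \<le> rk \<pi> m b + D" "rk \<pi> m b \<le> rk \<pi> m a + D"
 shows "rk \<pi> m' a \<le> rk \<pi> m' b + D" "rk \<pi> m' b \<le> rk \<pi> m' a + D"
proof -
 have "rk \<pi> m' a \<le> rk \<pi> m' b + D & rk \<pi> m' b \<le> rk \<pi> m' a + D"
 proof (cases "\<pi> b \<le> \<pi> a")
  case True
  then show ?thesis using assms(2,3) rk_diff(1)[of m' m \<pi> b a] rk_diff(2)[of m' m' \<pi> b a] assms(1) True by linarith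
 next
  case False
  then have le: "\<pi> a \<le> \<pi> b" by simp
  show ?thesis using assms(2,3) rk_diff(1)[of m' m \<pi> a b] rk_diff(2)[of m' m' \<pi> a b] assms(1) le by linarith
 qed
 then show "rk \<pi> m' a \<le> rk \<pi> m' b + D" "rk \<pi> m' b \<le> rk \<pi> m' a + D" by blast+
qed

lemma rk_Suc: "rk \<pi> m i \<le> rk \<pi> (Suc m) i" "rk \<pi> (Suc m) i \<le> rk \<pi> m i + 1"
proof -
 have "card {i'. m \<le> i' & i' < Suc m & \<pi> i' < \<pi> i} \<le> card {m}" by (rule card_mono) auto
 then show "rk \<pi> m i \<le> rk \<pi> (Suc m) i" "rk \<pi> (Suc m) i \<le> rk \<pi> m i + 1" using rk_split[of m "Suc m" \<pi> i] by auto
qed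

text \<open>One insertion shifts the place of an old item by at most 1 and its rank by at most 1, in
  the same direction, which costs 1 beyond the sortedness \<open>d\<close>.\<close>

lemma ins_rk:
 assumes L: "listing t L" and s: "dsorted d t (%p. \<pi> (L p))" and b: "b \<le> rk \<pi> t t + e" "rk \<pi> t t \<le> b + e"
  and e: "d + 1 \<le> e" and p: "p \<le> t" "b \<le> t"
 shows "p \<le> rk \<pi> (Suc t) (ins L t b p) + (if ins L t b p = t then e else d + 1)"
  "rk \<pi> (Suc t) (ins L t b p) \<le> p + (if ins L t b p = t then e else d + 1)"
proof -
 have Lt: "L x ~= t" if "x < t" for x
 proof -
  have "L x \<in> {..<t}" using L that unfolding listing_def bij_betw_def by blast
  then show ?thesis by simp
 qed
 have tt: "rk \<pi> (Suc t) t = rk \<pi> t t" unfolding rk_def by (rule arg_cong[where f = card]) (auto simp: less_Suc_eq)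
 consider "p < b" | "p = b" | "b < p" by linarith
 then have "p \<le> rk \<pi> (Suc t) (ins L t b p) + (if ins L t b p = t then e else d + 1) &
  rk \<pi> (Suc t) (ins L t b p) \<le> p + (if ins L t b p = t then e else d + 1)"
 proof cases
  case 1
  then have p: "p < t" "ins L t b p = L p" using p by (auto simp: ins_def)
  show ?thesis unfolding p(2) using sorted_rk[OF L s p(1)] rk_Suc[of \<pi> t "L p"] Lt[OF p(1)] by simp
 next
  case 2
  then have "ins L t b p = t" by (simp add: ins_def)
  then show ?thesis using b tt 2 by simp
 next
  case 3
  then have p: "p - 1 < t" "ins L t b p = L (p - 1)" using p by (auto simp: ins_def)
  show ?thesis unfolding p(2) if_not_P[OF Lt[OF p(1)]]
   using sorted_rk[OF L s p(1)] rk_Suc[of \<pi> t "L (p - 1)"] 3 by linarith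
 qed
 then show "p \<le> rk \<pi> (Suc t) (ins L t b p) + (if ins L t b p = t then e else d + 1)"
  "rk \<pi> (Suc t) (ins L t b p) \<le> p + (if ins L t b p = t then e else d + 1)" by blast+
qed

section \<open>Accuracy of the insertion point\<close>

context signal_model
begin

lemma less_rank_rk: "listing t L ==> less_rank t L = rk \<pi> t t"
proof -
 assume L: "listing t L"
 then have inj: "inj_on L {..<t}" and img: "L ` {..<t} = {..<t}" by (auto simp: listing_def bij_betw_def)
 have "{i'. i' < t & \<pi> i' < \<pi> t} = L ` {p. p < t & \<pi> (L p) < \<pi> t}"
 proof (intro equalityI subsetI)
  fix i assume i: "i \<in> {i'. i' < t & \<pi> i' < \<pi> t}"
  then have "i \<in> L ` {..<t}" using img by simp
  then show "i \<in> L ` {p. p < t & \<pi> (L p) < \<pi> t}" using i by auto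
 next
  fix i assume "i \<in> L ` {p. p < t & \<pi> (L p) < \<pi> t}"
  then obtain x where x: "x < t" "\<pi> (L x) < \<pi> t" "i = L x" by auto
  moreover have "L x \<in> {..<t}" using img x(1) by blast
  ultimately show "i \<in> {i'. i' < t & \<pi> i' < \<pi> t}" by simp
 qed
 moreover have "card (L ` {p. p < t & \<pi> (L p) < \<pi> t}) = card {p. p < t & \<pi> (L p) < \<pi> t}"
  by (rule card_image) (rule inj_on_subset[OF inj], auto)
 ultimately show ?thesis by (simp add: less_rank_def rk_def)
qed

abbreviation loc_at :: "(nat => nat => real) => nat => nat => (nat => nat) => nat" where
 "loc_at q G t L \<equiv> min (located (n + 2) (cell_test q (40 * G) t L) (40 * G) * (40 * G * A)) t"

lemma near_pairs_iff:
 assumes L: "listing t L" and p: "p < t"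
 shows "{t, L p} \<in> near_pairs q n A G t L \<longleftrightarrow>
  loc_at q G t L \<le> p + (300 * G + 4 * (40 * G * A)) & p \<le> loc_at q G t L + (300 * G + 4 * (40 * G * A))"
proof -
 have inj: "inj_on L {..<t}" using L by (auto simp: listing_def bij_betw_def)
 have Lt: "L x < t" if "x < t" for x using L that by (auto simp: listing_def bij_betw_def)
 have np: "near_pairs q n A G t L = (%p. {t, L p}) ` {p. p < t & loc_at q G t L \<le> p + (300 * G + 4 * (40 * G * A)) &
   p \<le> loc_at q G t L + (300 * G + 4 * (40 * G * A))}"
  unfolding near_pairs_def Let_def ..
 show ?thesis (is "_ \<longleftrightarrow> ?R p")
 proof
  assume "{t, L p} \<in> near_pairs q n A G t L"
  then obtain x where x: "x < t" "?R x" "{t, L p} = {t, L x}" unfolding np by blast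
  have "L p = L x" using x(3) Lt[OF p] Lt[OF x(1)] by (auto simp: doubleton_eq_iff)
  then have "p = x" using inj_onD[OF inj] p x(1) by simp
  then show "?R p" using x(2) by simp
 next
  assume "?R p"
  then show "{t, L p} \<in> near_pairs q n A G t L" unfolding np using p by (intro imageI) simp
 qed
qed

definition slot_sum :: "(nat => nat => real) => nat => (nat => nat) => nat => nat => real" where
 "slot_sum q t L a b = (\<Sum>j\<in>{a..<b}. q t (L j))"

lemma not_bad_insert:
 assumes L: "listing t L" and anti: "antisym_on_lt n q" and t: "t < n" and bi: "\<not> bad_insert e t L q" and p: "p \<le> t"
 shows "less_rank t L + e \<le> p ==> 0 < slot_sum q t L (less_rank t L) p"
  "p + e \<le> less_rank t L ==> slot_sum q t L p (less_rank t L) < 0"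
proof -
 have inj: "inj_on L {..<t}" using L by (auto simp: listing_def bij_betw_def)
 have Lt: "L x < t" if "x < t" for x using L that by (auto simp: listing_def bij_betw_def)
 have lr: "less_rank t L \<le> t" by (rule less_rank_le)
 show "0 < slot_sum q t L (less_rank t L) p" if "less_rank t L + e \<le> p"
 proof -
  have "inj_on L {less_rank t L..<p}" by (rule inj_on_subset[OF inj]) (use p in auto)
  then have i: "inj_on (%p'. (t, L p')) {less_rank t L..<p}" by (simp add: inj_on_def)
  have "upos q ((%p'. (t, L p')) ` {less_rank t L..<p})" using bi that p unfolding bad_insert_def by blast
  then show ?thesis unfolding upos_def sum.reindex[OF i] slot_sum_def by simp
 qed
 show "slot_sum q t L p (less_rank t L) < 0" if "p + e \<le> less_rank t L"
 proof -
  have "inj_on L {p..<less_rank t L}" by (rule inj_on_subset[OF inj]) (use lr in auto)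
  then have i: "inj_on (%p'. (L p', t)) {p..<less_rank t L}" by (simp add: inj_on_def)
  have "upos q ((%p'. (L p', t)) ` {p..<less_rank t L})" using bi that p unfolding bad_insert_def by blast
  then have "0 < (\<Sum>j\<in>{p..<less_rank t L}. q (L j) t)" unfolding upos_def sum.reindex[OF i] by simp
  also have "... = (\<Sum>j\<in>{p..<less_rank t L}. - q t (L j))"
  proof (rule sum.cong[OF refl])
   fix j assume "j \<in> {p..<less_rank t L}"
   then have "L j < n" using Lt[of j] lr t by simp
   then show "q (L j) t = - q t (L j)" using anti t unfolding antisym_on_lt_def by blast
  qed
  finally show ?thesis by (simp add: slot_sum_def sum_negf)
 qed
qed

lemma qtab_near:
 assumes L: "listing t L" and K: "E = E0 \<union> near_pairs q n A G t L" "E0 \<subseteq> item_pairs t" and j: "j < t"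
 shows "qtab q E t (L j) = (if loc_at q G t L \<le> j + (300 * G + 4 * (40 * G * A)) &
   j \<le> loc_at q G t L + (300 * G + 4 * (40 * G * A)) then q t (L j) else 0)"
  "qtab q E (L j) t = - qtab q E t (L j)"
proof -
 have Lj: "L j < t" using L j by (auto simp: listing_def bij_betw_def)
 have "{t, L j} \<notin> E0" using K(2) by (auto simp: item_pairs_def)
 then have *: "{t, L j} \<in> E \<longleftrightarrow> {t, L j} \<in> near_pairs q n A G t L" by (simp add: K(1))
 show "qtab q E t (L j) = (if loc_at q G t L \<le> j + (300 * G + 4 * (40 * G * A)) &
   j \<le> loc_at q G t L + (300 * G + 4 * (40 * G * A)) then q t (L j) else 0)"
  unfolding qtab_def * near_pairs_iff[OF L j] using Lj by simp
 show "qtab q E (L j) t = - qtab q E t (L j)"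
  unfolding qtab_def insert_commute[of "L j"] using Lj by simp
qed

text \<open>Unknown signals count as 0, so a slot beyond the inspected range scores like the slot
  \<open>y\<close> at the edge of the range. The edge is still at least \<open>e\<close> away from
  the true place, and any slot that far away scores strictly less than the true one.\<close>

lemma best_slot_near:
 assumes L: "listing t L" and anti: "antisym_on_lt n q" and t: "t < n" and bi: "\<not> bad_insert e t L q"
  and K: "E = E0 \<union> near_pairs q n A G t L" "E0 \<subseteq> item_pairs t"
  and l: "less_rank t L \<le> loc_at q G t L + h" "loc_at q G t L \<le> less_rank t L + h"
  and h: "h + e \<le> 300 * G + 4 * (40 * G * A)"
  and b: "b \<le> t" "\<forall>p\<le>t. slot_score (qtab q E) L t p \<le> slot_score (qtab q E) L t b" and e: "0 < e"
 shows "b \<le> less_rank t L + e" "less_rank t L \<le> b + e"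
proof -
 let ?r = "less_rank t L" and ?l = "loc_at q G t L" and ?H = "300 * G + 4 * (40 * G * A)"
 have rt: "?r \<le> t" by (rule less_rank_le)
 have diff: "slot_score (qtab q E) L t y - slot_score (qtab q E) L t x = - 2 * (\<Sum>j\<in>{x..<y}. if ?l \<le> j + ?H & j \<le> ?l + ?H then q t (L j) else 0)"
  if "x \<le> y" "y \<le> t" for x y
 proof -
  have "slot_score (qtab q E) L t y - slot_score (qtab q E) L t x = (\<Sum>j\<in>{x..<y}. qtab q E (L j) t - qtab q E t (L j))"
   by (rule slot_score_diff[OF that])
  also have "... = (\<Sum>j\<in>{x..<y}. - 2 * (if ?l \<le> j + ?H & j \<le> ?l + ?H then q t (L j) else 0))"
  proof (rule sum.cong[OF refl])
   fix j assume "j \<in> {x..<y}"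
   then have j: "j < t" using that by simp
   show "qtab q E (L j) t - qtab q E t (L j) = - 2 * (if ?l \<le> j + ?H & j \<le> ?l + ?H then q t (L j) else 0)"
    unfolding qtab_near(2)[OF L K j] qtab_near(1)[OF L K j] by simp
  qed
  finally show ?thesis by (simp add: sum_distrib_left)
 qed
 show "b \<le> ?r + e"
 proof (rule ccontr)
  assume a: "\<not> b \<le> ?r + e"
  define y where "y = min b (?l + ?H + 1)"
  have y: "?r + e \<le> y" "y \<le> t" using a b(1) l h unfolding y_def by linarith+
  have yl: "y \<le> ?l + ?H + 1" unfolding y_def by (rule min.cobounded2)
  have "(\<Sum>j\<in>{?r..<b}. if ?l \<le> j + ?H & j \<le> ?l + ?H then q t (L j) else 0) = (\<Sum>j\<in>{?r..<y}. q t (L j))"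
  proof (rule sum.mono_neutral_cong_right)
   show "{?r..<y} \<subseteq> {?r..<b}" by (auto simp: y_def)
   show "\<forall>j\<in>{?r..<b} - {?r..<y}. (if ?l \<le> j + ?H & j \<le> ?l + ?H then q t (L j) else 0) = 0"
    by (auto simp: y_def)
   show "(if ?l \<le> j + ?H & j \<le> ?l + ?H then q t (L j) else 0) = q t (L j)" if "j \<in> {?r..<y}" for j
   proof (rule if_P)
    have "?r \<le> j" "j < y" using that by simp_all
    then show "?l \<le> j + ?H & j \<le> ?l + ?H" using yl l h by linarith
   qed
  qed simp
  then have "slot_score (qtab q E) L t b - slot_score (qtab q E) L t ?r < 0"
   using diff[of ?r b] a b(1) not_bad_insert(1)[OF L anti t bi y(2) y(1)] by (simp add: slot_sum_def)
  then show False using b(2) rt by fastforce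
 qed
 show "?r \<le> b + e"
 proof (rule ccontr)
  assume a: "\<not> ?r \<le> b + e"
  define y where "y = max b (?l - ?H)"
  have y: "y + e \<le> ?r" "y \<le> t" using a b(1) rt l h unfolding y_def by linarith+
  have yl: "?l \<le> y + ?H" unfolding y_def by linarith
  have "(\<Sum>j\<in>{b..<?r}. if ?l \<le> j + ?H & j \<le> ?l + ?H then q t (L j) else 0) = (\<Sum>j\<in>{y..<?r}. q t (L j))"
  proof (rule sum.mono_neutral_cong_right)
   show "{y..<?r} \<subseteq> {b..<?r}" by (auto simp: y_def)
   show "\<forall>j\<in>{b..<?r} - {y..<?r}. (if ?l \<le> j + ?H & j \<le> ?l + ?H then q t (L j) else 0) = 0"
    by (auto simp: y_def)
   show "(if ?l \<le> j + ?H & j \<le> ?l + ?H then q t (L j) else 0) = q t (L j)" if "j \<in> {y..<?r}" for j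
   proof (rule if_P)
    have "y \<le> j" "j < ?r" using that by simp_all
    then show "?l \<le> j + ?H & j \<le> ?l + ?H" using yl l h by linarith
   qed
  qed simp
  then have "slot_score (qtab q E) L t ?r - slot_score (qtab q E) L t b > 0"
   using diff[of b ?r] a rt not_bad_insert(2)[OF L anti t bi y(2) y(1)] by (simp add: slot_sum_def)
  then show False using b(2) rt by fastforce
 qed
qed


lemma large_correct:
 assumes anti: "antisym_on_lt n q" and G: "1 \<le> G" "n + 2 \<le> 2 ^ G"
  and step: "\<And>t. t < n ==> stage_step q G t (Lf t) (\<Union>s<Suc t. near_pairs q n A G s (Lf s)) (Lf (Suc t))"
  and lst: "\<And>t. t \<le> n ==> listing t (Lf t)"
  and srt: "\<And>t L. t \<le> n ==> best_listing q t L ==> dsorted (12 * G) t (%p. \<pi> (L p))"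
  and good: "\<And>t. t < n ==> best_listing q t (Lf t) ==>
   \<not> bad_search (12 * G) (40 * G) t (Lf t) q & \<not> bad_insert (36 * G + 3) t (Lf t) q"
 shows "t \<le> n ==> best_listing q t (Lf t)"
proof (induction t rule: less_induct)
 case (less m)
 show ?case
 proof (cases m)
  case 0
  then show ?thesis using lst[of 0] by (simp add: best_listing_def list_score_def)
 next
  case (Suc t)
  have t: "t < n" using less.prems Suc by simp
  let ?W = "40 * G * A" and ?L = "Lf t"
  define E0 where "E0 = (\<Union>s<t. near_pairs q n A G s (Lf s))"
  define E where "E = (\<Union>s<Suc t. near_pairs q n A G s (Lf s))"
  have E: "E = E0 \<union> near_pairs q n A G t ?L" by (auto simp: E_def E0_def less_Suc_eq)
  have best: "best_listing q v (Lf v)" if "v \<le> t" for v using less.IH[of v] that t Suc by simp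
  have sv: "dsorted (12 * G) v (%p. \<pi> (Lf v p))" if "v \<le> t" for v
   using srt[of v "Lf v"] best[OF that] that t by simp
  have lv: "listing v (Lf v)" if "v \<le> t" for v using lst[of v] that t by simp
  have loc: "rk \<pi> v v \<le> loc_at q G v (Lf v) + (12 * G + 1 + 2 * ?W)"
   "loc_at q G v (Lf v) \<le> rk \<pi> v v + (12 * G + 1 + 2 * ?W)" if "v \<le> t" for v
  proof -
   have v: "v < n" using that t by simp
   have "0 < G" using G by simp
   note search_result[OF lv[OF that] sv[OF that] v refl this G(2) conjunct1[OF good[OF v best[OF that]]]]
   then show "rk \<pi> v v \<le> loc_at q G v (Lf v) + (12 * G + 1 + 2 * ?W)"
    "loc_at q G v (Lf v) \<le> rk \<pi> v v + (12 * G + 1 + 2 * ?W)"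
    unfolding less_rank_rk[OF lv[OF that]] by linarith+
  qed
  have E0s: "E0 \<subseteq> item_pairs t"
  proof
   fix z assume "z \<in> E0"
   then obtain s p where s: "s < t" "p < s" "z = {s, Lf s p}"
    unfolding E0_def near_pairs_def Let_def by blast
   have "Lf s p < s" using lv[of s] s by (auto simp: listing_def bij_betw_def)
   then show "z \<in> item_pairs t" using s by (simp add: item_pairs_def)
  qed
  \<comment> \<open>The ranks differ by at most 238G now, hence also when \<open>u\<close> was
    inserted. At that time the place of \<open>c\<close> was off by at most 12G and the located
    place by 12G + 1 + 2W with W = 40GA, in total less than the inspected 300G + 4W.\<close>
  have pair: "{u, c} \<in> E" if u: "u \<le> t" "c < u" and r: "rk \<pi> (Suc t) u \<le> rk \<pi> (Suc t) c + 238 * G"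
   "rk \<pi> (Suc t) c \<le> rk \<pi> (Suc t) u + 238 * G" for u c
  proof -
   have "Lf u ` {..<u} = {..<u}" using lv[OF u(1)] by (simp add: listing_def bij_betw_def)
   then have "c \<in> Lf u ` {..<u}" using u(2) by simp
   then obtain x where x: "x < u" "c = Lf u x" by (elim imageE) simp
   have us: "u \<le> Suc t" using u by simp
   note rk_near[OF us r]
   moreover note sorted_rk[OF lv[OF u(1)] sv[OF u(1)] x(1), folded x(2)]
   moreover note loc[OF u(1)]
   ultimately have "loc_at q G u (Lf u) \<le> x + (300 * G + 4 * ?W) & x \<le> loc_at q G u (Lf u) + (300 * G + 4 * ?W)"
    using G(1) by linarith
   then have "{u, c} \<in> near_pairs q n A G u (Lf u)"
    unfolding x(2) using near_pairs_iff[OF lv[OF u(1)] x(1)] by blast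
   then show ?thesis using u unfolding E_def by auto
  qed
  have bi: "\<not> bad_insert (36 * G + 3) t ?L q" using good[OF t] best by blast
  have slot: "b \<le> rk \<pi> t t + (36 * G + 3)" "rk \<pi> t t \<le> b + (36 * G + 3)"
   if b: "b \<le> t" "\<forall>p\<le>t. slot_score (qtab q E) ?L t p \<le> slot_score (qtab q E) ?L t b" for b
  proof -
   have h: "12 * G + 1 + 2 * ?W + (36 * G + 3) \<le> 300 * G + 4 * ?W" using G(1) by linarith
   note lr = less_rank_rk[OF lv[OF order_refl]]
   show "b \<le> rk \<pi> t t + (36 * G + 3)" "rk \<pi> t t \<le> b + (36 * G + 3)"
    using best_slot_near[OF lv[OF order_refl] anti t bi E E0s loc[OF order_refl, folded lr] h b] by (simp_all add: lr)
  qed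
  have pos: "p \<le> rk \<pi> (Suc t) (ins ?L t b p) + (36 * G + 3) & rk \<pi> (Suc t) (ins ?L t b p) \<le> p + (36 * G + 3)"
   if b: "b \<le> t" "\<forall>p\<le>t. slot_score (qtab q E) ?L t p \<le> slot_score (qtab q E) ?L t b" and p: "p \<le> t" for b p
  proof -
   have "12 * G + 1 \<le> 36 * G + 3" by simp
   from ins_rk[OF lv[OF order_refl] sv[OF order_refl] slot[OF b] this p b(1)] show ?thesis
    by (cases "ins ?L t b p = t") simp_all
  qed
  obtain Z where Z: "best_listing q (Suc t) Z" using best_listing_exists by blast
  have Zl: "listing (Suc t) Z" using Z by (simp add: best_listing_def)
  have Zs: "dsorted (12 * G) (Suc t) (%p. \<pi> (Z p))" by (rule srt[OF _ Z]) (use t in simp)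
  show ?thesis unfolding Suc
  proof (rule stage_best[OF step[OF t] lv[OF order_refl] anti t _ Z, folded E_def])
   fix b p p' assume b: "b \<le> t" "\<forall>p\<le>t. slot_score (qtab q E) ?L t p \<le> slot_score (qtab q E) ?L t b"
    and p: "p < p'" "p' \<le> t" "p' \<le> p + 160 * G"
   let ?x = "ins ?L t b p" and ?y = "ins ?L t b p'"
   have il: "inj_on (ins ?L t b) {..<Suc t}" "ins ?L t b ` {..<Suc t} = {..<Suc t}"
    using ins_listing[OF lv[OF order_refl] b(1)] by (auto simp: listing_def bij_betw_def)
   have ne: "?x ~= ?y" using inj_onD[OF il(1), of p p'] p by auto
   have "?x \<in> {..<Suc t}" "?y \<in> {..<Suc t}"
    by (subst il(2)[symmetric], rule imageI, use p in simp)+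
   then have xy: "?x \<le> t" "?y \<le> t" by simp_all
   have "p \<le> t" using p by simp
   note pp = pos[OF b this] pos[OF b p(2)]
   \<comment> \<open>160G between the two places and 36G + 3 from each place to its rank: 232G + 6
     <= 238G.\<close>
   have r: "rk \<pi> (Suc t) ?x \<le> rk \<pi> (Suc t) ?y + 238 * G" "rk \<pi> (Suc t) ?y \<le> rk \<pi> (Suc t) ?x + 238 * G"
    using pp p G(1) by linarith+
   show "{?x, ?y} \<in> E"
   proof (cases "?x < ?y")
    case True
    show ?thesis by (subst insert_commute) (rule pair[OF xy(2) True r(2,1)])
   next
    case False
    then have "?y < ?x" using ne by simp
    then show ?thesis by (rule pair[OF xy(1) _ r])
   qed
  next
   fix b g assume b: "b \<le> t" "\<forall>p\<le>t. slot_score (qtab q E) ?L t p \<le> slot_score (qtab q E) ?L t b"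
    and g: "listing (Suc t) g" "\<And>i. i < Suc t ==> Z i = ins ?L t b (g i)"
   \<comment> \<open>36G + 3 in the list after insertion and 12G in \<open>Z\<close>, together below
     80G.\<close>
   have "g i \<le> i + 80 * G & i \<le> g i + 80 * G" if i: "i < Suc t" for i
   proof -
    have "g i < Suc t" using g(1) i by (auto simp: listing_def bij_betw_def)
    then have "g i \<le> t" by simp
    from pos[OF b this] sorted_rk[OF Zl Zs i, unfolded g(2)[OF i]] show ?thesis using G(1) by linarith
   qed
   then show "rlocal (Suc t) (80 * G) g" using g(1) by (simp add: rlocal_def)
  qed
 qed
qed

end

section \<open>Probability of success\<close>

lemma program_bounded:
 assumes "1 \<le> n" "1 \<le> c" "real (cost c n0 n) \<le> tb" "real ((n - 1) * samples (radius c n0 n) A) \<le> sb"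
 shows "complexity_bounded (program c n0) A n \<pi> M D tb sb"
 unfolding complexity_bounded_def
proof (intro ballI allI)
 fix s :: "nat set => 'a" and \<omega> :: "nat => bool"
 let ?q = "llr D s" and ?h0 = "ready c n0 n A"
 interpret run ?q n A "2 ^ (200 * radius c n0 n)" "radius c n0 n" ?h0 by (rule ready_run[OF assms(1,2)])
 obtain t st where st: "exec ?q \<omega> (program c n0) (initial_state n A) t st" "t \<le> cost c n0 n"
  "rel (sem ?q finish (hst ?q ?h0 n)) st"
  using program_exec[OF assms(1,2), of ?q \<omega> n0 A] unfolding ex_def by blast
 have "inspected st = seen (hst ?q ?h0 n)" using st(3) finish_spec(2) by (simp add: rel_def)
 then have "card (inspected st) \<le> (n - 1) * samples (radius c n0 n) A" using hst_inv[of n] by simp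
 then have "real (card (inspected st)) \<le> sb" using assms(4) by linarith
 moreover have "real t \<le> tb" using st(2) assms(3) by linarith
 ultimately show "\<exists>t st. exec ?q \<omega> (program c n0) (initial_state n A) t st & real t \<le> tb &
   real (card (inspected st)) \<le> sb" using st(1) by blast
qed

section \<open>Failure of a stage, given the past\<close>

lemma less_rank_cong:
 "(\<And>p. p < t ==> L p = L' p) ==> signal_model.less_rank \<pi> t L = signal_model.less_rank \<pi> t L'"
 if "signal_model n \<pi> M D \<gamma> A"
 unfolding signal_model.less_rank_def[OF that] by (rule arg_cong[where f = card]) auto

lemma gcell_test_cong:
 assumes "\<And>p. p < t ==> L p = L' p" "r < T"
 shows "gcell_test A q T t L x r = gcell_test A q T t L' x r"
proof (cases "0 < x & \<not> t < x * (T * A)")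
 case True
 have "(\<Sum>k<A. q t (L ((x-1)*(T*A)+r*A+k))) = (\<Sum>k<A. q t (L' ((x-1)*(T*A)+r*A+k)))"
 proof (rule sum.cong[OF refl])
  fix k assume k: "k \<in> {..<A}"
  have "(r + 1) * A \<le> T * A" using assms(2) by (intro mult_right_mono) auto
  moreover have "x * (T * A) = (x - 1) * (T * A) + T * A" using True by (cases x) auto
  ultimately have "(x-1)*(T*A)+r*A+k < t" using True k by simp
  then show "q t (L ((x-1)*(T*A)+r*A+k)) = q t (L' ((x-1)*(T*A)+r*A+k))" using assms(1) by simp
 qed
 then show ?thesis by (simp add: gcell_test_def)
qed (auto simp: gcell_test_def)

context signal_model
begin

text \<open>Lists are functions on all naturals, but only their values below \<open>t\<close> carry
  meaning. Passing to restrictions leaves finitely many lists, so that conditioning on the list is a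
  finite sum.\<close>

lemma bad_search_cong:
 assumes "\<And>p. p < t ==> L p = L' p"
 shows "bad_search d T t L q = bad_search d T t L' q"
proof -
 have oc: "cell_test q T t L x r = cell_test q T t L' x r" if "r < T" for x r
  by (rule gcell_test_cong[OF assms that])
 have lr: "less_rank t L = less_rank t L'" by (rule less_rank_cong[OF signal_model_axioms assms])
 have pa: "path (n + 2) (cell_test q T t L) r = path (n + 2) (cell_test q T t L') r" if "r < T" for r
  unfolding path_def by (subst path_cong[where oc' = "cell_test q T t L'"]) (use that oc in auto)
 have "{r. r < T & wrong (lcell d T t L) (rcell d T t L) (path (n + 2) (cell_test q T t L) r)
    (cell_test q T t L (path (n + 2) (cell_test q T t L) r) r)} =
   {r. r < T & wrong (lcell d T t L') (rcell d T t L') (path (n + 2) (cell_test q T t L') r)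
    (cell_test q T t L' (path (n + 2) (cell_test q T t L') r) r)}"
  unfolding lcell_def rcell_def lr by (rule Collect_cong, rule conj_cong[OF refl]) (simp only: pa oc)
 then show ?thesis unfolding bad_search_def Let_def by simp
qed

lemma bad_insert_cong:
 assumes "\<And>p. p < t ==> L p = L' p"
 shows "bad_insert e t L q = bad_insert e t L' q"
proof -
 have lr: "less_rank t L = less_rank t L'" by (rule less_rank_cong[OF signal_model_axioms assms])
 have lt: "less_rank t L' \<le> t" by (rule less_rank_le)
 have 1: "(%p'. (t, L p')) ` {less_rank t L'..<p} = (%p'. (t, L' p')) ` {less_rank t L'..<p}" if "p \<le> t" for p
  by (rule image_cong[OF refl]) (use that assms in simp)
 have 2: "(%p'. (L p', t)) ` {p..<less_rank t L'} = (%p'. (L' p', t)) ` {p..<less_rank t L'}" if "p \<le> t" for p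
  by (rule image_cong[OF refl]) (use lt assms in simp)
 show ?thesis unfolding bad_insert_def lr
  by (intro ex_cong1 conj_cong refl) (simp only: 1 2)
qed

lemma llr_measurable_all:
 assumes "I \<subseteq> pairs"
 shows "(%s. llr D s a b) \<in> borel_measurable (PiM I law)"
proof (cases "{a, b} \<in> I")
 case True
 then have "{a, b} \<in> pairs" using assms by blast
 then have "a < n" "b < n" "a ~= b" by (auto simp: item_pairs_def card_2_iff doubleton_eq_iff)
 then show ?thesis using llr_measurable_local[OF assms] True by blast
next
 case False
 \<comment> \<open>At an index outside \<open>I\<close> every point of the product space is
   \<open>undefined\<close>, so the expression is constant.\<close>
 have "llr D s a b = log 2 (D a b undefined / D b a undefined)" if "s \<in> space (PiM I law)" for s
  using that False by (simp add: llr_def space_PiM PiE_def extensional_def)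
 then show ?thesis by (subst measurable_cong) auto
qed

lemma hmeas_hst:
 assumes "I \<subseteq> pairs" "t \<le> nvar h0 2"
 shows "hmeas (PiM I law) (%s. hst (llr D s) h0 t)"
 unfolding hst_sem[OF assms(2)] by (rule hmeas_sem[OF llr_measurable_all[OF assms(1)]]) (simp add: hmeas_def)

lemma order_at_local:
 assumes "run n A cp G h0" "t \<le> n"
 shows "local_pred (item_pairs t) (%s. restrict (order_at (llr D s) h0 t) {..<t} = L)"
 unfolding local_pred_def
proof (intro conjI allI)
 show sub: "item_pairs t \<subseteq> pairs" using assms(2) by (auto simp: item_pairs_def)
 interpret run "llr D s" n A cp G h0 for s by (rule assms(1))
 have "t \<le> nvar h0 2" using assms(2) cp h0 by (simp add: env_def)
 from hmeas_hst[OF sub this] have "(%s. order_at (llr D s) h0 t p) \<in> measurable (PiM (item_pairs t) law) (count_space UNIV)" for p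
  by (simp add: hmeas_def order_at_def)
 note [measurable] = this
 have eq: "(restrict f {..<t} = L) \<longleftrightarrow> L \<in> extensional {..<t} & (\<forall>p\<in>{..<t}. f p = L p)" for f
  by (auto simp: fun_eq_iff extensional_def)
 show "Measurable.pred (PiM (item_pairs t) law) (%s. restrict (order_at (llr D s) h0 t) {..<t} = L)"
  unfolding eq by measurable
 fix s
 have "agree (llr D s) (llr D (restrict s (item_pairs t))) (item_pairs t)"
  unfolding agree_def using llr_restrict by metis
 from hst_agree[OF assms(2) this]
 show "(restrict (order_at (llr D (restrict s (item_pairs t))) h0 t) {..<t} = L) =
   (restrict (order_at (llr D s) h0 t) {..<t} = L)" by (simp add: order_at_def)
qed

text \<open>Condition on the current list: it is a function of the signals among earlier items,
  while the bad event depends on the signals of \<open>t\<close>. Sortedness is made part of the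
  event, as the bound concerns sorted lists.\<close>

lemma prob_stage:
 assumes rn: "run n A cp G h0" and t: "t < n" and c: "0 \<le> c"
  and P: "\<And>L. listing t L ==> local_pred (star t) (%s. P L (llr D s))"
  and Pc: "\<And>L L' q. (\<And>p. p < t ==> L p = L' p) ==> P L q = P L' q"
  and pr: "\<And>L. listing t L ==> dsorted d t (%p. \<pi> (L p)) ==> prob {s \<in> space \<Omega>. P L (llr D s)} \<le> c"
 defines "Bad \<equiv> {s \<in> space \<Omega>. dsorted d t (%p. \<pi> (order_at (llr D s) h0 t p)) & P (order_at (llr D s) h0 t) (llr D s)}"
 shows "Bad \<in> sets \<Omega>" "prob Bad \<le> c"
proof -
 interpret run "llr D s" n A cp G h0 for s by (rule rn)
 define X where "X s = restrict (order_at (llr D s) h0 t) {..<t}" for s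
 let ?G = "%L. dsorted d t (%p. \<pi> (L p))" and ?P = "%L s. listing t L & P L (llr D s)"
 have lst: "listing t (order_at (llr D s) h0 t)" for s using hst_inv[of t] t by simp
 have Xeq: "X s p = order_at (llr D s) h0 t p" if "p < t" for s p using that by (simp add: X_def)
 have Xl: "listing t (X s)" for s
 proof -
  have "bij_betw (X s) {..<t} {..<t} \<longleftrightarrow> bij_betw (order_at (llr D s) h0 t) {..<t} {..<t}"
   by (rule bij_betw_cong) (simp add: Xeq)
  then show ?thesis using lst by (simp add: listing_def)
 qed
 have GX: "?G (X s) = ?G (order_at (llr D s) h0 t)" for s
  unfolding dsorted_def
 proof (intro all_cong1 imp_cong refl)
  fix i j assume "i + d < j" "j < t"
  then have "i < t" "j < t" by simp_all
  then show "\<pi> (X s i) < \<pi> (X s j) \<longleftrightarrow> \<pi> (order_at (llr D s) h0 t i) < \<pi> (order_at (llr D s) h0 t j)" by (simp add: Xeq)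
 qed
 have B: "Bad = {s \<in> space \<Omega>. ?G (X s) & ?P (X s) s}"
 proof -
  have "P (X s) q = P (order_at (llr D s) h0 t) q" for s q by (rule Pc) (rule Xeq)
  then show ?thesis unfolding Bad_def GX using Xl by simp
 qed
 have loc: "local_pred (star t) (?P L)" for L
 proof (cases "listing t L")
  case True
  then show ?thesis using P by simp
 next
  case False
  then show ?thesis using local_pred_const[OF star_sub[OF t], of False] by simp
 qed
 have pb: "prob {s \<in> space \<Omega>. ?P L s} \<le> c" if "?G L" for L
 proof (cases "listing t L")
  case True
  then show ?thesis using pr that by simp
 next
  case False
  then show ?thesis using c by simp
 qed
 have fin: "finite (PiE {..<t} (%_. {..<t}))" by (rule finite_PiE) auto
 have X: "X s \<in> PiE {..<t} (%_. {..<t})" for s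
  using Xl[of s] by (auto simp: listing_def bij_betw_def X_def)
 note f = prob_fresh[where X = X and P = ?P and G = ?G and c = c, OF t fin X order_at_local[OF rn less_imp_le[OF t], folded X_def] loc pb c]
 show "Bad \<in> sets \<Omega>" "prob Bad \<le> c" unfolding B by (rule f; assumption?)+
qed

lemma success_prob_ge:
 assumes n: "1 \<le> n" "1 \<le> c" and F: "F \<in> sets \<Omega>"
  and good: "\<And>s. s \<in> space \<Omega> ==> s \<notin> F ==> best_listing (llr D s) n (order_at (llr D s) (ready c n0 n A) n)"
 shows "1 - prob F \<le> success_prob (program c n0) A n \<pi> M D"
proof -
 let ?h0 = "ready c n0 n A"
 define fin where "fin s = sem (llr D s) finish (hst (llr D s) ?h0 n)" for s
 define \<sigma> where "\<sigma> s i = (if i < n then outp (fin s) i else i)" for s i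
 interpret run "llr D s" n A "2 ^ (200 * radius c n0 n)" "radius c n0 n" ?h0 for s by (rule ready_run[OF n])
 have perm: "\<sigma> s (order_at (llr D s) ?h0 n p) = p" if "p < n" for s p
 proof -
  have "order_at (llr D s) ?h0 n p < n" using hst_inv[of n s] that by (auto simp: listing_def bij_betw_def)
  then show ?thesis using finish_spec(1)[of s] that by (simp add: \<sigma>_def fin_def)
 qed
 have \<sigma>p: "\<sigma> s permutes {..<n}" for s
 proof -
  have "listing n (order_at (llr D s) ?h0 n)" using hst_inv[of n s] by simp
  \<comment> \<open>With all values 0 every listing is best, so \<open>best_listing_optimal\<close>
    shows that \<open>\<sigma>\<close> is a permutation whatever the signals are.\<close>
  then have "best_listing (%_ _. 0) n (order_at (llr D s) ?h0 n)" by (simp add: best_listing_def list_score_def)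
  then have "optimal_order n (%_ _. 0) (\<sigma> s)"
   by (rule best_listing_optimal) (erule perm, simp add: \<sigma>_def)
  then show ?thesis by (simp add: optimal_order_def)
 qed
 define S where "S = {s \<in> space \<Omega>. optimal_order n (llr D s) (\<sigma> s)}"
 have sub: "space \<Omega> - F \<subseteq> S"
 proof
  fix s assume s: "s \<in> space \<Omega> - F"
  then have "best_listing (llr D s) n (order_at (llr D s) ?h0 n)" using good by blast
  then have "optimal_order n (llr D s) (\<sigma> s)"
   by (rule best_listing_optimal) (erule perm, simp add: \<sigma>_def)
  then show "s \<in> S" using s by (simp add: S_def)
 qed
 have \<Omega>: "\<Omega> = PiM pairs law" by (simp add: signals_def)
 have q[measurable]: "(%s. llr D s a b) \<in> borel_measurable \<Omega>" for a b
  unfolding \<Omega> by (rule llr_measurable_all) simp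
 have "n \<le> nvar ?h0 2" using cp h0 by (simp add: env_def)
 then have "hmeas \<Omega> (%s. hst (llr D s) ?h0 n)" unfolding \<Omega> by (intro hmeas_hst) simp
 then have "hmeas \<Omega> fin" unfolding fin_def by (rule hmeas_sem[OF q])
 then have [measurable]: "(%s. \<sigma> s i) \<in> measurable \<Omega> (count_space UNIV)" for i
  by (cases "i < n") (simp_all add: \<sigma>_def hmeas_def)
 let ?\<Pi> = "{\<tau>. \<tau> permutes {..<n}}"
 have fin\<Pi>: "finite ?\<Pi>" by (rule finite_permutations) simp
 have sc[measurable]: "(%s. order_score n (llr D s) \<tau>) \<in> borel_measurable \<Omega>" for \<tau>
  unfolding order_score_def case_prod_beta' by measurable
 \<comment> \<open>Measurability: the output is one of finitely many permutations, and its
   optimality is a finite conjunction of inequalities between measurable scores.\<close>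
 have "S = (\<Union>\<tau>\<in>?\<Pi>. {s \<in> space \<Omega>. (\<forall>i\<in>{..<n}. \<sigma> s i = \<tau> i) &
   (\<forall>\<rho>\<in>?\<Pi>. order_score n (llr D s) \<rho> \<le> order_score n (llr D s) \<tau>)})" (is "S = ?U")
 proof (intro equalityI subsetI)
  fix s assume "s \<in> S"
  then show "s \<in> ?U" using \<sigma>p[of s] by (auto simp: S_def optimal_order_def intro!: exI[of _ "\<sigma> s"])
 next
  fix s assume "s \<in> ?U"
  then obtain \<tau> where \<tau>: "\<tau> permutes {..<n}" "s \<in> space \<Omega>" "\<forall>i\<in>{..<n}. \<sigma> s i = \<tau> i"
   "\<forall>\<rho>\<in>?\<Pi>. order_score n (llr D s) \<rho> \<le> order_score n (llr D s) \<tau>" by blast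
  have "\<sigma> s = \<tau>"
  proof
   fix i show "\<sigma> s i = \<tau> i"
    using \<tau>(3) permutes_not_in[OF \<tau>(1), of i] permutes_not_in[OF \<sigma>p, of i] by (cases "i < n") auto
  qed
  then show "s \<in> S" using \<tau> by (simp add: S_def optimal_order_def)
 qed
 moreover have "?U \<in> sets \<Omega>"
 proof (rule sets.finite_UN[OF fin\<Pi>])
  fix \<tau> assume "\<tau> \<in> ?\<Pi>"
  have "Measurable.pred \<Omega> (%s. \<forall>\<rho>\<in>?\<Pi>. order_score n (llr D s) \<rho> \<le> order_score n (llr D s) \<tau>)"
   by (rule pred_intros_finite(3)[OF fin\<Pi>], unfold pred_def, rule borel_measurable_le[OF sc sc])
  then show "{s \<in> space \<Omega>. (\<forall>i\<in>{..<n}. \<sigma> s i = \<tau> i) &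
   (\<forall>\<rho>\<in>?\<Pi>. order_score n (llr D s) \<rho> \<le> order_score n (llr D s) \<tau>)} \<in> sets \<Omega>"
   by measurable
 qed
 ultimately have S: "S \<in> sets \<Omega>" by simp
 \<comment> \<open>Runs are deterministic, so the existence of a successful run means success of the
   unique run, which is the same for all coins.\<close>
 have spec: "(\<exists>t st. exec (llr D s) \<omega> (program c n0) (initial_state n A) t st &
   optimal_order n (llr D s) (output_order n st)) \<longleftrightarrow> optimal_order n (llr D s) (\<sigma> s)" for s \<omega>
 proof -
  obtain t st where st: "exec (llr D s) \<omega> (program c n0) (initial_state n A) t st" "rel (fin s) st"
   using program_exec[OF n, of "llr D s" \<omega> n0 A] unfolding ex_def fin_def by blast
  have "nvar (fin s) 0 = n" unfolding fin_def using hst_inv[of n s]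
   by (subst sem_nvar) (auto simp: finish_def env_def)
  then have "output_order n st = \<sigma> s" using st(2) by (auto simp: output_order_def \<sigma>_def rel_def fun_eq_iff)
  then show ?thesis using st(1) exec_deterministic[OF st(1)] by metis
 qed
 interpret C: prob_space coins unfolding coins_def by (intro prob_space_PiM measure_pmf.prob_space_axioms)
 have "success_prob (program c n0) A n \<pi> M D = measure (\<Omega> \<Otimes>\<^sub>M coins) (S \<times> space coins)"
  unfolding success_prob_def spec by (rule arg_cong[where f = "measure _"]) (auto simp: space_pair_measure S_def)
 also have "... = prob S"
  by (simp add: measure_def C.emeasure_pair_measure_Times[OF S sets.top] C.emeasure_space_1)
 finally have "success_prob (program c n0) A n \<pi> M D = prob S" .
 moreover have "1 - prob F = prob (space \<Omega> - F)" by (rule prob_compl[OF F, symmetric])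
 moreover have "prob (space \<Omega> - F) \<le> prob S" by (rule finite_measure_mono[OF sub S])
 ultimately show ?thesis by simp
qed

end

context signal_model
begin

text \<open>The origin of the conditions, with l = \<open>ell n\<close>, G = c l and x = y l. The
  first lets \<gamma> x^2 pay for the n^(8G) (n + 1) cuts of \<open>good1\<close>. In
  \<open>good2\<close> the budget \<gamma> G is split: the second condition puts the corrections, 34
  h x bits, under a quarter, the third puts 46 G / 2^h under a quarter, and the fifth puts 35 l
  together with the target (\<alpha> + 5) l under the remaining half. The fourth is 20x <= G. There
  are five failure events, each of probability at most 2^(-(\<alpha> + 3) l).\<close>

lemma strongly_large_success:
 fixes \<alpha> :: real and c y h n0 :: nat
 assumes \<alpha>: "0 < \<alpha>"
  and par: "8 * real c + \<alpha> + 4 \<le> \<gamma> * (real y)\<^sup>2" "136 * real h * real y \<le> \<gamma> * real c" "184 \<le> \<gamma> * 2 ^ h"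
   "20 * y \<le> c" "80 + 2 * \<alpha> \<le> \<gamma> * real c" "1 \<le> y"
  and n: "1 \<le> n" "n0 \<le> n" "64 * (c * ell n)\<^sup>2 \<le> n"
 shows "1 - real n powr (- \<alpha>) \<le> success_prob (program c n0) A n \<pi> M D"
proof -
 define l where "l = ell n"
 define G where "G = c * l"
 define x where "x = y * l"
 define u where "u = 2 powr (- ((\<alpha> + 3) * real l))"
 let ?h0 = "ready c n0 n A"
 have G_r: "radius c n0 n = G" using n(2) by (simp add: radius_def G_def l_def)
 have l1: "1 \<le> l" using ell_pos[OF n(1)] by (simp add: l_def)
 have c1: "1 \<le> c" using par(4,6) by linarith
 have "real c \<ge> \<gamma> * real c" using \<gamma> by (simp add: mult_left_le_one_le)
 then have cr: "80 + 2 * \<alpha> \<le> real c" using par(5) by linarith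
 have n1l: "n + 1 \<le> 2 ^ l" unfolding l_def by (rule ell_le)
 then have "real (n + 1) \<le> real (2 ^ l)" by (rule of_nat_mono)
 then have nl: "real (n + 1) \<le> 2 ^ l" by simp
 then have nl': "real n \<le> 2 ^ l" by linarith
 have pw: "z ^ k \<le> 2 powr (real k * real l)" if "0 \<le> z" "z \<le> 2 ^ l" for z :: real and k
 proof -
  have "z ^ k \<le> (2 ^ l) ^ k" by (rule power_mono[OF that(2,1)])
  also have "... = 2 powr (real (l * k))" by (simp only: powr_realpow zero_less_numeral flip: power_mult)
  finally show ?thesis by (simp add: mult.commute)
 qed
 have pw1: "real (n + 1) \<le> 2 powr real l" using pw[of "real (n + 1)" 1] nl by simp
 have pwn: "real n \<le> 2 powr real l" using pw1 by simp
 have u0: "0 < u" by (simp add: u_def)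
 have log_l: "log 2 (real n) < real l"
 proof -
  have "log 2 (real n) < log 2 (2 ^ l)" using n(1) n1l nl by (subst log_less_cancel_iff) auto
  then show ?thesis by (simp add: log_nat_power)
 qed
 have gl: "\<And>z. 1 \<le> \<gamma> * z ==> log 2 (real n) / \<gamma> < z * real l"
 proof -
  fix z assume z: "1 \<le> \<gamma> * z"
  have "log 2 (real n) < real l" by (rule log_l)
  also have "... \<le> (\<gamma> * z) * real l" using z by (simp add: mult_right_le_one_le mult_le_cancel_right1)
  finally show "log 2 (real n) / \<gamma> < z * real l" using \<gamma> by (simp add: field_simps)
 qed
 have ll: "real l \<le> (real l)\<^sup>2" using l1 by (simp add: power2_eq_square)
 have G64: "64 * G\<^sup>2 \<le> n" using n(3) by (simp add: G_def l_def)
 have x20: "20 * x \<le> G" using par(4) by (simp add: x_def G_def)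
 have G0: "1 \<le> G" using c1 l1 by (simp add: G_def)
 have "x \<le> G" using x20 by simp
 then have "2 * x * G \<le> 64 * G\<^sup>2" by (simp add: power2_eq_square)
 then have xG: "2 * x * G \<le> n" using G64 by linarith
 have "G \<le> G\<^sup>2" using G0 by (simp add: power2_eq_square)
 then have xn: "x \<le> n" using \<open>x \<le> G\<close> G64 by linarith
 have x0: "0 < x" using par(6) l1 by (simp add: x_def)
 define B1 where "B1 = {s \<in> space \<Omega>. \<not> good1 n \<pi> (llr D s) G x}"
 define B2 where "B2 = {s \<in> space \<Omega>. \<not> good2 n \<pi> (llr D s) G x}"
 define B3 where "B3 = {s \<in> space \<Omega>. \<not> good2 n (rev_order n \<pi>) (%a b. llr D s b a) G x}"
 have b1: "B1 \<in> sets \<Omega> & prob B1 \<le> u"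
 proof -
  have "1 \<le> \<gamma> * (real y)\<^sup>2" using par(1) \<alpha> by simp
  from gl[OF this] have "log 2 (real n) / \<gamma> < (real y)\<^sup>2 * real l" .
  also have "... \<le> (real y)\<^sup>2 * (real l)\<^sup>2" by (rule mult_left_mono[OF ll]) simp
  finally have lx: "log 2 (real n) / \<gamma> < real (x\<^sup>2)" by (simp add: x_def power_mult_distrib)
  have "real n ^ (8 * G) * real (n + 1) * 2 powr (- (\<gamma> * real (x\<^sup>2))) \<le>
    2 powr (real (8 * G) * real l) * 2 powr real l * 2 powr (- (\<gamma> * real (x\<^sup>2)))"
   by (intro mult_mono pw pw1 nl' order_refl) auto
  also have "... = 2 powr (real (8 * G) * real l + real l - \<gamma> * real (x\<^sup>2))" by (simp add: powr_add powr_diff powr_minus divide_inverse)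
  also have "... \<le> u" unfolding u_def
  proof (rule powr_mono)
   have "(8 * real c + \<alpha> + 4) * (real l)\<^sup>2 \<le> (\<gamma> * (real y)\<^sup>2) * (real l)\<^sup>2" by (rule mult_right_mono[OF par(1)]) simp
   then have "8 * real c * (real l)\<^sup>2 + (\<alpha> + 4) * (real l)\<^sup>2 \<le> \<gamma> * (real y)\<^sup>2 * (real l)\<^sup>2" by (simp add: algebra_simps)
   moreover have "(\<alpha> + 4) * real l \<le> (\<alpha> + 4) * (real l)\<^sup>2" by (rule mult_left_mono[OF ll]) (use \<alpha> in simp)
   ultimately show "real (8 * G) * real l + real l - \<gamma> * real (x\<^sup>2) \<le> - ((\<alpha> + 3) * real l)"
    by (simp add: G_def x_def power_mult_distrib algebra_simps power2_eq_square)
  qed simp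
  finally have bd: "real n ^ (8 * G) * real (n + 1) * 2 powr (- (\<gamma> * real (x\<^sup>2))) \<le> u" .
  show ?thesis unfolding B1_def using prob_good1[OF G64 lx] bd by auto
 qed
 have "1 \<le> \<gamma> * real c" using par(5) \<alpha> by linarith
 from gl[OF this] have lG: "log 2 (real n) / \<gamma> < real G" by (simp add: G_def)
 define e where "e = 2 powr (- ((\<alpha> + 5) * real l))"
 define N where "N = 2 powr (2 * real (23 * G) / 2 ^ h + real (h * (34 * x)))"
 have N1: "1 \<le> N" unfolding N_def by (rule ge_one_powr_ge_zero) auto
 have NU: "real (card {D. D \<subseteq> U & card D \<le> 34 * x}) \<le> N" if "finite U" "card U \<le> 23 * G" for U :: "nat set"
  unfolding N_def by (rule card_small_subsets_pow2[OF that])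
 have e1: "e \<le> 1" unfolding e_def using powr_mono[of "- ((\<alpha> + 5) * real l)" 0 2] \<alpha> by simp
 have eb: "real (n + 1) ^ 35 * N * 2 powr (- (\<gamma> * real G)) \<le> e"
 proof -
  have "real (n + 1) ^ 35 * N * 2 powr (- (\<gamma> * real G)) \<le> 2 powr (real 35 * real l) * N * 2 powr (- (\<gamma> * real G))"
   by (intro mult_right_mono pw nl) (auto simp: N_def)
  also have "... = 2 powr (35 * real l + (2 * real (23 * G) / 2 ^ h + real (h * (34 * x))) - \<gamma> * real G)"
   by (simp add: N_def powr_add powr_diff powr_minus divide_inverse)
  also have "... \<le> e" unfolding e_def
  proof (rule powr_mono)
   have "46 / 2 ^ h \<le> \<gamma> / 4" using par(3) by (simp add: field_simps)
   then have "(46 / 2 ^ h) * real G \<le> (\<gamma> / 4) * real G" by (rule mult_right_mono) simp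
   then have 1: "2 * real (23 * G) / 2 ^ h \<le> \<gamma> * real G / 4" by (simp add: field_simps)
   have "(136 * real h * real y) * real l \<le> (\<gamma> * real c) * real l" by (rule mult_right_mono[OF par(2)]) simp
   then have 2: "real (h * (34 * x)) \<le> \<gamma> * real G / 4" by (simp add: x_def G_def algebra_simps)
   have "(80 + 2 * \<alpha>) * real l \<le> (\<gamma> * real c) * real l" by (rule mult_right_mono[OF par(5)]) simp
   then have 3: "(40 + \<alpha>) * real l \<le> \<gamma> * real G / 2" by (simp add: G_def algebra_simps)
   show "35 * real l + (2 * real (23 * G) / 2 ^ h + real (h * (34 * x))) - \<gamma> * real G \<le> - ((\<alpha> + 5) * real l)"
   proof -
    have "(\<alpha> + 5) * real l = (40 + \<alpha>) * real l - 35 * real l" by (simp add: algebra_simps)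
    then show ?thesis using 1 2 3 by linarith
   qed
  qed simp
  finally show ?thesis .
 qed
 have eu: "real (n + 1) * (real x * e) \<le> u"
 proof -
  have "real x \<le> 2 powr real l" using xn pwn by linarith
  then have "real (n + 1) * (real x * e) \<le> 2 powr real l * (2 powr real l * e)"
   by (intro mult_mono pw1 order_refl) (auto simp: e_def)
  also have "... = u" unfolding e_def u_def by (simp add: algebra_simps flip: powr_add)
  finally show ?thesis .
 qed
 have b2: "B2 \<in> sets \<Omega> & prob B2 \<le> u"
 proof -
  note * = prob_good2[OF good2_hyp n(1) x20 xG lG N1 NU eb e1]
  show ?thesis unfolding B2_def by (intro conjI order_trans[OF _ eu] *; assumption)
 qed
 have b3: "B3 \<in> sets \<Omega> & prob B3 \<le> u"
 proof -
  note * = prob_good2[OF good2_hyp_rev n(1) x20 xG lG N1 NU eb e1]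
  show ?thesis unfolding B3_def by (intro conjI order_trans[OF _ eu] *; assumption)
 qed
 let ?L = "%s t. order_at (llr D s) ?h0 t"
 define S where "S t = {s \<in> space \<Omega>. dsorted (12 * G) t (%p. \<pi> (?L s t p)) & bad_search (12 * G) (40 * G) t (?L s t) (llr D s)}" for t
 define I where "I t = {s \<in> space \<Omega>. dsorted (12 * G) t (%p. \<pi> (?L s t p)) & bad_insert (36 * G + 3) t (?L s t) (llr D s)}" for t
 have rn: "run n A (2 ^ (200 * G)) G ?h0" using ready_run[OF n(1) c1, of A n0] unfolding G_r .
 have bS: "S t \<in> sets \<Omega> & prob (S t) \<le> 2 powr (- real G)" if t: "t < n" for t
  unfolding S_def
  by (intro conjI; rule prob_stage[OF rn t _ bad_search_local[OF _ t] bad_search_cong prob_bad_search[OF _ _ t refl]]; simp)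
 have e3: "3 * (12 * G + 1) \<le> 36 * G + 3" by simp
 have lI: "log 2 (real n) / \<gamma> < real (36 * G + 3)" using lG by simp
 have bI: "I t \<in> sets \<Omega> & prob (I t) \<le> real (n + 1) * 2 powr (- (\<gamma> * real (36 * G + 3)))" if t: "t < n" for t
  unfolding I_def
  by (intro conjI; rule prob_stage[where d = "12 * G", OF rn t _ bad_insert_local[OF _ t] bad_insert_cong prob_bad_insert[where d = "12 * G", OF _ _ t e3 lI]]; simp)
 define F4 where "F4 = (\<Union>t\<in>{..<n}. S t)"
 define F5 where "F5 = (\<Union>t\<in>{..<n}. I t)"
 have b4: "F4 \<in> sets \<Omega> & prob F4 \<le> u"
 proof
  show "F4 \<in> sets \<Omega>" unfolding F4_def using bS by (intro sets.finite_UN) auto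
  have "prob F4 \<le> (\<Sum>t<n. prob (S t))" unfolding F4_def by (rule finite_measure_subadditive_finite) (use bS in auto)
  also have "... \<le> (\<Sum>t<n. 2 powr (- real G))" by (rule sum_mono) (use bS in auto)
  also have "... = real n * 2 powr (- real G)" by simp
  also have "... \<le> 2 powr real l * 2 powr (- real G)" by (rule mult_right_mono[OF pwn]) simp
  also have "... = 2 powr (real l - real G)" by (simp add: powr_add powr_diff powr_minus divide_inverse)
  also have "... \<le> u" unfolding u_def
  proof (rule powr_mono)
   have "(\<alpha> + 4) * real l \<le> real c * real l" by (rule mult_right_mono) (use cr \<alpha> in auto)
   then show "real l - real G \<le> - ((\<alpha> + 3) * real l)" by (simp add: G_def algebra_simps)
  qed simp
  finally show "prob F4 \<le> u" .
 qed
 have b5: "F5 \<in> sets \<Omega> & prob F5 \<le> u"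
 proof
  show "F5 \<in> sets \<Omega>" unfolding F5_def using bI by (intro sets.finite_UN) auto
  let ?b = "2 powr (- (\<gamma> * real (36 * G + 3)))"
  have "prob F5 \<le> (\<Sum>t<n. prob (I t))" unfolding F5_def by (rule finite_measure_subadditive_finite) (use bI in auto)
  also have "... \<le> (\<Sum>t<n. real (n + 1) * ?b)" by (rule sum_mono) (use bI in blast)
  also have "... = real n * (real (n + 1) * ?b)" by simp
  also have "... \<le> 2 powr real l * (2 powr real l * ?b)" by (intro mult_mono pwn pw1 order_refl) auto
  also have "... = 2 powr (real l + (real l + - (\<gamma> * real (36 * G + 3))))" by (simp only: powr_add)
  also have "... \<le> u" unfolding u_def
  proof (rule powr_mono)
   have "(\<alpha> + 5) * real l \<le> (\<gamma> * real c) * real l" by (rule mult_right_mono) (use par(5) \<alpha> in auto)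
   then have 1: "(\<alpha> + 5) * real l \<le> \<gamma> * real G" by (simp add: G_def)
   have "\<gamma> * real G \<le> \<gamma> * real (36 * G + 3)" using \<gamma> by (intro mult_left_mono) auto
   then show "real l + (real l + - (\<gamma> * real (36 * G + 3))) \<le> - ((\<alpha> + 3) * real l)"
    using 1 by (simp add: algebra_simps)
  qed simp
  finally show "prob F5 \<le> u" .
 qed
 define F where "F = B1 \<union> (B2 \<union> (B3 \<union> (F4 \<union> F5)))"
 have Fs: "F \<in> sets \<Omega>" unfolding F_def using b1 b2 b3 b4 b5 by (intro sets.Un) auto
 have "prob F \<le> prob B1 + (prob B2 + (prob B3 + (prob F4 + prob F5)))"
  unfolding F_def using b1 b2 b3 b4 b5
  by (intro order_trans[OF measure_Un_le] add_mono order_refl sets.Un) auto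
 then have "prob F \<le> 5 * u" using b1 b2 b3 b4 b5 by linarith
 \<comment> \<open>The 3 in the exponent of \<open>u\<close> absorbs the number of failure
   events.\<close>
 also have "5 * u \<le> 2 powr (3 * real l) * u"
 proof (rule mult_right_mono)
  have "(5::real) \<le> 2 powr 3" by simp
  also have "(2::real) powr 3 \<le> 2 powr (3 * real l)" by (rule powr_mono) (use l1 in auto)
  finally show "(5::real) \<le> 2 powr (3 * real l)" .
 qed (use u0 in simp)
 also have "... = 2 powr (real l * - \<alpha>)" unfolding u_def by (simp add: algebra_simps flip: powr_add)
 also have "... = (2 powr real l) powr (- \<alpha>)" by (rule powr_powr[symmetric])
 also have "... \<le> real n powr (- \<alpha>)" by (rule powr_mono2') (use pwn n(1) \<alpha> in auto)
 finally have pF: "prob F \<le> real n powr (- \<alpha>)" .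
 have "best_listing (llr D s) n (?L s n)" if s: "s \<in> space \<Omega>" "s \<notin> F" for s
 proof -
  interpret R: run "llr D s" n A "2 ^ (200 * G)" G ?h0 by (rule rn)
  have g: "good1 n \<pi> (llr D s) G x" "good2 n \<pi> (llr D s) G x" "good2 n (rev_order n \<pi>) (%a b. llr D s b a) G x"
   using s by (auto simp: F_def B1_def B2_def B3_def)
  note anti = llr_antisym_on[OF s(1)]
  have srt: "dsorted (12 * G) t (%p. \<pi> (L p))" if "t \<le> n" "best_listing (llr D s) t L" for t L
   by (rule best_listing_sorted[OF g that(2,1) anti x0 x20 perm])
  have "l \<le> G" using c1 by (simp add: G_def)
  moreover have "l ~= G" using c1 par(4,6) l1 by (simp add: G_def)
  ultimately have "Suc l \<le> G" by simp
  then have "(2::nat) ^ Suc l \<le> 2 ^ G" by (rule power_increasing) simp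
  moreover have "n + 2 \<le> 2 ^ Suc l" using n1l n(1) by simp
  ultimately have nG: "n + 2 \<le> 2 ^ G" by linarith
  have ng: "\<not> bad_search (12 * G) (40 * G) t (?L s t) (llr D s) & \<not> bad_insert (36 * G + 3) t (?L s t) (llr D s)"
   if t: "t < n" "best_listing (llr D s) t (?L s t)" for t
  proof -
   have d: "dsorted (12 * G) t (%p. \<pi> (?L s t p))" by (rule srt[OF less_imp_le[OF t(1)] t(2)])
   have "s \<notin> S t" "s \<notin> I t" using s(2) t(1) by (auto simp: F_def F4_def F5_def)
   then show ?thesis using d s(1) by (simp add: S_def I_def)
  qed
  show ?thesis
   by (rule large_correct[OF anti G0 nG R.hst_step[unfolded known_def] _ srt ng order_refl]; (assumption | use R.hst_inv in blast))
 qed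
 then have "1 - prob F \<le> success_prob (program c n0) A n \<pi> M D"
  by (rule success_prob_ge[OF n(1) c1 Fs])
 then show ?thesis using pF by linarith
qed

lemma small_success:
 assumes "1 \<le> n" "1 \<le> c" "n < n0"
 shows "1 \<le> success_prob (program c n0) A n \<pi> M D"
proof -
 define G where "G = radius c n0 n"
 let ?h0 = "ready c n0 n A"
 have nG: "n \<le> G" using assms(3) by (simp add: G_def radius_def)
 have "best_listing (llr D s) n (order_at (llr D s) ?h0 n)" if s: "s \<in> space \<Omega>" for s
 proof -
  interpret R: run "llr D s" n A "2 ^ (200 * G)" G ?h0 unfolding G_def by (rule ready_run[OF assms(1,2)])
  show ?thesis
   by (rule small_correct[OF llr_antisym_on[OF s] nG R.hst_step[unfolded known_def] _ order_refl]; (assumption | use R.hst_inv in blast))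
 qed
 then have "1 - prob {} \<le> success_prob (program c n0) A n \<pi> M D"
  by (intro success_prob_ge[OF assms(1,2)]) auto
 then show ?thesis by simp
qed

end

section \<open>Choice of the parameters\<close>

text \<open>The conditions are circular: \<open>c\<close> has to exceed a multiple of h y /
  \<gamma>, and \<gamma> y^2 a multiple of \<open>c\<close>. Inserting c = 136 h y / \<gamma> turns
  the latter into \<gamma>^2 y >= 8 * 136 h plus lower terms, whence 1101 = 1088 + 13 in
  \<open>ypar\<close>. As \<open>h\<close> is about log (1/\<gamma>), \<open>c\<close> is (\<alpha>
  + 1) \<gamma>^-3 up to logarithms.\<close>

definition hpar :: "real => nat" where "hpar \<gamma> = nat \<lceil>log 2 (184 / \<gamma>)\<rceil>"
definition ypar :: "real => real => nat" where "ypar \<alpha> \<gamma> = nat \<lceil>1101 * real (hpar \<gamma>) * (\<alpha> + 1) / \<gamma>\<^sup>2\<rceil>"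
definition cpar :: "real => real => nat" where "cpar \<alpha> \<gamma> = nat \<lceil>136 * real (hpar \<gamma>) * real (ypar \<alpha> \<gamma>) / \<gamma>\<rceil>"

lemma nat_ceiling_bounds:
 assumes "0 \<le> z"
 shows "z \<le> real (nat \<lceil>z\<rceil>)" "real (nat \<lceil>z\<rceil>) \<le> z + 1"
 using assms by linarith+

lemma parameters:
 fixes \<alpha> \<gamma> :: real
 assumes \<alpha>: "0 < \<alpha>" and \<gamma>: "0 < \<gamma>" "\<gamma> \<le> 1"
 defines "h \<equiv> hpar \<gamma>" and "y \<equiv> ypar \<alpha> \<gamma>" and "c \<equiv> cpar \<alpha> \<gamma>" and "g \<equiv> (\<alpha> + 1) * \<gamma> powr (-3)"
 shows "8 * real c + \<alpha> + 4 \<le> \<gamma> * (real y)\<^sup>2" "136 * real h * real y \<le> \<gamma> * real c" "184 \<le> \<gamma> * 2 ^ h"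
  "20 * y \<le> c" "80 + 2 * \<alpha> \<le> \<gamma> * real c" "1 \<le> y" "0 < g" "real c \<le> 15100000 * g * log 2 (2 + g) ^ 2"
proof -
 have l0: "0 < log 2 (184 / \<gamma>)" using \<gamma> by (subst zero_less_log_cancel_iff) (auto simp: field_simps)
 have hb: "log 2 (184 / \<gamma>) \<le> real h" "real h \<le> log 2 (184 / \<gamma>) + 1"
  unfolding h_def hpar_def using nat_ceiling_bounds[of "log 2 (184 / \<gamma>)"] l0 by auto
 then have h1: "1 \<le> real h" using l0 by simp
 have "184 / \<gamma> = 2 powr (log 2 (184 / \<gamma>))" using \<gamma> by simp
 also have "... \<le> 2 powr (real h)" by (rule powr_mono) (use hb in auto)
 finally have "184 / \<gamma> \<le> 2 ^ h" by (simp add: powr_realpow)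
 then show "184 \<le> \<gamma> * 2 ^ h" using \<gamma> by (simp add: field_simps)
 let ?Y = "1101 * real h * (\<alpha> + 1) / \<gamma>\<^sup>2"
 have Y0: "0 \<le> ?Y" using \<alpha> \<gamma> by simp
 have yb: "?Y \<le> real y" "real y \<le> ?Y + 1" unfolding y_def ypar_def h_def[symmetric] using nat_ceiling_bounds[OF Y0] by auto
 have gg: "\<gamma>\<^sup>2 \<le> \<gamma>" "\<gamma>\<^sup>2 \<le> 1"
  using power_decreasing[of 1 2 \<gamma>] power_decreasing[of 0 2 \<gamma>] \<gamma> by auto
 have ha: "\<alpha> + 1 \<le> real h * (\<alpha> + 1)" using h1 \<alpha> by (simp add: mult_le_cancel_right1)
 have Yl: "1101 * (\<alpha> + 1) \<le> ?Y"
 proof -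
  have "1101 * (\<alpha> + 1) \<le> 1101 * real h * (\<alpha> + 1)" using ha by simp
  also have "... \<le> ?Y" using gg \<alpha> \<gamma> by (simp add: le_divide_eq mult_left_le)
  finally show ?thesis .
 qed
 have yl: "1101 * (\<alpha> + 1) \<le> real y" using Yl yb(1) by linarith
 have "1 \<le> 1101 * (\<alpha> + 1)" using \<alpha> by simp
 then have yr: "1 \<le> real y" using yl by (rule order_trans)
 then show y1: "1 \<le> y" by simp
 let ?C = "136 * real h * real y / \<gamma>"
 have C0: "0 \<le> ?C" using \<gamma> by simp
 have cb: "?C \<le> real c" "real c \<le> ?C + 1" unfolding c_def cpar_def h_def[symmetric] y_def[symmetric] using nat_ceiling_bounds[OF C0] by auto
 show p2: "136 * real h * real y \<le> \<gamma> * real c" using cb(1) \<gamma> by (simp add: field_simps)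
 have hy: "real y \<le> real h * real y" using h1 by (simp add: mult_le_cancel_right1)
 have p2': "136 * (real h * real y) \<le> \<gamma> * real c" using p2 by (simp add: mult.assoc)
 have yl': "1101 * \<alpha> + 1101 \<le> real y" using yl by (simp add: algebra_simps)
 have "\<gamma> * real c \<le> real c" using \<gamma> by (simp add: mult_left_le_one_le)
 then have "20 * real y \<le> real c" using p2' hy by linarith
 then show "20 * y \<le> c" by linarith
 show "80 + 2 * \<alpha> \<le> \<gamma> * real c" using p2' hy yl' \<alpha> by linarith
 have yg: "real h * (\<alpha> + 1) * 1101 \<le> \<gamma>\<^sup>2 * real y" using yb(1) \<gamma> by (simp add: field_simps)
 show "8 * real c + \<alpha> + 4 \<le> \<gamma> * (real y)\<^sup>2"
 proof -
  have "(real h * (\<alpha> + 1) * 1101) * real y \<le> (\<gamma>\<^sup>2 * real y) * real y" by (rule mult_right_mono[OF yg]) simp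
  then have *: "1101 * (real h * (\<alpha> + 1) * real y) \<le> \<gamma> * (\<gamma> * (real y)\<^sup>2)" by (simp add: power2_eq_square mult_ac)
  have "\<gamma> * (8 * real c) \<le> 1088 * (real h * real y) + 8 * \<gamma>" using cb(2) \<gamma> by (simp add: field_simps)
  also have "... \<le> 1088 * (real h * (\<alpha> + 1) * real y) + 8"
  proof -
   have "real h * real y \<le> real h * (\<alpha> + 1) * real y" using \<alpha> by (simp add: algebra_simps)
   then show ?thesis using \<gamma> by linarith
  qed
  finally have 1: "\<gamma> * (8 * real c) \<le> 1088 * (real h * (\<alpha> + 1) * real y) + 8" .
  have 2: "\<alpha> + 1 \<le> real h * (\<alpha> + 1) * real y"
   using mult_mono[OF ha yr] \<alpha> by simp
  have 3: "\<gamma> * (\<alpha> + 4) \<le> \<alpha> + 4" using \<gamma> \<alpha> by (simp add: mult_left_le_one_le)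
  define P where "P = real h * (\<alpha> + 1) * real y"
  define U where "U = \<gamma> * (\<gamma> * (real y)\<^sup>2)"
  have "\<gamma> * (8 * real c + \<alpha> + 4) = \<gamma> * (8 * real c) + \<gamma> * (\<alpha> + 4)" by (simp add: algebra_simps)
  then have "\<gamma> * (8 * real c + \<alpha> + 4) \<le> U"
   using *[folded P_def U_def] 1[folded P_def] 2[folded P_def] 3 \<alpha> by linarith
  then have "\<gamma> * (8 * real c + \<alpha> + 4) \<le> \<gamma> * (\<gamma> * (real y)\<^sup>2)" unfolding U_def .
  then show ?thesis by (simp only: mult_le_cancel_left_pos[OF \<gamma>(1)])
 qed
 have "\<gamma> powr 3 = \<gamma> ^ 3" using powr_realpow[OF \<gamma>(1), of 3] by simp
 then have g: "g = (\<alpha> + 1) / \<gamma> ^ 3" unfolding g_def powr_minus by (simp add: divide_inverse)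
 have g3: "\<gamma> ^ 3 \<le> \<gamma>" "\<gamma> ^ 3 \<le> 1" using power_decreasing[of 1 3 \<gamma>] power_decreasing[of 0 3 \<gamma>] \<gamma> by auto
 show g0: "0 < g" using \<alpha> \<gamma> by (simp add: g)
 have ag: "\<alpha> + 1 \<le> g" unfolding g using g3 \<alpha> \<gamma> by (simp add: le_divide_eq mult_left_le)
 have ig: "1 / \<gamma> \<le> g"
 proof -
  have "1 / \<gamma> \<le> 1 / \<gamma> ^ 3" using g3 \<gamma> by (simp add: frac_le)
  also have "... \<le> g" unfolding g using \<alpha> \<gamma> by (simp add: divide_right_mono)
  finally show ?thesis .
 qed
 define lg where "lg = log 2 (2 + g)"
 have lg1: "1 \<le> lg" unfolding lg_def using g0 by (simp add: le_log_iff)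
 have hl: "real h \<le> 10 * lg"
 proof -
  have "log 2 (184 / \<gamma>) \<le> log 2 (2 ^ 8 * (2 + g))"
  proof (subst log_le_cancel_iff)
   have "184 / \<gamma> \<le> 184 * g" using ig by (simp add: field_simps)
   then show "184 / \<gamma> \<le> 2 ^ 8 * (2 + g)" using g0 by simp
  qed (use \<gamma> g0 in auto)
  also have "... = log 2 (2 ^ 8) + lg" unfolding lg_def using g0 by (subst log_mult) auto
  also have "log 2 ((2::real) ^ 8) = 8" by (subst log_nat_power) simp_all
  finally show ?thesis using hb(2) lg1 by linarith
 qed
 have "real c \<le> 136 * real h * (?Y + 1) / \<gamma> + 1"
 proof -
  have "136 * real h * real y / \<gamma> \<le> 136 * real h * (?Y + 1) / \<gamma>"
   using yb(2) \<gamma> by (intro divide_right_mono mult_left_mono) auto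
  then show ?thesis using cb(2) by linarith
 qed
 also have "... = 149736 * (real h)\<^sup>2 * g + 136 * real h * (1 / \<gamma>) + 1"
  unfolding g using \<gamma> by (simp add: field_simps power2_eq_square power3_eq_cube)
 also have "... \<le> 149736 * (real h)\<^sup>2 * g + 136 * (real h)\<^sup>2 * g + (real h)\<^sup>2 * g"
 proof (intro add_mono order_refl)
  have hh: "real h \<le> (real h)\<^sup>2" "1 \<le> (real h)\<^sup>2" 
   using power_increasing[of 1 2 "real h"] power_increasing[of 0 2 "real h"] h1 by auto
  show "136 * real h * (1 / \<gamma>) \<le> 136 * (real h)\<^sup>2 * g" by (intro mult_mono ig) (use hh \<gamma> in auto)
  have "1 \<le> g" using ag \<alpha> by linarith
  then show "1 \<le> (real h)\<^sup>2 * g" using mult_mono[OF hh(2) \<open>1 \<le> g\<close>] by simp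
 qed
 \<comment> \<open>149873 = 136 * 1101 + 136 + 1.\<close>
 also have "... = 149873 * ((real h)\<^sup>2 * g)" by simp
 also have "... \<le> 149873 * ((10 * lg)\<^sup>2 * g)"
  by (intro mult_left_mono mult_right_mono power_mono) (use hl h1 g0 in auto)
 also have "... \<le> 15100000 * g * lg\<^sup>2"
  using g0 mult_nonneg_nonneg[of g "lg\<^sup>2"] by (simp add: power_mult_distrib algebra_simps)
 finally show "real c \<le> 15100000 * g * log 2 (2 + g) ^ 2" unfolding lg_def .
qed

section \<open>Bounds on time and samples\<close>

lemma ell_log:
 assumes "1 \<le> n"
 shows "real (ell n) \<le> 1 + log 2 (real n)"
proof -
 have "real (2 ^ ell n) \<le> real (2 * n)" using ell_upper[OF assms] by (rule of_nat_mono)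
 then have "log 2 (2 ^ ell n) \<le> log 2 (2 * real n)" using assms by (subst log_le_cancel_iff) auto
 also have "... = 1 + log 2 (real n)" using assms by (subst log_mult) auto
 finally show ?thesis by (simp add: log_nat_power)
qed

text \<open>A squared logarithm grows more slowly than n. From \<open>n0\<close> on, the patterns
  have at most \<open>n\<close> pairs, as condition (a) demands.\<close>

lemma large_enough: "\<exists>n0\<ge>1. \<forall>n\<ge>n0. 64 * (c * ell n)\<^sup>2 \<le> n"
proof -
 have "((%z::real. (1 + log 2 z)\<^sup>2 / z) \<longlongrightarrow> 0) at_top" by real_asymp
 moreover have "0 < 1 / (64 * (real c)\<^sup>2 + 1)" by (simp add: add_nonneg_pos)
 ultimately have "eventually (%z::real. (1 + log 2 z)\<^sup>2 / z < 1 / (64 * (real c)\<^sup>2 + 1)) at_top" by (rule order_tendstoD(2))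
 then have "eventually (%z::real. 64 * (real c * (1 + log 2 z))\<^sup>2 \<le> z) at_top"
  using eventually_gt_at_top[of 0]
 proof eventually_elim
  case (elim z)
  have "(64 * (real c)\<^sup>2 + 1) * (1 + log 2 z)\<^sup>2 < z"
   using elim by (simp add: divide_less_eq less_divide_eq add_nonneg_pos mult.commute)
  then have "64 * (real c)\<^sup>2 * (1 + log 2 z)\<^sup>2 + (1 + log 2 z)\<^sup>2 < z" by (simp only: distrib_right mult_1)
  moreover have "0 \<le> (1 + log 2 z)\<^sup>2" by simp
  ultimately have "64 * (real c)\<^sup>2 * (1 + log 2 z)\<^sup>2 \<le> z" by linarith
  then show ?case by (simp add: power_mult_distrib)
 qed
 then obtain z0 where z0: "\<And>z. z0 \<le> z ==> 64 * (real c * (1 + log 2 z))\<^sup>2 \<le> z" by (auto simp: eventually_at_top_linorder)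
 have "64 * (c * ell n)\<^sup>2 \<le> n" if n: "nat \<lceil>z0\<rceil> + 1 \<le> n" for n
 proof -
  have "z0 \<le> real n" using n by linarith
  from z0[OF this] have "64 * (real c * (1 + log 2 (real n)))\<^sup>2 \<le> real n" .
  moreover have "(real c * real (ell n))\<^sup>2 \<le> (real c * (1 + log 2 (real n)))\<^sup>2"
   using ell_log[of n] n by (intro power_mono mult_left_mono) auto
  ultimately have "real (64 * (c * ell n)\<^sup>2) \<le> real n" by simp
  then show ?thesis by (simp only: of_nat_le_iff)
 qed
 then show ?thesis by (intro exI[of _ "nat \<lceil>z0\<rceil> + 1"]) auto
qed

text \<open>\<open>2 ^ ell n\<close> is at most \<open>2 * n\<close>, so the cap is n^(200c) up to a
  constant factor, and the time is of the order of its \<open>cdep main\<close>-th power. The part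
  \<open>n0\<close> of the radius only enters the constant.\<close>

lemma cost_bound:
 assumes c: "1 \<le> c"
 shows "\<exists>K::real. \<forall>n\<ge>1. real (cost c n0 n) \<le> K * real n powr real (200 * c * cdep main)"
proof -
 define d where "d = cdep main"
 define e where "e = 200 * c * d"
 have d1: "1 \<le> d" unfolding d_def by (rule cdep_pos)
 define K1 where "K1 = (200 * c + 1) * 2 + 200 * n0 + 2"
 define K where "K = ecst (cap0 c n0) + 2 + (ccst (init1 c n0) * K1 ^ 2 + (4 * K1 + ccst main * (2 ^ (1 + 200 * n0 + 200 * c)) ^ d))"
 have "cost c n0 n \<le> K * n ^ e" if n: "1 \<le> n" for n
 proof -
  have "1 * 1 \<le> c * d" by (rule mult_le_mono[OF c d1])
  then have ce: "2 \<le> e" by (simp add: e_def mult.assoc)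
  have ne: "n ^ k \<le> n ^ e" if "k \<le> e" for k using n that by (intro power_increasing) auto
  have n1: "1 \<le> n ^ e" using n by simp
  have cap: "cap1 c n0 n + 1 \<le> K1 * n"
  proof -
   have "(200 * c + 1) * (n + 1) \<le> (200 * c + 1) * (2 * n)" using n by (intro mult_le_mono2) simp
   moreover have "200 * n0 \<le> 200 * n0 * n" "2 \<le> 2 * n" using n by auto
   ultimately have "cap1 c n0 n + 1 \<le> (200 * c + 1) * (2 * n) + 200 * n0 * n + 2 * n" unfolding cap1_def by linarith
   also have "... = K1 * n" by (simp add: K1_def algebra_simps)
   finally show ?thesis .
  qed
  have t1: "ecst (cap0 c n0) + 2 \<le> (ecst (cap0 c n0) + 2) * n ^ e"
   using mult_le_mono2[OF n1, of "ecst (cap0 c n0) + 2"] by (simp only: nat_mult_1_right)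
  have "(cap1 c n0 n + 1) ^ 2 \<le> (K1 * n) ^ 2" by (rule power_mono[OF cap]) simp
  also have "... = K1 ^ 2 * n ^ 2" by (rule power_mult_distrib)
  also have "... \<le> K1 ^ 2 * n ^ e" by (rule mult_le_mono2[OF ne[OF ce]])
  finally have "(cap1 c n0 n + 1) ^ 2 \<le> K1 ^ 2 * n ^ e" .
  then have t2: "ccst (init1 c n0) * (cap1 c n0 n + 1) ^ 2 \<le> ccst (init1 c n0) * (K1 ^ 2 * n ^ e)" by (rule mult_le_mono2)
  have "K1 * n \<le> K1 * n ^ e" using ne[of 1] ce by (intro mult_le_mono2) simp
  then have t3: "4 * (cap1 c n0 n + 1) \<le> 4 * (K1 * n ^ e)" by (intro mult_le_mono2[OF order_trans[OF cap]])
  have "2 ^ (200 * radius c n0 n) + 1 \<le> (2::nat) ^ (1 + 200 * n0 + 200 * c) * n ^ (200 * c)"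
  proof -
   have "200 * radius c n0 n \<le> 200 * n0 + ell n * (200 * c)" by (simp add: radius_def)
   then have "(2::nat) ^ (200 * radius c n0 n) \<le> 2 ^ (200 * n0 + ell n * (200 * c))" by (rule power_increasing) simp
   also have "... = 2 ^ (200 * n0) * (2 ^ ell n) ^ (200 * c)" by (simp add: power_add power_mult)
   also have "... \<le> 2 ^ (200 * n0) * (2 * n) ^ (200 * c)" by (intro mult_le_mono2 power_mono ell_upper[OF n]) simp
   finally have 1: "(2::nat) ^ (200 * radius c n0 n) \<le> 2 ^ (200 * n0) * (2 * n) ^ (200 * c)" .
   have "(1::nat) \<le> 2 ^ (200 * radius c n0 n)" by simp
   then have "2 ^ (200 * radius c n0 n) + 1 \<le> (2::nat) * (2 ^ (200 * n0) * (2 * n) ^ (200 * c))" using 1 by linarith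
   also have "... = 2 ^ (1 + 200 * n0 + 200 * c) * n ^ (200 * c)" by (simp add: power_add power_mult_distrib)
   finally show ?thesis .
  qed
  then have "(2 ^ (200 * radius c n0 n) + 1) ^ d \<le> ((2::nat) ^ (1 + 200 * n0 + 200 * c) * n ^ (200 * c)) ^ d"
   by (rule power_mono) simp
  also have "... = (2 ^ (1 + 200 * n0 + 200 * c)) ^ d * n ^ e" unfolding power_mult_distrib e_def by (simp only: power_mult)
  finally have "(2 ^ (200 * radius c n0 n) + 1) ^ d \<le> ((2::nat) ^ (1 + 200 * n0 + 200 * c)) ^ d * n ^ e" .
  then have t4: "ccst main * (2 ^ (200 * radius c n0 n) + 1) ^ d \<le> ccst main * (((2::nat) ^ (1 + 200 * n0 + 200 * c)) ^ d * n ^ e)"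
   by (rule mult_le_mono2)
  have "cost c n0 n \<le> (ecst (cap0 c n0) + 2) * n ^ e + (ccst (init1 c n0) * (K1 ^ 2 * n ^ e) + (4 * (K1 * n ^ e) +
    ccst main * (((2::nat) ^ (1 + 200 * n0 + 200 * c)) ^ d * n ^ e)))"
   unfolding cost_def d_def[symmetric] by (intro add_mono t1 t2 t3 t4)
  also have "... = K * n ^ e" unfolding K_def by (simp only: distrib_right mult.assoc)
  finally show ?thesis .
 qed
 then have "real (cost c n0 n) \<le> real K * real n powr real e" if "1 \<le> n" for n
 proof -
  have "real (cost c n0 n) \<le> real (K * n ^ e)" using \<open>\<And>n. 1 \<le> n ==> cost c n0 n \<le> K * n ^ e\<close>[OF that] by (rule of_nat_mono)
  then show ?thesis using that by (simp add: powr_realpow)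
 qed
 then show ?thesis unfolding e_def d_def by blast
qed

lemma sample_bound:
 assumes "1 \<le> n" "1 \<le> c"
 shows "real ((n - 1) * samples (radius c n0 n) A) \<le> (2 * real ((c + n0) * (360 * A + 601))) * real n * log 2 (real n)"
\<comment> \<open>For n = 1 both sides are 0; from n = 2 on the logarithm is at least 1, so that
  \<open>ell n\<close> is at most twice the logarithm.\<close>
proof (cases "n = 1")
 case False
 then have n: "2 \<le> n" using assms by simp
 have l: "1 \<le> ell n" using ell_pos[OF assms(1)] by simp
 have "radius c n0 n \<le> (c + n0) * ell n"
 proof -
  have "n0 \<le> n0 * ell n" using l by simp
  then show ?thesis unfolding radius_def by (simp add: distrib_right)
 qed
 moreover have "samples G A \<le> G * (360 * A + 600) + 1" for G by (simp add: samples_def algebra_simps)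
 ultimately have s: "samples (radius c n0 n) A \<le> (c + n0) * ell n * (360 * A + 600) + 1"
  by (meson add_le_mono1 mult_le_mono1 order_trans)
 show ?thesis
 proof -
  have "1 * 1 \<le> (c + n0) * ell n" by (rule mult_le_mono) (use l assms(2) in auto)
  then have "1 \<le> (c + n0) * ell n" by simp
  then have "samples (radius c n0 n) A \<le> (c + n0) * ell n * (360 * A + 601)" using s by (simp add: algebra_simps)
  then have "(n - 1) * samples (radius c n0 n) A \<le> n * ((c + n0) * ell n * (360 * A + 601))" by (intro mult_le_mono) auto
  then have "real ((n - 1) * samples (radius c n0 n) A) \<le> real (n * ((c + n0) * ell n * (360 * A + 601)))" by (rule of_nat_mono)
  also have "... = real ((c + n0) * (360 * A + 601)) * real n * real (ell n)" by simp
  also have "... \<le> real ((c + n0) * (360 * A + 601)) * real n * (2 * log 2 (real n))"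
  proof (intro mult_left_mono)
   have "1 \<le> log 2 (real n)" using n by (simp add: le_log_iff)
   then show "real (ell n) \<le> 2 * log 2 (real n)" using ell_log[OF assms(1)] by linarith
  qed auto
  finally show ?thesis by simp
 qed
qed simp

text \<open>Decreasing \<gamma> raises the lower limit for \<open>m\<close> and weakens the
  probability bound; the parameters may then be chosen for \<gamma> <= 1.\<close>

lemma strongly_biased_min:
 assumes "strongly_biased \<gamma> A n \<pi> M D" "0 < \<gamma>" "1 \<le> n"
 shows "strongly_biased (min \<gamma> 1) A n \<pi> M D"
 unfolding strongly_biased_def
proof (intro conjI allI impI)
 fix m a b assume m: "log 2 (real n) / min \<gamma> 1 < real m" "m \<le> n" "distinct_pairs n m a b"
  "2 / 3 * real m \<le> real (card {k. k < m & \<pi> (a k) < \<pi> (b k)})"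
 have "log 2 (real n) / \<gamma> \<le> log 2 (real n) / min \<gamma> 1"
  using assms(2,3) by (intro divide_left_mono) (auto simp: zero_le_log_cancel_iff)
 then have "log 2 (real n) / \<gamma> < real m" using m(1) by linarith
 then have "1 - 2 powr (- (\<gamma> * real m)) < prob_positive_sum n \<pi> M D m a b"
  using assms(1) m(2-4) unfolding strongly_biased_def by blast
 moreover have "2 powr (- (\<gamma> * real m)) \<le> 2 powr (- (min \<gamma> 1 * real m))"
  by (rule powr_mono) (auto intro: mult_right_mono)
 ultimately show "1 - 2 powr (- (min \<gamma> 1 * real m)) < prob_positive_sum n \<pi> M D m a b" by linarith
qed (use assms(1) in "simp add: strongly_biased_def")

theorem theorem5:
  shows "\<exists>E :: real \<times> real \<Rightarrow> real.
    soft_O {(\<alpha>, \<gamma>). 0 < \<alpha> \<and> 0 < \<gamma>} E (\<lambda>(\<alpha>, \<gamma>). (\<alpha> + 1) * (min \<gamma> 1) powr (-3)) \<and>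
    (\<forall>\<gamma>>0. \<forall>\<alpha>>0. \<exists>(p :: prog) (K :: real). \<forall>A :: nat. \<exists>C :: real.
       \<forall>n\<ge>1. \<forall>\<pi> (M :: 's measure) (D :: nat \<Rightarrow> nat \<Rightarrow> 's \<Rightarrow> real).
         \<pi> permutes {..<n} \<longrightarrow> signal_densities n M D \<longrightarrow> strongly_biased \<gamma> A n \<pi> M D \<longrightarrow>
           success_prob p A n \<pi> M D \<ge> 1 - real n powr (- \<alpha>) \<and>
           complexity_bounded p A n \<pi> M D
             (K * real n powr E (\<alpha>, \<gamma>)) (C * real n * log 2 (real n)))"
proof -
 \<comment> \<open>The degree in \<open>cost_bound\<close>.\<close>
 define E :: "real \<times> real => real" where "E = (%(\<alpha>, \<gamma>). real (200 * cpar \<alpha> (min \<gamma> 1) * cdep main))"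
 have "soft_O {(\<alpha>, \<gamma>). 0 < \<alpha> & 0 < \<gamma>} E (%(\<alpha>, \<gamma>). (\<alpha> + 1) * (min \<gamma> 1) powr (-3))"
  unfolding soft_O_def
 proof (intro exI ballI)
  fix p :: "real \<times> real" assume "p \<in> {(\<alpha>, \<gamma>). 0 < \<alpha> & 0 < \<gamma>}"
  then obtain \<alpha> \<gamma> where p: "p = (\<alpha>, \<gamma>)" "0 < \<alpha>" "0 < \<gamma>" by auto
  define g where "g = (\<alpha> + 1) * (min \<gamma> 1) powr (-3)"
  have "0 < min \<gamma> 1" "min \<gamma> 1 \<le> 1" using p by auto
  note pp = parameters[OF p(2) this, folded g_def]
  have "\<bar>E p\<bar> = real (200 * cdep main) * real (cpar \<alpha> (min \<gamma> 1))" by (simp add: E_def p)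
  also have "... \<le> real (200 * cdep main) * (15100000 * g * log 2 (2 + g) ^ 2)" by (rule mult_left_mono[OF pp(8)]) simp
  also have "... = (real (200 * cdep main) * 15100000) * \<bar>g\<bar> * log 2 (2 + \<bar>g\<bar>) ^ 2" using pp(7) by simp
  finally show "\<bar>E p\<bar> \<le> (real (200 * cdep main) * 15100000) * \<bar>case p of (\<alpha>, \<gamma>) => (\<alpha> + 1) * (min \<gamma> 1) powr (-3)\<bar> *
    log 2 (2 + \<bar>case p of (\<alpha>, \<gamma>) => (\<alpha> + 1) * (min \<gamma> 1) powr (-3)\<bar>) ^ 2"
   by (simp add: p g_def)
 qed
 moreover have "\<exists>(p :: prog) (K :: real). \<forall>A :: nat. \<exists>C :: real.
   \<forall>n\<ge>1. \<forall>\<pi> (M :: 's measure) (D :: nat => nat => 's => real).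
    \<pi> permutes {..<n} --> signal_densities n M D --> strongly_biased \<gamma> A n \<pi> M D -->
     success_prob p A n \<pi> M D \<ge> 1 - real n powr (- \<alpha>) &
     complexity_bounded p A n \<pi> M D
      (K * real n powr E (\<alpha>, \<gamma>)) (C * real n * log 2 (real n))"
  if \<gamma>: "0 < \<gamma>" and \<alpha>: "0 < \<alpha>" for \<alpha> \<gamma>
 proof -
  define c where "c = cpar \<alpha> (min \<gamma> 1)"
  have m: "0 < min \<gamma> 1" "min \<gamma> 1 \<le> 1" using \<gamma> by auto
  note par = parameters[OF \<alpha> m, folded c_def]
  have c1: "1 \<le> c" using par(4,6) by linarith
  obtain n0 where n0: "\<And>n. n0 \<le> n ==> 64 * (c * ell n)\<^sup>2 \<le> n" using large_enough by blast
  obtain K where K: "\<And>n. 1 \<le> n ==> real (cost c n0 n) \<le> K * real n powr real (200 * c * cdep main)"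
   using cost_bound[OF c1] by blast
  show ?thesis
  \<comment> \<open>The program and the time constant are fixed before \<open>A\<close> is known:
    \<open>A\<close> is read from a register, and the loops are capped independently of it. Only
    \<open>C\<close> depends on \<open>A\<close>.\<close>
  proof (rule exI[of _ "program c n0"], rule exI[of _ K], rule allI, rule exI, intro allI impI)
   fix A n \<pi> and M :: "'s measure" and D :: "nat => nat => 's => real"
   assume n: "1 \<le> n" and a: "\<pi> permutes {..<n}" "signal_densities n M D" "strongly_biased \<gamma> A n \<pi> M D"
   interpret signal_model n \<pi> M D "min \<gamma> 1" A
    by unfold_locales (use a m strongly_biased_min[OF a(3) \<gamma> n] in auto)
   have "1 - real n powr (- \<alpha>) \<le> success_prob (program c n0) A n \<pi> M D"
   proof (cases "n < n0")
    case True
    have "0 \<le> real n powr (- \<alpha>)" by simp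
    then show ?thesis using small_success[OF n c1 True] by linarith
   next
    case False
    then have "n0 \<le> n" by simp
    then show ?thesis by (intro strongly_large_success[OF \<alpha> par(1-6) n] n0)
   qed
   moreover have "complexity_bounded (program c n0) A n \<pi> M D (K * real n powr E (\<alpha>, \<gamma>))
     ((2 * real ((c + n0) * (360 * A + 601))) * real n * log 2 (real n))"
    by (rule program_bounded[OF n c1 _ sample_bound[OF n c1]]) (use K[OF n] in "simp add: E_def c_def")
   ultimately show "1 - real n powr (- \<alpha>) \<le> success_prob (program c n0) A n \<pi> M D &
     complexity_bounded (program c n0) A n \<pi> M D (K * real n powr E (\<alpha>, \<gamma>))
     ((2 * real ((c + n0) * (360 * A + 601))) * real n * log 2 (real n))" ..
  qed
 qed
 ultimately show ?thesis by blast
qed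

end
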